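(* Let $A=A(\mathcal{E}^{(8)\ast},W)$, where $W$ is any cell system on $\mathcal{E}^{(8)\ast}$, and let $C$, $L$, $K$ be graded vector spaces with Hilbert series $H_C(t) = 2t + t^2 + t^3 + t^5$, $H_L(t)=4t^5$ and $H_K(t)=2$. Then the Hochschild cohomology of $A$ is given, as graded vector spaces, by $HH^0(A) \cong C^{\ast}[5] \oplus L$, $HH^1(A) \cong C^{\ast}[5]$, $HH^2(A) \cong C[-3]$, $HH^3(A) \cong C[-3]\oplus K^{\ast}[-3]$, $HH^4(A) \cong C^{\ast}[-3]\oplus K[-3]$, and $HH^{4+i}(A) \cong HH^i(A)[-8]$ for $i \geq 1$.
   Context: All vector spaces and algebras are over $\mathbb{C}$. For a finite directed graph $\mathcal{G}$ (loops and multiple edges allowed), $s(a)$, $r(a)$ denote the source and range of an edge $a$. The path algebra $\mathbb{C}\mathcal{G}$ has as basis all finite paths (vertices are the paths of length 0), with product $ab$ the concatenation (first $a$, then $b$) if $r(a)=s(b)$ and $0$ otherwise; it is graded by path length. The graph $\mathcal{E}^{(8)\ast}$ (Coxeter number $h=8$) has vertices $1,2,3,4$ and edges $1\to2$, $2\to2$, $2\to3$, $2\to4$, $3\to1$, $3\to2$, $3\to3$, $4\to3$. Cell systems. Let $h$ be the Coxeter number of $\mathcal{G}$, $q=e^{i\pi/h}$, $[m]_q=(q^m-q^{-m})/(q-q^{-1})$, and let $(\phi_v)_v$ be the Perron-Frobenius eigenvector of $\mathcal{G}$ (eigenvalue $[3]_q$). A cell system $W$ on $\mathcal{G}$ assigns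 to each closed path $abc$ of length 3 a complex number $W(abc)=W(bca)=W(cab)$ such that: (I) for all vertices $i,j$ and edges $a,a'$ from $i$ to $j$, $\sum W(ab_1b_2)\overline{W(a'b_1b_2)}=\delta_{a,a'}[2]_q\phi_i\phi_j$, summed over all paths $b_1b_2$ of length 2 from $j$ to $i$; (II) for all edges $a_1:i_4\to i_1$, $a_2:i_2\to i_1$, $a_3:i_2\to i_3$, $a_4:i_4\to i_3$, $\sum \phi_k^{-1}W(a_2b_1b_2)\overline{W(a_3b_3b_2)}W(a_4b_3b_4)\overline{W(a_1b_1b_4)}=\delta_{a_1,a_4}\delta_{a_2,a_3}\phi_{i_4}\phi_{i_1}\phi_{i_2}+\delta_{a_1,a_2}\delta_{a_3,a_4}\phi_{i_1}\phi_{i_2}\phi_{i_3}$, summed over all vertices $k$ and edges $b_1:i_1\to k$, $b_2:k\to i_2$, $b_3:i_3\to k$, $b_4:k\to i_4$. The almost Calabi-Yau algebra $A(\mathcal{G},W)$ is the quotient of $\mathbb{C}\mathcal{G}$ by the two-sided ideal generated by the elements $\sum_{b,b'}W(abb')\,bb'$, one for each edge $a$, the sum being over all paths $bb'$ of length 2 from $r(a)$ to $s(a)$. It is graded by path length. Conventions. $HH^n(A)=\mathrm{Ext}^n_{A^e}(A,A)$, where $A^e=A^{\mathrm{op}}\otimes A$ is the enveloping algebra, with the grading induced by path length (a homomorphism raising path length by $d$ has degree $d$; $HH^0(A)$ is the center of $A$ with its path-length grading). Isomorphisms are of graded vector spaces. $V[n]$ is $V$ with degrees raised by $n$ ($V[n]_j=V_{j-n}$);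 $V^\ast$ is the graded dual, $(V^\ast)_j=(V_{-j})^\ast$. The Hilbert series of $V$ is $H_V(t)=\sum_j\dim(V_j)t^j$; a constant Hilbert series means concentration in degree 0. *)

theory Defs
  imports
    "HOL-Algebra.Module"
    "HOL-Algebra.QuotRing"
    "HOL-Computational_Algebra.Formal_Laurent_Series"
    Complex_Main
    "Graph_Theory.Arc_Walk"
begin

section \<open>Modules, linear maps and quotients\<close>

text \<open>
  Modules, algebras and vector spaces are records of type \<^typ>\<open>('r, 'm) module\<close>. When an object
  carries no multiplication, the fields \<open>mult\<close> and \<open>one\<close> of the record are left unspecified.
  The locale \<open>module\<close> of HOL-Algebra requires a commutative ring of scalars, so it serves for
  complex vector spaces; left modules over a noncommutative ring have their own locale.
\<close>

locale left_module = R?: ring R + M?: abelian_group M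
  for R :: "('r, 'e) ring_scheme" (structure) and M :: "('r, 'm) module" (structure) +
  assumes smult_closed:
      "\<lbrakk>a \<in> carrier R; x \<in> carrier M\<rbrakk> \<Longrightarrow> a \<odot>\<^bsub>M\<^esub> x \<in> carrier M"
    and smult_l_distr:
      "\<lbrakk>a \<in> carrier R; b \<in> carrier R; x \<in> carrier M\<rbrakk> \<Longrightarrow>
        (a \<oplus>\<^bsub>R\<^esub> b) \<odot>\<^bsub>M\<^esub> x = a \<odot>\<^bsub>M\<^esub> x \<oplus>\<^bsub>M\<^esub> b \<odot>\<^bsub>M\<^esub> x"
    and smult_r_distr:
      "\<lbrakk>a \<in> carrier R; x \<in> carrier M; y \<in> carrier M\<rbrakk> \<Longrightarrow>
        a \<odot>\<^bsub>M\<^esub> (x \<oplus>\<^bsub>M\<^esub> y) = a \<odot>\<^bsub>M\<^esub> x \<oplus>\<^bsub>M\<^esub> a \<odot>\<^bsub>M\<^esub> y"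
    and smult_assoc:
      "\<lbrakk>a \<in> carrier R; b \<in> carrier R; x \<in> carrier M\<rbrakk> \<Longrightarrow>
        (a \<otimes>\<^bsub>R\<^esub> b) \<odot>\<^bsub>M\<^esub> x = a \<odot>\<^bsub>M\<^esub> (b \<odot>\<^bsub>M\<^esub> x)"
    and smult_one:
      "x \<in> carrier M \<Longrightarrow> \<one>\<^bsub>R\<^esub> \<odot>\<^bsub>M\<^esub> x = x"

definition lin_maps ::
  "('r, 'e) ring_scheme \<Rightarrow> ('r, 'm) module \<Rightarrow> ('r, 'n) module \<Rightarrow> ('m \<Rightarrow> 'n) set" where
  "lin_maps R M N = {f \<in> carrier M \<rightarrow>\<^sub>E carrier N.
     (\<forall>x\<in>carrier M. \<forall>y\<in>carrier M. f (x \<oplus>\<^bsub>M\<^esub> y) = f x \<oplus>\<^bsub>N\<^esub> f y) \<and>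
     (\<forall>r\<in>carrier R. \<forall>x\<in>carrier M. f (r \<odot>\<^bsub>M\<^esub> x) = r \<odot>\<^bsub>N\<^esub> f x)}"

definition mod_span :: "('r, 'e) ring_scheme \<Rightarrow> ('r, 'm) module \<Rightarrow> 'm set \<Rightarrow> 'm set" where
  "mod_span R M S = \<Inter>{N. submodule N R M \<and> S \<subseteq> N}"

definition quot_module :: "('r, 'm) module \<Rightarrow> 'm set \<Rightarrow> ('r, 'm set) module" where
  "quot_module M N =
     \<lparr>carrier = a_rcosets\<^bsub>M\<^esub> N, monoid.mult = undefined, one = undefined,
      zero = N, add = set_add M,
      module.smult = (\<lambda>r X. \<Union>x\<in>X. N +>\<^bsub>M\<^esub> (r \<odot>\<^bsub>M\<^esub> x))\<rparr>"

definition quot_algebra :: "('r, 'm) module \<Rightarrow> 'm set \<Rightarrow> ('r, 'm set) module" where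
  "quot_algebra A I = ring.extend (A Quot I) (module.fields (module.smult (quot_module A I)))"

text \<open>The free left module on a set \<open>X\<close>: finitely supported functions on \<open>X\<close>.\<close>

definition free_module :: "('r, 'e) ring_scheme \<Rightarrow> 'x set \<Rightarrow> ('r, 'x \<Rightarrow> 'r) module" where
  "free_module R X =
     \<lparr>carrier = {f. (\<forall>x\<in>X. f x \<in> carrier R) \<and> (\<forall>x. x \<notin> X \<longrightarrow> f x = \<zero>\<^bsub>R\<^esub>) \<and>
                    finite {x. f x \<noteq> \<zero>\<^bsub>R\<^esub>}},
      monoid.mult = undefined, one = undefined,
      zero = (\<lambda>x. \<zero>\<^bsub>R\<^esub>), add = (\<lambda>f g x. f x \<oplus>\<^bsub>R\<^esub> g x),
      module.smult = (\<lambda>r f x. r \<otimes>\<^bsub>R\<^esub> f x)\<rparr>"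

text \<open>Projective means direct summand of a free module. Since \<open>P\<close> is a quotient of the free
  module on its own carrier, free modules on subsets of the type of \<open>P\<close> suffice.\<close>

definition projective_module :: "('r, 'e) ring_scheme \<Rightarrow> ('r, 'p) module \<Rightarrow> bool" where
  "projective_module R P \<longleftrightarrow> left_module R P \<and>
     (\<exists>X :: 'p set. \<exists>i \<in> lin_maps R P (free_module R X). \<exists>q \<in> lin_maps R (free_module R X) P.
        \<forall>x\<in>carrier P. q (i x) = x)"


section \<open>Complex vector spaces\<close>

definition complex_alg :: "(complex, complex) module" where
  "complex_alg = \<lparr>carrier = UNIV, monoid.mult = (*), one = 1, zero = 0, add = (+), module.smult = (*)\<rparr>"

definition cvs_iso :: "(complex, 'v) module \<Rightarrow> (complex, 'w) module \<Rightarrow> bool" where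
  "cvs_iso V W \<longleftrightarrow> (\<exists>f \<in> lin_maps complex_alg V W. bij_betw f (carrier V) (carrier W))"

definition has_dim :: "(complex, 'v) module \<Rightarrow> nat \<Rightarrow> bool" where
  "has_dim V n \<longleftrightarrow> (\<exists>b :: nat \<Rightarrow> 'v. b ` {..<n} \<subseteq> carrier V \<and>
     (\<forall>x\<in>carrier V. \<exists>!c. c \<in> {..<n} \<rightarrow>\<^sub>E UNIV \<and> x = (\<Oplus>\<^bsub>V\<^esub>i\<in>{..<n}. c i \<odot>\<^bsub>V\<^esub> b i)))"

definition cvs_sum ::
  "(complex, 'v) module \<Rightarrow> (complex, 'w) module \<Rightarrow> (complex, 'v \<times> 'w) module" where
  "cvs_sum V W =
     \<lparr>carrier = carrier V \<times> carrier W, monoid.mult = undefined, one = undefined,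
      zero = (\<zero>\<^bsub>V\<^esub>, \<zero>\<^bsub>W\<^esub>),
      add = (\<lambda>(x, y) (x', y'). (x \<oplus>\<^bsub>V\<^esub> x', y \<oplus>\<^bsub>W\<^esub> y')),
      module.smult = (\<lambda>c (x, y). (c \<odot>\<^bsub>V\<^esub> x, c \<odot>\<^bsub>W\<^esub> y))\<rparr>"

text \<open>For modules over a complex algebra \<open>R\<close>, the vector space of \<open>R\<close>-linear maps; the scalar
  \<open>c\<close> acts on a module as the element \<open>c \<odot> \<one>\<close> of \<open>R\<close>.\<close>

definition hom_space ::
  "(complex, 'r) module \<Rightarrow> ('r, 'm) module \<Rightarrow> ('r, 'n) module \<Rightarrow> (complex, 'm \<Rightarrow> 'n) module" where
  "hom_space R M N =
     \<lparr>carrier = lin_maps R M N, monoid.mult = undefined, one = undefined,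
      zero = (\<lambda>x\<in>carrier M. \<zero>\<^bsub>N\<^esub>),
      add = (\<lambda>f g. \<lambda>x\<in>carrier M. f x \<oplus>\<^bsub>N\<^esub> g x),
      module.smult = (\<lambda>c f. \<lambda>x\<in>carrier M. (c \<odot>\<^bsub>R\<^esub> \<one>\<^bsub>R\<^esub>) \<odot>\<^bsub>N\<^esub> f x)\<rparr>"

definition cvs_dual :: "(complex, 'v) module \<Rightarrow> (complex, 'v \<Rightarrow> complex) module" where
  "cvs_dual V = hom_space complex_alg V complex_alg"


section \<open>Graded complex vector spaces\<close>

text \<open>A graded vector space is the family of its homogeneous components.\<close>

type_synonym 'v gvs = "int \<Rightarrow> (complex, 'v) module"

definition graded_vector_space :: "'v gvs \<Rightarrow> bool" where
  "graded_vector_space V \<longleftrightarrow> (\<forall>j. Module.module complex_alg (V j))"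

definition has_hilbert_series :: "'v gvs \<Rightarrow> int fls \<Rightarrow> bool" where
  "has_hilbert_series V H \<longleftrightarrow> (\<forall>j. \<exists>n. has_dim (V j) n \<and> fls_nth H j = int n)"

definition gvs_iso :: "'v gvs \<Rightarrow> 'w gvs \<Rightarrow> bool" (infix "\<simeq>\<^sub>g" 50) where
  "V \<simeq>\<^sub>g W \<longleftrightarrow> (\<forall>j. cvs_iso (V j) (W j))"

definition gvs_sum :: "'v gvs \<Rightarrow> 'w gvs \<Rightarrow> ('v \<times> 'w) gvs" (infixr "\<oplus>\<^sub>g" 65) where
  "V \<oplus>\<^sub>g W = (\<lambda>j. cvs_sum (V j) (W j))"

definition gvs_dual :: "'v gvs \<Rightarrow> ('v \<Rightarrow> complex) gvs" where
  "gvs_dual V = (\<lambda>j. cvs_dual (V (- j)))"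

definition gvs_shift :: "'v gvs \<Rightarrow> int \<Rightarrow> 'v gvs" where
  "gvs_shift V n = (\<lambda>j. V (j - n))"


section \<open>Graded modules and Ext\<close>

text \<open>Gradings are internal: \<open>GM j\<close> is the homogeneous component of degree \<open>j\<close>.\<close>

definition graded_module ::
  "('r, 'e) ring_scheme \<Rightarrow> (int \<Rightarrow> 'r set) \<Rightarrow> ('r, 'm) module \<Rightarrow> (int \<Rightarrow> 'm set) \<Rightarrow> bool" where
  "graded_module R GR M GM \<longleftrightarrow> left_module R M \<and>
     (\<forall>j. subgroup (GM j) (add_monoid M)) \<and>
     (\<forall>x\<in>carrier M. \<exists>!c :: int \<Rightarrow> 'm. (\<forall>j. c j \<in> GM j) \<and> finite {j. c j \<noteq> \<zero>\<^bsub>M\<^esub>} \<and>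
        x = (\<Oplus>\<^bsub>M\<^esub>j\<in>{j. c j \<noteq> \<zero>\<^bsub>M\<^esub>}. c j)) \<and>
     (\<forall>i j. \<forall>r\<in>GR i. \<forall>x\<in>GM j. r \<odot>\<^bsub>M\<^esub> x \<in> GM (i + j))"

definition deg_maps ::
  "('r, 'e) ring_scheme \<Rightarrow> ('r, 'm) module \<Rightarrow> (int \<Rightarrow> 'm set) \<Rightarrow>
   ('r, 'n) module \<Rightarrow> (int \<Rightarrow> 'n set) \<Rightarrow> int \<Rightarrow> ('m \<Rightarrow> 'n) set" where
  "deg_maps R M GM N GN k = {f \<in> lin_maps R M N. \<forall>j. f ` GM j \<subseteq> GN (j + k)}"

text \<open>\<open>\<dots> \<rightarrow> P 2 \<rightarrow> P 1 \<rightarrow> P 0 \<rightarrow> M \<rightarrow> 0\<close> exact, with differentials \<open>d n : P (n + 1) \<rightarrow> P n\<close>,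
  augmentation \<open>aug : P 0 \<rightarrow> M\<close>, and all maps of degree 0.\<close>

definition graded_projective_resolution ::
  "('r, 'e) ring_scheme \<Rightarrow> (int \<Rightarrow> 'r set) \<Rightarrow> ('r, 'm) module \<Rightarrow> (int \<Rightarrow> 'm set) \<Rightarrow>
   (nat \<Rightarrow> ('r, 'p) module) \<Rightarrow> (nat \<Rightarrow> int \<Rightarrow> 'p set) \<Rightarrow> (nat \<Rightarrow> 'p \<Rightarrow> 'p) \<Rightarrow> ('p \<Rightarrow> 'm) \<Rightarrow> bool"
where
  "graded_projective_resolution R GR M GM P GP d aug \<longleftrightarrow>
     (\<forall>n. graded_module R GR (P n) (GP n) \<and> projective_module R (P n)) \<and>
     (\<forall>n. d n \<in> deg_maps R (P (Suc n)) (GP (Suc n)) (P n) (GP n) 0) \<and>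
     aug \<in> deg_maps R (P 0) (GP 0) M GM 0 \<and>
     aug ` carrier (P 0) = carrier M \<and>
     d 0 ` carrier (P 1) = {x \<in> carrier (P 0). aug x = \<zero>\<^bsub>M\<^esub>} \<and>
     (\<forall>n. d (Suc n) ` carrier (P (Suc (Suc n))) =
        {x \<in> carrier (P (Suc n)). d n x = \<zero>\<^bsub>P n\<^esub>})"

definition ext_cocycles ::
  "('r, 'e) ring_scheme \<Rightarrow> (nat \<Rightarrow> ('r, 'p) module) \<Rightarrow> (nat \<Rightarrow> int \<Rightarrow> 'p set) \<Rightarrow>
   (nat \<Rightarrow> 'p \<Rightarrow> 'p) \<Rightarrow> ('r, 'n) module \<Rightarrow> (int \<Rightarrow> 'n set) \<Rightarrow> nat \<Rightarrow> int \<Rightarrow> ('p \<Rightarrow> 'n) set" where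
  "ext_cocycles R P GP d N GN n k =
     {f \<in> deg_maps R (P n) (GP n) N GN k. \<forall>x\<in>carrier (P (Suc n)). f (d n x) = \<zero>\<^bsub>N\<^esub>}"

definition ext_coboundaries ::
  "('r, 'e) ring_scheme \<Rightarrow> (nat \<Rightarrow> ('r, 'p) module) \<Rightarrow> (nat \<Rightarrow> int \<Rightarrow> 'p set) \<Rightarrow>
   (nat \<Rightarrow> 'p \<Rightarrow> 'p) \<Rightarrow> ('r, 'n) module \<Rightarrow> (int \<Rightarrow> 'n set) \<Rightarrow> nat \<Rightarrow> int \<Rightarrow> ('p \<Rightarrow> 'n) set" where
  "ext_coboundaries R P GP d N GN n k =
     (case n of
        0 \<Rightarrow> {\<lambda>x\<in>carrier (P 0). \<zero>\<^bsub>N\<^esub>}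
      | Suc m \<Rightarrow> (\<lambda>g. \<lambda>x\<in>carrier (P (Suc m)). g (d m x)) ` deg_maps R (P m) (GP m) N GN k)"

text \<open>The degree \<open>k\<close> part of \<open>Ext\<^sup>n\<^sub>R(M, N)\<close>, computed from a graded projective resolution
  \<open>(P, GP, d)\<close> of \<open>M\<close>: the \<open>n\<close>-th cohomology of \<open>Hom\<^sub>R(P, N)\<close> in degree \<open>k\<close>. Up to isomorphism it
  does not depend on the resolution.\<close>

definition graded_Ext ::
  "(complex, 'r) module \<Rightarrow> (nat \<Rightarrow> ('r, 'p) module) \<Rightarrow> (nat \<Rightarrow> int \<Rightarrow> 'p set) \<Rightarrow>
   (nat \<Rightarrow> 'p \<Rightarrow> 'p) \<Rightarrow> ('r, 'n) module \<Rightarrow> (int \<Rightarrow> 'n set) \<Rightarrow> nat \<Rightarrow> ('p \<Rightarrow> 'n) set gvs" where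
  "graded_Ext R P GP d N GN n = (\<lambda>k.
     quot_module
       ((hom_space R (P n) N)\<lparr>carrier := ext_cocycles R P GP d N GN n k\<rparr>)
       (ext_coboundaries R P GP d N GN n k))"


section \<open>Enveloping algebra and Hochschild cohomology\<close>

definition opposite :: "(complex, 'a) module \<Rightarrow> (complex, 'a) module" where
  "opposite A = A\<lparr>monoid.mult := (\<lambda>x y. y \<otimes>\<^bsub>A\<^esub> x)\<rparr>"

definition ind :: "'x \<Rightarrow> 'x \<Rightarrow> complex" where
  "ind x = (\<lambda>y. if y = x then 1 else 0)"

text \<open>The tensor product over the complex numbers is the free vector space on pairs modulo the
  bilinearity relations; \<open>ind (a, b)\<close> is the symbol of the pure tensor of \<open>a\<close> and \<open>b\<close>.\<close>

definition tensor_free ::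
  "(complex, 'a) module \<Rightarrow> (complex, 'b) module \<Rightarrow> (complex, 'a \<times> 'b \<Rightarrow> complex) module" where
  "tensor_free A B = free_module complex_alg (carrier A \<times> carrier B)"

definition tensor_rels ::
  "(complex, 'a) module \<Rightarrow> (complex, 'b) module \<Rightarrow> ('a \<times> 'b \<Rightarrow> complex) set" where
  "tensor_rels A B =
     {(\<lambda>z. ind (a \<oplus>\<^bsub>A\<^esub> a', b) z - ind (a, b) z - ind (a', b) z) | a a' b.
        a \<in> carrier A \<and> a' \<in> carrier A \<and> b \<in> carrier B} \<union>
     {(\<lambda>z. ind (a, b \<oplus>\<^bsub>B\<^esub> b') z - ind (a, b) z - ind (a, b') z) | a b b'.
        a \<in> carrier A \<and> b \<in> carrier B \<and> b' \<in> carrier B} \<union>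
     {(\<lambda>z. ind (c \<odot>\<^bsub>A\<^esub> a, b) z - c * ind (a, b) z) | c a b.
        a \<in> carrier A \<and> b \<in> carrier B} \<union>
     {(\<lambda>z. ind (a, c \<odot>\<^bsub>B\<^esub> b) z - c * ind (a, b) z) | c a b.
        a \<in> carrier A \<and> b \<in> carrier B}"

definition tensor_kernel ::
  "(complex, 'a) module \<Rightarrow> (complex, 'b) module \<Rightarrow> ('a \<times> 'b \<Rightarrow> complex) set" where
  "tensor_kernel A B = mod_span complex_alg (tensor_free A B) (tensor_rels A B)"

text \<open>Bilinear extension of \<open>(a, b) (a', b') = (a a', b b')\<close>.\<close>

definition tensor_mult ::
  "(complex, 'a) module \<Rightarrow> (complex, 'b) module \<Rightarrow>
   ('a \<times> 'b \<Rightarrow> complex) \<Rightarrow> ('a \<times> 'b \<Rightarrow> complex) \<Rightarrow> 'a \<times> 'b \<Rightarrow> complex" where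
  "tensor_mult A B f g = (\<lambda>z. \<Sum>x\<in>{x. f x \<noteq> 0}. \<Sum>y\<in>{y. g y \<noteq> 0}.
     f x * g y * ind (fst x \<otimes>\<^bsub>A\<^esub> fst y, snd x \<otimes>\<^bsub>B\<^esub> snd y) z)"

definition tensor_algebra ::
  "(complex, 'a) module \<Rightarrow> (complex, 'b) module \<Rightarrow> (complex, ('a \<times> 'b \<Rightarrow> complex) set) module" where
  "tensor_algebra A B =
     (quot_module (tensor_free A B) (tensor_kernel A B))
       \<lparr>monoid.mult := (\<lambda>X Y. \<Union>f\<in>X. \<Union>g\<in>Y.
           tensor_kernel A B +>\<^bsub>tensor_free A B\<^esub> tensor_mult A B f g),
        one := tensor_kernel A B +>\<^bsub>tensor_free A B\<^esub> ind (\<one>\<^bsub>A\<^esub>, \<one>\<^bsub>B\<^esub>)\<rparr>"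

definition tensor_grading ::
  "(complex, 'a) module \<Rightarrow> (int \<Rightarrow> 'a set) \<Rightarrow> (complex, 'b) module \<Rightarrow> (int \<Rightarrow> 'b set) \<Rightarrow>
   int \<Rightarrow> ('a \<times> 'b \<Rightarrow> complex) set set" where
  "tensor_grading A GA B GB n = mod_span complex_alg (tensor_algebra A B)
     {tensor_kernel A B +>\<^bsub>tensor_free A B\<^esub> ind (a, b) | a b i j. a \<in> GA i \<and> b \<in> GB j \<and> i + j = n}"

type_synonym 'a env = "('a \<times> 'a \<Rightarrow> complex) set"

definition enveloping_algebra :: "(complex, 'a) module \<Rightarrow> (complex, 'a env) module" where
  "enveloping_algebra A = tensor_algebra (opposite A) A"

definition enveloping_grading ::
  "(complex, 'a) module \<Rightarrow> (int \<Rightarrow> 'a set) \<Rightarrow> int \<Rightarrow> 'a env set" where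
  "enveloping_grading A GA = tensor_grading (opposite A) GA A GA"

text \<open>\<open>A\<close> as a left module over its enveloping algebra: the pure tensor of \<open>a\<close> and \<open>b\<close> sends \<open>m\<close>
  to \<open>b m a\<close>. The action of a coset is evaluated on an arbitrary representative.\<close>

definition regular_bimodule :: "(complex, 'a) module \<Rightarrow> ('a env, 'a) module" where
  "regular_bimodule A =
     \<lparr>carrier = carrier A, monoid.mult = undefined, one = undefined, zero = \<zero>\<^bsub>A\<^esub>, add = add A,
      module.smult = (\<lambda>X m. let f = (SOME f. f \<in> X) in
        \<Oplus>\<^bsub>A\<^esub>z\<in>{z. f z \<noteq> 0}. f z \<odot>\<^bsub>A\<^esub> (snd z \<otimes>\<^bsub>A\<^esub> m \<otimes>\<^bsub>A\<^esub> fst z))\<rparr>"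

definition hochschild_resolution ::
  "(complex, 'a) module \<Rightarrow> (int \<Rightarrow> 'a set) \<Rightarrow>
   (nat \<Rightarrow> ('a env, 'p) module) \<Rightarrow> (nat \<Rightarrow> int \<Rightarrow> 'p set) \<Rightarrow> (nat \<Rightarrow> 'p \<Rightarrow> 'p) \<Rightarrow> ('p \<Rightarrow> 'a) \<Rightarrow> bool"
where
  "hochschild_resolution A GA P GP d aug \<longleftrightarrow>
     graded_projective_resolution (enveloping_algebra A) (enveloping_grading A GA)
       (regular_bimodule A) GA P GP d aug"

definition hochschild_cohomology ::
  "(complex, 'a) module \<Rightarrow> (int \<Rightarrow> 'a set) \<Rightarrow>
   (nat \<Rightarrow> ('a env, 'p) module) \<Rightarrow> (nat \<Rightarrow> int \<Rightarrow> 'p set) \<Rightarrow> (nat \<Rightarrow> 'p \<Rightarrow> 'p) \<Rightarrow>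
   nat \<Rightarrow> ('p \<Rightarrow> 'a) set gvs" where
  "hochschild_cohomology A GA P GP d n =
     graded_Ext (enveloping_algebra A) P GP d (regular_bimodule A) GA n"


section \<open>Path algebras\<close>

text \<open>A path is a starting vertex together with a list of consecutive arcs, so that paths of
  length 0 are vertices.\<close>

type_synonym ('v, 'e) path = "'v \<times> 'e list"

definition paths :: "('v, 'e) pre_digraph \<Rightarrow> ('v, 'e) path set" where
  "paths G = {(u, p). \<exists>v. pre_digraph.awalk G u p v}"

text \<open>The coefficient of a product at a path \<open>(u, p)\<close> is the sum over all ways of cutting the path
  into an initial segment of length \<open>k\<close> and the remaining final segment.\<close>

definition path_algebra ::
  "('v, 'e) pre_digraph \<Rightarrow> (complex, ('v, 'e) path \<Rightarrow> complex) module" where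
  "path_algebra G =
     (free_module complex_alg (paths G))
       \<lparr>monoid.mult := (\<lambda>f g (u, p). \<Sum>k\<le>length p.
           f (u, take k p) * g (last (pre_digraph.awalk_verts G u (take k p)), drop k p)),
        one := (\<lambda>(u, p). if u \<in> verts G \<and> p = [] then 1 else 0)\<rparr>"


section \<open>Cell systems and almost Calabi-Yau algebras\<close>

definition qint :: "nat \<Rightarrow> nat \<Rightarrow> complex" where
  "qint h m = (let q = exp (\<i> * complex_of_real pi / of_nat h) in
     (q ^ m - inverse q ^ m) / (q - inverse q))"

text \<open>A positive eigenvector of the adjacency matrix for the eigenvalue \<open>[3]\<^sub>q\<close>; it is unique only
  up to a positive factor.\<close>

definition perron_frobenius :: "('v, 'e) pre_digraph \<Rightarrow> nat \<Rightarrow> ('v \<Rightarrow> real) \<Rightarrow> bool" where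
  "perron_frobenius G h \<phi> \<longleftrightarrow> (\<forall>v\<in>verts G. \<phi> v > 0) \<and>
     (\<forall>v\<in>verts G. (\<Sum>a\<in>out_arcs G v. complex_of_real (\<phi> (head G a))) = qint h 3 * \<phi> v)"

definition cell_system ::
  "('v, 'e) pre_digraph \<Rightarrow> nat \<Rightarrow> ('v \<Rightarrow> real) \<Rightarrow> ('e \<Rightarrow> 'e \<Rightarrow> 'e \<Rightarrow> complex) \<Rightarrow> bool" where
  "cell_system G h \<phi> W \<longleftrightarrow>
     (\<forall>a\<in>arcs G. \<forall>b\<in>arcs G. \<forall>c\<in>arcs G.
        head G a = tail G b \<and> head G b = tail G c \<and> head G c = tail G a \<longrightarrow>
        W a b c = W b c a \<and> W a b c = W c a b) \<and>
     (\<forall>i\<in>verts G. \<forall>j\<in>verts G. \<forall>a\<in>arcs G. \<forall>a'\<in>arcs G.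
        tail G a = i \<and> head G a = j \<and> tail G a' = i \<and> head G a' = j \<longrightarrow>
        (\<Sum>(b1, b2)\<in>{(b1, b2). b1 \<in> arcs G \<and> b2 \<in> arcs G \<and>
              tail G b1 = j \<and> head G b1 = tail G b2 \<and> head G b2 = i}.
           W a b1 b2 * cnj (W a' b1 b2)) =
        (if a = a' then qint h 2 * \<phi> i * \<phi> j else 0)) \<and>
     (\<forall>i1\<in>verts G. \<forall>i2\<in>verts G. \<forall>i3\<in>verts G. \<forall>i4\<in>verts G.
      \<forall>a1\<in>arcs G. \<forall>a2\<in>arcs G. \<forall>a3\<in>arcs G. \<forall>a4\<in>arcs G.
        tail G a1 = i4 \<and> head G a1 = i1 \<and> tail G a2 = i2 \<and> head G a2 = i1 \<and>
        tail G a3 = i2 \<and> head G a3 = i3 \<and> tail G a4 = i4 \<and> head G a4 = i3 \<longrightarrow>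
        (\<Sum>(k, b1, b2, b3, b4)\<in>{(k, b1, b2, b3, b4). k \<in> verts G \<and>
              b1 \<in> arcs G \<and> b2 \<in> arcs G \<and> b3 \<in> arcs G \<and> b4 \<in> arcs G \<and>
              tail G b1 = i1 \<and> head G b1 = k \<and> tail G b2 = k \<and> head G b2 = i2 \<and>
              tail G b3 = i3 \<and> head G b3 = k \<and> tail G b4 = k \<and> head G b4 = i4}.
           inverse (complex_of_real (\<phi> k)) *
           W a2 b1 b2 * cnj (W a3 b3 b2) * W a4 b3 b4 * cnj (W a1 b1 b4)) =
        (if a1 = a4 \<and> a2 = a3 then complex_of_real (\<phi> i4 * \<phi> i1 * \<phi> i2) else 0) +
        (if a1 = a2 \<and> a3 = a4 then complex_of_real (\<phi> i1 * \<phi> i2 * \<phi> i3) else 0))"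

text \<open>The element of the path algebra attached to the arc \<open>a\<close>, a combination of the paths of
  length 2 from the head of \<open>a\<close> to its tail.\<close>

definition cell_relation ::
  "('v, 'e) pre_digraph \<Rightarrow> ('e \<Rightarrow> 'e \<Rightarrow> 'e \<Rightarrow> complex) \<Rightarrow> 'e \<Rightarrow> ('v, 'e) path \<Rightarrow> complex" where
  "cell_relation G W a = (\<lambda>(u, p).
     if u = head G a \<and> pre_digraph.awalk G u p (tail G a) \<and> length p = 2
     then W a (p ! 0) (p ! 1) else 0)"

definition cell_ideal ::
  "('v, 'e) pre_digraph \<Rightarrow> ('e \<Rightarrow> 'e \<Rightarrow> 'e \<Rightarrow> complex) \<Rightarrow> (('v, 'e) path \<Rightarrow> complex) set" where
  "cell_ideal G W = Idl\<^bsub>path_algebra G\<^esub> (cell_relation G W ` arcs G)"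

definition almost_CY_algebra ::
  "('v, 'e) pre_digraph \<Rightarrow> ('e \<Rightarrow> 'e \<Rightarrow> 'e \<Rightarrow> complex) \<Rightarrow>
   (complex, (('v, 'e) path \<Rightarrow> complex) set) module" where
  "almost_CY_algebra G W = quot_algebra (path_algebra G) (cell_ideal G W)"

definition almost_CY_grading ::
  "('v, 'e) pre_digraph \<Rightarrow> ('e \<Rightarrow> 'e \<Rightarrow> 'e \<Rightarrow> complex) \<Rightarrow>
   int \<Rightarrow> (('v, 'e) path \<Rightarrow> complex) set set" where
  "almost_CY_grading G W j = (\<lambda>f. cell_ideal G W +>\<^bsub>path_algebra G\<^esub> f) `
     {f \<in> carrier (path_algebra G). \<forall>u p. f (u, p) \<noteq> 0 \<longrightarrow> int (length p) = j}"


section \<open>The graph\<close>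

definition E8star :: "(nat, nat \<times> nat) pre_digraph" where
  "E8star =
     \<lparr>verts = {1, 2, 3, 4},
      arcs = {(1, 2), (2, 2), (2, 3), (2, 4), (3, 1), (3, 2), (3, 3), (4, 3)},
      tail = fst, head = snd\<rparr>"

end

theory Submission
  imports Defs "HOL-Library.Code_Binary_Nat"
begin

text \<open>
 Rescaling the arcs turns every cell system into one integral presentation, with the relations
 \<open>-aa+pq, bb+qp, qa+bq+xy, ap+pb+uv, px, yp, vq, qu\<close> for the arcs \<open>y = 12, a = 22, p = 23, u = 24, x = 31, q = 32, b = 33, v = 43\<close>:
 the equations (I) and (II) force all cells to be nonzero and to satisfy the single
 cubic identity that the rescaling needs. The algebra has a basis of 48 paths with integral structure
 constants. Its bimodule resolution has period 4 up to a degree shift by 8, with generators indexed by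
 vertices, arcs, relations and vertices, the period being closed by a Casimir element. Keeping only the left
 factors gives complexes with explicit integral contractions, and a descent on the degree of the right
 factors turns these into exactness of the bimodule complex. Homomorphisms into the algebra are
 coordinate vectors, the Hom complex splits by explicit integral matrices, and an arbitrary graded
 projective resolution is compared with this one up to chain homotopy.
\<close>

section \<open>Projective resolutions and Ext\<close>

text \<open>After rescaling, the relations are the cyclic derivatives of a potential. Hence the
  four-term bimodule complex on vertices, arcs, relations and vertices; the kernel at its end is
  generated in degree 8 = 3 + 5, where 5 is the length of the longest basis paths. A contraction of
  the bimodule complex itself would be a table over pairs of basis paths, while left factors alone
  need one row per generator and path: this is the reason for the detour through the filtration by
  right factors. That the 48 paths form a basis has two halves. Certificates rewrite each product of
  a basis path with an arc modulo the relations, and the path algebra acts on coordinate vectors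
  with the relations acting by zero. The cell ideal is then the annihilator of the vector of the
  unit, and associativity of the table is inherited from the path algebra instead of being checked
  on triples. The evaluated identities are between integer lists, so contractions appear multiplied
  by 2 or 8 and the division is done over the complex numbers. The ring axioms of the enveloping
  algebra come from the given resolution, whose terms are modules over it.\<close>

lemma lin_mapsD:
 assumes "f \<in> lin_maps R M N"
 shows "f \<in> carrier M \<rightarrow>\<^sub>E carrier N"
  and "x \<in> carrier M ==> f x \<in> carrier N"
  and "x \<in> carrier M ==> y \<in> carrier M ==> f (x \<oplus>\<^bsub>M\<^esub> y) = f x \<oplus>\<^bsub>N\<^esub> f y"
  and "r \<in> carrier R ==> x \<in> carrier M ==> f (r \<odot>\<^bsub>M\<^esub> x) = r \<odot>\<^bsub>N\<^esub> f x"
 using assms by (auto simp: lin_maps_def)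

lemma lin_mapsI:
 assumes "\<And>x. x \<in> carrier M ==> f x \<in> carrier N"
  and "\<And>x y. x \<in> carrier M ==> y \<in> carrier M ==> f (x \<oplus>\<^bsub>M\<^esub> y) = f x \<oplus>\<^bsub>N\<^esub> f y"
  and "\<And>r x. r \<in> carrier R ==> x \<in> carrier M ==> f (r \<odot>\<^bsub>M\<^esub> x) = r \<odot>\<^bsub>N\<^esub> f x"
  and "\<And>x y. x \<in> carrier M ==> y \<in> carrier M ==> x \<oplus>\<^bsub>M\<^esub> y \<in> carrier M"
  and "\<And>r x. r \<in> carrier R ==> x \<in> carrier M ==> r \<odot>\<^bsub>M\<^esub> x \<in> carrier M"
 shows "restrict f (carrier M) \<in> lin_maps R M N"
 using assms by (auto simp: lin_maps_def)

lemma lin_maps_group_hom: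
 assumes "f \<in> lin_maps R M N" "abelian_group M" "abelian_group N"
 shows "abelian_group_hom M N f"
 using assms by (auto simp: lin_maps_def abelian_group_hom_def abelian_group_hom_axioms_def
   group_hom_def group_hom_axioms_def hom_def abelian_group.a_group)

lemma (in abelian_group_hom) hom_finsum:
 assumes "finite I" "g \<in> I \<rightarrow> carrier G"
 shows "h (\<Oplus>\<^bsub>G\<^esub>i\<in>I. g i) = (\<Oplus>\<^bsub>H\<^esub>i\<in>I. h (g i))"
 using assms
 by (induction rule: finite_induct) (auto simp: Pi_def)

text \<open>This is the sum that \<open>graded_module\<close> uses. Having the support built in
  allows families over an infinite index set to be added, shifted and mapped without choosing common
  finite supports each time.\<close>

definition fsum :: "('r, 'm) ring_scheme => ('i => 'r) => 'r" where
 "fsum M t = finsum M t {i. t i \<noteq> \<zero>\<^bsub>M\<^esub>}"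

context abelian_group
begin

lemma fsum_eq:
 assumes "finite S" "\<And>i. t i \<in> carrier G" "\<And>i. i \<notin> S ==> t i = \<zero>"
 shows "fsum G t = finsum G t S"
 unfolding fsum_def
 by (rule add.finprod_mono_neutral_cong_left) (use assms in auto)

lemma fsum_closed:
 assumes "\<And>i. t i \<in> carrier G"
 shows "fsum G t \<in> carrier G"
 unfolding fsum_def using assms by (intro finsum_closed) auto

lemma fsum_add:
 assumes "\<And>i. t i \<in> carrier G" "\<And>i. u i \<in> carrier G"
  and "finite {i. t i \<noteq> \<zero>}" "finite {i. u i \<noteq> \<zero>}"
 shows "fsum G (\<lambda>i. t i \<oplus> u i) = fsum G t \<oplus> fsum G u"
proof -
 let ?S = "{i. t i \<noteq> \<zero>} \<union> {i. u i \<noteq> \<zero>}"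
 have S: "finite ?S" using assms by simp
 have "fsum G (\<lambda>i. t i \<oplus> u i) = finsum G (\<lambda>i. t i \<oplus> u i) ?S"
  by (rule fsum_eq[OF S]) (use assms in auto)
 also have "... = finsum G t ?S \<oplus> finsum G u ?S"
  by (rule finsum_addf) (use assms in auto)
 also have "finsum G t ?S = fsum G t" by (rule fsum_eq[OF S, symmetric]) (use assms in auto)
 also have "finsum G u ?S = fsum G u" by (rule fsum_eq[OF S, symmetric]) (use assms in auto)
 finally show ?thesis .
qed

lemma fsum_single:
 assumes "\<And>i. i \<noteq> j ==> t i = \<zero>" "t j \<in> carrier G"
 shows "fsum G t = t j"
proof -
 have "t i \<in> carrier G" for i by (cases "i = j") (use assms in auto)
 then have "fsum G t = finsum G t {j}" by (intro fsum_eq) (use assms in auto)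
 then show ?thesis using assms by simp
qed

lemma fsum_shift:
 fixes t :: "int => 'a"
 assumes "\<And>i. t i \<in> carrier G"
 shows "fsum G (\<lambda>i. t (i - k)) = fsum G t"
proof -
 have "{i. t i \<noteq> \<zero>} = (\<lambda>i. i - k) ` {i. t (i - k) \<noteq> \<zero>}"
  by (auto simp: image_iff intro!: exI[of _ "_ + k"])
 moreover have "finsum G t ((\<lambda>i. i - k) ` {i. t (i - k) \<noteq> \<zero>}) =
   finsum G (\<lambda>i. t (i - k)) {i. t (i - k) \<noteq> \<zero>}"
  by (rule finsum_reindex) (use assms in \<open>auto simp: inj_on_def\<close>)
 ultimately show ?thesis by (simp add: fsum_def)
qed

end

lemma (in abelian_group_hom) hom_fsum:
 assumes "\<And>i. t i \<in> carrier G" "finite {i. t i \<noteq> \<zero>\<^bsub>G\<^esub>}"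
 shows "h (fsum G t) = fsum H (\<lambda>i. h (t i))"
proof -
 have "fsum H (\<lambda>i. h (t i)) = finsum H (\<lambda>i. h (t i)) {i. t i \<noteq> \<zero>\<^bsub>G\<^esub>}"
  by (rule H.fsum_eq) (use assms in auto)
 then show ?thesis unfolding fsum_def by (simp add: hom_finsum assms)
qed

context left_module
begin

lemma smult_add_hom:
 "r \<in> carrier R ==> abelian_group_hom M M (\<lambda>x. r \<odot>\<^bsub>M\<^esub> x)"
 by (auto simp: abelian_group_hom_def abelian_group_hom_axioms_def group_hom_def
   group_hom_axioms_def hom_def M.abelian_group_axioms M.a_group smult_closed smult_r_distr)

lemma smult_zero [simp]: "r \<in> carrier R ==> r \<odot>\<^bsub>M\<^esub> \<zero>\<^bsub>M\<^esub> = \<zero>\<^bsub>M\<^esub>"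
 using abelian_group_hom.hom_zero[OF smult_add_hom] .

lemma zero_smult [simp]: "x \<in> carrier M ==> \<zero>\<^bsub>R\<^esub> \<odot>\<^bsub>M\<^esub> x = \<zero>\<^bsub>M\<^esub>"
 using smult_l_distr[of "\<zero>\<^bsub>R\<^esub>" "\<zero>\<^bsub>R\<^esub>" x] by (simp add: smult_closed)

end

section \<open>Free modules and lifting through projective modules\<close>

lemma free_module_hom_expand:
 assumes R: "ring R" and N: "left_module R N"
  and h: "h \<in> lin_maps R (free_module R X) N"
  and S: "finite S" "S \<subseteq> X" and f: "f \<in> carrier (free_module R X)" "{x. f x \<noteq> \<zero>\<^bsub>R\<^esub>} \<subseteq> S"
 shows "h f = (\<Oplus>\<^bsub>N\<^esub>x\<in>S. f x \<odot>\<^bsub>N\<^esub> h (\<lambda>y. if y = x then \<one>\<^bsub>R\<^esub> else \<zero>\<^bsub>R\<^esub>))"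
proof -
 interpret R: ring R by fact
 interpret N: left_module R N by fact
 let ?F = "free_module R X"
 let ?d = "\<lambda>x y. if y = x then \<one>\<^bsub>R\<^esub> else \<zero>\<^bsub>R\<^esub>"
 have d: "?d x \<in> carrier ?F" if "x \<in> X" for x
 proof -
  have "{y. ?d x y \<noteq> \<zero>\<^bsub>R\<^esub>} \<subseteq> {x}" by auto
  then have "finite {y. ?d x y \<noteq> \<zero>\<^bsub>R\<^esub>}" by (rule finite_subset) simp
  with that show ?thesis by (auto simp: free_module_def)
 qed
 show ?thesis using S f
 proof (induction S arbitrary: f rule: finite_induct)
  case empty
  then have 0: "f = \<zero>\<^bsub>?F\<^esub>" by (auto simp: free_module_def)
  have z: "\<zero>\<^bsub>?F\<^esub> \<in> carrier ?F" by (simp add: free_module_def)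
  have "\<zero>\<^bsub>?F\<^esub> \<oplus>\<^bsub>?F\<^esub> \<zero>\<^bsub>?F\<^esub> = \<zero>\<^bsub>?F\<^esub>" by (simp add: free_module_def)
  then have "h \<zero>\<^bsub>?F\<^esub> = h \<zero>\<^bsub>?F\<^esub> \<oplus>\<^bsub>N\<^esub> h \<zero>\<^bsub>?F\<^esub>"
   using lin_mapsD(3)[OF h z z] by simp
  then show ?case using 0 lin_mapsD(2)[OF h z] by simp
 next
  case (insert x S)
  let ?g = "f(x := \<zero>\<^bsub>R\<^esub>)"
  have fin: "finite {y. ?g y \<noteq> \<zero>\<^bsub>R\<^esub>}"
   using insert.prems by (auto simp: free_module_def intro: finite_subset[OF _ insert.hyps(1)])
  have g: "?g \<in> carrier ?F" using insert.prems fin by (auto simp: free_module_def)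
  have gS: "{y. ?g y \<noteq> \<zero>\<^bsub>R\<^esub>} \<subseteq> S" using insert.prems by auto
  have xX: "x \<in> X" and fx: "f x \<in> carrier R" using insert.prems by (auto simp: free_module_def)
  have fxd: "f x \<odot>\<^bsub>?F\<^esub> ?d x \<in> carrier ?F"
  proof -
   have "{y. f x \<otimes>\<^bsub>R\<^esub> ?d x y \<noteq> \<zero>\<^bsub>R\<^esub>} \<subseteq> {x}" using fx by auto
   then have "finite {y. f x \<otimes>\<^bsub>R\<^esub> ?d x y \<noteq> \<zero>\<^bsub>R\<^esub>}" by (rule finite_subset) simp
   then show ?thesis using fx xX by (auto simp: free_module_def)
  qed
  have fy: "f y \<in> carrier R" for y
   using insert.prems(2) by (cases "y \<in> X") (auto simp: free_module_def)
  have feq: "f = ?g \<oplus>\<^bsub>?F\<^esub> (f x \<odot>\<^bsub>?F\<^esub> ?d x)"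
   by (rule ext) (use fy in \<open>auto simp: free_module_def\<close>)
  let ?t = "\<lambda>y. f y \<odot>\<^bsub>N\<^esub> h (?d y)"
  have t: "?t \<in> insert x S \<rightarrow> carrier N"
   using insert.prems lin_mapsD(2)[OF h d] by (auto simp: free_module_def intro!: N.smult_closed)
  have 1: "h f = h ?g \<oplus>\<^bsub>N\<^esub> ?t x"
   using lin_mapsD(3)[OF h g fxd] lin_mapsD(4)[OF h fx d[OF xX]] feq by simp
  have 2: "h ?g = (\<Oplus>\<^bsub>N\<^esub>y\<in>S. ?g y \<odot>\<^bsub>N\<^esub> h (?d y))"
   by (rule insert.IH[OF _ g gS]) (use insert.prems in auto)
  have 3: "(\<Oplus>\<^bsub>N\<^esub>y\<in>S. ?g y \<odot>\<^bsub>N\<^esub> h (?d y)) = finsum N ?t S"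
   by (rule N.M.finsum_cong') (use insert.hyps t in \<open>auto simp: Pi_def\<close>)
  have "finsum N ?t (insert x S) = ?t x \<oplus>\<^bsub>N\<^esub> finsum N ?t S"
   by (rule N.M.finsum_insert) (use insert.hyps t in auto)
  also have "... = finsum N ?t S \<oplus>\<^bsub>N\<^esub> ?t x"
   by (rule N.M.add.m_comm) (use t in \<open>auto intro!: N.M.finsum_closed\<close>)
  also have "... = h f" using 1 2 3 by simp
  finally show ?case by simp
 qed
qed

text \<open>The lift is written down from the splitting \<open>i\<close>, \<open>q\<close>: choose a
  preimage \<open>n x\<close> of the image of each basis vector and let \<open>\<gamma> p\<close> be
  the sum of \<open>i p x\<close> times \<open>n x\<close>. Linearity of \<gamma> then only needs
  linearity of \<open>i\<close>, so no map out of the free module has to be constructed from its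
  values on the basis.\<close>

lemma projective_lift:
 fixes P :: "('r, 'p) module"
 assumes P: "projective_module R P" and N: "left_module R N" and N': "left_module R N'"
  and \<beta>: "\<beta> \<in> lin_maps R N N'" and \<alpha>: "\<alpha> \<in> lin_maps R P N'"
  and im: "\<alpha> ` carrier P \<subseteq> \<beta> ` carrier N"
 shows "\<exists>\<gamma>\<in>lin_maps R P N. \<forall>x\<in>carrier P. \<beta> (\<gamma> x) = \<alpha> x"
proof -
 interpret N: left_module R N by fact
 interpret N': left_module R N' by fact
 interpret P: left_module R P using P by (simp add: projective_module_def)
 from P obtain X :: "'p set" and i q where i: "i \<in> lin_maps R P (free_module R X)"
  and q: "q \<in> lin_maps R (free_module R X) P" and qi: "\<And>x. x \<in> carrier P ==> q (i x) = x"
  by (auto simp: projective_module_def; blast)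
 let ?F = "free_module R X"
 define e where "e = (\<lambda>x y :: 'p. if y = x then \<one>\<^bsub>R\<^esub> else \<zero>\<^bsub>R\<^esub>)"
 have e: "e x \<in> carrier ?F" if "x \<in> X" for x
 proof -
  have "{y. e x y \<noteq> \<zero>\<^bsub>R\<^esub>} \<subseteq> {x}" by (auto simp: e_def)
  then have "finite {y. e x y \<noteq> \<zero>\<^bsub>R\<^esub>}" by (rule finite_subset) simp
  with that show ?thesis by (auto simp: free_module_def e_def)
 qed
 have "\<forall>x. \<exists>n. n \<in> carrier N \<and> (x \<in> X --> \<beta> n = \<alpha> (q (e x)))"
 proof
  fix x
  show "\<exists>n. n \<in> carrier N \<and> (x \<in> X --> \<beta> n = \<alpha> (q (e x)))"
  proof (cases "x \<in> X")
   case True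
   then have "\<alpha> (q (e x)) \<in> \<beta> ` carrier N" using im lin_mapsD(2)[OF q e] by blast
   then show ?thesis by auto
  qed auto
 qed
 then obtain n where n: "\<And>x. n x \<in> carrier N" "\<And>x. x \<in> X ==> \<beta> (n x) = \<alpha> (q (e x))"
  by metis
 have ip: "i p x \<in> carrier R" "finite {x. i p x \<noteq> \<zero>\<^bsub>R\<^esub>}" "i p x \<noteq> \<zero>\<^bsub>R\<^esub> ==> x \<in> X" if "p \<in> carrier P" for p x
  using lin_mapsD(2)[OF i that] by (cases "x \<in> X"; auto simp: free_module_def)+
 define t where "t p x = i p x \<odot>\<^bsub>N\<^esub> n x" for p x
 have t: "t p x \<in> carrier N" if "p \<in> carrier P" for p x
  using ip[OF that] n by (auto simp: t_def intro: N.smult_closed)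
 have tf: "finite {x. t p x \<noteq> \<zero>\<^bsub>N\<^esub>}" if "p \<in> carrier P" for p
  by (rule finite_subset[OF _ ip(2)[OF that]]) (use n in \<open>auto simp: t_def\<close>)
 define \<gamma> where "\<gamma> p = fsum N (t p)" for p
 have \<gamma>: "\<gamma> p \<in> carrier N" if "p \<in> carrier P" for p
  unfolding \<gamma>_def by (rule N.M.fsum_closed) (use t that in auto)
 have add: "\<gamma> (x \<oplus>\<^bsub>P\<^esub> y) = \<gamma> x \<oplus>\<^bsub>N\<^esub> \<gamma> y" if xy: "x \<in> carrier P" "y \<in> carrier P" for x y
 proof -
  have "t (x \<oplus>\<^bsub>P\<^esub> y) = (\<lambda>z. t x z \<oplus>\<^bsub>N\<^esub> t y z)"
   using lin_mapsD(3)[OF i xy] ip(1)[OF xy(1)] ip(1)[OF xy(2)] n(1)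
   by (simp add: fun_eq_iff t_def free_module_def N.smult_l_distr)
  then show ?thesis
   unfolding \<gamma>_def using N.M.fsum_add[OF t[OF xy(1)] t[OF xy(2)] tf[OF xy(1)] tf[OF xy(2)]] by simp
 qed
 have smult: "\<gamma> (r \<odot>\<^bsub>P\<^esub> x) = r \<odot>\<^bsub>N\<^esub> \<gamma> x" if rx: "r \<in> carrier R" "x \<in> carrier P" for r x
 proof -
  have "t (r \<odot>\<^bsub>P\<^esub> x) = (\<lambda>z. r \<odot>\<^bsub>N\<^esub> t x z)"
   using lin_mapsD(4)[OF i rx] ip(1)[OF rx(2)] n(1) rx(1)
   by (simp add: fun_eq_iff t_def free_module_def N.smult_assoc)
  then show ?thesis
   unfolding \<gamma>_def
   using abelian_group_hom.hom_fsum[OF N.smult_add_hom[OF rx(1)] t[OF rx(2)] tf[OF rx(2)]] by simp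
 qed
 have lift: "\<beta> (\<gamma> p) = \<alpha> p" if p: "p \<in> carrier P" for p
 proof -
  \<comment> \<open>\<open>h\<close> is \<alpha> after \<open>q\<close>. Expanding it at
    \<open>i p\<close> over the support and using \<open>q (i p) = p\<close> recovers
    \<open>\<alpha> p\<close> from the values on basis vectors.\<close>
  define h where "h = (\<lambda>f\<in>carrier ?F. \<alpha> (q f))"
  have Fcl: "f \<oplus>\<^bsub>?F\<^esub> g \<in> carrier ?F" if "f \<in> carrier ?F" "g \<in> carrier ?F" for f g
  proof -
   have "{x. f x \<oplus>\<^bsub>R\<^esub> g x \<noteq> \<zero>\<^bsub>R\<^esub>} \<subseteq> {x. f x \<noteq> \<zero>\<^bsub>R\<^esub>} \<union> {x. g x \<noteq> \<zero>\<^bsub>R\<^esub>}" by auto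
   then have "finite {x. f x \<oplus>\<^bsub>R\<^esub> g x \<noteq> \<zero>\<^bsub>R\<^esub>}"
    by (rule finite_subset) (use that in \<open>auto simp: free_module_def\<close>)
   then show ?thesis using that by (auto simp: free_module_def)
  qed
  have Fsm: "r \<odot>\<^bsub>?F\<^esub> f \<in> carrier ?F" if "r \<in> carrier R" "f \<in> carrier ?F" for r f
  proof -
   have "{x. r \<otimes>\<^bsub>R\<^esub> f x \<noteq> \<zero>\<^bsub>R\<^esub>} \<subseteq> {x. f x \<noteq> \<zero>\<^bsub>R\<^esub>}" using that by auto
   then have "finite {x. r \<otimes>\<^bsub>R\<^esub> f x \<noteq> \<zero>\<^bsub>R\<^esub>}"
    by (rule finite_subset) (use that in \<open>auto simp: free_module_def\<close>)
   then show ?thesis using that by (auto simp: free_module_def)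
  qed
  have h: "h \<in> lin_maps R ?F N'"
   unfolding h_def
   by (rule lin_mapsI) (auto simp: lin_mapsD(2-)[OF q] lin_mapsD(2-)[OF \<alpha>] Fcl Fsm)
  have he: "h (e x) = \<beta> (n x)" if "x \<in> X" for x
   using that n(2) e by (simp add: h_def)
  let ?S = "{x. i p x \<noteq> \<zero>\<^bsub>R\<^esub>}"
  have S: "finite ?S" "?S \<subseteq> X" using ip[OF p] by auto
  interpret \<beta>: abelian_group_hom N N' \<beta>
   by (rule lin_maps_group_hom[OF \<beta> N.M.abelian_group_axioms N'.M.abelian_group_axioms])
  have "\<alpha> p = h (i p)" using qi[OF p] lin_mapsD(2)[OF i p] by (simp add: h_def)
  also have "... = (\<Oplus>\<^bsub>N'\<^esub>x\<in>?S. i p x \<odot>\<^bsub>N'\<^esub> h (e x))"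
   unfolding e_def
   by (rule free_module_hom_expand[OF N.R.ring_axioms N' h S lin_mapsD(2)[OF i p]]) auto
  also have "... = (\<Oplus>\<^bsub>N'\<^esub>x\<in>?S. \<beta> (t p x))"
   by (rule N'.M.finsum_cong')
    (use S(2) he ip(1)[OF p] n(1) t[OF p] lin_mapsD(4)[OF \<beta>] in \<open>auto simp: t_def intro!: N'.smult_closed\<close>)
  also have "... = fsum N' (\<lambda>x. \<beta> (t p x))"
   by (rule N'.M.fsum_eq[symmetric]) (use S(1) t[OF p] n(1) in \<open>auto simp: t_def\<close>)
  also have "... = \<beta> (\<gamma> p)"
   unfolding \<gamma>_def by (rule \<beta>.hom_fsum[symmetric]) (use t[OF p] tf[OF p] in auto)
  finally show ?thesis by simp
 qed
 have "restrict \<gamma> (carrier P) \<in> lin_maps R P N"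
  by (rule lin_mapsI) (use \<gamma> add smult P.smult_closed in auto)
 then show ?thesis using lift by (intro bexI[of _ "restrict \<gamma> (carrier P)"]) auto
qed

section \<open>Homogeneous components\<close>

definition hpart :: "('r, 'm) module => (int => 'm set) => 'm => int => 'm" where
 "hpart M GM x = (THE c. (\<forall>j. c j \<in> GM j) \<and> finite {j. c j \<noteq> \<zero>\<^bsub>M\<^esub>} \<and> x = fsum M c)"

locale graded = left_module R M for R :: "('r, 'e) ring_scheme" (structure)
  and M :: "('r, 'm) module" (structure) +
 fixes GR :: "int => 'r set" and GM :: "int => 'm set"
 assumes graded: "graded_module R GR M GM"
begin

lemma component_subgroup: "subgroup (GM j) (add_monoid M)"
 using graded by (simp add: graded_module_def)

lemma component_carrier: "x \<in> GM j ==> x \<in> carrier M"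
 using subgroup.subset[OF component_subgroup] by auto

lemma component_zero: "\<zero>\<^bsub>M\<^esub> \<in> GM j"
 using subgroup.one_closed[OF component_subgroup] by auto

lemma component_add: "x \<in> GM j ==> y \<in> GM j ==> x \<oplus>\<^bsub>M\<^esub> y \<in> GM j"
 using subgroup.m_closed[OF component_subgroup] by auto

lemma component_minus: "x \<in> GM j ==> y \<in> GM j ==> x \<ominus>\<^bsub>M\<^esub> y \<in> GM j"
 using subgroup.m_inv_closed[OF component_subgroup, of y j] component_add
 by (simp add: a_minus_def a_inv_def)

lemma component_smult: "r \<in> GR i ==> x \<in> GM j ==> r \<odot>\<^bsub>M\<^esub> x \<in> GM (i + j)"
 using graded by (simp add: graded_module_def)

lemma decomposition_ex1:
 "x \<in> carrier M ==> \<exists>!c. (\<forall>j. c j \<in> GM j) \<and> finite {j. c j \<noteq> \<zero>\<^bsub>M\<^esub>} \<and> x = fsum M c"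
 using graded unfolding graded_module_def fsum_def by blast

lemma hpart:
 assumes "x \<in> carrier M"
 shows "hpart M GM x j \<in> GM j" "finite {j. hpart M GM x j \<noteq> \<zero>\<^bsub>M\<^esub>}" "fsum M (hpart M GM x) = x"
  "hpart M GM x j \<in> carrier M"
 using theI'[OF decomposition_ex1[OF assms]] component_carrier unfolding hpart_def[symmetric] by auto

lemma hpart_unique:
 assumes "\<And>j. c j \<in> GM j" "finite {j. c j \<noteq> \<zero>\<^bsub>M\<^esub>}" "x = fsum M c"
 shows "hpart M GM x = c"
proof -
 have "x \<in> carrier M" unfolding assms(3) by (rule M.fsum_closed) (use assms(1) component_carrier in auto)
 from the1_equality[OF decomposition_ex1[OF this], of c] assms show ?thesis
  unfolding hpart_def by auto
qed

lemma hpart_component: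
 assumes "x \<in> GM i"
 shows "hpart M GM x = (\<lambda>j. if j = i then x else \<zero>\<^bsub>M\<^esub>)"
proof (rule hpart_unique)
 have "{j. (if j = i then x else \<zero>\<^bsub>M\<^esub>) \<noteq> \<zero>\<^bsub>M\<^esub>} \<subseteq> {i}" by auto
 then show "finite {j. (if j = i then x else \<zero>\<^bsub>M\<^esub>) \<noteq> \<zero>\<^bsub>M\<^esub>}" by (rule finite_subset) simp
 show "x = fsum M (\<lambda>j. if j = i then x else \<zero>\<^bsub>M\<^esub>)"
  by (subst M.fsum_single[where j = i]) (use assms component_carrier in auto)
qed (use assms component_zero in auto)

lemma hpart_zero: "hpart M GM \<zero>\<^bsub>M\<^esub> = (\<lambda>j. \<zero>\<^bsub>M\<^esub>)"
 using hpart_component[OF component_zero] by simp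

lemma hpart_add:
 assumes "x \<in> carrier M" "y \<in> carrier M"
 shows "hpart M GM (x \<oplus>\<^bsub>M\<^esub> y) = (\<lambda>j. hpart M GM x j \<oplus>\<^bsub>M\<^esub> hpart M GM y j)"
proof (rule hpart_unique)
 have "{j. hpart M GM x j \<oplus>\<^bsub>M\<^esub> hpart M GM y j \<noteq> \<zero>\<^bsub>M\<^esub>} \<subseteq>
   {j. hpart M GM x j \<noteq> \<zero>\<^bsub>M\<^esub>} \<union> {j. hpart M GM y j \<noteq> \<zero>\<^bsub>M\<^esub>}" by auto
 then show "finite {j. hpart M GM x j \<oplus>\<^bsub>M\<^esub> hpart M GM y j \<noteq> \<zero>\<^bsub>M\<^esub>}"
  by (rule finite_subset) (use hpart(2) assms in auto)
 show "x \<oplus>\<^bsub>M\<^esub> y = fsum M (\<lambda>j. hpart M GM x j \<oplus>\<^bsub>M\<^esub> hpart M GM y j)"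
  by (subst M.fsum_add) (use hpart assms in auto)
qed (use hpart assms component_add in auto)

end

lemma gradedI: "graded_module R GR M GM ==> graded R M GR GM"
 by (simp add: graded_def graded_axioms_def graded_module_def)

text \<open>The images of the components of \<open>x\<close> form a decomposition of
  \<open>h x\<close>, so uniqueness applies. Only additivity is required because the lemma serves
  linear maps as well as multiplication by a homogeneous scalar.\<close>

lemma hpart_hom:
 assumes M: "graded R M GR GM" and N: "graded R N GR GN" and h: "abelian_group_hom M N h"
  and deg: "\<And>j x. x \<in> GM j ==> h x \<in> GN (j + k)" and x: "x \<in> carrier M"
 shows "hpart N GN (h x) = (\<lambda>j. h (hpart M GM x (j - k)))"
proof -
 interpret M: graded R M GR GM by fact
 interpret N: graded R N GR GN by fact
 interpret h: abelian_group_hom M N h by fact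
 note p = M.hpart[OF x]
 show ?thesis
 proof (rule N.hpart_unique)
  show "h (hpart M GM x (j - k)) \<in> GN j" for j using deg[OF p(1)[of "j - k"]] by simp
  have "{j. h (hpart M GM x (j - k)) \<noteq> \<zero>\<^bsub>N\<^esub>} \<subseteq> (\<lambda>j. j + k) ` {j. hpart M GM x j \<noteq> \<zero>\<^bsub>M\<^esub>}"
  proof
   fix j assume "j \<in> {j. h (hpart M GM x (j - k)) \<noteq> \<zero>\<^bsub>N\<^esub>}"
   then have "hpart M GM x (j - k) \<noteq> \<zero>\<^bsub>M\<^esub>" by auto
   then show "j \<in> (\<lambda>j. j + k) ` {j. hpart M GM x j \<noteq> \<zero>\<^bsub>M\<^esub>}"
    by (intro image_eqI[of _ _ "j - k"]) auto
  qed
  then show "finite {j. h (hpart M GM x (j - k)) \<noteq> \<zero>\<^bsub>N\<^esub>}" by (rule finite_subset) (use p in auto)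
  have "h x = fsum N (\<lambda>j. h (hpart M GM x j))"
   using h.hom_fsum[of "hpart M GM x"] p by auto
  also have "... = fsum N (\<lambda>j. h (hpart M GM x (j - k)))"
   by (rule N.M.fsum_shift[symmetric]) (use p in auto)
  finally show "h x = fsum N (\<lambda>j. h (hpart M GM x (j - k)))" .
 qed
qed

text \<open>Generation of the ring by homogeneous elements, phrased as an additive induction
  principle: this is the form in which linearity over homogeneous scalars is extended to all
  scalars.\<close>

definition spanned_by_degrees :: "('r, 'e) ring_scheme => (int => 'r set) => bool" where
 "spanned_by_degrees R GR \<longleftrightarrow> (\<forall>i. GR i \<subseteq> carrier R) \<and>
   (\<forall>T. (\<forall>i. GR i \<subseteq> T) -->
   (\<forall>a\<in>T \<inter> carrier R. \<forall>b\<in>T \<inter> carrier R. a \<oplus>\<^bsub>R\<^esub> b \<in> T) --> carrier R \<subseteq> T)"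

lemma deg_mapsD:
 assumes "f \<in> deg_maps R M GM N GN k"
 shows "f \<in> lin_maps R M N" "x \<in> GM j ==> f x \<in> GN (j + k)"
 using assms by (auto simp: deg_maps_def)

text \<open>The degree \<open>k\<close> part of an ungraded lift is still a lift.\<close>

lemma graded_lift:
 assumes gen: "spanned_by_degrees R GR"
  and P: "graded_module R GR P GP" "projective_module R P"
  and N: "graded_module R GR N GN" and N': "graded_module R GR N' GN'"
  and \<beta>: "\<beta> \<in> deg_maps R N GN N' GN' 0" and \<alpha>: "\<alpha> \<in> deg_maps R P GP N' GN' k"
  and im: "\<alpha> ` carrier P \<subseteq> \<beta> ` carrier N"
 shows "\<exists>\<gamma>\<in>deg_maps R P GP N GN k. \<forall>x\<in>carrier P. \<beta> (\<gamma> x) = \<alpha> x"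
proof -
 interpret P: graded R P GR GP by (rule gradedI) fact
 interpret N: graded R N GR GN by (rule gradedI) fact
 interpret N': graded R N' GR GN' by (rule gradedI) fact
 note a = deg_mapsD[OF \<alpha>] and b = deg_mapsD[OF \<beta>]
 obtain \<gamma> where \<gamma>: "\<gamma> \<in> lin_maps R P N" and lift: "\<And>x. x \<in> carrier P ==> \<beta> (\<gamma> x) = \<alpha> x"
  using projective_lift[OF P(2) N.left_module_axioms N'.left_module_axioms b(1) a(1) im] by auto
 interpret \<gamma>: abelian_group_hom P N \<gamma>
  by (rule lin_maps_group_hom[OF \<gamma> P.M.abelian_group_axioms N.M.abelian_group_axioms])
 interpret \<alpha>: abelian_group_hom P N' \<alpha>
  by (rule lin_maps_group_hom[OF a(1) P.M.abelian_group_axioms N'.M.abelian_group_axioms])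
 interpret \<beta>: abelian_group_hom N N' \<beta>
  by (rule lin_maps_group_hom[OF b(1) N.M.abelian_group_axioms N'.M.abelian_group_axioms])
 \<comment> \<open>The degree \<open>j + k\<close> part of the image of the degree \<open>j\<close>
   part of \<open>x\<close>; their sum \<delta> is the part of \<gamma> that raises degrees by
   \<open>k\<close>.\<close>
 define t where "t x j = hpart N GN (\<gamma> (hpart P GP x j)) (j + k)" for x j
 have tG: "t x j \<in> GN (j + k)" and tc: "t x j \<in> carrier N" if "x \<in> carrier P" for x j
  unfolding t_def by (rule N.hpart; use that P.hpart in auto)+
 have tf: "finite {j. t x j \<noteq> \<zero>\<^bsub>N\<^esub>}" if "x \<in> carrier P" for x
  by (rule finite_subset[OF _ P.hpart(2)[OF that]]) (auto simp: t_def N.hpart_zero)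
 define \<delta> where "\<delta> x = fsum N (t x)" for x
 have \<delta>: "\<delta> x \<in> carrier N" if "x \<in> carrier P" for x
  unfolding \<delta>_def by (rule N.M.fsum_closed) (use tc that in auto)
 have add: "\<delta> (x \<oplus>\<^bsub>P\<^esub> y) = \<delta> x \<oplus>\<^bsub>N\<^esub> \<delta> y" if xy: "x \<in> carrier P" "y \<in> carrier P" for x y
 proof -
  have "t (x \<oplus>\<^bsub>P\<^esub> y) = (\<lambda>j. t x j \<oplus>\<^bsub>N\<^esub> t y j)"
   using xy P.hpart(4) by (simp add: fun_eq_iff t_def P.hpart_add N.hpart_add)
  then show ?thesis
   unfolding \<delta>_def using N.M.fsum_add[OF tc[OF xy(1)] tc[OF xy(2)] tf[OF xy(1)] tf[OF xy(2)]] by simp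
 qed
 have homog: "\<delta> (r \<odot>\<^bsub>P\<^esub> x) = r \<odot>\<^bsub>N\<^esub> \<delta> x" if r: "r \<in> GR i" "r \<in> carrier R" and x: "x \<in> carrier P" for r x i
 proof -
  have 1: "hpart P GP (r \<odot>\<^bsub>P\<^esub> x) = (\<lambda>j. r \<odot>\<^bsub>P\<^esub> hpart P GP x (j - i))"
   by (rule hpart_hom[OF P.graded_axioms P.graded_axioms P.smult_add_hom[OF r(2)] _ x])
    (use P.component_smult[OF r(1)] in \<open>auto simp: add.commute\<close>)
  have 2: "hpart N GN (r \<odot>\<^bsub>N\<^esub> y) = (\<lambda>j. r \<odot>\<^bsub>N\<^esub> hpart N GN y (j - i))" if "y \<in> carrier N" for y
   by (rule hpart_hom[OF N.graded_axioms N.graded_axioms N.smult_add_hom[OF r(2)] _ that])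
    (use N.component_smult[OF r(1)] in \<open>auto simp: add.commute\<close>)
  have "t (r \<odot>\<^bsub>P\<^esub> x) = (\<lambda>j. r \<odot>\<^bsub>N\<^esub> t x (j - i))"
   using P.hpart(4)[OF x] lin_mapsD(4)[OF \<gamma> r(2)]
   by (simp add: fun_eq_iff t_def 1 2 algebra_simps)
  then have "\<delta> (r \<odot>\<^bsub>P\<^esub> x) = fsum N (\<lambda>j. r \<odot>\<^bsub>N\<^esub> t x (j - i))" by (simp add: \<delta>_def)
  also have "... = fsum N (\<lambda>j. r \<odot>\<^bsub>N\<^esub> t x j)"
   by (rule N.M.fsum_shift) (use tc[OF x] r in \<open>auto intro: N.smult_closed\<close>)
  also have "... = r \<odot>\<^bsub>N\<^esub> \<delta> x"
   unfolding \<delta>_def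
   by (rule abelian_group_hom.hom_fsum[OF N.smult_add_hom[OF r(2)], symmetric]) (use tc tf x in auto)
  finally show ?thesis .
 qed
 \<comment> \<open>Comparing components proves linearity for homogeneous scalars only, hence the
   passage through the set of all scalars for which it holds.\<close>
 have "carrier R \<subseteq> {r \<in> carrier R. \<forall>x\<in>carrier P. \<delta> (r \<odot>\<^bsub>P\<^esub> x) = r \<odot>\<^bsub>N\<^esub> \<delta> x}" (is "_ \<subseteq> ?T")
 proof -
  have 1: "\<forall>i. GR i \<subseteq> ?T"
  proof (intro allI subsetI CollectI conjI ballI)
   fix i r assume r: "r \<in> GR i"
   then show rR: "r \<in> carrier R" using gen by (auto simp: spanned_by_degrees_def)
   show "\<delta> (r \<odot>\<^bsub>P\<^esub> x) = r \<odot>\<^bsub>N\<^esub> \<delta> x" if "x \<in> carrier P" for x by (rule homog[OF r rR that])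
  qed
  have 2: "\<forall>a\<in>?T \<inter> carrier R. \<forall>b\<in>?T \<inter> carrier R. a \<oplus>\<^bsub>R\<^esub> b \<in> ?T"
  proof (intro ballI CollectI conjI)
   fix a b assume ab: "a \<in> ?T \<inter> carrier R" "b \<in> ?T \<inter> carrier R"
   then show "a \<oplus>\<^bsub>R\<^esub> b \<in> carrier R" using P.R.a_closed by auto
   fix x assume x: "x \<in> carrier P"
   have ab': "a \<in> carrier R" "b \<in> carrier R" "\<delta> (a \<odot>\<^bsub>P\<^esub> x) = a \<odot>\<^bsub>N\<^esub> \<delta> x"
    "\<delta> (b \<odot>\<^bsub>P\<^esub> x) = b \<odot>\<^bsub>N\<^esub> \<delta> x" using ab x by auto
   have "\<delta> ((a \<oplus>\<^bsub>R\<^esub> b) \<odot>\<^bsub>P\<^esub> x) = \<delta> (a \<odot>\<^bsub>P\<^esub> x) \<oplus>\<^bsub>N\<^esub> \<delta> (b \<odot>\<^bsub>P\<^esub> x)"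
    using P.smult_l_distr[OF ab'(1,2) x] add[OF P.smult_closed[OF ab'(1) x] P.smult_closed[OF ab'(2) x]] by simp
   also have "... = (a \<oplus>\<^bsub>R\<^esub> b) \<odot>\<^bsub>N\<^esub> \<delta> x"
    using N.smult_l_distr[OF ab'(1,2) \<delta>[OF x]] ab'(3,4) by simp
   finally show "\<delta> ((a \<oplus>\<^bsub>R\<^esub> b) \<odot>\<^bsub>P\<^esub> x) = (a \<oplus>\<^bsub>R\<^esub> b) \<odot>\<^bsub>N\<^esub> \<delta> x" .
  qed
  show ?thesis using gen 1 2 unfolding spanned_by_degrees_def by blast
 qed
 then have lin: "restrict \<delta> (carrier P) \<in> lin_maps R P N"
  by (intro lin_mapsI) (use \<delta> add P.smult_closed in auto)
 have deg: "\<delta> x \<in> GN (i + k)" if x: "x \<in> GP i" for x i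
 proof -
  have xc: "x \<in> carrier P" using P.component_carrier[OF x] .
  have "t x j = \<zero>\<^bsub>N\<^esub>" if "j \<noteq> i" for j
   using that by (simp add: t_def P.hpart_component[OF x] N.hpart_zero)
  then have "\<delta> x = t x i" unfolding \<delta>_def by (rule N.M.fsum_single) (use tc xc in auto)
  then show ?thesis using tG[OF xc] by simp
 qed
 have "\<beta> (\<delta> x) = \<alpha> x" if x: "x \<in> carrier P" for x
 proof -
  note p = P.hpart[OF x]
  \<comment> \<open>\<beta> has degree 0 and commutes with taking components, and the value of
    \<alpha> on a homogeneous element is already homogeneous of the right degree.\<close>
  have "\<beta> (t x j) = \<alpha> (hpart P GP x j)" for j
  proof -
   have "hpart N' GN' (\<beta> (\<gamma> (hpart P GP x j))) = (\<lambda>l. \<beta> (hpart N GN (\<gamma> (hpart P GP x j)) (l - 0)))"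
    by (rule hpart_hom[OF N.graded_axioms N'.graded_axioms \<beta>.abelian_group_hom_axioms])
     (use b(2) p in auto)
   then have "\<beta> (t x j) = hpart N' GN' (\<alpha> (hpart P GP x j)) (j + k)"
    using lift[OF p(4)] by (simp add: t_def)
   then show ?thesis using N'.hpart_component[OF a(2)[OF p(1)]] by simp
  qed
  then have "\<beta> (\<delta> x) = fsum N' (\<lambda>j. \<alpha> (hpart P GP x j))"
   unfolding \<delta>_def using \<beta>.hom_fsum[of "t x"] tc[OF x] tf[OF x] by simp
  also have "... = \<alpha> x" using \<alpha>.hom_fsum[of "hpart P GP x"] p by simp
  finally show ?thesis .
 qed
 moreover have "restrict \<delta> (carrier P) \<in> deg_maps R P GP N GN k"
  using lin deg P.component_carrier by (auto simp: deg_maps_def)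
 ultimately show ?thesis by (intro bexI[of _ "restrict \<delta> (carrier P)"]) auto
qed

lemma deg_maps_comp:
 assumes f: "f \<in> deg_maps R M GM N GN k" and g: "g \<in> deg_maps R N GN L GL l"
  and M: "graded_module R GR M GM"
 shows "(\<lambda>x\<in>carrier M. g (f x)) \<in> deg_maps R M GM L GL (k + l)"
proof -
 interpret M: graded R M GR GM by (rule gradedI) fact
 note f = deg_mapsD[OF f] and g = deg_mapsD[OF g]
 have "(\<lambda>x\<in>carrier M. g (f x)) \<in> lin_maps R M L"
  by (rule lin_mapsI) (simp_all add: lin_mapsD(2-)[OF f(1)] lin_mapsD(2-)[OF g(1)] M.smult_closed)
 moreover have "g (f x) \<in> GL (j + (k + l))" if "x \<in> GM j" for x j
  using g(2)[OF f(2)[OF that]] by (simp add: add.assoc)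
 ultimately show ?thesis using M.component_carrier by (auto simp: deg_maps_def)
qed

lemma deg_maps_minus:
 assumes f: "f \<in> deg_maps R M GM N GN k" and g: "g \<in> deg_maps R M GM N GN k"
  and M: "graded_module R GR M GM" and N: "graded_module R GR N GN"
 shows "(\<lambda>x\<in>carrier M. f x \<ominus>\<^bsub>N\<^esub> g x) \<in> deg_maps R M GM N GN k"
proof -
 interpret M: graded R M GR GM by (rule gradedI) fact
 interpret N: graded R N GR GN by (rule gradedI) fact
 note f = deg_mapsD[OF f] and g = deg_mapsD[OF g]
 note cl = lin_mapsD(2)[OF f(1)] lin_mapsD(2)[OF g(1)]
 have "(\<lambda>x\<in>carrier M. f x \<ominus>\<^bsub>N\<^esub> g x) \<in> lin_maps R M N"
 proof (rule lin_mapsI)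
  fix x y assume xy: "x \<in> carrier M" "y \<in> carrier M"
  have "(f x \<oplus>\<^bsub>N\<^esub> f y) \<ominus>\<^bsub>N\<^esub> (g x \<oplus>\<^bsub>N\<^esub> g y) = (f x \<ominus>\<^bsub>N\<^esub> g x) \<oplus>\<^bsub>N\<^esub> (f y \<ominus>\<^bsub>N\<^esub> g y)"
   using xy cl by (simp add: a_minus_def N.M.minus_add N.M.a_ac)
  then show "f (x \<oplus>\<^bsub>M\<^esub> y) \<ominus>\<^bsub>N\<^esub> g (x \<oplus>\<^bsub>M\<^esub> y) = (f x \<ominus>\<^bsub>N\<^esub> g x) \<oplus>\<^bsub>N\<^esub> (f y \<ominus>\<^bsub>N\<^esub> g y)"
   using xy by (simp add: lin_mapsD(3)[OF f(1)] lin_mapsD(3)[OF g(1)])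
 next
  fix r x assume rx: "r \<in> carrier R" "x \<in> carrier M"
  interpret r: abelian_group_hom N N "\<lambda>x. r \<odot>\<^bsub>N\<^esub> x" by (rule N.smult_add_hom[OF rx(1)])
  show "f (r \<odot>\<^bsub>M\<^esub> x) \<ominus>\<^bsub>N\<^esub> g (r \<odot>\<^bsub>M\<^esub> x) = r \<odot>\<^bsub>N\<^esub> (f x \<ominus>\<^bsub>N\<^esub> g x)"
   using rx cl by (simp add: lin_mapsD(4)[OF f(1)] lin_mapsD(4)[OF g(1)] a_minus_def)
 qed (use cl M.smult_closed in auto)
 moreover have "f x \<ominus>\<^bsub>N\<^esub> g x \<in> GN (j + k)" if "x \<in> GM j" for x j
  using f(2)[OF that] g(2)[OF that] by (rule N.component_minus)
 ultimately show ?thesis using M.component_carrier by (auto simp: deg_maps_def)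
qed

section \<open>Chain maps and homotopies between resolutions\<close>

locale resolution =
 fixes R :: "('r, 'e) ring_scheme" and GR :: "int => 'r set" and M :: "('r, 'm) module" and GM
  and P :: "nat => ('r, 'p) module" and GP d aug
 assumes resolution: "graded_projective_resolution R GR M GM P GP d aug"
  and spanned: "spanned_by_degrees R GR" and target: "graded_module R GR M GM"
begin

lemma graded_P: "graded_module R GR (P n) (GP n)" and projective_P: "projective_module R (P n)"
 and d: "d n \<in> deg_maps R (P (Suc n)) (GP (Suc n)) (P n) (GP n) 0"
 and aug: "aug \<in> deg_maps R (P 0) (GP 0) M GM 0"
 and aug_surj: "aug ` carrier (P 0) = carrier M"
 and exact_0: "d 0 ` carrier (P (Suc 0)) = {x \<in> carrier (P 0). aug x = \<zero>\<^bsub>M\<^esub>}"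
 and exact: "d (Suc n) ` carrier (P (Suc (Suc n))) = {x \<in> carrier (P (Suc n)). d n x = \<zero>\<^bsub>P n\<^esub>}"
 using resolution by (auto simp: graded_projective_resolution_def)

sublocale P: graded R "P n" GR "GP n" for n by (rule gradedI[OF graded_P])
sublocale M: graded R M GR GM by (rule gradedI[OF target])
sublocale d: abelian_group_hom "P (Suc n)" "P n" "d n" for n
 by (rule lin_maps_group_hom[OF deg_mapsD(1)[OF d] P.M.abelian_group_axioms P.M.abelian_group_axioms])
sublocale aug: abelian_group_hom "P 0" M aug
 by (rule lin_maps_group_hom[OF deg_mapsD(1)[OF aug] P.M.abelian_group_axioms M.M.abelian_group_axioms])

lemma d_d: "x \<in> carrier (P (Suc (Suc n))) ==> d n (d (Suc n) x) = \<zero>\<^bsub>P n\<^esub>"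
 using exact[of n] by blast

lemma aug_d: "x \<in> carrier (P (Suc 0)) ==> aug (d 0 x) = \<zero>\<^bsub>M\<^esub>"
 using exact_0 by blast

end

locale two_resolutions = P: resolution R GR M GM P GP d aug + Q: resolution R GR M GM Q GQ \<delta> \<epsilon>
 for R :: "('r, 'e) ring_scheme" and GR :: "int => 'r set" and M :: "('r, 'm) module" and GM
  and P :: "nat => ('r, 'p) module" and GP d aug
  and Q :: "nat => ('r, 'q) module" and GQ \<delta> \<epsilon>
begin

text \<open>The comparison theorem, by dependent choice. Besides its degree, each map must carry the
  fact that its composite with the differential lands in the next image, since this is what makes
  the next lift possible.\<close>

lemma chain_map:
 "\<exists>f. (\<forall>n. f n \<in> deg_maps R (P n) (GP n) (Q n) (GQ n) 0) \<and>
   (\<forall>x\<in>carrier (P 0). \<epsilon> (f 0 x) = aug x) \<and>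
   (\<forall>n. \<forall>x\<in>carrier (P (Suc n)). \<delta> n (f (Suc n) x) = f n (d n x))"
proof -
 define I where "I n f \<longleftrightarrow> f \<in> deg_maps R (P n) (GP n) (Q n) (GQ n) 0 \<and>
   (n = 0 --> (\<forall>x\<in>carrier (P 0). \<epsilon> (f x) = aug x)) \<and>
   (\<forall>x\<in>carrier (P (Suc n)). f (d n x) \<in> \<delta> n ` carrier (Q (Suc n)))" for n f
 have "\<exists>f. \<forall>n. I n (f n) \<and> (\<forall>x\<in>carrier (P (Suc n)). \<delta> n (f (Suc n) x) = f n (d n x))"
 proof (rule dependent_nat_choice)
  obtain f where f: "f \<in> deg_maps R (P 0) (GP 0) (Q 0) (GQ 0) 0" "\<forall>x\<in>carrier (P 0). \<epsilon> (f x) = aug x"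
   using graded_lift[OF P.spanned P.graded_P P.projective_P Q.graded_P P.target Q.aug P.aug]
    Q.aug_surj P.aug_surj by auto
  moreover have "f (d 0 x) \<in> \<delta> 0 ` carrier (Q (Suc 0))" if "x \<in> carrier (P (Suc 0))" for x
   unfolding Q.exact_0 using f that P.aug_d lin_mapsD(2)[OF deg_mapsD(1)[OF f(1)]] by auto
  ultimately show "\<exists>f. I 0 f" by (auto simp: I_def)
 next
  fix f n assume f: "I n f"
  then have fd: "f \<in> deg_maps R (P n) (GP n) (Q n) (GQ n) 0" by (simp add: I_def)
  let ?a = "\<lambda>x\<in>carrier (P (Suc n)). f (d n x)"
  have "?a \<in> deg_maps R (P (Suc n)) (GP (Suc n)) (Q n) (GQ n) 0"
   using deg_maps_comp[OF P.d fd P.graded_P] by simp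
  moreover have "?a ` carrier (P (Suc n)) \<subseteq> \<delta> n ` carrier (Q (Suc n))"
   using f by (auto simp: I_def)
  ultimately obtain g where g: "g \<in> deg_maps R (P (Suc n)) (GP (Suc n)) (Q (Suc n)) (GQ (Suc n)) 0"
   "\<forall>x\<in>carrier (P (Suc n)). \<delta> n (g x) = ?a x"
   using graded_lift[OF P.spanned P.graded_P P.projective_P Q.graded_P Q.graded_P Q.d] by blast
  interpret f: abelian_group_hom "P n" "Q n" f
   by (rule lin_maps_group_hom[OF deg_mapsD(1)[OF fd] P.P.M.abelian_group_axioms Q.P.M.abelian_group_axioms])
  have "g (d (Suc n) x) \<in> \<delta> (Suc n) ` carrier (Q (Suc (Suc n)))" if x: "x \<in> carrier (P (Suc (Suc n)))" for x
   unfolding Q.exact using g x lin_mapsD(2)[OF deg_mapsD(1)[OF g(1)]] by (simp add: P.d_d)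
  then show "\<exists>g. I (Suc n) g \<and> (\<forall>x\<in>carrier (P (Suc n)). \<delta> n (g x) = f (d n x))"
   using g by (auto simp: I_def)
 qed
 then obtain f where "\<And>n. I n (f n)" "\<And>n x. x \<in> carrier (P (Suc n)) ==> \<delta> n (f (Suc n) x) = f n (d n x)"
  by blast
 then show ?thesis by (intro exI[of _ f]) (simp add: I_def)
qed

text \<open>Two chain maps lifting the same map are chain homotopic; here their difference is \<open>w\<close>.\<close>

lemma null_homotopy:
 assumes w: "\<And>n. w n \<in> deg_maps R (P n) (GP n) (Q n) (GQ n) 0"
  and w0: "\<And>x. x \<in> carrier (P 0) ==> \<epsilon> (w 0 x) = \<zero>\<^bsub>M\<^esub>"
  and wd: "\<And>n x. x \<in> carrier (P (Suc n)) ==> \<delta> n (w (Suc n) x) = w n (d n x)"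
 shows "\<exists>s. (\<forall>n. s n \<in> deg_maps R (P n) (GP n) (Q (Suc n)) (GQ (Suc n)) 0) \<and>
   (\<forall>x\<in>carrier (P 0). \<delta> 0 (s 0 x) = w 0 x) \<and>
   (\<forall>n. \<forall>x\<in>carrier (P (Suc n)). \<delta> (Suc n) (s (Suc n) x) = w (Suc n) x \<ominus>\<^bsub>Q (Suc n)\<^esub> s n (d n x))"
proof -
 note wc = lin_mapsD(2)[OF deg_mapsD(1)[OF w]]
 \<comment> \<open>The property carried along is that the defect of the homotopy built so far is a
   boundary; this is the hypothesis of the next lift.\<close>
 define I where "I n s \<longleftrightarrow> s \<in> deg_maps R (P n) (GP n) (Q (Suc n)) (GQ (Suc n)) 0 \<and>
   (n = 0 --> (\<forall>x\<in>carrier (P 0). \<delta> 0 (s x) = w 0 x)) \<and>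
   (\<forall>x\<in>carrier (P (Suc n)). w (Suc n) x \<ominus>\<^bsub>Q (Suc n)\<^esub> s (d n x) \<in> \<delta> (Suc n) ` carrier (Q (Suc (Suc n))))" for n s
 have "\<exists>s. \<forall>n. I n (s n) \<and>
   (\<forall>x\<in>carrier (P (Suc n)). \<delta> (Suc n) (s (Suc n) x) = w (Suc n) x \<ominus>\<^bsub>Q (Suc n)\<^esub> s n (d n x))"
 proof (rule dependent_nat_choice)
  have "w 0 ` carrier (P 0) \<subseteq> \<delta> 0 ` carrier (Q (Suc 0))"
   unfolding Q.exact_0 using wc w0 by auto
  then obtain s where s: "s \<in> deg_maps R (P 0) (GP 0) (Q (Suc 0)) (GQ (Suc 0)) 0"
   "\<forall>x\<in>carrier (P 0). \<delta> 0 (s x) = w 0 x"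
   using graded_lift[OF P.spanned P.graded_P P.projective_P Q.graded_P Q.graded_P Q.d w] by blast
  note sc = lin_mapsD(2)[OF deg_mapsD(1)[OF s(1)]]
  have "w (Suc 0) x \<ominus>\<^bsub>Q (Suc 0)\<^esub> s (d 0 x) \<in> \<delta> (Suc 0) ` carrier (Q (Suc (Suc 0)))"
   if x: "x \<in> carrier (P (Suc 0))" for x
   unfolding Q.exact using x wc sc s(2) wd[OF x]
   by (simp add: a_minus_def Q.P.M.r_neg)
  then show "\<exists>s. I 0 s" using s by (auto simp: I_def)
 next
  fix s n assume s: "I n s"
  then have sd: "s \<in> deg_maps R (P n) (GP n) (Q (Suc n)) (GQ (Suc n)) 0" by (simp add: I_def)
  note sc = lin_mapsD(2)[OF deg_mapsD(1)[OF sd]]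
  let ?b = "\<lambda>x\<in>carrier (P (Suc n)). s (d n x)"
  have b: "?b \<in> deg_maps R (P (Suc n)) (GP (Suc n)) (Q (Suc n)) (GQ (Suc n)) 0"
   using deg_maps_comp[OF P.d sd P.graded_P] by simp
  let ?a = "\<lambda>x\<in>carrier (P (Suc n)). w (Suc n) x \<ominus>\<^bsub>Q (Suc n)\<^esub> ?b x"
  have "?a ` carrier (P (Suc n)) \<subseteq> \<delta> (Suc n) ` carrier (Q (Suc (Suc n)))"
   using s by (auto simp: I_def)
  then obtain g where g: "g \<in> deg_maps R (P (Suc n)) (GP (Suc n)) (Q (Suc (Suc n))) (GQ (Suc (Suc n))) 0"
   "\<forall>x\<in>carrier (P (Suc n)). \<delta> (Suc n) (g x) = ?a x"
   using graded_lift[OF P.spanned P.graded_P P.projective_P Q.graded_P Q.graded_P Q.d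
     deg_maps_minus[OF w b P.graded_P Q.graded_P]] by blast
  note gc = lin_mapsD(2)[OF deg_mapsD(1)[OF g(1)]]
  interpret s: abelian_group_hom "P n" "Q (Suc n)" s
   by (rule lin_maps_group_hom[OF deg_mapsD(1)[OF sd] P.P.M.abelian_group_axioms Q.P.M.abelian_group_axioms])
  have "w (Suc (Suc n)) x \<ominus>\<^bsub>Q (Suc (Suc n))\<^esub> g (d (Suc n) x) \<in> \<delta> (Suc (Suc n)) ` carrier (Q (Suc (Suc (Suc n))))"
   if x: "x \<in> carrier (P (Suc (Suc n)))" for x
  proof -
   have "\<delta> (Suc n) (g (d (Suc n) x)) = w (Suc n) (d (Suc n) x)"
    using g(2) x wc P.d_d[OF x] by (simp add: a_minus_def)
   then show ?thesis
    unfolding Q.exact using x wc gc wd[OF x] by (simp add: a_minus_def Q.P.M.r_neg)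
  qed
  then show "\<exists>g. I (Suc n) g \<and>
    (\<forall>x\<in>carrier (P (Suc n)). \<delta> (Suc n) (g x) = w (Suc n) x \<ominus>\<^bsub>Q (Suc n)\<^esub> s (d n x))"
   using g by (auto simp: I_def)
 qed
 then obtain s where "\<And>n. I n (s n)" "\<And>n x. x \<in> carrier (P (Suc n)) ==>
   \<delta> (Suc n) (s (Suc n) x) = w (Suc n) x \<ominus>\<^bsub>Q (Suc n)\<^esub> s n (d n x)"
  by blast
 then show ?thesis by (intro exI[of _ s]) (simp add: I_def)
qed

end

section \<open>Independence of Ext from the resolution\<close>

lemma coboundariesI:
 assumes "u \<in> deg_maps R (P m) (GP m) N GN k" "f = (\<lambda>x\<in>carrier (P (Suc m)). u (d m x))"
 shows "f \<in> ext_coboundaries R P GP d N GN (Suc m) k"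
 using assms by (auto simp: ext_coboundaries_def)

lemma coboundaries_minus:
 assumes P: "\<And>n. graded_module R GR (P n) (GP n)" and N: "graded_module R GR N GN"
  and d: "\<And>n. d n \<in> deg_maps R (P (Suc n)) (GP (Suc n)) (P n) (GP n) 0"
  and f: "f \<in> ext_coboundaries R P GP d N GN n k" and g: "g \<in> ext_coboundaries R P GP d N GN n k"
 shows "(\<lambda>x\<in>carrier (P n). f x \<ominus>\<^bsub>N\<^esub> g x) \<in> ext_coboundaries R P GP d N GN n k"
proof (cases n)
 case 0
 interpret N: graded R N GR GN by (rule gradedI) fact
 show ?thesis using f g 0 by (auto simp: ext_coboundaries_def fun_eq_iff a_minus_def)
next
 case (Suc m)
 then obtain u v where uv: "u \<in> deg_maps R (P m) (GP m) N GN k" "v \<in> deg_maps R (P m) (GP m) N GN k"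
  "f = (\<lambda>x\<in>carrier (P (Suc m)). u (d m x))" "g = (\<lambda>x\<in>carrier (P (Suc m)). v (d m x))"
  using f g by (auto simp: ext_coboundaries_def)
 have "(\<lambda>x\<in>carrier (P (Suc m)). f x \<ominus>\<^bsub>N\<^esub> g x) =
   (\<lambda>x\<in>carrier (P (Suc m)). (\<lambda>x\<in>carrier (P m). u x \<ominus>\<^bsub>N\<^esub> v x) (d m x))"
  using uv(3,4) Suc lin_mapsD(2)[OF deg_mapsD(1)[OF d]] by (auto simp: fun_eq_iff)
 then show ?thesis unfolding Suc
  using deg_maps_minus[OF uv(1,2) P N] by (intro coboundariesI)
qed

text \<open>A chain endomorphism over the identity differs from the identity by
  \<open>d s + s d\<close>. A cocycle kills the first summand, and the second gives a
  coboundary.\<close>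

lemma (in resolution) cocycle_homotopy:
 assumes N: "graded_module R GR N GN"
  and a: "\<And>n. a n \<in> deg_maps R (P n) (GP n) (P n) (GP n) 0"
  and a0: "\<And>x. x \<in> carrier (P 0) ==> aug (a 0 x) = aug x"
  and ad: "\<And>n x. x \<in> carrier (P (Suc n)) ==> d n (a (Suc n) x) = a n (d n x)"
  and \<phi>: "\<phi> \<in> ext_cocycles R P GP d N GN n k"
 shows "(\<lambda>x\<in>carrier (P n). \<phi> (a n x) \<ominus>\<^bsub>N\<^esub> \<phi> x) \<in> ext_coboundaries R P GP d N GN n k"
proof -
 interpret N: graded R N GR GN by (rule gradedI) fact
 interpret PP: two_resolutions R GR M GM P GP d aug P GP d aug ..
 note ac = lin_mapsD(2)[OF deg_mapsD(1)[OF a]]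
 have \<phi>d: "\<phi> \<in> deg_maps R (P n) (GP n) N GN k" and \<phi>0: "\<And>x. x \<in> carrier (P (Suc n)) ==> \<phi> (d n x) = \<zero>\<^bsub>N\<^esub>"
  using \<phi> by (auto simp: ext_cocycles_def)
 interpret \<phi>: abelian_group_hom "P n" N \<phi>
  by (rule lin_maps_group_hom[OF deg_mapsD(1)[OF \<phi>d] P.M.abelian_group_axioms N.M.abelian_group_axioms])
 have id: "(\<lambda>x\<in>carrier (P n). x) \<in> deg_maps R (P n) (GP n) (P n) (GP n) 0" for n
  using P.component_carrier P.smult_closed by (auto simp: deg_maps_def lin_maps_def)
 define w where "w n = (\<lambda>x\<in>carrier (P n). a n x \<ominus>\<^bsub>P n\<^esub> (\<lambda>x\<in>carrier (P n). x) x)" for n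
 have w: "w n \<in> deg_maps R (P n) (GP n) (P n) (GP n) 0" for n
  unfolding w_def by (rule deg_maps_minus[OF a id graded_P graded_P])
 have "\<exists>s. (\<forall>n. s n \<in> deg_maps R (P n) (GP n) (P (Suc n)) (GP (Suc n)) 0) \<and>
   (\<forall>x\<in>carrier (P 0). d 0 (s 0 x) = w 0 x) \<and>
   (\<forall>n. \<forall>x\<in>carrier (P (Suc n)). d (Suc n) (s (Suc n) x) = w (Suc n) x \<ominus>\<^bsub>P (Suc n)\<^esub> s n (d n x))"
  by (rule PP.null_homotopy[OF w])
   (use ac a0 ad in \<open>auto simp: w_def a_minus_def M.M.r_neg\<close>)
 then obtain s where s: "\<And>n. s n \<in> deg_maps R (P n) (GP n) (P (Suc n)) (GP (Suc n)) 0"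
  and s0: "\<And>x. x \<in> carrier (P 0) ==> d 0 (s 0 x) = w 0 x"
  and sS: "\<And>n x. x \<in> carrier (P (Suc n)) ==> d (Suc n) (s (Suc n) x) = w (Suc n) x \<ominus>\<^bsub>P (Suc n)\<^esub> s n (d n x)"
  by blast
 note sc = lin_mapsD(2)[OF deg_mapsD(1)[OF s]]
 note wc = lin_mapsD(2)[OF deg_mapsD(1)[OF w]]
 have \<phi>w: "\<phi> (w n x) = \<phi> (a n x) \<ominus>\<^bsub>N\<^esub> \<phi> x" if "x \<in> carrier (P n)" for x
  using that ac by (simp add: w_def a_minus_def)
 show ?thesis
 proof (cases n)
  \<comment> \<open>In degree 0 the second summand is absent and the difference is the zero map, the
    only coboundary there.\<close>
  case 0
  have "\<phi> (w 0 x) = \<zero>\<^bsub>N\<^esub>" if "x \<in> carrier (P 0)" for x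
   using \<phi>0 s0[OF that] sc[OF that] 0 by metis
  then show ?thesis using \<phi>w 0 by (auto simp: ext_coboundaries_def fun_eq_iff)
 next
  case (Suc m)
  have "\<phi> (w n x) = \<phi> (s m (d m x))" if x: "x \<in> carrier (P n)" for x
  proof -
   have "\<phi> (w n x \<ominus>\<^bsub>P n\<^esub> s m (d m x)) = \<zero>\<^bsub>N\<^esub>"
    using \<phi>0 sS[of x m] sc[of x "Suc m"] x Suc by metis
   moreover have "s m (d m x) \<in> carrier (P n)" using sc x Suc by auto
   ultimately show ?thesis using wc[OF x] by (simp add: a_minus_def N.M.r_neg1 N.M.minus_equality)
     (metis N.M.add.inv_equality N.M.minus_minus \<phi>.hom_closed N.M.a_inv_closed)
  qed
  then have "(\<lambda>x\<in>carrier (P (Suc m)). \<phi> (a (Suc m) x) \<ominus>\<^bsub>N\<^esub> \<phi> x) =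
    (\<lambda>x\<in>carrier (P (Suc m)). (\<lambda>x\<in>carrier (P m). \<phi> (s m x)) (d m x))"
   using \<phi>w Suc by (auto simp: fun_eq_iff)
  moreover have "(\<lambda>x\<in>carrier (P m). \<phi> (s m x)) \<in> deg_maps R (P m) (GP m) N GN k"
   using deg_maps_comp[OF s[of m] _ graded_P] \<phi>d Suc by force
  ultimately show ?thesis unfolding Suc by (intro coboundariesI)
 qed
qed

text \<open>Stated for representatives and not for quotient spaces, because the isomorphism will be
  read off from coordinates of the pulled back cocycle. The clauses say that pulling back along one
  family of maps \<open>g\<close> is well defined and injective on classes, and surjective up to
  coboundaries.\<close>

lemma (in two_resolutions) ext_comparison:
 assumes N: "graded_module R GR N GN"
 shows "\<exists>g. (\<forall>n. g n \<in> deg_maps R (Q n) (GQ n) (P n) (GP n) 0) \<and> (\<forall>n k.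
  (\<forall>\<phi>\<in>ext_cocycles R P GP d N GN n k.
   (\<lambda>x\<in>carrier (Q n). \<phi> (g n x)) \<in> ext_cocycles R Q GQ \<delta> N GN n k \<and>
   ((\<lambda>x\<in>carrier (Q n). \<phi> (g n x)) \<in> ext_coboundaries R Q GQ \<delta> N GN n k \<longleftrightarrow>
    \<phi> \<in> ext_coboundaries R P GP d N GN n k)) \<and>
  (\<forall>\<psi>\<in>ext_cocycles R Q GQ \<delta> N GN n k. \<exists>\<phi>\<in>ext_cocycles R P GP d N GN n k.
   (\<lambda>x\<in>carrier (Q n). \<phi> (g n x) \<ominus>\<^bsub>N\<^esub> \<psi> x) \<in> ext_coboundaries R Q GQ \<delta> N GN n k))"
proof -
 interpret N: graded R N GR GN by (rule gradedI) fact
 interpret swap: two_resolutions R GR M GM Q GQ \<delta> \<epsilon> P GP d aug ..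
 obtain f where f: "\<And>n. f n \<in> deg_maps R (P n) (GP n) (Q n) (GQ n) 0"
  "\<And>x. x \<in> carrier (P 0) ==> \<epsilon> (f 0 x) = aug x"
  "\<And>n x. x \<in> carrier (P (Suc n)) ==> \<delta> n (f (Suc n) x) = f n (d n x)"
  using chain_map by blast
 obtain g where g: "\<And>n. g n \<in> deg_maps R (Q n) (GQ n) (P n) (GP n) 0"
  "\<And>x. x \<in> carrier (Q 0) ==> aug (g 0 x) = \<epsilon> x"
  "\<And>n x. x \<in> carrier (Q (Suc n)) ==> d n (g (Suc n) x) = g n (\<delta> n x)"
  using swap.chain_map by blast
 note fc = lin_mapsD(2)[OF deg_mapsD(1)[OF f(1)]]
 note gc = lin_mapsD(2)[OF deg_mapsD(1)[OF g(1)]]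
 have gf: "(\<lambda>x\<in>carrier (P n). g n (f n x)) \<in> deg_maps R (P n) (GP n) (P n) (GP n) 0" for n
  using deg_maps_comp[OF f(1) g(1) P.graded_P] by simp
 have fg: "(\<lambda>x\<in>carrier (Q n). f n (g n x)) \<in> deg_maps R (Q n) (GQ n) (Q n) (GQ n) 0" for n
  using deg_maps_comp[OF g(1) f(1) Q.graded_P] by simp
 have coc_g: "(\<lambda>x\<in>carrier (Q n). \<phi> (g n x)) \<in> ext_cocycles R Q GQ \<delta> N GN n k"
  if "\<phi> \<in> ext_cocycles R P GP d N GN n k" for \<phi> n k
  using that deg_maps_comp[OF g(1) _ Q.graded_P, of \<phi> n N GN k] gc g(3)[symmetric]
  by (auto simp: ext_cocycles_def)
 have coc_f: "(\<lambda>x\<in>carrier (P n). \<psi> (f n x)) \<in> ext_cocycles R P GP d N GN n k"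
  if "\<psi> \<in> ext_cocycles R Q GQ \<delta> N GN n k" for \<psi> n k
  using that deg_maps_comp[OF f(1) _ P.graded_P, of \<psi> n N GN k] fc f(3)[symmetric]
  by (auto simp: ext_cocycles_def)
 have cob_g: "(\<lambda>x\<in>carrier (Q n). \<phi> (g n x)) \<in> ext_coboundaries R Q GQ \<delta> N GN n k"
  if \<phi>: "\<phi> \<in> ext_coboundaries R P GP d N GN n k" for \<phi> n k
 proof (cases n)
  case 0
  then show ?thesis using \<phi> gc by (auto simp: ext_coboundaries_def fun_eq_iff)
 next
  case (Suc m)
  then obtain u where u: "u \<in> deg_maps R (P m) (GP m) N GN k" "\<phi> = (\<lambda>x\<in>carrier (P (Suc m)). u (d m x))"
   using \<phi> by (auto simp: ext_coboundaries_def)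
  have "(\<lambda>x\<in>carrier (Q (Suc m)). \<phi> (g (Suc m) x)) =
    (\<lambda>x\<in>carrier (Q (Suc m)). (\<lambda>x\<in>carrier (Q m). u (g m x)) (\<delta> m x))"
   using u(2) Suc gc g(3) by (auto simp: fun_eq_iff)
  then show ?thesis unfolding Suc
   using deg_maps_comp[OF g(1) u(1) Q.graded_P, simplified] by (intro coboundariesI)
 qed
 have cob_f: "(\<lambda>x\<in>carrier (P n). \<psi> (f n x)) \<in> ext_coboundaries R P GP d N GN n k"
  if \<psi>: "\<psi> \<in> ext_coboundaries R Q GQ \<delta> N GN n k" for \<psi> n k
 proof (cases n)
  case 0
  then show ?thesis using \<psi> fc by (auto simp: ext_coboundaries_def fun_eq_iff)
 next
  case (Suc m)
  then obtain u where u: "u \<in> deg_maps R (Q m) (GQ m) N GN k" "\<psi> = (\<lambda>x\<in>carrier (Q (Suc m)). u (\<delta> m x))"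
   using \<psi> by (auto simp: ext_coboundaries_def)
  have "(\<lambda>x\<in>carrier (P (Suc m)). \<psi> (f (Suc m) x)) =
    (\<lambda>x\<in>carrier (P (Suc m)). (\<lambda>x\<in>carrier (P m). u (f m x)) (d m x))"
   using u(2) Suc fc f(3) by (auto simp: fun_eq_iff)
  then show ?thesis unfolding Suc
   using deg_maps_comp[OF f(1) u(1) P.graded_P, simplified] by (intro coboundariesI)
 qed
 \<comment> \<open>Injectivity: pulling back further along \<open>f\<close> keeps it a coboundary,
   and the composite of \<open>f\<close> followed by \<open>g\<close> changes \<phi> only by a
   coboundary.\<close>
 have "\<phi> \<in> ext_coboundaries R P GP d N GN n k"
  if \<phi>: "\<phi> \<in> ext_cocycles R P GP d N GN n k"
   and b: "(\<lambda>x\<in>carrier (Q n). \<phi> (g n x)) \<in> ext_coboundaries R Q GQ \<delta> N GN n k" for \<phi> n k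
 proof -
  have \<phi>d: "\<phi> \<in> deg_maps R (P n) (GP n) N GN k" using \<phi> by (simp add: ext_cocycles_def)
  note \<phi>c = lin_mapsD(1,2)[OF deg_mapsD(1)[OF \<phi>d]]
  have 1: "(\<lambda>x\<in>carrier (P n). \<phi> ((\<lambda>x\<in>carrier (P n). g n (f n x)) x) \<ominus>\<^bsub>N\<^esub> \<phi> x)
    \<in> ext_coboundaries R P GP d N GN n k" (is "?h \<in> _")
   by (rule P.cocycle_homotopy[OF N gf _ _ \<phi>]) (use fc gc f g in auto)
  have 2: "(\<lambda>x\<in>carrier (P n). \<phi> (g n (f n x))) \<in> ext_coboundaries R P GP d N GN n k" (is "?g \<in> _")
  proof -
   have "(\<lambda>x\<in>carrier (P n). \<phi> (g n (f n x))) = (\<lambda>x\<in>carrier (P n). (\<lambda>x\<in>carrier (Q n). \<phi> (g n x)) (f n x))"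
    using fc by (auto simp: fun_eq_iff)
   then show ?thesis using cob_f[OF b] by simp
  qed
  have "\<phi> = (\<lambda>x\<in>carrier (P n). ?g x \<ominus>\<^bsub>N\<^esub> ?h x)"
  proof
   fix x
   show "\<phi> x = (\<lambda>x\<in>carrier (P n). ?g x \<ominus>\<^bsub>N\<^esub> ?h x) x"
   proof (cases "x \<in> carrier (P n)")
    case True
    then have "\<phi> (g n (f n x)) \<in> carrier N" "\<phi> x \<in> carrier N" using \<phi>c fc gc by auto
    then show ?thesis
     using True by (simp add: a_minus_def N.M.minus_add N.M.r_neg2)
   qed (use \<phi>c(1) in \<open>auto simp: PiE_def extensional_def\<close>)
  qed
  with coboundaries_minus[OF P.graded_P N P.d 2 1] show ?thesis by simp
 qed
 moreover have "\<exists>\<phi>\<in>ext_cocycles R P GP d N GN n k.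
   (\<lambda>x\<in>carrier (Q n). \<phi> (g n x) \<ominus>\<^bsub>N\<^esub> \<psi> x) \<in> ext_coboundaries R Q GQ \<delta> N GN n k"
  if \<psi>: "\<psi> \<in> ext_cocycles R Q GQ \<delta> N GN n k" for \<psi> n k
 proof (rule bexI[OF _ coc_f[OF \<psi>]])
  have "(\<lambda>x\<in>carrier (Q n). \<psi> ((\<lambda>x\<in>carrier (Q n). f n (g n x)) x) \<ominus>\<^bsub>N\<^esub> \<psi> x)
    \<in> ext_coboundaries R Q GQ \<delta> N GN n k"
   by (rule Q.cocycle_homotopy[OF N fg _ _ \<psi>]) (use fc gc f g in auto)
  moreover have "(\<lambda>x\<in>carrier (Q n). \<psi> ((\<lambda>x\<in>carrier (Q n). f n (g n x)) x) \<ominus>\<^bsub>N\<^esub> \<psi> x) =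
    (\<lambda>x\<in>carrier (Q n). (\<lambda>x\<in>carrier (P n). \<psi> (f n x)) (g n x) \<ominus>\<^bsub>N\<^esub> \<psi> x)"
   using gc by (auto simp: fun_eq_iff)
  ultimately show "(\<lambda>x\<in>carrier (Q n). (\<lambda>x\<in>carrier (P n). \<psi> (f n x)) (g n x) \<ominus>\<^bsub>N\<^esub> \<psi> x)
    \<in> ext_coboundaries R Q GQ \<delta> N GN n k" by simp
 qed
 ultimately show ?thesis using g(1) coc_g cob_g by (intro exI[of _ g]) blast
qed

section \<open>Sums of left ideals generated by idempotents\<close>

text \<open>The module \<open>psum R G e\<close> is the direct sum of the left ideals \<open>R e\<^sub>g\<close> for idempotents \<open>e\<^sub>g\<close>.\<close>

definition psum :: "('r, 'a) ring_scheme => 'g set => ('g => 'r) => ('r, 'g => 'r) module" where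
 "psum R G e =
   \<lparr>carrier = {F. (\<forall>g\<in>G. F g \<in> carrier R \<and> F g \<otimes>\<^bsub>R\<^esub> e g = F g) \<and> (\<forall>g. g \<notin> G --> F g = \<zero>\<^bsub>R\<^esub>)},
   monoid.mult = undefined, one = undefined,
   zero = (\<lambda>g. \<zero>\<^bsub>R\<^esub>), add = (\<lambda>F F' g. F g \<oplus>\<^bsub>R\<^esub> F' g),
   module.smult = (\<lambda>r F g. r \<otimes>\<^bsub>R\<^esub> F g)\<rparr>"

locale ideal_sum = ring R for R :: "('r, 'a) ring_scheme" (structure) +
 fixes G :: "'g set" and e :: "'g => 'r"
 assumes finite_G: "finite G" and e_closed: "g \<in> G ==> e g \<in> carrier R"
  and e_idem: "g \<in> G ==> e g \<otimes> e g = e g" and nontriv: "\<one> \<noteq> \<zero>"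
begin

abbreviation "Q \<equiv> psum R G e"

lemma psum_carrier:
 assumes "F \<in> carrier Q"
 shows "F g \<in> carrier R" "g \<in> G ==> F g \<otimes> e g = F g" "g \<notin> G ==> F g = \<zero>"
 using assms by (cases "g \<in> G"; auto simp: psum_def)+

lemma psum_carrierI:
 assumes "\<And>g. g \<in> G ==> F g \<in> carrier R" "\<And>g. g \<in> G ==> F g \<otimes> e g = F g" "\<And>g. g \<notin> G ==> F g = \<zero>"
 shows "F \<in> carrier Q"
 using assms by (auto simp: psum_def)

lemma psum_simps [simp]:
 "\<zero>\<^bsub>Q\<^esub> = (\<lambda>g. \<zero>)" "(F \<oplus>\<^bsub>Q\<^esub> F') = (\<lambda>g. F g \<oplus> F' g)" "r \<odot>\<^bsub>Q\<^esub> F = (\<lambda>g. r \<otimes> F g)"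
 by (auto simp: psum_def)

lemma psum_abelian: "abelian_group Q"
proof (rule abelian_groupI)
 show "\<exists>y\<in>carrier Q. y \<oplus>\<^bsub>Q\<^esub> x = \<zero>\<^bsub>Q\<^esub>" if x: "x \<in> carrier Q" for x
 proof (rule bexI)
  show "(\<lambda>g. \<ominus> x g) \<oplus>\<^bsub>Q\<^esub> x = \<zero>\<^bsub>Q\<^esub>" using psum_carrier[OF x] by (simp add: l_neg)
  show "(\<lambda>g. \<ominus> x g) \<in> carrier Q"
   by (rule psum_carrierI) (use psum_carrier[OF x] e_closed in \<open>auto simp: l_minus\<close>)
 qed
qed (auto intro!: psum_carrierI simp: psum_carrier e_closed l_distr a_ac)

lemma psum_left_module: "left_module R Q"
proof -
 interpret Q: abelian_group Q by (rule psum_abelian)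
 show ?thesis
  by unfold_locales
   (auto intro!: psum_carrierI simp: psum_carrier e_closed l_distr r_distr m_assoc)
qed

definition gen :: "'g => 'g => 'r" where
 "gen g = (\<lambda>h. if h = g then e g else \<zero>)"

lemma gen_closed: "g \<in> G ==> gen g \<in> carrier Q"
 by (rule psum_carrierI) (auto simp: gen_def e_closed e_idem)

text \<open>A direct summand of the free module on \<open>G\<close>: the inclusion keeps the
  components, the retraction multiplies them on the right by \<open>e g\<close>. Since
  \<open>projective_module\<close> takes basis elements from the type of the module, each
  \<open>g\<close> is replaced by its indicator function; these are distinct because the ring is
  nontrivial.\<close>

lemma psum_projective: "projective_module R Q"
proof -
 interpret Q: left_module R Q by (rule psum_left_module)
 define \<iota> where "\<iota> g = (\<lambda>h :: 'g. if h = g then \<one> else \<zero>)" for g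
 have inj: "\<iota> g = \<iota> h \<longleftrightarrow> g = h" for g h
 proof
  assume "\<iota> g = \<iota> h"
  from fun_cong[OF this, of g] show "g = h" using nontriv by (auto simp: \<iota>_def split: if_splits)
 qed simp
 define un where "un x = (THE g. x = \<iota> g)" for x
 have un: "un (\<iota> g) = g" for g by (simp add: un_def inj)
 let ?X = "\<iota> ` G" let ?F = "free_module R (\<iota> ` G)"
 define i where "i F = (\<lambda>x. if x \<in> ?X then F (un x) else \<zero>)" for F :: "'g => 'r"
 define q where "q f = (\<lambda>g. if g \<in> G then f (\<iota> g) \<otimes> e g else \<zero>)" for f :: "('g => 'r) => 'r"
 have fin: "finite {x. f x \<noteq> \<zero>}" if "\<And>x. x \<notin> ?X ==> f x = \<zero>" for f :: "('g => 'r) => 'r"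
  by (rule finite_subset[OF _ finite_imageI[OF finite_G, of \<iota>]]) (use that in auto)
 have iF: "i F \<in> carrier ?F" if "F \<in> carrier Q" for F
  using psum_carrier(1)[OF that] fin[of "i F"] by (auto simp: free_module_def i_def)
 have Fc: "f x \<in> carrier R" "x \<notin> ?X ==> f x = \<zero>" if "f \<in> carrier ?F" for f x
  using that by (cases "x \<in> ?X"; auto simp: free_module_def)+
 have Fa: "f \<oplus>\<^bsub>?F\<^esub> g \<in> carrier ?F" if "f \<in> carrier ?F" "g \<in> carrier ?F" for f g
  using Fc[OF that(1)] Fc[OF that(2)] fin[of "f \<oplus>\<^bsub>?F\<^esub> g"] by (auto simp: free_module_def)
 have Fs: "r \<odot>\<^bsub>?F\<^esub> f \<in> carrier ?F" if "r \<in> carrier R" "f \<in> carrier ?F" for r f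
  using Fc[OF that(2)] that(1) fin[of "r \<odot>\<^bsub>?F\<^esub> f"] by (auto simp: free_module_def)
 have "restrict i (carrier Q) \<in> lin_maps R Q ?F"
  by (rule lin_mapsI)
   (use iF psum_carrier Q.a_closed Q.smult_closed in \<open>auto simp: i_def free_module_def\<close>)
 moreover have "restrict q (carrier ?F) \<in> lin_maps R ?F Q"
 proof (rule lin_mapsI)
  show "q f \<in> carrier Q" if "f \<in> carrier ?F" for f
   by (rule psum_carrierI) (use Fc[OF that] e_closed e_idem in \<open>auto simp: q_def m_assoc\<close>)
  show "q (f \<oplus>\<^bsub>?F\<^esub> g) = q f \<oplus>\<^bsub>Q\<^esub> q g" if "f \<in> carrier ?F" "g \<in> carrier ?F" for f g
   using Fc[OF that(1)] Fc[OF that(2)] e_closed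
   by (auto simp: q_def free_module_def l_distr fun_eq_iff)
  show "q (r \<odot>\<^bsub>?F\<^esub> f) = r \<odot>\<^bsub>Q\<^esub> q f" if "r \<in> carrier R" "f \<in> carrier ?F" for r f
   using Fc[OF that(2)] that(1) e_closed by (auto simp: q_def free_module_def m_assoc fun_eq_iff)
 qed (use Fa Fs in auto)
 moreover have "restrict q (carrier ?F) (restrict i (carrier Q) F) = F" if F: "F \<in> carrier Q" for F
  using F iF[OF F] psum_carrier[OF F] un by (auto simp: q_def i_def fun_eq_iff)
 ultimately show ?thesis
  unfolding projective_module_def
  by (intro conjI psum_left_module exI[of _ ?X] bexI[of _ "restrict i (carrier Q)"]
    bexI[of _ "restrict q (carrier ?F)"]) auto
qed

lemma psum_finsum:
 assumes "finite J" "\<And>j. j \<in> J ==> t j \<in> carrier Q"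
 shows "(\<Oplus>\<^bsub>Q\<^esub>j\<in>J. t j) = (\<lambda>g. \<Oplus>j\<in>J. t j g)"
proof -
 interpret Q: left_module R Q by (rule psum_left_module)
 from assms show ?thesis
 proof (induction J rule: finite_induct)
  case (insert j J)
  then have "(\<Oplus>\<^bsub>Q\<^esub>j\<in>insert j J. t j) = t j \<oplus>\<^bsub>Q\<^esub> (\<Oplus>\<^bsub>Q\<^esub>j\<in>J. t j)"
   by (intro Q.finsum_insert) auto
  then show ?case using insert psum_carrier(1) by (auto simp: fun_eq_iff)
 qed simp
qed

lemma psum_expand:
 assumes F: "F \<in> carrier Q"
 shows "F = (\<Oplus>\<^bsub>Q\<^esub>g\<in>G. F g \<odot>\<^bsub>Q\<^esub> gen g)"
proof -
 interpret Q: left_module R Q by (rule psum_left_module)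
 note Fc = psum_carrier[OF F]
 have "(\<Oplus>\<^bsub>Q\<^esub>g\<in>G. F g \<odot>\<^bsub>Q\<^esub> gen g) = (\<lambda>h. \<Oplus>g\<in>G. (F g \<odot>\<^bsub>Q\<^esub> gen g) h)"
  by (rule psum_finsum[OF finite_G]) (rule Q.smult_closed[OF Fc(1) gen_closed])
 also have "... = F"
 proof
  fix h
  have "(\<Oplus>g\<in>G. (F g \<odot>\<^bsub>Q\<^esub> gen g) h) = (\<Oplus>g\<in>G. if h = g then F g else \<zero>)"
   by (rule finsum_cong') (use Fc e_closed in \<open>auto simp: gen_def\<close>)
  also have "... = F h"
  proof (cases "h \<in> G")
   case True
   then show ?thesis using finsum_singleton[OF True finite_G, of F] Fc(1) by simp
  next
   case False
   then have "(\<Oplus>g\<in>G. if h = g then F g else \<zero>) = (\<Oplus>g\<in>G. \<zero>)"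
    by (intro finsum_cong') auto
   then show ?thesis using Fc(3)[OF False] by simp
  qed
  finally show "(\<Oplus>g\<in>G. (F g \<odot>\<^bsub>Q\<^esub> gen g) h) = F h" .
 qed
 finally show ?thesis by simp
qed

lemma lin_map_expand:
 assumes M: "left_module R M" and f: "f \<in> lin_maps R Q M" and F: "F \<in> carrier Q"
 shows "f F = (\<Oplus>\<^bsub>M\<^esub>g\<in>G. F g \<odot>\<^bsub>M\<^esub> f (gen g))"
proof -
 interpret Q: left_module R Q by (rule psum_left_module)
 interpret M: left_module R M by fact
 interpret f: abelian_group_hom Q M f
  by (rule lin_maps_group_hom[OF f psum_abelian M.M.abelian_group_axioms])
 note Fc = psum_carrier(1)[OF F]
 have "f F = f (\<Oplus>\<^bsub>Q\<^esub>g\<in>G. F g \<odot>\<^bsub>Q\<^esub> gen g)" using psum_expand[OF F] by simp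
 also have "... = (\<Oplus>\<^bsub>M\<^esub>g\<in>G. f (F g \<odot>\<^bsub>Q\<^esub> gen g))"
  by (rule f.hom_finsum[OF finite_G]) (use Q.smult_closed[OF Fc gen_closed] in auto)
 also have "... = (\<Oplus>\<^bsub>M\<^esub>g\<in>G. F g \<odot>\<^bsub>M\<^esub> f (gen g))"
  by (rule M.M.finsum_cong')
   (use M.smult_closed[OF Fc lin_mapsD(2)[OF f gen_closed]] lin_mapsD(4)[OF f Fc gen_closed] in auto)
 finally show ?thesis .
qed

text \<open>Maps out of the sum of the left ideals generated by the \<open>e g\<close> correspond to
  elements of the subgroups \<open>e g M\<close>; the second condition on \<open>x g\<close> is what
  makes the generator go to \<open>x g\<close>.\<close>

lemma lin_map_of_generators:
 assumes M: "left_module R M" and x: "\<And>g. g \<in> G ==> x g \<in> carrier M" "\<And>g. g \<in> G ==> e g \<odot>\<^bsub>M\<^esub> x g = x g"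
 defines "f \<equiv> \<lambda>F\<in>carrier Q. \<Oplus>\<^bsub>M\<^esub>g\<in>G. F g \<odot>\<^bsub>M\<^esub> x g"
 shows "f \<in> lin_maps R Q M" "g \<in> G ==> f (gen g) = x g"
proof -
 interpret Q: left_module R Q by (rule psum_left_module)
 interpret M: left_module R M by fact
 show "f \<in> lin_maps R Q M"
  unfolding f_def
 proof (rule lin_mapsI)
  fix F assume F: "F \<in> carrier Q"
  note Fc = psum_carrier(1)[OF F]
  have cl: "(\<lambda>g. F g \<odot>\<^bsub>M\<^esub> x g) \<in> G \<rightarrow> carrier M" by (auto intro!: M.smult_closed Fc x(1))
  then show "(\<Oplus>\<^bsub>M\<^esub>g\<in>G. F g \<odot>\<^bsub>M\<^esub> x g) \<in> carrier M" by (rule M.M.finsum_closed)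
  show "(\<Oplus>\<^bsub>M\<^esub>g\<in>G. (r \<odot>\<^bsub>Q\<^esub> F) g \<odot>\<^bsub>M\<^esub> x g) = r \<odot>\<^bsub>M\<^esub> (\<Oplus>\<^bsub>M\<^esub>g\<in>G. F g \<odot>\<^bsub>M\<^esub> x g)"
   if r: "r \<in> carrier R" for r
  proof -
   have "(\<Oplus>\<^bsub>M\<^esub>g\<in>G. (r \<odot>\<^bsub>Q\<^esub> F) g \<odot>\<^bsub>M\<^esub> x g) = (\<Oplus>\<^bsub>M\<^esub>g\<in>G. r \<odot>\<^bsub>M\<^esub> (F g \<odot>\<^bsub>M\<^esub> x g))"
    by (rule M.M.finsum_cong')
     (auto intro!: M.smult_closed Fc x(1) r simp: M.smult_assoc[OF r Fc x(1)])
   then show ?thesis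
    using abelian_group_hom.hom_finsum[OF M.smult_add_hom[OF r] finite_G cl] by simp
  qed
 next
  fix F F' assume F: "F \<in> carrier Q" "F' \<in> carrier Q"
  note Fc = psum_carrier(1)[OF F(1)] psum_carrier(1)[OF F(2)]
  have "(\<Oplus>\<^bsub>M\<^esub>g\<in>G. (F \<oplus>\<^bsub>Q\<^esub> F') g \<odot>\<^bsub>M\<^esub> x g) = (\<Oplus>\<^bsub>M\<^esub>g\<in>G. F g \<odot>\<^bsub>M\<^esub> x g \<oplus>\<^bsub>M\<^esub> F' g \<odot>\<^bsub>M\<^esub> x g)"
   by (rule M.M.finsum_cong')
    (auto intro!: M.smult_closed M.M.a_closed Fc x(1) simp: M.smult_l_distr[OF Fc x(1)])
  also have "... = (\<Oplus>\<^bsub>M\<^esub>g\<in>G. F g \<odot>\<^bsub>M\<^esub> x g) \<oplus>\<^bsub>M\<^esub> (\<Oplus>\<^bsub>M\<^esub>g\<in>G. F' g \<odot>\<^bsub>M\<^esub> x g)"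
   by (rule M.M.finsum_addf) (auto intro!: M.smult_closed Fc x(1))
  finally show "(\<Oplus>\<^bsub>M\<^esub>g\<in>G. (F \<oplus>\<^bsub>Q\<^esub> F') g \<odot>\<^bsub>M\<^esub> x g) =
    (\<Oplus>\<^bsub>M\<^esub>g\<in>G. F g \<odot>\<^bsub>M\<^esub> x g) \<oplus>\<^bsub>M\<^esub> (\<Oplus>\<^bsub>M\<^esub>g\<in>G. F' g \<odot>\<^bsub>M\<^esub> x g)" .
 qed (rule Q.a_closed Q.smult_closed; assumption)+
 show "f (gen g) = x g" if g: "g \<in> G"
 proof -
  have "(\<Oplus>\<^bsub>M\<^esub>h\<in>G. gen g h \<odot>\<^bsub>M\<^esub> x h) = (\<Oplus>\<^bsub>M\<^esub>h\<in>G. if g = h then x h else \<zero>\<^bsub>M\<^esub>)"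
   by (rule M.M.finsum_cong') (auto simp: gen_def x)
  then show ?thesis
   using M.M.finsum_singleton[OF g finite_G, of x] x(1) gen_closed[OF g] by (simp add: f_def)
 qed
qed

end

section \<open>Algebras with a basis and their enveloping algebras\<close>

lemma complex_alg_simps [simp]:
 "carrier complex_alg = UNIV" "add complex_alg = (+)" "zero complex_alg = 0"
 "one complex_alg = 1" "monoid.mult complex_alg = (*)" "module.smult complex_alg = (*)"
 by (simp_all add: complex_alg_def)

lemma complex_alg_cring: "cring complex_alg"
proof (rule cringI)
 show "abelian_group complex_alg"
  by (rule abelian_groupI) (auto simp: intro: exI[of _ "- _"])
 show "comm_monoid complex_alg"
  by (rule comm_monoidI) auto
qed (auto simp: algebra_simps)

text \<open>Coordinates are functions on the whole index type that vanish off \<open>B\<close>. The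
  scalars stay arbitrary and \<open>chi\<close> is only additive, so that the same locale serves the
  algebra, its enveloping algebra and modules over the latter.\<close>

locale coord_group = abelian_group A for A :: "('s, 'a) module" +
 fixes B :: "'i set" and chi :: "'a => 'i => complex"
 assumes finite_B: "finite B"
  and chi_bij: "bij_betw chi (carrier A) {y. \<forall>i. i \<notin> B --> y i = 0}"
  and chi_add: "x \<in> carrier A ==> y \<in> carrier A ==> chi (x \<oplus>\<^bsub>A\<^esub> y) = (\<lambda>i. chi x i + chi y i)"
begin

lemma chi_eqI: "x \<in> carrier A ==> y \<in> carrier A ==> (\<And>i. chi x i = chi y i) ==> x = y"
 by (rule inj_onD[OF bij_betw_imp_inj_on[OF chi_bij]]) (auto simp: fun_eq_iff)

lemma chi_outside: "x \<in> carrier A ==> i \<notin> B ==> chi x i = 0"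
 using chi_bij by (auto simp: bij_betw_def)

lemma chi_zero [simp]: "chi \<zero>\<^bsub>A\<^esub> i = 0"
 using fun_cong[OF chi_add[OF zero_closed zero_closed], of i] by simp

lemma chi_minus: "x \<in> carrier A ==> chi (\<ominus>\<^bsub>A\<^esub> x) i = - chi x i"
 using fun_cong[OF chi_add[OF a_inv_closed, of x x], of i]
 by (simp add: l_neg add_eq_0_iff)

lemma chi_finsum:
 assumes "finite J" "\<And>j. j \<in> J ==> t j \<in> carrier A"
 shows "chi (\<Oplus>\<^bsub>A\<^esub>j\<in>J. t j) i = (\<Sum>j\<in>J. chi (t j) i)"
 using assms
proof (induction J rule: finite_induct)
 case (insert j J)
 then have "(\<Oplus>\<^bsub>A\<^esub>j\<in>insert j J. t j) = t j \<oplus>\<^bsub>A\<^esub> (\<Oplus>\<^bsub>A\<^esub>j\<in>J. t j)"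
  by (intro finsum_insert) auto
 moreover have "(\<Oplus>\<^bsub>A\<^esub>j\<in>J. t j) \<in> carrier A" by (rule finsum_closed) (use insert in auto)
 ultimately show ?case using insert by (simp add: chi_add)
qed simp

definition elem :: "('i => complex) => 'a" where
 "elem y = inv_into (carrier A) chi y"

lemma elem: assumes "\<And>i. i \<notin> B ==> y i = 0"
 shows "elem y \<in> carrier A" "chi (elem y) = y"
proof -
 have "y \<in> chi ` carrier A" using assms chi_bij by (simp add: bij_betw_def)
 then show "elem y \<in> carrier A" "chi (elem y) = y"
  unfolding elem_def by (auto intro: inv_into_into f_inv_into_f)
qed

definition homogeneous :: "('i => int) => int => 'a set" where
 "homogeneous dg j = {x \<in> carrier A. \<forall>i. chi x i \<noteq> 0 --> dg i = j}"

lemma homogeneous_subgroup: "subgroup (homogeneous dg j) (add_monoid A)"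
proof (rule subgroup.intro)
 show "x \<otimes>\<^bsub>add_monoid A\<^esub> y \<in> homogeneous dg j"
  if xy: "x \<in> homogeneous dg j" "y \<in> homogeneous dg j" for x y
 proof -
  have c: "x \<in> carrier A" "y \<in> carrier A" using xy by (auto simp: homogeneous_def)
  have "dg i = j" if "chi x i + chi y i \<noteq> 0" for i
   using xy that by (cases "chi x i = 0") (auto simp: homogeneous_def)
  then show ?thesis using c by (auto simp: homogeneous_def chi_add)
 qed
 show "inv\<^bsub>add_monoid A\<^esub> x \<in> homogeneous dg j" if "x \<in> homogeneous dg j" for x
  using that by (auto simp: homogeneous_def chi_minus a_inv_def[symmetric])
qed (auto simp: homogeneous_def)

text \<open>Components arise by cutting the coordinates according to \<open>dg\<close>; finiteness
  of \<open>B\<close> leaves finitely many nonzero ones. The form is exactly the one demanded by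
  \<open>graded_module\<close>.\<close>

lemma homogeneous_decomposition:
 assumes x: "x \<in> carrier A"
 shows "\<exists>!c. (\<forall>j. c j \<in> homogeneous dg j) \<and> finite {j. c j \<noteq> \<zero>\<^bsub>A\<^esub>} \<and>
  x = (\<Oplus>\<^bsub>A\<^esub>j\<in>{j. c j \<noteq> \<zero>\<^bsub>A\<^esub>}. c j)"
proof -
 define y where "y j = (\<lambda>i. if dg i = j then chi x i else 0)" for j
 have y: "elem (y j) \<in> carrier A" "chi (elem (y j)) = y j" for j
  by (rule elem; use chi_outside[OF x] in \<open>auto simp: y_def\<close>)+
 have y0: "elem (y j) = \<zero>\<^bsub>A\<^esub>" if "j \<notin> dg ` B" for j
 proof (rule chi_eqI[OF y(1) zero_closed])
  show "chi (elem (y j)) i = chi \<zero>\<^bsub>A\<^esub> i" for i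
   using that chi_outside[OF x, of i] by (cases "i \<in> B") (auto simp: y(2), auto simp: y_def)
 qed
 show ?thesis
 proof (rule ex1I)
  let ?J = "{j. elem (y j) \<noteq> \<zero>\<^bsub>A\<^esub>}"
  have fin: "finite ?J"
   by (rule finite_subset[OF _ finite_imageI[OF finite_B, of dg]]) (use y0 in auto)
  moreover have "elem (y j) \<in> homogeneous dg j" for j
   using y(1) by (auto simp: homogeneous_def y(2)) (auto simp: y_def split: if_splits)
  moreover have "x = (\<Oplus>\<^bsub>A\<^esub>j\<in>?J. elem (y j))"
  proof (rule chi_eqI[OF x])
   show "(\<Oplus>\<^bsub>A\<^esub>j\<in>?J. elem (y j)) \<in> carrier A" by (rule finsum_closed) (use y in auto)
   fix i
   have "chi (\<Oplus>\<^bsub>A\<^esub>j\<in>?J. elem (y j)) i = (\<Sum>j\<in>?J. if j = dg i then chi x i else 0)"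
    using fin y by (subst chi_finsum) (auto simp: y_def intro!: sum.cong)
   also have "... = (if dg i \<in> ?J then chi x i else 0)" using fin by simp
   also have "... = chi x i"
    using y(2)[of "dg i"] by (auto simp: y_def fun_eq_iff) (metis chi_zero)
   finally show "chi x i = chi (\<Oplus>\<^bsub>A\<^esub>j\<in>?J. elem (y j)) i" by simp
  qed
  ultimately show "(\<forall>j. elem (y j) \<in> homogeneous dg j) \<and> finite ?J \<and> x = (\<Oplus>\<^bsub>A\<^esub>j\<in>?J. elem (y j))"
   by blast
 next
  fix c assume c: "(\<forall>j. c j \<in> homogeneous dg j) \<and> finite {j. c j \<noteq> \<zero>\<^bsub>A\<^esub>} \<and>
    x = (\<Oplus>\<^bsub>A\<^esub>j\<in>{j. c j \<noteq> \<zero>\<^bsub>A\<^esub>}. c j)"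
  let ?J = "{j. c j \<noteq> \<zero>\<^bsub>A\<^esub>}"
  have cc: "c j \<in> carrier A" for j using c by (auto simp: homogeneous_def)
  have c0: "chi (c j) i = 0" if "dg i \<noteq> j" for i j using c that by (auto simp: homogeneous_def)
  have key: "chi x i = chi (c (dg i)) i" for i
  proof -
   have "chi x i = (\<Sum>j\<in>?J. chi (c j) i)"
    using chi_finsum[of ?J c i] c cc by metis
   also have "... = (\<Sum>j\<in>?J. if j = dg i then chi (c (dg i)) i else 0)"
    by (rule sum.cong) (use c0 in auto)
   also have "... = chi (c (dg i)) i" using c by auto
   finally show ?thesis .
  qed
  show "c = (\<lambda>j. elem (y j))"
  proof
   fix j
   show "c j = elem (y j)"
    by (rule chi_eqI[OF cc y(1)], unfold y(2)) (use key c0 in \<open>auto simp: y_def\<close>)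
  qed
 qed
qed

end

text \<open>The constants \<mu> describe the product of an algebra that is already known to be a
  ring. Associativity is therefore inherited, and no identity on triples of basis elements ever has
  to be verified.\<close>

locale coord_algebra = ring A + coord_group A B chi
 for A :: "(complex, 'a) module" and B :: "'i set" and chi +
 fixes \<mu> :: "'i => 'i => 'i => complex" and dg :: "'i => int" and GA :: "int => 'a set"
 assumes smult_closed: "x \<in> carrier A ==> c \<odot>\<^bsub>A\<^esub> x \<in> carrier A"
  and chi_smult: "x \<in> carrier A ==> chi (c \<odot>\<^bsub>A\<^esub> x) = (\<lambda>i. c * chi x i)"
  and chi_mult: "x \<in> carrier A ==> y \<in> carrier A ==>
   chi (x \<otimes>\<^bsub>A\<^esub> y) = (\<lambda>k. \<Sum>i\<in>B. \<Sum>j\<in>B. chi x i * chi y j * \<mu> i j k)"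
  and \<mu>_graded: "i \<in> B ==> j \<in> B ==> \<mu> i j k \<noteq> 0 ==> dg k = dg i + dg j"
  and GA: "GA = homogeneous dg"
begin

lemma module: "Module.module complex_alg A"
 by (rule moduleI[OF complex_alg_cring abelian_group_axioms])
  (auto intro!: smult_closed chi_eqI simp: chi_smult chi_add smult_closed algebra_simps)

definition basis :: "'i => 'a" where
 "basis i = elem (\<lambda>k. if k = i then 1 else 0)"

lemma basis: "i \<in> B ==> basis i \<in> carrier A" "i \<in> B ==> chi (basis i) k = (if k = i then 1 else 0)"
 unfolding basis_def by (subst elem elem(2); auto)+

lemma basis_expand: "x \<in> carrier A ==> x = (\<Oplus>\<^bsub>A\<^esub>i\<in>B. chi x i \<odot>\<^bsub>A\<^esub> basis i)"
proof (rule chi_eqI)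
 assume x: "x \<in> carrier A"
 show "(\<Oplus>\<^bsub>A\<^esub>i\<in>B. chi x i \<odot>\<^bsub>A\<^esub> basis i) \<in> carrier A"
  by (rule finsum_closed) (auto intro: smult_closed basis)
 fix k
 have "chi (\<Oplus>\<^bsub>A\<^esub>i\<in>B. chi x i \<odot>\<^bsub>A\<^esub> basis i) k = (\<Sum>i\<in>B. if i = k then chi x i else 0)"
  by (subst chi_finsum[OF finite_B]) (auto intro!: smult_closed basis sum.cong simp: chi_smult basis)
 then show "chi x k = chi (\<Oplus>\<^bsub>A\<^esub>i\<in>B. chi x i \<odot>\<^bsub>A\<^esub> basis i) k"
  using finite_B chi_outside[OF x, of k] by auto
qed simp

lemma algebra_induct [consumes 1, case_names basis add zero]:
 assumes x: "x \<in> carrier A" and b: "\<And>c i. i \<in> B ==> P (c \<odot>\<^bsub>A\<^esub> basis i)"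
  and a: "\<And>x y. x \<in> carrier A ==> y \<in> carrier A ==> P x ==> P y ==> P (x \<oplus>\<^bsub>A\<^esub> y)"
  and z: "P \<zero>\<^bsub>A\<^esub>"
 shows "P x"
proof -
 have "P (\<Oplus>\<^bsub>A\<^esub>i\<in>J. chi x i \<odot>\<^bsub>A\<^esub> basis i)" if "J \<subseteq> B" for J
  using finite_subset[OF that finite_B] that
 proof (induction J rule: finite_induct)
  case (insert j J)
  have t: "chi x i \<odot>\<^bsub>A\<^esub> basis i \<in> carrier A" if "i \<in> B" for i using that by (auto intro: smult_closed basis)
  have "(\<Oplus>\<^bsub>A\<^esub>i\<in>insert j J. chi x i \<odot>\<^bsub>A\<^esub> basis i) =
    chi x j \<odot>\<^bsub>A\<^esub> basis j \<oplus>\<^bsub>A\<^esub> (\<Oplus>\<^bsub>A\<^esub>i\<in>J. chi x i \<odot>\<^bsub>A\<^esub> basis i)"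
   by (rule finsum_insert) (use insert t in auto)
  moreover have "(\<Oplus>\<^bsub>A\<^esub>i\<in>J. chi x i \<odot>\<^bsub>A\<^esub> basis i) \<in> carrier A"
   by (rule finsum_closed) (use insert t in auto)
  ultimately show ?case using insert a b t by auto
 qed (simp add: z)
 from this[of B] show ?thesis using basis_expand[OF x] by simp
qed

end

lemma sum_rotate:
 "(\<Sum>l\<in>B. \<Sum>j\<in>B. \<Sum>i\<in>B. \<Sum>n\<in>B. f l j i n) = (\<Sum>j\<in>B. \<Sum>i\<in>B. \<Sum>n\<in>B. \<Sum>l\<in>B. f l j i n)"
 by (subst sum.swap, rule sum.cong[OF refl], subst sum.swap, rule sum.cong[OF refl], rule sum.swap)

section \<open>The tensor product and its coordinates\<close>

lemma mod_span_superset: "S \<subseteq> mod_span R M S"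
 by (auto simp: mod_span_def)

lemma mod_span_least: "submodule N R M ==> S \<subseteq> N ==> mod_span R M S \<subseteq> N"
 by (auto simp: mod_span_def)

lemma mod_span_submodule:
 assumes "Module.module R M" "S \<subseteq> carrier M"
 shows "submodule (mod_span R M S) R M"
proof -
 interpret Module.module R M by fact
 show ?thesis
 proof (rule submoduleI)
  show "mod_span R M S \<subseteq> carrier M" by (rule mod_span_least[OF carrier_is_submodule assms(2)])
  show "\<zero>\<^bsub>M\<^esub> \<in> mod_span R M S"
   unfolding mod_span_def using subgroup.one_closed[OF submodule.axioms(1)] by fastforce
 qed (auto simp: mod_span_def submoduleE)
qed

lemma free_module_module: "Module.module complex_alg (free_module complex_alg X)"
proof -
 have fin: "finite {x. f x \<noteq> (0::complex)} ==> finite {x. g x \<noteq> 0} ==> finite {x. f x + g x \<noteq> 0}" for f g :: "'a => complex"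
  by (rule finite_subset[of _ "{x. f x \<noteq> 0} \<union> {x. g x \<noteq> 0}"]) auto
 have "abelian_group (free_module complex_alg X)"
 proof (rule abelian_groupI)
  show "\<exists>y\<in>carrier (free_module complex_alg X). y \<oplus>\<^bsub>free_module complex_alg X\<^esub> f = \<zero>\<^bsub>free_module complex_alg X\<^esub>"
   if "f \<in> carrier (free_module complex_alg X)" for f
   using that by (intro bexI[of _ "\<lambda>x. - f x"]) (auto simp: free_module_def)
 qed (auto simp: free_module_def fin algebra_simps)
 then show ?thesis
  by (rule moduleI[OF complex_alg_cring]) (auto simp: free_module_def algebra_simps intro: finite_subset[rotated])
qed

lemma opposite_simps [simp]:
 "carrier (opposite A) = carrier A" "add (opposite A) = add A" "zero (opposite A) = zero A"
 "one (opposite A) = one A" "module.smult (opposite A) = module.smult A"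
 "monoid.mult (opposite A) = (\<lambda>x y. y \<otimes>\<^bsub>A\<^esub> x)"
 by (simp_all add: opposite_def)

context coord_algebra
begin

abbreviation "F \<equiv> tensor_free (opposite A) A"
abbreviation "K \<equiv> tensor_kernel (opposite A) A"

lemma F_carrier: "f \<in> carrier F \<longleftrightarrow> finite {z. f z \<noteq> 0} \<and> (\<forall>z. f z \<noteq> 0 --> z \<in> carrier A \<times> carrier A)"
 by (auto simp: tensor_free_def free_module_def)

lemma F_simps [simp]: "\<zero>\<^bsub>F\<^esub> = (\<lambda>z. 0)" "f \<oplus>\<^bsub>F\<^esub> g = (\<lambda>z. f z + g z)" "c \<odot>\<^bsub>F\<^esub> f = (\<lambda>z. c * f z)"
 by (simp_all add: tensor_free_def free_module_def)

lemma F_module: "Module.module complex_alg F"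
 unfolding tensor_free_def by (rule free_module_module)

sublocale F: Module.module complex_alg F by (rule F_module)

lemma F_comb: "f \<in> carrier F ==> g \<in> carrier F ==> (\<lambda>z. f z + c * g z) \<in> carrier F"
 using F.M.a_closed[of f "c \<odot>\<^bsub>F\<^esub> g"] F.smult_closed[of c g] by simp

lemma F_ind: "a \<in> carrier A ==> b \<in> carrier A ==> ind (a, b) \<in> carrier F"
 by (auto simp: F_carrier ind_def)

lemma F_diff: "f \<in> carrier F ==> g \<in> carrier F ==> (\<lambda>z. f z - g z) \<in> carrier F"
 using F_comb[of f g "-1"] by simp

lemma F_scale: "f \<in> carrier F ==> (\<lambda>z. c * f z) \<in> carrier F"
 using F.smult_closed[of c f] by simp

lemma F_sum: "finite J ==> (\<And>j. j \<in> J ==> h j \<in> carrier F) ==> (\<lambda>z. \<Sum>j\<in>J. h j z) \<in> carrier F"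
proof (induction J rule: finite_induct)
 case empty then show ?case using F.M.zero_closed by simp
next
 case (insert j J)
 then show ?case using F_comb[of "h j" "\<lambda>z. \<Sum>j\<in>J. h j z" 1] by simp
qed

lemma tensor_rels_closed: "tensor_rels (opposite A) A \<subseteq> carrier F"
 unfolding tensor_rels_def by (auto intro!: F_diff F_ind F_scale smult_closed)

lemma K_submodule: "submodule K complex_alg F"
 unfolding tensor_kernel_def by (rule mod_span_submodule[OF F_module tensor_rels_closed])

lemma K_closed: "f \<in> K ==> f \<in> carrier F"
 using F.submoduleE(1)[OF K_submodule] by auto

lemma K_add: "f \<in> K ==> g \<in> K ==> (\<lambda>z. f z + g z) \<in> K"
 using F.submoduleE(5)[OF K_submodule] by simp

lemma K_scale: "f \<in> K ==> (\<lambda>z. c * f z) \<in> K"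
 using F.submoduleE(4)[OF K_submodule, of c f] by simp

lemma K_zero: "(\<lambda>z. 0) \<in> K"
 using subgroup.one_closed[OF submodule.axioms(1)[OF K_submodule]] by simp

lemma K_sum: "finite J ==> (\<And>j. j \<in> J ==> h j \<in> K) ==> (\<lambda>z. \<Sum>j\<in>J. h j z) \<in> K"
 by (induction J rule: finite_induct) (auto intro: K_zero K_add)

lemma K_rels:
 assumes "a \<in> carrier A" "b \<in> carrier A"
 shows "a' \<in> carrier A ==> (\<lambda>z. ind (a \<oplus>\<^bsub>A\<^esub> a', b) z - ind (a, b) z - ind (a', b) z) \<in> K"
  and "b' \<in> carrier A ==> (\<lambda>z. ind (a, b \<oplus>\<^bsub>A\<^esub> b') z - ind (a, b) z - ind (a, b') z) \<in> K"
  and "(\<lambda>z. ind (c \<odot>\<^bsub>A\<^esub> a, b) z - c * ind (a, b) z) \<in> K"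
  and "(\<lambda>z. ind (a, c \<odot>\<^bsub>A\<^esub> b) z - c * ind (a, b) z) \<in> K"
proof -
 have *: "f \<in> K" if "f \<in> tensor_rels (opposite A) A" for f
  using that unfolding tensor_kernel_def by (rule subsetD[OF mod_span_superset])
 show "(\<lambda>z. ind (a \<oplus>\<^bsub>A\<^esub> a', b) z - ind (a, b) z - ind (a', b) z) \<in> K" if "a' \<in> carrier A"
  by (rule *, unfold tensor_rels_def opposite_simps, rule UnI1, rule UnI1, rule UnI1, rule CollectI, rule exI[of _ a], rule exI[of _ a'], rule exI[of _ b])
   (use assms that in simp)
 show "(\<lambda>z. ind (a, b \<oplus>\<^bsub>A\<^esub> b') z - ind (a, b) z - ind (a, b') z) \<in> K" if "b' \<in> carrier A"
  by (rule *, unfold tensor_rels_def opposite_simps, rule UnI1, rule UnI1, rule UnI2, rule CollectI, rule exI[of _ a], rule exI[of _ b], rule exI[of _ b'])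
   (use assms that in simp)
 show "(\<lambda>z. ind (c \<odot>\<^bsub>A\<^esub> a, b) z - c * ind (a, b) z) \<in> K"
  by (rule *, unfold tensor_rels_def opposite_simps, rule UnI1, rule UnI2, rule CollectI, rule exI[of _ c], rule exI[of _ a], rule exI[of _ b])
   (use assms in simp)
 show "(\<lambda>z. ind (a, c \<odot>\<^bsub>A\<^esub> b) z - c * ind (a, b) z) \<in> K"
  by (rule *, unfold tensor_rels_def opposite_simps, rule UnI2, rule CollectI, rule exI[of _ c], rule exI[of _ a], rule exI[of _ b])
   (use assms in simp)
qed

text \<open>The product of two coordinate functions, extended linearly from pairs to formal
  combinations of pairs. These functionals will turn out to cut out exactly the kernel
  \<open>K\<close>.\<close>

definition val :: "('a \<times> 'a => complex) => 'i \<times> 'i => complex" where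
 "val f p = (\<Sum>z\<in>{z. f z \<noteq> 0}. f z * chi (fst z) (fst p) * chi (snd z) (snd p))"

lemma val_eq:
 assumes "finite S" "\<And>z. z \<notin> S ==> f z = 0"
 shows "val f p = (\<Sum>z\<in>S. f z * chi (fst z) (fst p) * chi (snd z) (snd p))"
 unfolding val_def by (rule sum.mono_neutral_left) (use assms in auto)

lemma val_comb:
 assumes "f \<in> carrier F" "g \<in> carrier F"
 shows "val (\<lambda>z. f z + c * g z) p = val f p + c * val g p"
proof -
 let ?S = "{z. f z \<noteq> 0} \<union> {z. g z \<noteq> 0}"
 have S: "finite ?S" using assms by (simp add: F_carrier)
 have "val (\<lambda>z. f z + c * g z) p = (\<Sum>z\<in>?S. (f z + c * g z) * chi (fst z) (fst p) * chi (snd z) (snd p))"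
  "val f p = (\<Sum>z\<in>?S. f z * chi (fst z) (fst p) * chi (snd z) (snd p))"
  "val g p = (\<Sum>z\<in>?S. g z * chi (fst z) (fst p) * chi (snd z) (snd p))"
  by (rule val_eq[OF S]; auto)+
 then show ?thesis by (simp add: sum_distrib_left sum.distrib algebra_simps)
qed

lemma val_diff: "f \<in> carrier F ==> g \<in> carrier F ==> val (\<lambda>z. f z - g z) p = val f p - val g p"
 using val_comb[of f g "-1" p] by simp

lemma val_zero [simp]: "val (\<lambda>z. 0) p = 0"
 by (simp add: val_def)

lemma val_scale: "f \<in> carrier F ==> val (\<lambda>z. c * f z) p = c * val f p"
 using val_comb[OF F.M.zero_closed, of f c p] by simp

lemma val_sum: "finite J ==> (\<And>j. j \<in> J ==> h j \<in> carrier F) ==>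
  val (\<lambda>z. \<Sum>j\<in>J. h j z) p = (\<Sum>j\<in>J. val (h j) p)"
proof (induction J rule: finite_induct)
 case (insert j J)
 then show ?case using val_comb[of "h j" "\<lambda>z. \<Sum>j\<in>J. h j z" 1 p] F_sum[of J h] by simp
qed simp

lemma val_ind: "val (ind (a, b)) p = chi a (fst p) * chi b (snd p)"
 by (subst val_eq[of "{(a, b)}"]) (auto simp: ind_def)

text \<open>The common zeros of the functionals form a submodule, and it contains the bilinearity
  relations because coordinates are linear.\<close>

lemma val_K: "f \<in> K ==> val f p = 0"
proof -
 assume f: "f \<in> K"
 let ?N = "{f \<in> carrier F. \<forall>p. val f p = 0}"
 have "submodule ?N complex_alg F"
 proof (rule F.submoduleI)
  show "\<ominus>\<^bsub>F\<^esub> f \<in> ?N" if f: "f \<in> ?N" for f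
  proof -
   have "f \<in> carrier F" using f by simp
   then have "\<ominus>\<^bsub>F\<^esub> f = (\<lambda>z. (-1) * f z)"
    by (intro F.M.minus_equality) (use F_scale[of f "-1"] in auto)
   then show ?thesis using f F_scale[of f "-1"] val_scale[of f "-1"] by simp
  qed
  show "f \<oplus>\<^bsub>F\<^esub> g \<in> ?N" if "f \<in> ?N" "g \<in> ?N" for f g
   using that F_comb[of f g 1] val_comb[of f g 1] by simp
  show "c \<odot>\<^bsub>F\<^esub> f \<in> ?N" if "f \<in> ?N" for c f
   using that F_scale[of f c] val_scale[of f c] by simp
 qed (use F.M.zero_closed in auto)
 moreover have "tensor_rels (opposite A) A \<subseteq> ?N"
 proof
  fix f assume f: "f \<in> tensor_rels (opposite A) A"
  have "val f p = 0" for p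
   using f unfolding tensor_rels_def
   by (auto simp: val_diff val_scale F_ind F_diff F_scale smult_closed val_ind chi_add chi_smult)
    (simp_all add: algebra_simps)
  with f tensor_rels_closed show "f \<in> ?N" by auto
 qed
 ultimately have "K \<subseteq> ?N" unfolding tensor_kernel_def by (rule mod_span_least)
 with f show ?thesis by blast
qed

text \<open>Induction over a set \<open>S\<close> that contains all nonzero coordinates: one
  coordinate is split off at a time, each split costing one additivity relation and one scalar
  relation.\<close>

lemma reduce_left:
 assumes b: "b \<in> carrier A" and S: "S \<subseteq> B"
 shows "a \<in> carrier A ==> (\<And>i. i \<notin> S ==> chi a i = 0) ==>
  (\<lambda>z. ind (a, b) z - (\<Sum>i\<in>S. chi a i * ind (basis i, b) z)) \<in> K"
 using finite_subset[OF S finite_B] S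
proof (induction S arbitrary: a rule: finite_induct)
 case empty
 have "a = 0 \<odot>\<^bsub>A\<^esub> a"
  by (rule chi_eqI) (use empty smult_closed in \<open>auto simp: chi_smult\<close>)
 then show ?case using K_rels(3)[OF empty(1) b, of 0] by simp
next
 case (insert i S)
 let ?y = "(chi a)(i := 0)"
 have y: "?y k = 0" if "k \<notin> B" for k using that insert.prems chi_outside by auto
 let ?a = "elem ?y"
 have a: "?a \<in> carrier A" "chi ?a = ?y" by (rule elem; use y in auto)+
 have i: "basis i \<in> carrier A" "chi (basis i) k = (if k = i then 1 else 0)" for k
  using basis insert.prems by auto
 have eq: "a = ?a \<oplus>\<^bsub>A\<^esub> (chi a i \<odot>\<^bsub>A\<^esub> basis i)"
  by (rule chi_eqI) (use insert.prems a i smult_closed in \<open>auto simp: chi_add chi_smult\<close>)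
 have 1: "(\<lambda>z. ind (a, b) z - ind (?a, b) z - ind (chi a i \<odot>\<^bsub>A\<^esub> basis i, b) z) \<in> K"
  using K_rels(1)[OF a(1) b smult_closed[OF i(1)], of "chi a i"] eq by simp
 have 2: "(\<lambda>z. ind (chi a i \<odot>\<^bsub>A\<^esub> basis i, b) z - chi a i * ind (basis i, b) z) \<in> K"
  by (rule K_rels(3)[OF i(1) b])
 have 3: "(\<lambda>z. ind (?a, b) z - (\<Sum>k\<in>S. chi ?a k * ind (basis k, b) z)) \<in> K"
  by (rule insert.IH[OF a(1)]) (use insert.prems insert.hyps a(2) in auto)
 have "(\<Sum>k\<in>S. chi ?a k * ind (basis k, b) z) = (\<Sum>k\<in>S. chi a k * ind (basis k, b) z)" for z
  by (rule sum.cong) (use insert.hyps a(2) in auto)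
 with K_add[OF K_add[OF 1 2] 3] insert.hyps show ?case by (simp add: algebra_simps)
qed

lemma reduce_right:
 assumes b: "b \<in> carrier A" and S: "S \<subseteq> B"
 shows "a \<in> carrier A ==> (\<And>i. i \<notin> S ==> chi a i = 0) ==>
  (\<lambda>z. ind (b, a) z - (\<Sum>i\<in>S. chi a i * ind (b, basis i) z)) \<in> K"
 using finite_subset[OF S finite_B] S
proof (induction S arbitrary: a rule: finite_induct)
 case empty
 have "a = 0 \<odot>\<^bsub>A\<^esub> a"
  by (rule chi_eqI) (use empty smult_closed in \<open>auto simp: chi_smult\<close>)
 then show ?case using K_rels(4)[OF b empty(1), of 0] by simp
next
 case (insert i S)
 let ?y = "(chi a)(i := 0)"
 have y: "?y k = 0" if "k \<notin> B" for k using that insert.prems chi_outside by auto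
 let ?a = "elem ?y"
 have a: "?a \<in> carrier A" "chi ?a = ?y" by (rule elem; use y in auto)+
 have i: "basis i \<in> carrier A" "chi (basis i) k = (if k = i then 1 else 0)" for k
  using basis insert.prems by auto
 have eq: "a = ?a \<oplus>\<^bsub>A\<^esub> (chi a i \<odot>\<^bsub>A\<^esub> basis i)"
  by (rule chi_eqI) (use insert.prems a i smult_closed in \<open>auto simp: chi_add chi_smult\<close>)
 have 1: "(\<lambda>z. ind (b, a) z - ind (b, ?a) z - ind (b, chi a i \<odot>\<^bsub>A\<^esub> basis i) z) \<in> K"
  using K_rels(2)[OF b a(1) smult_closed[OF i(1)], of "chi a i"] eq by simp
 have 2: "(\<lambda>z. ind (b, chi a i \<odot>\<^bsub>A\<^esub> basis i) z - chi a i * ind (b, basis i) z) \<in> K"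
  by (rule K_rels(4)[OF b i(1)])
 have 3: "(\<lambda>z. ind (b, ?a) z - (\<Sum>k\<in>S. chi ?a k * ind (b, basis k) z)) \<in> K"
  by (rule insert.IH[OF a(1)]) (use insert.prems insert.hyps a(2) in auto)
 have "(\<Sum>k\<in>S. chi ?a k * ind (b, basis k) z) = (\<Sum>k\<in>S. chi a k * ind (b, basis k) z)" for z
  by (rule sum.cong) (use insert.hyps a(2) in auto)
 with K_add[OF K_add[OF 1 2] 3] insert.hyps show ?case by (simp add: algebra_simps)
qed

lemma reduce_ind:
 assumes a: "a \<in> carrier A" and b: "b \<in> carrier A"
 shows "(\<lambda>z. ind (a, b) z - (\<Sum>i\<in>B. \<Sum>j\<in>B. chi a i * chi b j * ind (basis i, basis j) z)) \<in> K"
proof -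
 have 1: "(\<lambda>z. ind (a, b) z - (\<Sum>i\<in>B. chi a i * ind (basis i, b) z)) \<in> K"
  by (rule reduce_left[OF b order_refl a]) (rule chi_outside[OF a])
 have "(\<lambda>z. \<Sum>i\<in>B. chi a i * (ind (basis i, b) z - (\<Sum>j\<in>B. chi b j * ind (basis i, basis j) z))) \<in> K"
  by (intro K_sum finite_B K_scale reduce_right basis order_refl b) (auto simp: chi_outside[OF b])
 from K_add[OF 1 this] show ?thesis
  by (simp add: right_diff_distrib sum_subtractf sum_distrib_left algebra_simps)
qed

text \<open>Replacing every pair in \<open>f\<close> by its expansion in pairs of basis elements
  changes \<open>f\<close> by an element of \<open>K\<close>. The coefficients after the replacement
  are the values \<open>val f p\<close>, hence zero.\<close>

lemma K_if_val:
 assumes f: "f \<in> carrier F" and 0: "\<And>p. val f p = 0"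
 shows "f \<in> K"
proof -
 let ?S = "{z. f z \<noteq> 0}"
 let ?h = "\<lambda>z w. \<Sum>i\<in>B. \<Sum>j\<in>B. chi (fst z) i * chi (snd z) j * ind (basis i, basis j) w"
 have S: "finite ?S" using f by (simp add: F_carrier)
 have "(\<lambda>w. \<Sum>z\<in>?S. f z * (ind z w - ?h z w)) \<in> K"
 proof (intro K_sum S K_scale)
  fix z assume "z \<in> ?S"
  then show "(\<lambda>w. ind z w - ?h z w) \<in> K"
   using f reduce_ind[of "fst z" "snd z"] by (cases z) (auto simp: F_carrier)
 qed
 moreover have "(\<Sum>z\<in>?S. f z * (ind z w - ?h z w)) = f w" for w
 proof -
  have "(\<Sum>z\<in>?S. f z * ind z w) = (\<Sum>z\<in>?S. if z = w then f w else 0)"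
   by (rule sum.cong) (auto simp: ind_def)
  also have "... = f w" using S by auto
  finally have 1: "(\<Sum>z\<in>?S. f z * ind z w) = f w" .
  have "(\<Sum>z\<in>?S. f z * ?h z w) =
    (\<Sum>i\<in>B. \<Sum>j\<in>B. (\<Sum>z\<in>?S. f z * chi (fst z) i * chi (snd z) j) * ind (basis i, basis j) w)"
   by (simp add: sum_distrib_left sum_distrib_right algebra_simps)
    (subst sum.swap, rule sum.cong[OF refl], subst sum.swap, rule refl)
  also have "... = 0" using 0[of "(_, _)"] by (simp add: val_def)
  finally show ?thesis using 1 by (simp add: right_diff_distrib sum_subtractf)
 qed
 ultimately show ?thesis by simp
qed

end

section \<open>Cosets and coordinates of the enveloping algebra\<close>

context coord_algebra
begin

abbreviation "R \<equiv> enveloping_algebra A"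

definition tens :: "'a => 'a => 'a env" where
 "tens a b = K +>\<^bsub>F\<^esub> ind (a, b)"

definition env_chi :: "'a env => 'i \<times> 'i => complex" where
 "env_chi X = val (SOME f. f \<in> X)"

text \<open>Pairs list the factor from the opposite algebra first, hence the exchanged arguments in
  the first component. The same order, right factor before left factor, is kept for the bimodule
  coordinates below.\<close>

definition env_\<mu> :: "'i \<times> 'i => 'i \<times> 'i => 'i \<times> 'i => complex" where
 "env_\<mu> p q r = \<mu> (fst q) (fst p) (fst r) * \<mu> (snd p) (snd q) (snd r)"

definition env_dg :: "'i \<times> 'i => int" where
 "env_dg p = dg (fst p) + dg (snd p)"

lemma coset_iff: "g \<in> K +>\<^bsub>F\<^esub> f \<longleftrightarrow> (\<lambda>z. g z - f z) \<in> K"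
proof
 assume "g \<in> K +>\<^bsub>F\<^esub> f"
 then obtain k where "k \<in> K" "g = (\<lambda>z. k z + f z)" by (auto simp: a_r_coset_def')
 then show "(\<lambda>z. g z - f z) \<in> K" by simp
next
 assume "(\<lambda>z. g z - f z) \<in> K"
 then show "g \<in> K +>\<^bsub>F\<^esub> f" by (auto simp: a_r_coset_def' intro!: bexI[of _ "\<lambda>z. g z - f z"])
qed

lemma coset_self: "f \<in> K +>\<^bsub>F\<^esub> f"
 by (simp add: coset_iff K_zero)

lemma env_chi_coset: "f \<in> carrier F ==> env_chi (K +>\<^bsub>F\<^esub> f) = val f"
proof -
 assume f: "f \<in> carrier F"
 define g where "g = (SOME g. g \<in> K +>\<^bsub>F\<^esub> f)"
 have "g \<in> K +>\<^bsub>F\<^esub> f" unfolding g_def by (rule someI[of _ f]) (rule coset_self)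
 then have k: "(\<lambda>z. g z - f z) \<in> K" by (simp add: coset_iff)
 have "g = (\<lambda>z. f z + 1 * (g z - f z))" by simp
 then have "val g p = val f p" for p
  using val_comb[OF f K_closed[OF k], of 1 p] val_K[OF k, of p] by simp
 then show ?thesis by (auto simp: env_chi_def g_def[symmetric])
qed

lemma coset_eqI:
 assumes "f \<in> carrier F" "g \<in> carrier F" "\<And>p. val f p = val g p"
 shows "K +>\<^bsub>F\<^esub> f = K +>\<^bsub>F\<^esub> g"
proof -
 have 1: "(\<lambda>z. f z - g z) \<in> K" by (rule K_if_val) (use assms F_diff val_diff in auto)
 have 2: "(\<lambda>z. (-1) * (f z - g z)) \<in> K" by (rule K_scale[OF 1])
 have "(\<lambda>z. h z - f z) \<in> K \<longleftrightarrow> (\<lambda>z. h z - g z) \<in> K" for h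
  using K_add[OF 1, of "\<lambda>z. h z - f z"] K_add[OF 2, of "\<lambda>z. h z - g z"] by (auto simp: algebra_simps)
 then show ?thesis by (auto simp: coset_iff)
qed

sublocale K: abelian_subgroup K F
 by (rule abelian_subgroupI3[OF additive_subgroup.intro[OF submodule.axioms(1)[OF K_submodule]]
    F.M.abelian_group_axioms])

lemma env_simps:
 "carrier R = a_rcosets\<^bsub>F\<^esub> K" "X \<oplus>\<^bsub>R\<^esub> Y = X <+>\<^bsub>F\<^esub> Y" "one R = tens \<one>\<^bsub>A\<^esub> \<one>\<^bsub>A\<^esub>"
 "X \<otimes>\<^bsub>R\<^esub> Y = (\<Union>f\<in>X. \<Union>g\<in>Y. K +>\<^bsub>F\<^esub> tensor_mult (opposite A) A f g)"
 "c \<odot>\<^bsub>R\<^esub> X = (\<Union>f\<in>X. K +>\<^bsub>F\<^esub> (c \<odot>\<^bsub>F\<^esub> f))"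
 by (simp_all add: enveloping_algebra_def tensor_algebra_def quot_module_def tens_def)

lemma env_carrier: "X \<in> carrier R \<longleftrightarrow> (\<exists>f\<in>carrier F. X = K +>\<^bsub>F\<^esub> f)"
 by (auto simp: env_simps A_RCOSETS_def')

lemma env_cases:
 assumes "X \<in> carrier R"
 obtains f where "f \<in> carrier F" "X = K +>\<^bsub>F\<^esub> f"
 using assms by (auto simp: env_carrier)

lemma tens_closed: "a \<in> carrier A ==> b \<in> carrier A ==> tens a b \<in> carrier R"
 unfolding env_carrier tens_def using F_ind by blast

lemma env_chi_tens:
 "a \<in> carrier A ==> b \<in> carrier A ==> env_chi (tens a b) p = chi a (fst p) * chi b (snd p)"
 by (simp add: tens_def env_chi_coset F_ind val_ind)

lemma env_add: "f \<in> carrier F ==> g \<in> carrier F ==>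
  (K +>\<^bsub>F\<^esub> f) \<oplus>\<^bsub>R\<^esub> (K +>\<^bsub>F\<^esub> g) = K +>\<^bsub>F\<^esub> (\<lambda>z. f z + g z)"
 using K.a_rcos_sum[of f g] by (simp add: env_simps)

lemma env_smult: "f \<in> carrier F ==> c \<odot>\<^bsub>R\<^esub> (K +>\<^bsub>F\<^esub> f) = K +>\<^bsub>F\<^esub> (\<lambda>z. c * f z)"
proof -
 assume f: "f \<in> carrier F"
 have "K +>\<^bsub>F\<^esub> (\<lambda>z. c * g z) = K +>\<^bsub>F\<^esub> (\<lambda>z. c * f z)" if "g \<in> K +>\<^bsub>F\<^esub> f" for g
 proof (rule coset_eqI)
  have k: "(\<lambda>z. g z - f z) \<in> K" using that by (simp add: coset_iff)
  have "g = (\<lambda>z. f z + 1 * (g z - f z))" by simp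
  then have g: "g \<in> carrier F" "val g p = val f p" for p
   using F_comb[OF f K_closed[OF k], of 1] val_comb[OF f K_closed[OF k], of 1 p] val_K[OF k, of p] by auto
  show "val (\<lambda>z. c * g z) p = val (\<lambda>z. c * f z) p" for p
   using g f by (simp add: val_scale)
  show "(\<lambda>z. c * g z) \<in> carrier F" by (rule F_scale[OF g(1)])
 qed (rule F_scale[OF f])
 note const = this
 have "c \<odot>\<^bsub>R\<^esub> (K +>\<^bsub>F\<^esub> f) = (\<Union>g\<in>K +>\<^bsub>F\<^esub> f. K +>\<^bsub>F\<^esub> (\<lambda>z. c * g z))"
  by (simp add: env_simps)
 also have "... = (\<Union>g\<in>K +>\<^bsub>F\<^esub> f. K +>\<^bsub>F\<^esub> (\<lambda>z. c * f z))"
  by (rule SUP_cong[OF refl const])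
 also have "... = K +>\<^bsub>F\<^esub> (\<lambda>z. c * f z)"
  using coset_self[of f] by blast
 finally show ?thesis .
qed

text \<open>The coordinates of a product of representatives depend only on the coordinates of the
  representatives, which is what later makes the product of cosets computable.\<close>

lemma tensor_mult_expand:
 assumes f: "f \<in> carrier F" and g: "g \<in> carrier F"
 shows "tensor_mult (opposite A) A f g \<in> carrier F"
  and "val (tensor_mult (opposite A) A f g) r =
   (\<Sum>p\<in>B \<times> B. \<Sum>q\<in>B \<times> B. val f p * val g q * env_\<mu> p q r)"
proof -
 let ?S = "{z. f z \<noteq> 0}" let ?T = "{z. g z \<noteq> 0}"
 define h where "h z = (\<lambda>w. f (fst z) * g (snd z) * ind (fst (snd z) \<otimes>\<^bsub>A\<^esub> fst (fst z), snd (fst z) \<otimes>\<^bsub>A\<^esub> snd (snd z)) w)" for z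
 have ST: "finite (?S \<times> ?T)" using f g by (simp add: F_carrier)
 have cl: "fst x \<in> carrier A" "snd x \<in> carrier A" "fst y \<in> carrier A" "snd y \<in> carrier A"
  if "(x, y) \<in> ?S \<times> ?T" for x y
  using that f g unfolding F_carrier by (cases x; cases y; auto)+
 have hF: "h z \<in> carrier F" if "z \<in> ?S \<times> ?T" for z
  unfolding h_def using that cl[of "fst z" "snd z"] by (intro F_scale F_ind) auto
 have eq: "tensor_mult (opposite A) A f g = (\<lambda>w. \<Sum>z\<in>?S \<times> ?T. h z w)"
  by (simp add: tensor_mult_def h_def sum.cartesian_product case_prod_unfold)
 show "tensor_mult (opposite A) A f g \<in> carrier F"
  unfolding eq by (rule F_sum[OF ST hF])
 let ?c = "\<lambda>x p. chi (fst x) (fst p) * chi (snd x) (snd p)"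
 have inner: "val (h (x, y)) r = f x * g y * (\<Sum>p\<in>B \<times> B. \<Sum>q\<in>B \<times> B. ?c x p * ?c y q * env_\<mu> p q r)"
  if "(x, y) \<in> ?S \<times> ?T" for x y
 proof -
  note c = cl[OF that]
  have "val (h (x, y)) r = f x * g y * (chi (fst y \<otimes>\<^bsub>A\<^esub> fst x) (fst r) * chi (snd x \<otimes>\<^bsub>A\<^esub> snd y) (snd r))"
   using c by (simp add: h_def val_scale F_ind val_ind)
  also have "chi (fst y \<otimes>\<^bsub>A\<^esub> fst x) (fst r) =
    (\<Sum>i\<in>B. \<Sum>j\<in>B. chi (fst x) i * chi (fst y) j * \<mu> j i (fst r))"
   using c by (simp add: chi_mult, subst sum.swap) (simp add: algebra_simps)
  also have "chi (snd x \<otimes>\<^bsub>A\<^esub> snd y) (snd r) =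
    (\<Sum>i\<in>B. \<Sum>j\<in>B. chi (snd x) i * chi (snd y) j * \<mu> i j (snd r))"
   using c by (simp add: chi_mult)
  also have "(\<Sum>i\<in>B. \<Sum>j\<in>B. chi (fst x) i * chi (fst y) j * \<mu> j i (fst r)) *
     (\<Sum>i\<in>B. \<Sum>j\<in>B. chi (snd x) i * chi (snd y) j * \<mu> i j (snd r)) =
    (\<Sum>i\<in>B. \<Sum>i'\<in>B. \<Sum>j\<in>B. \<Sum>j'\<in>B. chi (fst x) i * chi (fst y) j * \<mu> j i (fst r) *
     (chi (snd x) i' * chi (snd y) j' * \<mu> i' j' (snd r)))"
   by (simp add: sum_product)
  also have "... = (\<Sum>p\<in>B \<times> B. \<Sum>q\<in>B \<times> B. ?c x p * ?c y q * env_\<mu> p q r)"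
   by (simp add: sum.cartesian_product' env_\<mu>_def algebra_simps)
  finally show ?thesis .
 qed
 have "val (tensor_mult (opposite A) A f g) r = (\<Sum>z\<in>?S \<times> ?T. val (h z) r)"
  unfolding eq by (rule val_sum[OF ST hF])
 also have "... = (\<Sum>x\<in>?S. \<Sum>y\<in>?T. val (h (x, y)) r)"
  by (simp add: sum.cartesian_product case_prod_unfold)
 also have "... = (\<Sum>x\<in>?S. \<Sum>y\<in>?T. \<Sum>p\<in>B \<times> B. \<Sum>q\<in>B \<times> B. (f x * ?c x p) * (g y * ?c y q) * env_\<mu> p q r)"
  by (intro sum.cong refl) (simp add: inner sum_distrib_left algebra_simps)
 also have "... = (\<Sum>x\<in>?S. \<Sum>p\<in>B \<times> B. \<Sum>q\<in>B \<times> B. \<Sum>y\<in>?T. (f x * ?c x p) * (g y * ?c y q) * env_\<mu> p q r)"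
  by (intro sum.cong refl, subst sum.swap, intro sum.cong refl, rule sum.swap)
 also have "... = (\<Sum>p\<in>B \<times> B. \<Sum>q\<in>B \<times> B. \<Sum>x\<in>?S. \<Sum>y\<in>?T. (f x * ?c x p) * (g y * ?c y q) * env_\<mu> p q r)"
  by (subst sum.swap, intro sum.cong refl, rule sum.swap)
 also have "... = (\<Sum>p\<in>B \<times> B. \<Sum>q\<in>B \<times> B. val f p * val g q * env_\<mu> p q r)"
  by (intro sum.cong refl) (simp only: val_def, simp only: sum_product, simp only: sum_distrib_right, simp only: mult.assoc)
 finally show "val (tensor_mult (opposite A) A f g) r =
   (\<Sum>p\<in>B \<times> B. \<Sum>q\<in>B \<times> B. val f p * val g q * env_\<mu> p q r)" .
qed

end

text \<open>The ring axioms are an assumption here. They will be supplied by the given resolution,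
  since \<open>left_module\<close> includes them for its ring of scalars.\<close>

locale env_coord_algebra = coord_algebra A B chi \<mu> dg GA
 for A :: "(complex, 'a) module" and B :: "'i set" and chi \<mu> dg GA +
 assumes env_ring: "ring (enveloping_algebra A)"
begin

sublocale R: ring R by (rule env_ring)

text \<open>The product of two cosets is a coset because \<open>R\<close> is assumed to be a ring, so it must be the
 coset of the product of any two representatives.\<close>

lemma env_mult:
 assumes f: "f \<in> carrier F" and g: "g \<in> carrier F"
 shows "(K +>\<^bsub>F\<^esub> f) \<otimes>\<^bsub>R\<^esub> (K +>\<^bsub>F\<^esub> g) = K +>\<^bsub>F\<^esub> tensor_mult (opposite A) A f g"
proof -
 let ?m = "tensor_mult (opposite A) A f g"
 have "(K +>\<^bsub>F\<^esub> f) \<otimes>\<^bsub>R\<^esub> (K +>\<^bsub>F\<^esub> g) \<in> carrier R"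
  by (rule R.m_closed) (use f g env_carrier in auto)
 then obtain h where h: "h \<in> carrier F" "(K +>\<^bsub>F\<^esub> f) \<otimes>\<^bsub>R\<^esub> (K +>\<^bsub>F\<^esub> g) = K +>\<^bsub>F\<^esub> h"
  by (rule env_cases)
 have "?m \<in> (K +>\<^bsub>F\<^esub> f) \<otimes>\<^bsub>R\<^esub> (K +>\<^bsub>F\<^esub> g)"
  unfolding env_simps using coset_self by blast
 then have "(\<lambda>z. ?m z - h z) \<in> K" unfolding h(2) coset_iff .
 from val_K[OF this] have "val ?m p = val h p" for p
  using val_diff[OF tensor_mult_expand(1)[OF f g] h(1)] by simp
 then show ?thesis unfolding h(2)
  by (intro coset_eqI h(1) tensor_mult_expand(1)[OF f g]) (rule sym)
qed

sublocale R: coord_group R "B \<times> B" env_chi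
proof
 show "finite (B \<times> B)" using finite_B by simp
 show "env_chi (X \<oplus>\<^bsub>R\<^esub> Y) = (\<lambda>p. env_chi X p + env_chi Y p)" if "X \<in> carrier R" "Y \<in> carrier R" for X Y
 proof -
  from that(1) obtain f where f: "f \<in> carrier F" "X = K +>\<^bsub>F\<^esub> f" by (rule env_cases)
  from that(2) obtain g where g: "g \<in> carrier F" "Y = K +>\<^bsub>F\<^esub> g" by (rule env_cases)
  note fg = f(1) g(1) f(2) g(2)
  have "(\<lambda>z. f z + g z) \<in> carrier F" using F_comb[OF fg(1,2), of 1] by simp
  then show ?thesis
   unfolding fg(3,4) env_add[OF fg(1,2)] env_chi_coset[OF fg(1)] env_chi_coset[OF fg(2)]
   using val_comb[OF fg(1,2), of 1] by (simp add: env_chi_coset fun_eq_iff)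
 qed
 show "bij_betw env_chi (carrier R) {y. \<forall>p. p \<notin> B \<times> B --> y p = 0}"
  unfolding bij_betw_def
 proof (rule conjI, rule inj_onI, goal_cases inj surj)
  case (inj X Y)
  then have XY: "X \<in> carrier R" "Y \<in> carrier R" "env_chi X = env_chi Y" by auto
  from XY(1) obtain f where f: "f \<in> carrier F" "X = K +>\<^bsub>F\<^esub> f" by (rule env_cases)
  from XY(2) obtain g where g: "g \<in> carrier F" "Y = K +>\<^bsub>F\<^esub> g" by (rule env_cases)
  note fg = f(1) g(1) f(2) g(2)
  show "X = Y" unfolding fg(3,4)
   by (rule coset_eqI[OF fg(1,2)]) (use XY(3) fg in \<open>simp add: env_chi_coset\<close>)
 next
  case surj
  show ?case
  proof (rule equalityI; rule subsetI)
  fix y assume "y \<in> env_chi ` carrier R"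
  then obtain X where X: "X \<in> carrier R" "y = env_chi X" by blast
  from X(1) obtain f where f: "f \<in> carrier F" "X = K +>\<^bsub>F\<^esub> f" by (rule env_cases)
  have y: "y = val f" using X f env_chi_coset by simp
  show "y \<in> {y. \<forall>p. p \<notin> B \<times> B --> y p = 0}"
   unfolding y mem_Collect_eq val_def
  proof (intro allI impI sum.neutral ballI)
   fix p z assume p: "p \<notin> B \<times> B" and z: "z \<in> {z. f z \<noteq> 0}"
   then have "fst z \<in> carrier A" "snd z \<in> carrier A" using f(1) unfolding F_carrier by (cases z; auto)+
   then show "f z * chi (fst z) (fst p) * chi (snd z) (snd p) = 0"
    using p chi_outside by (cases p) auto
  qed
 next
  fix y :: "'i \<times> 'i => complex" assume y: "y \<in> {y. \<forall>p. p \<notin> B \<times> B --> y p = 0}"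
  let ?f = "\<lambda>w. \<Sum>p\<in>B \<times> B. y p * ind (basis (fst p), basis (snd p)) w"
  have fin: "finite (B \<times> B)" using finite_B by simp
  have t: "(\<lambda>w. y p * ind (basis (fst p), basis (snd p)) w) \<in> carrier F" if "p \<in> B \<times> B" for p
   using that by (intro F_scale F_ind basis) auto
  have f: "?f \<in> carrier F" by (rule F_sum[OF fin t])
  have "val ?f q = y q" for q
  proof -
   have "val ?f q = (\<Sum>p\<in>B \<times> B. y p * (chi (basis (fst p)) (fst q) * chi (basis (snd p)) (snd q)))"
    by (subst val_sum[OF fin t]) (auto intro!: sum.cong simp: val_scale F_ind basis val_ind)
   also have "... = (\<Sum>p\<in>B \<times> B. if p = q then y q else 0)"
    by (rule sum.cong) (auto simp: basis prod_eq_iff)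
   also have "... = y q" using y fin by (cases q) auto
   finally show ?thesis .
  qed
  then have "y = env_chi (K +>\<^bsub>F\<^esub> ?f)" by (simp add: env_chi_coset[OF f] fun_eq_iff)
  then show "y \<in> env_chi ` carrier R"
   by (rule image_eqI) (unfold env_carrier, rule bexI[OF refl f])
  qed
 qed
qed

lemma env_chi_smult:
 assumes "X \<in> carrier R"
 shows "c \<odot>\<^bsub>R\<^esub> X \<in> carrier R" "env_chi (c \<odot>\<^bsub>R\<^esub> X) = (\<lambda>p. c * env_chi X p)"
proof -
 from assms obtain f where f: "f \<in> carrier F" "X = K +>\<^bsub>F\<^esub> f" by (rule env_cases)
 then show "c \<odot>\<^bsub>R\<^esub> X \<in> carrier R" "env_chi (c \<odot>\<^bsub>R\<^esub> X) = (\<lambda>p. c * env_chi X p)"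
  using F_scale[OF f(1), of c] by (auto simp: env_smult env_carrier env_chi_coset val_scale)
qed

lemma env_chi_mult:
 assumes "X \<in> carrier R" "Y \<in> carrier R"
 shows "env_chi (X \<otimes>\<^bsub>R\<^esub> Y) = (\<lambda>r. \<Sum>p\<in>B \<times> B. \<Sum>q\<in>B \<times> B. env_chi X p * env_chi Y q * env_\<mu> p q r)"
proof -
 from assms(1) obtain f where "f \<in> carrier F" "X = K +>\<^bsub>F\<^esub> f" by (rule env_cases)
 moreover from assms(2) obtain g where "g \<in> carrier F" "Y = K +>\<^bsub>F\<^esub> g" by (rule env_cases)
 ultimately show ?thesis by (simp add: env_mult env_chi_coset tensor_mult_expand fun_eq_iff)
qed

lemma tens_mult:
 assumes "a \<in> carrier A" "b \<in> carrier A" "a' \<in> carrier A" "b' \<in> carrier A"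
 shows "tens a b \<otimes>\<^bsub>R\<^esub> tens a' b' = tens (a' \<otimes>\<^bsub>A\<^esub> a) (b \<otimes>\<^bsub>A\<^esub> b')"
proof -
 have "tensor_mult (opposite A) A (ind (a, b)) (ind (a', b')) = ind (a' \<otimes>\<^bsub>A\<^esub> a, b \<otimes>\<^bsub>A\<^esub> b')"
 proof -
  have "{x. ind y x \<noteq> (0 :: complex)} = {y}" for y :: "'a \<times> 'a" by (auto simp: ind_def)
  then show ?thesis by (simp add: tensor_mult_def) (simp add: ind_def)
 qed
 then show ?thesis using assms by (simp add: tens_def env_mult F_ind)
qed

lemma env_coord_algebra_homogeneous:
 "coord_algebra R (B \<times> B) env_chi env_\<mu> env_dg (R.homogeneous env_dg)"
proof
 show "env_dg r = env_dg p + env_dg q" if "p \<in> B \<times> B" "q \<in> B \<times> B" "env_\<mu> p q r \<noteq> 0" for p q r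
 proof -
  have "dg (fst r) = dg (fst q) + dg (fst p)" "dg (snd r) = dg (snd p) + dg (snd q)"
   using that \<mu>_graded by (auto simp: env_\<mu>_def)
  then show ?thesis by (simp add: env_dg_def)
 qed
qed (simp_all add: env_chi_smult env_chi_mult)

sublocale RC: coord_algebra R "B \<times> B" env_chi env_\<mu> env_dg "R.homogeneous env_dg"
 by (rule env_coord_algebra_homogeneous)

lemma env_basis: "p \<in> B \<times> B ==> RC.basis p = tens (basis (fst p)) (basis (snd p))"
 by (rule R.chi_eqI)
  (auto intro!: RC.basis tens_closed basis simp: RC.basis env_chi_tens basis prod_eq_iff)

lemma smult_tens: "a \<in> carrier A ==> b \<in> carrier A ==> c \<odot>\<^bsub>R\<^esub> tens a b = tens (c \<odot>\<^bsub>A\<^esub> a) b"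
 by (rule R.chi_eqI)
  (auto intro!: env_chi_smult tens_closed smult_closed simp: env_chi_smult tens_closed env_chi_tens smult_closed chi_smult)

lemma env_induct [consumes 1, case_names tens add]:
 assumes X: "X \<in> carrier R" and t: "\<And>a b. a \<in> carrier A ==> b \<in> carrier A ==> P (tens a b)"
  and a: "\<And>X Y. X \<in> carrier R ==> Y \<in> carrier R ==> P X ==> P Y ==> P (X \<oplus>\<^bsub>R\<^esub> Y)"
 shows "P X"
 using X
proof (induction rule: RC.algebra_induct)
 case (basis c p)
 then show ?case by (auto simp: env_basis smult_tens coord_algebra.basis[OF coord_algebra_axioms] intro!: t smult_closed)
next
 case zero
 have "\<zero>\<^bsub>R\<^esub> = tens \<zero>\<^bsub>A\<^esub> \<zero>\<^bsub>A\<^esub>"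
  by (rule R.chi_eqI) (auto intro: tens_closed simp: env_chi_tens)
 then show ?case using t by simp
next
 case (add X Y)
 then show ?case by (rule a)
qed

text \<open>The grading is defined as a span of pure tensors. Expanding a homogeneous element in the
  basis uses only pure tensors of basis elements of the same total degree, which turns the span into
  a condition on coordinates.\<close>

lemma env_grading: "enveloping_grading A GA = R.homogeneous env_dg"
proof (rule ext, rule equalityI)
 fix n
 let ?S = "{tens a b | a b i j. a \<in> GA i \<and> b \<in> GA j \<and> i + j = n}"
 have eq: "enveloping_grading A GA n = mod_span complex_alg R ?S"
  by (simp add: enveloping_grading_def tensor_grading_def tens_def enveloping_algebra_def[symmetric])
 have S: "?S \<subseteq> R.homogeneous env_dg n"
 proof
  fix X assume "X \<in> ?S"
  then obtain a b i j where X: "X = tens a b" "a \<in> GA i" "b \<in> GA j" "i + j = n" by blast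
  then have ab: "a \<in> carrier A" "b \<in> carrier A" by (auto simp: GA homogeneous_def)
  with X show "X \<in> R.homogeneous env_dg n"
   by (auto simp: R.homogeneous_def tens_closed env_chi_tens env_dg_def GA homogeneous_def)
 qed
 have "submodule (R.homogeneous env_dg n) complex_alg R"
  by (rule submodule.intro[OF R.homogeneous_subgroup])
   (auto simp: submodule_axioms_def R.homogeneous_def env_chi_smult)
 from mod_span_least[OF this S] show "enveloping_grading A GA n \<subseteq> R.homogeneous env_dg n"
  by (simp add: eq)
 show "R.homogeneous env_dg n \<subseteq> enveloping_grading A GA n"
 proof
  fix X assume X: "X \<in> R.homogeneous env_dg n"
  interpret M: Module.module complex_alg R by (rule RC.module)
  have sub: "submodule (mod_span complex_alg R ?S) complex_alg R"
   by (rule mod_span_submodule[OF RC.module]) (rule order_trans[OF S], auto simp: R.homogeneous_def)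
  note N = M.submoduleE[OF sub]
  have trm: "env_chi X p \<odot>\<^bsub>R\<^esub> RC.basis p \<in> mod_span complex_alg R ?S" if p: "p \<in> B \<times> B" for p
  proof (cases "env_chi X p = 0")
   case True
   have "env_chi X p \<odot>\<^bsub>R\<^esub> RC.basis p = \<zero>\<^bsub>R\<^esub>"
    by (rule R.chi_eqI) (auto intro!: env_chi_smult RC.basis p simp: env_chi_smult RC.basis p True)
   then show ?thesis using subgroup.one_closed[OF submodule.axioms(1)[OF sub]] by simp
  next
   case False
   then have "dg (fst p) + dg (snd p) = n" using X by (auto simp: R.homogeneous_def env_dg_def)
   then have "RC.basis p \<in> ?S"
    using p unfolding env_basis[OF p]
    by (intro CollectI exI[of _ "basis (fst p)"] exI[of _ "basis (snd p)"] exI[of _ "dg (fst p)"] exI[of _ "dg (snd p)"])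
     (auto simp: GA homogeneous_def basis split: if_splits)
   then show ?thesis using N(4) mod_span_superset by (metis (no_types, lifting) UNIV_I complex_alg_simps(1) subsetD)
  qed
  have "(\<Oplus>\<^bsub>R\<^esub>p\<in>J. env_chi X p \<odot>\<^bsub>R\<^esub> RC.basis p) \<in> mod_span complex_alg R ?S" if "J \<subseteq> B \<times> B" for J
   using finite_subset[OF that R.finite_B] that
  proof (induction J rule: finite_induct)
   case empty
   then show ?case using subgroup.one_closed[OF submodule.axioms(1)[OF sub]] by simp
  next
   case (insert p J)
   have "(\<Oplus>\<^bsub>R\<^esub>p\<in>insert p J. env_chi X p \<odot>\<^bsub>R\<^esub> RC.basis p) =
    env_chi X p \<odot>\<^bsub>R\<^esub> RC.basis p \<oplus>\<^bsub>R\<^esub> (\<Oplus>\<^bsub>R\<^esub>p\<in>J. env_chi X p \<odot>\<^bsub>R\<^esub> RC.basis p)"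
    by (rule R.finsum_insert) (use insert in \<open>auto intro!: env_chi_smult RC.basis\<close>)
   then show ?case using insert trm N(5) by auto
  qed
  from this[of "B \<times> B"] show "X \<in> enveloping_grading A GA n"
   using RC.basis_expand[of X] X by (simp add: eq R.homogeneous_def)
 qed
qed

section \<open>The algebra as a module over its enveloping algebra\<close>

abbreviation "M \<equiv> regular_bimodule A"

lemma bimodule_simps [simp]:
 "carrier M = carrier A" "add M = add A" "zero M = zero A"
 by (simp_all add: regular_bimodule_def)

definition act_\<mu> :: "'i \<times> 'i => 'i => 'i => complex" where
 "act_\<mu> p n k = (\<Sum>l\<in>B. \<mu> (snd p) n l * \<mu> l (fst p) k)"

lemma chi_sandwich:
 assumes "a \<in> carrier A" "b \<in> carrier A" "m \<in> carrier A"
 shows "chi (b \<otimes>\<^bsub>A\<^esub> m \<otimes>\<^bsub>A\<^esub> a) k =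
  (\<Sum>p\<in>B \<times> B. \<Sum>n\<in>B. chi a (fst p) * chi b (snd p) * chi m n * act_\<mu> p n k)"
proof -
 have "chi (b \<otimes>\<^bsub>A\<^esub> m \<otimes>\<^bsub>A\<^esub> a) k =
   (\<Sum>l\<in>B. \<Sum>j\<in>B. (\<Sum>i\<in>B. \<Sum>n\<in>B. chi b i * chi m n * \<mu> i n l) * chi a j * \<mu> l j k)"
  using assms by (simp add: chi_mult)
 also have "... = (\<Sum>l\<in>B. \<Sum>j\<in>B. \<Sum>i\<in>B. \<Sum>n\<in>B. chi a j * chi b i * chi m n * (\<mu> i n l * \<mu> l j k))"
  by (simp add: sum_distrib_left sum_distrib_right algebra_simps)
 also have "... = (\<Sum>j\<in>B. \<Sum>i\<in>B. \<Sum>n\<in>B. \<Sum>l\<in>B. chi a j * chi b i * chi m n * (\<mu> i n l * \<mu> l j k))"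
  by (rule sum_rotate)
 also have "... = (\<Sum>j\<in>B. \<Sum>i\<in>B. \<Sum>n\<in>B. chi a j * chi b i * chi m n * act_\<mu> (j, i) n k)"
  by (simp add: act_\<mu>_def sum_distrib_left)
 also have "... = (\<Sum>p\<in>B \<times> B. \<Sum>n\<in>B. chi a (fst p) * chi b (snd p) * chi m n * act_\<mu> p n k)"
  by (simp add: sum.cartesian_product')
 finally show ?thesis .
qed

lemma act:
 assumes X: "X \<in> carrier R" and m: "m \<in> carrier A"
 shows "X \<odot>\<^bsub>M\<^esub> m \<in> carrier A"
  and "chi (X \<odot>\<^bsub>M\<^esub> m) k = (\<Sum>p\<in>B \<times> B. \<Sum>n\<in>B. env_chi X p * chi m n * act_\<mu> p n k)"
proof -
 define g where "g = (SOME g. g \<in> X)"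
 from X obtain f where f: "f \<in> carrier F" "X = K +>\<^bsub>F\<^esub> f" by (rule env_cases)
 have "g \<in> X" unfolding g_def f(2) by (rule someI[of _ f]) (rule coset_self)
 then have "(\<lambda>z. g z - f z) \<in> K" by (simp add: f(2) coset_iff)
 from F_comb[OF f(1) K_closed[OF this], of 1] have g: "g \<in> carrier F" by simp
 let ?S = "{z. g z \<noteq> 0}"
 have S: "finite ?S" using g by (simp add: F_carrier)
 have c: "fst z \<in> carrier A" "snd z \<in> carrier A" if "z \<in> ?S" for z
  using that g unfolding F_carrier by (cases z; auto)+
 have eq: "X \<odot>\<^bsub>M\<^esub> m = (\<Oplus>\<^bsub>A\<^esub>z\<in>?S. g z \<odot>\<^bsub>A\<^esub> (snd z \<otimes>\<^bsub>A\<^esub> m \<otimes>\<^bsub>A\<^esub> fst z))"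
  by (simp add: regular_bimodule_def g_def Let_def)
 have t: "g z \<odot>\<^bsub>A\<^esub> (snd z \<otimes>\<^bsub>A\<^esub> m \<otimes>\<^bsub>A\<^esub> fst z) \<in> carrier A" if "z \<in> ?S" for z
  using c[OF that] m by (auto intro: smult_closed)
 show "X \<odot>\<^bsub>M\<^esub> m \<in> carrier A" unfolding eq by (rule finsum_closed) (use t in auto)
 have "chi (X \<odot>\<^bsub>M\<^esub> m) k = (\<Sum>z\<in>?S. g z * chi (snd z \<otimes>\<^bsub>A\<^esub> m \<otimes>\<^bsub>A\<^esub> fst z) k)"
  unfolding eq using c m by (subst chi_finsum[OF S t]) (auto simp: chi_smult)
 also have "... = (\<Sum>z\<in>?S. \<Sum>p\<in>B \<times> B. \<Sum>n\<in>B. g z * chi (fst z) (fst p) * chi (snd z) (snd p) * chi m n * act_\<mu> p n k)"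
  by (intro sum.cong refl) (simp add: chi_sandwich c m sum_distrib_left algebra_simps)
 also have "... = (\<Sum>p\<in>B \<times> B. \<Sum>n\<in>B. \<Sum>z\<in>?S. g z * chi (fst z) (fst p) * chi (snd z) (snd p) * chi m n * act_\<mu> p n k)"
  by (subst sum.swap, intro sum.cong refl, rule sum.swap)
 also have "... = (\<Sum>p\<in>B \<times> B. \<Sum>n\<in>B. env_chi X p * chi m n * act_\<mu> p n k)"
  by (simp add: env_chi_def g_def[symmetric] val_def sum_distrib_right)
 finally show "chi (X \<odot>\<^bsub>M\<^esub> m) k = (\<Sum>p\<in>B \<times> B. \<Sum>n\<in>B. env_chi X p * chi m n * act_\<mu> p n k)" .
qed

lemma act_tens:
 assumes "a \<in> carrier A" "b \<in> carrier A" "m \<in> carrier A"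
 shows "tens a b \<odot>\<^bsub>M\<^esub> m = b \<otimes>\<^bsub>A\<^esub> m \<otimes>\<^bsub>A\<^esub> a"
 by (rule chi_eqI) (use assms act tens_closed in \<open>auto simp: act tens_closed env_chi_tens chi_sandwich\<close>)

lemma act_add_left:
 "X \<in> carrier R ==> Y \<in> carrier R ==> m \<in> carrier A ==>
  (X \<oplus>\<^bsub>R\<^esub> Y) \<odot>\<^bsub>M\<^esub> m = X \<odot>\<^bsub>M\<^esub> m \<oplus>\<^bsub>A\<^esub> Y \<odot>\<^bsub>M\<^esub> m"
 by (rule chi_eqI) (auto intro!: act a_closed R.a_closed simp: act chi_add R.chi_add sum.distrib algebra_simps)

lemma act_add_right:
 "X \<in> carrier R ==> m \<in> carrier A ==> n \<in> carrier A ==>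
  X \<odot>\<^bsub>M\<^esub> (m \<oplus>\<^bsub>A\<^esub> n) = X \<odot>\<^bsub>M\<^esub> m \<oplus>\<^bsub>A\<^esub> X \<odot>\<^bsub>M\<^esub> n"
 by (rule chi_eqI) (auto intro!: act a_closed simp: act chi_add sum.distrib algebra_simps)

text \<open>Compatibility with products needs checking only for pure tensors in both arguments,
  where it is associativity of the algebra; \<open>act_add_left\<close> and
  \<open>act_add_right\<close> extend it to sums.\<close>

lemma bimodule_left_module: "left_module R M"
proof -
 have ab: "abelian_group M"
  by (rule abelian_groupI) (auto intro: a_assoc a_comm l_neg bexI[of _ "\<ominus>\<^bsub>A\<^esub> _"])
 have assoc: "(X \<otimes>\<^bsub>R\<^esub> Y) \<odot>\<^bsub>M\<^esub> m = X \<odot>\<^bsub>M\<^esub> (Y \<odot>\<^bsub>M\<^esub> m)"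
  if X: "X \<in> carrier R" and Y: "Y \<in> carrier R" and m: "m \<in> carrier A" for X Y m
  using X
 proof (induction rule: env_induct)
  case (tens a b)
  show ?case using Y
  proof (induction rule: env_induct)
   case (tens a' b')
   with \<open>a \<in> carrier A\<close> \<open>b \<in> carrier A\<close> m show ?case
    by (simp add: tens_mult act_tens m_assoc)
  next
   case (add Y Z)
   with tens_closed[OF tens] m show ?case by (simp add: R.r_distr act_add_left act_add_right act)
  qed
 next
  case (add X Z)
  with Y m show ?case by (simp add: R.l_distr act_add_left act)
 qed
 have one: "\<one>\<^bsub>R\<^esub> \<odot>\<^bsub>M\<^esub> m = m" if "m \<in> carrier A" for m
  using that by (simp add: env_simps act_tens)
 show ?thesis
  by (intro left_module.intro ab env_ring left_module_axioms.intro)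
   (simp_all add: act act_add_left act_add_right assoc one)
qed

sublocale M: left_module R M by (rule bimodule_left_module)

sublocale M: coord_group M B chi
 by unfold_locales (use finite_B chi_bij chi_add in auto)

lemma M_homogeneous: "M.homogeneous dg = GA"
 by (simp add: M.homogeneous_def GA homogeneous_def fun_eq_iff)

lemma bimodule_graded: "graded_module R (enveloping_grading A GA) M GA"
 unfolding graded_module_def
proof (intro conjI allI ballI bimodule_left_module)
 show "subgroup (GA j) (add_monoid M)" for j
  using M.homogeneous_subgroup[of dg j] by (simp only: M_homogeneous)
 show "\<exists>!c. (\<forall>j. c j \<in> GA j) \<and> finite {j. c j \<noteq> \<zero>\<^bsub>M\<^esub>} \<and> x = (\<Oplus>\<^bsub>M\<^esub>j\<in>{j. c j \<noteq> \<zero>\<^bsub>M\<^esub>}. c j)"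
  if "x \<in> carrier M" for x
  using M.homogeneous_decomposition[OF that, of dg] by (simp only: M_homogeneous)
 fix i j X m assume X: "X \<in> enveloping_grading A GA i" and m: "m \<in> GA j"
 have X': "X \<in> R.homogeneous env_dg i" using X by (simp only: env_grading)
 have c: "X \<in> carrier R" "m \<in> carrier A" using X' m by (auto simp: R.homogeneous_def GA homogeneous_def)
 have "dg k = i + j" if nz: "chi (X \<odot>\<^bsub>M\<^esub> m) k \<noteq> 0" for k
 proof -
  obtain p where "(\<Sum>n\<in>B. env_chi X p * chi m n * act_\<mu> p n k) \<noteq> 0"
   using nz unfolding act(2)[OF c] by (meson sum.neutral)
  then obtain n where n: "env_chi X p * chi m n * act_\<mu> p n k \<noteq> 0" by (meson sum.neutral)
  then have in_B: "fst p \<in> B" "snd p \<in> B" "n \<in> B"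
   using R.chi_outside[OF c(1), of p] chi_outside[OF c(2), of n] by (auto simp: mem_Times_iff)
  have "act_\<mu> p n k \<noteq> 0" using n by auto
  then obtain l where "l \<in> B" "\<mu> (snd p) n l * \<mu> l (fst p) k \<noteq> 0" unfolding act_\<mu>_def by (meson sum.neutral)
  then have "dg l = dg (snd p) + dg n" "dg k = dg l + dg (fst p)" using \<mu>_graded in_B by auto
  moreover have "env_dg p = i" using X' n by (cases p) (auto simp: R.homogeneous_def)
  moreover have "dg n = j" using m n by (auto simp: GA homogeneous_def)
  ultimately show ?thesis by (simp add: env_dg_def)
 qed
 then show "X \<odot>\<^bsub>M\<^esub> m \<in> GA (i + j)" using act(1)[OF c] by (simp add: GA homogeneous_def)
qed

lemma env_spanned: "spanned_by_degrees R (enveloping_grading A GA)"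
 unfolding spanned_by_degrees_def env_grading
proof (intro conjI allI impI)
 show "R.homogeneous env_dg i \<subseteq> carrier R" for i by (auto simp: R.homogeneous_def)
 fix T assume T: "\<forall>i. R.homogeneous env_dg i \<subseteq> T"
  "\<forall>a\<in>T \<inter> carrier R. \<forall>b\<in>T \<inter> carrier R. a \<oplus>\<^bsub>R\<^esub> b \<in> T"
 show "carrier R \<subseteq> T"
 proof
  fix X assume "X \<in> carrier R"
  then show "X \<in> T"
  proof (induction rule: RC.algebra_induct)
   case (basis c p)
   then have "c \<odot>\<^bsub>R\<^esub> RC.basis p \<in> R.homogeneous env_dg (env_dg p)"
    using RC.basis env_chi_smult by (auto simp: R.homogeneous_def split: if_splits)
   with T(1) show ?case by blast
  next
   case zero
   have "\<zero>\<^bsub>R\<^esub> \<in> R.homogeneous env_dg 0" by (simp add: R.homogeneous_def)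
   with T(1) show ?case by blast
  next
   case (add X Y)
   with T(2) show ?case by blast
  qed
 qed
qed

end

section \<open>Structure constants and integer matrices\<close>

text \<open>Integer combinations as lists, with repeated indices allowed: products and differentials
  then need no collecting of terms, and identities between them can be decided by
  evaluation.\<close>

type_synonym 'i comb = "(int \<times> 'i) list"

definition coeff :: "'i comb => 'i => int" where
 "coeff xs i = sum_list (map (\<lambda>(c, j). if j = i then c else 0) xs)"

definition lin :: "('i => 'j comb) => 'i comb => 'j comb" where
 "lin f xs = concat (map (\<lambda>(c, i). map (\<lambda>(e, j). (c * e, j)) (f i)) xs)"

text \<open>Tests only the indices that occur in the list, so it is executable over an infinite
  index type; \<open>vanishes_coeff\<close> recovers the statement for all indices.\<close>

definition vanishes :: "'i comb => bool" where
 "vanishes xs \<longleftrightarrow> list_all (\<lambda>(_, i). coeff xs i = 0) xs"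

definition lookup :: "('i \<times> 'j comb) list => 'i => 'j comb" where
 "lookup t i = (case map_of t i of None => [] | Some x => x)"

lemma coeff_Nil [simp]: "coeff [] i = 0"
 and coeff_Cons: "coeff ((c, j) # xs) i = (if j = i then c else 0) + coeff xs i"
 and coeff_append [simp]: "coeff (xs @ ys) i = coeff xs i + coeff ys i"
 by (simp_all add: coeff_def)

lemma coeff_outside: "i \<notin> snd ` set xs ==> coeff xs i = 0"
 by (induction xs) (auto simp: coeff_Cons)

lemma vanishes_coeff: "vanishes xs ==> coeff xs i = 0"
 using coeff_outside[of i xs] by (cases "i \<in> snd ` set xs") (auto simp: vanishes_def list_all_iff)

lemma coeff_scale: "coeff (map (\<lambda>(e, j). (c * e, j)) xs) i = c * coeff xs i"
 by (induction xs) (auto simp: coeff_Cons algebra_simps)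

lemma lin_Nil [simp]: "lin f [] = []"
 and lin_Cons: "lin f ((c, i) # xs) = map (\<lambda>(e, j). (c * e, j)) (f i) @ lin f xs"
 by (simp_all add: lin_def)

lemma lin_append [simp]: "lin f (xs @ ys) = lin f xs @ lin f ys"
 by (simp add: lin_def)

lemma coeff_lin:
 assumes "finite I" "snd ` set xs \<subseteq> I"
 shows "coeff (lin f xs) j = (\<Sum>i\<in>I. coeff xs i * coeff (f i) j)"
 using assms(2)
proof (induction xs)
 case (Cons x xs)
 obtain c k where x: "x = (c, k)" by (cases x)
 with Cons.prems have k: "k \<in> I" by auto
 have "(\<Sum>i\<in>I. coeff (x # xs) i * coeff (f i) j) =
   (\<Sum>i\<in>I. if i = k then c * coeff (f k) j else 0) + (\<Sum>i\<in>I. coeff xs i * coeff (f i) j)"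
  unfolding sum.distrib[symmetric] by (rule sum.cong) (auto simp: x coeff_Cons algebra_simps)
 then show ?case using Cons k assms(1) by (simp add: x lin_Cons coeff_scale)
qed simp

lemma lin_set: "(c, j) \<in> set (lin f xs) ==> \<exists>e i e'. (e, i) \<in> set xs \<and> (e', j) \<in> set (f i)"
 by (fastforce simp: lin_def)

text \<open>The matrix with integer columns \<open>f i\<close>, for \<open>i\<close> in the finite set \<open>I\<close>, applied to a vector.\<close>

definition apply_cols :: "'i set => ('i => 'j comb) => ('i => complex) => 'j => complex" where
 "apply_cols I f y j = (\<Sum>i\<in>I. y i * of_int (coeff (f i) j))"

text \<open>The bridge from evaluation to linear algebra: a composite of two integer matrices,
  formed on lists by \<open>lin\<close>, acts on complex vectors as the composite of the maps. The
  support condition says that no intermediate index is lost by summing over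
  \<open>J\<close>.\<close>

lemma apply_cols_comp:
 assumes "finite I" "finite J" "\<And>i. i \<in> I ==> snd ` set (f i) \<subseteq> J"
 shows "apply_cols J g (apply_cols I f y) k = apply_cols I (\<lambda>i. lin g (f i)) y k"
proof -
 have "apply_cols J g (apply_cols I f y) k = (\<Sum>j\<in>J. \<Sum>i\<in>I. y i * (of_int (coeff (f i) j) * of_int (coeff (g j) k)))"
  by (simp add: apply_cols_def sum_distrib_right mult.assoc)
 also have "... = (\<Sum>i\<in>I. y i * of_int (\<Sum>j\<in>J. coeff (f i) j * coeff (g j) k))"
  by (subst sum.swap) (simp add: sum_distrib_left)
 also have "... = apply_cols I (\<lambda>i. lin g (f i)) y k"
  unfolding apply_cols_def by (rule sum.cong) (use assms in \<open>auto simp: coeff_lin[of J]\<close>)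
 finally show ?thesis .
qed

lemma apply_cols_append:
 "apply_cols I (\<lambda>i. f i @ g i) y j = apply_cols I f y j + apply_cols I g y j"
 by (simp add: apply_cols_def sum.distrib algebra_simps)

lemma apply_cols_diag:
 "finite I ==> apply_cols I (\<lambda>i. [(c, i)]) y j = (if j \<in> I then of_int c * y j else 0)"
proof -
 assume I: "finite I"
 have "apply_cols I (\<lambda>i. [(c, i)]) y j = (\<Sum>i\<in>I. if i = j then of_int c * y j else 0)"
  unfolding apply_cols_def by (rule sum.cong) (auto simp: coeff_Cons)
 then show ?thesis using I by simp
qed

lemma apply_cols_vanishes: "(\<And>i. i \<in> I ==> vanishes (f i)) ==> apply_cols I f y j = 0"
 by (simp add: apply_cols_def vanishes_coeff)

lemma apply_cols_add: "apply_cols I f (\<lambda>i. y i + z i) j = apply_cols I f y j + apply_cols I f z j"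
 and apply_cols_diff: "apply_cols I f (\<lambda>i. y i - z i) j = apply_cols I f y j - apply_cols I f z j"
 and apply_cols_scale: "apply_cols I f (\<lambda>i. c * y i) j = c * apply_cols I f y j"
 by (simp_all add: apply_cols_def sum.distrib sum_subtractf sum_distrib_left algebra_simps)

lemma apply_cols_zero: "(\<And>i. i \<in> I ==> y i = 0) ==> apply_cols I f y j = 0"
 by (simp add: apply_cols_def)

lemma apply_cols_outside: "(\<And>i. i \<in> I ==> j \<notin> snd ` set (f i)) ==> apply_cols I f y j = 0"
 by (simp add: apply_cols_def coeff_outside)

text \<open>The vertices are numbered \<open>0, \<dots>, 3\<close> and the arcs \<open>y, a, p, u, x, q, b, v\<close> of the header
 \<open>0, \<dots>, 7\<close>. The basis consists of the paths \<open>words i\<close> for \<open>i < 48\<close>, vertices first and arcs next, and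
 \<open>rmul_row i\<close> lists the products of the \<open>i\<close>-th one with the arcs. The later tables were found by rational
 linear algebra, the integers 2 and 8 clearing denominators; only the identities checked below are used.
 Index 4 of \<open>proj\<close> and \<open>cycles\<close> stands for the positive multiples of 4, where, unlike in degree 0, there are
 coboundaries.\<close>

definition arc_src :: "nat => nat" where
 "arc_src g =
  [0, 1, 1, 1, 2, 2, 2, 3] ! g"

definition arc_tgt :: "nat => nat" where
 "arc_tgt g =
  [1, 1, 2, 3, 0, 1, 2, 2] ! g"

definition words :: "nat => nat list" where
 "words i =
  (if i < 8 then [[], [], [], [], [0], [1], [2], [3]] ! i else if i < 16 then [[4], [5], [6], [7], [0,
  1], [0, 3], [1, 1], [1, 2]] ! (i - 8) else if i < 24 then [[1, 3], [2, 6], [5, 1], [6, 4], [6, 5],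
  [6, 6], [7, 4], [7, 6]] ! (i - 16) else if i < 32 then [[0, 1, 2], [0, 1, 3], [1, 1, 1], [1, 1, 2],
  [1, 2, 6], [2, 6, 4], [5, 1, 3], [6, 5, 1]] ! (i - 24) else if i < 40 then [[6, 6, 5], [6, 6, 6],
  [7, 6, 4], [7, 6, 5], [0, 1, 2, 6], [1, 1, 1, 1], [1, 1, 1, 2], [1, 2, 6, 4]] ! (i - 32) else [[6,
  5, 1, 3], [6, 6, 6, 5], [6, 6, 6, 6], [7, 6, 5, 1], [0, 1, 2, 6, 4], [1, 1, 1, 1, 1], [6, 6, 6, 6,
  6], [7, 6, 5, 1, 3]] ! (i - 40))"

abbreviation "wlen i \<equiv> length (words i)"

definition rmul_row :: "nat => (nat \<times> nat comb) list" where
 "rmul_row i =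
  (if i < 6 then [[(0, [(1, 4)])], [(1, [(1, 5)]), (2, [(1, 6)]), (3, [(1, 7)])], [(4, [(1, 8)]), (5,
  [(1, 9)]), (6, [(1, 10)])], [(7, [(1, 11)])], [(1, [(1, 12)]), (3, [(1, 13)])], [(1, [(1, 14)]), (2,
  [(1, 15)]), (3, [(1, 16)])]] ! i else if i < 12 then [[(5, [(1, 14)]), (6, [(1, 17)])], [(7, [(-1,
  15), (-1, 17)])], [(0, [(-1, 18), (-1, 20)])], [(1, [(1, 18)]), (2, [(-1, 21)])], [(4, [(1, 19)]),
  (5, [(1, 20)]), (6, [(1, 21)])], [(4, [(1, 22)]), (6, [(1, 23)])]] ! (i - 6) else if i < 18 then
  [[(2, [(1, 24)]), (3, [(1, 25)])], [(7, [(-1, 24)])], [(1, [(1, 26)]), (2, [(1, 27)])], [(5, [(1,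
  26)]), (6, [(1, 28)])], [(7, [(-1, 27), (-1, 28)])], [(4, [(1, 29)]), (5, [(-1, 26)]), (6, [(-1,
  27)])]] ! (i - 12) else if i < 24 then [[(1, [(-1, 32)]), (2, [(1, 33)]), (3, [(1, 30)])], [(0,
  [(-1, 31), (-1, 32)])], [(1, [(1, 31)]), (2, [(-1, 33)])], [(5, [(1, 32)]), (6, [(1, 33)])], [(0,
  [(-1, 35)])], [(4, [(1, 34)]), (5, [(1, 35)])]] ! (i - 18) else if i < 30 then [[(6, [(1, 36)])],
  [(7, [(-1, 36)])], [(1, [(1, 37)]), (2, [(1, 38)])], [(5, [(1, 37)]), (6, [(-1, 38)])], [(4, [(1,
  39)]), (5, [(-1, 37)]), (6, [(-1, 38)])], [(0, [(2, 37)])]] ! (i - 24) else if i < 36 then [[(7,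
  [(-2, 42)])], [(1, [(-1, 41)]), (2, [(1, 42)]), (3, [(1, 40)])], [(1, [(-1, 41)]), (2, [(-1, 42)])],
  [(5, [(1, 41)]), (6, [(1, 42)])], [(0, [(-1, 43)])], [(1, [(1, 43)])]] ! (i - 30) else if i < 42
  then [[(4, [(1, 44)])], [(1, [(1, 45)])], [(5, [(1, 45)])], [(0, [(2, 45)])], [(7, [(-2, 46)])],
  [(2, [(-1, 46)])]] ! (i - 36) else [[(6, [(1, 46)])], [(3, [(1, 47)])], [], [], [], []] ! (i - 42))"

text \<open>Entry \<open>g\<close> is the cyclic derivative by the arc \<open>g\<close> of the
  potential xyp + quv + apq + pbq - aaa/3 + bbb/3, a combination of paths from the target of
  \<open>g\<close> to its source.\<close>

definition rels :: "nat => (int \<times> nat \<times> nat) list" where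
 "rels g =
  [[(1, 2, 4)], [(-1, 1, 1), (1, 2, 5)], [(1, 5, 1), (1, 6, 5), (1, 4, 0)], [(1, 7, 5)], [(1, 0, 2)],
  [(1, 1, 2), (1, 2, 6), (1, 3, 7)], [(1, 6, 6), (1, 5, 2)], [(1, 5, 3)]] ! g"

text \<open>For each vertex, the part of the Casimir element that starts and ends there: a sum of
  tensors of basis paths of total length 5. That it commutes with the arcs and is a cycle, as
  required for closing the period, is among the identities evaluated below.\<close>

definition casimir :: "nat => (nat \<times> nat) comb" where
 "casimir i =
  (if i = 0 then [(-1, (25, 22)), (-1, (13, 34)), (1, (24, 19)), (1, (12, 29)), (1, (4, 39)), (1, (0,
  44)), (1, (36, 8)), (1, (44, 0))] else if i = 1 then [(1, (16, 35)), (2, (38, 9)), (1, (27, 18)),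
  (-1, (15, 32)), (2, (6, 41)), (2, (14, 26)), (2, (5, 37)), (2, (1, 45)), (2, (26, 14)), (2, (37,
  5)), (1, (29, 12)), (2, (45, 1)), (1, (39, 4)), (-1, (28, 20)), (-1, (27, 20)), (-1, (28, 18)), (1,
  (17, 32)), (-1, (17, 31)), (-1, (15, 31)), (1, (7, 43))] else if i = 2 then [(1, (40, 11)), (1, (30,
  23)), (-2, (42, 10)), (-2, (33, 21)), (-2, (21, 33)), (-2, (10, 42)), (-2, (2, 46)), (2, (9, 38)),
  (1, (18, 27)), (-1, (31, 17)), (-2, (46, 2)), (2, (41, 6)), (-1, (32, 15)), (-1, (31, 15)), (1, (32,
  17)), (-1, (20, 27)), (-1, (20, 28)), (-1, (18, 28)), (1, (19, 24)), (1, (8, 36))] else [(1, (47,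
  3)), (1, (3, 47)), (1, (11, 40)), (1, (23, 30)), (1, (35, 16)), (-1, (22, 25)), (1, (43, 7)), (-1,
  (34, 13))])"

text \<open>Twice a linear contraction of the periodic complex of left factors. In degree 0 it
  removes the last arc of a basis path and records it as a generator. In degree 3 it inverts the
  coefficients 1, 2, -2, 1 with which the Casimir element contains the four longest paths tensored
  with a vertex on the right.\<close>

definition homotopy :: "nat => nat => (nat \<times> (nat \<times> nat) comb) list" where
 "homotopy n g =
  (if n = 0 then (if g = 0 then [(8, [(2, (4, 2))]), (19, [(2, (4, 10))]), (22, [(2, (4, 11))]), (29,
  [(2, (4, 17))]), (34, [(2, (4, 23))]), (39, [(2, (4, 28))]), (44, [(2, (4, 36))])] else if g = 1
  then [(4, [(2, (0, 0))]), (5, [(2, (1, 1))]), (9, [(2, (5, 2))]), (12, [(2, (1, 4))]), (14, [(2, (1,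
  5))]), (18, [(2, (1, 9))]), (20, [(2, (5, 10))]), (26, [(2, (1, 14))]), (31, [(2, (1, 20))]), (32,
  [(2, (5, 21))]), (35, [(2, (5, 23))]), (37, [(2, (1, 26))]), (41, [(2, (5, 33))]), (43, [(2, (1,
  35))]), (45, [(2, (1, 37))])] else if g = 2 then [(6, [(2, (2, 1))]), (10, [(2, (6, 2))]), (11, [(2,
  (7, 3))]), (15, [(2, (2, 5))]), (17, [(2, (6, 6))]), (21, [(2, (6, 10))]), (23, [(2, (6, 11))]),
  (24, [(2, (2, 12))]), (27, [(2, (2, 14))]), (28, [(2, (6, 15))]), (33, [(2, (6, 21))]), (36, [(2,
  (6, 24))]), (38, [(2, (2, 26))]), (42, [(2, (6, 33))]), (46, [(2, (6, 42))])] else [(7, [(2, (3,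
  1))]), (13, [(2, (3, 4))]), (16, [(2, (3, 5))]), (25, [(2, (3, 12))]), (30, [(2, (3, 18))]), (40,
  [(2, (3, 31))]), (47, [(2, (3, 43))])]) else if n = 1 then (if g = 0 then [(8, [(2, (2, 2))]), (19,
  [(2, (2, 10))]), (22, [(2, (2, 11))]), (29, [(2, (1, 14)), (2, (2, 17))]), (34, [(2, (2, 23))]),
  (39, [(2, (1, 26)), (2, (2, 28))]), (44, [(2, (2, 36))])] else if g = 1 then [(12, [(-2, (1, 4))]),
  (18, [(-2, (1, 9))]), (31, [(-2, (1, 20))]), (32, [(2, (1, 18))]), (41, [(1, (1, 31)), (1, (1,
  32))]), (43, [(-2, (1, 35))]), (45, [(-2, (1, 37))])] else if g = 2 then [(4, [(2, (4, 0))]), (9,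
  [(2, (6, 2))]), (18, [(2, (5, 9))]), (20, [(-2, (4, 8)), (-2, (5, 9))]), (31, [(2, (5, 20))]), (32,
  [(-2, (4, 19)), (-2, (5, 20))]), (35, [(-2, (4, 22))]), (37, [(1, (4, 29))]), (41, [(-2, (5, 32))]),
  (43, [(-2, (4, 34))]), (45, [(1, (4, 39))])] else if g = 3 then [(9, [(2, (7, 2))]), (14, [(2, (7,
  6))]), (20, [(2, (7, 10))]), (26, [(2, (7, 15))]), (32, [(2, (7, 21))]), (35, [(2, (7, 23))]), (37,
  [(2, (7, 27))]), (41, [(2, (7, 33))]), (45, [(2, (7, 38))])] else if g = 4 then [(6, [(2, (0, 1))]),
  (15, [(2, (0, 5))]), (21, [(-2, (0, 9))]), (24, [(2, (0, 12))]), (27, [(2, (0, 14))]), (33, [(2, (0,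
  18))]), (38, [(2, (0, 26))]), (42, [(2, (0, 31))]), (46, [(-2, (0, 41))])] else if g = 5 then [(6,
  [(2, (1, 1))]), (11, [(2, (3, 3))]), (15, [(2, (1, 5))]), (17, [(2, (2, 6))]), (24, [(2, (1, 12))]),
  (27, [(2, (1, 14))]), (28, [(2, (2, 15))]), (36, [(2, (2, 24))]), (38, [(2, (1, 26))]), (42, [(1,
  (1, 31)), (-1, (1, 32))]), (46, [(-2, (1, 41))])] else if g = 6 then [(17, [(2, (6, 6))]), (23, [(2,
  (6, 11))]), (27, [(2, (5, 14))]), (28, [(2, (6, 15))]), (36, [(2, (6, 24))]), (38, [(-1, (4, 29)),
  (2, (5, 26))]), (46, [(-2, (5, 41))])] else [(7, [(2, (5, 1))]), (13, [(2, (5, 4))]), (16, [(2, (5,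
  5))]), (25, [(2, (5, 12))]), (30, [(-2, (4, 19)), (2, (5, 18)), (-2, (5, 20))]), (40, [(2, (5, 31)),
  (-2, (5, 32))]), (47, [(2, (5, 43))])]) else if n = 2 then (if g = 0 then [(4, [(2, (0, 0))]), (20,
  [(-2, (0, 8))]), (32, [(-2, (0, 19))]), (35, [(-2, (0, 22))]), (37, [(1, (0, 29))]), (43, [(-2, (0,
  34))]), (45, [(1, (0, 39))])] else if g = 1 then [(43, [(2, (1, 35))]), (45, [(2, (1, 37))])] else
  if g = 2 then [(21, [(-2, (1, 9))]), (27, [(2, (1, 14))]), (33, [(-2, (1, 20))]), (38, [(2, (1,
  26))]), (42, [(-2, (1, 32))]), (46, [(-2, (1, 41))])] else if g = 3 then [(7, [(2, (1, 1))]), (13,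
  [(2, (1, 4))]), (16, [(2, (1, 5))]), (25, [(2, (1, 12))]), (30, [(2, (1, 18)), (2, (1, 20))]), (40,
  [(2, (1, 31)), (2, (1, 32))]), (47, [(2, (1, 43))])] else if g = 4 then [(44, [(2, (2, 36))])] else
  if g = 5 then [(35, [(2, (2, 23))]), (37, [(1, (2, 27)), (-1, (2, 28))]), (45, [(2, (2, 38))])] else
  if g = 6 then [(10, [(2, (2, 2))]), (17, [(2, (2, 6))]), (21, [(2, (2, 10))]), (23, [(2, (2, 11))]),
  (27, [(-2, (2, 17))]), (28, [(2, (2, 15))]), (33, [(2, (2, 21))]), (36, [(2, (2, 24))]), (38, [(-1,
  (2, 27)), (-1, (2, 28))]), (42, [(2, (2, 33))]), (46, [(2, (2, 42))])] else [(11, [(2, (3, 3))]),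
  (17, [(-2, (3, 7))]), (24, [(-2, (3, 13))]), (28, [(-2, (3, 16))]), (36, [(-2, (3, 25))]), (42,
  [(-1, (3, 30))]), (46, [(-1, (3, 40))])]) else (if g = 0 then [(44, [(2, (0, 0))])] else if g = 1
  then [(45, [(1, (1, 1))])] else if g = 2 then [(46, [(-1, (2, 2))])] else [(47, [(2, (3, 3))])]))"

text \<open>Up to a common factor 8, \<open>splitting\<close>, \<open>proj\<close> and
  \<open>cycles\<close> decompose the Hom complex into a contractible part and its cohomology:
  \<open>splitting n\<close> leads from position \<open>n + 1\<close> back to position
  \<open>n\<close>, \<open>cycles\<close> lists representatives of classes, and \<open>proj\<close>
  takes the class.\<close>

definition splitting :: "nat => nat => (nat \<times> (nat \<times> nat) comb) list" where
 "splitting n g =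
  (if n = 0 then (if g = 0 then [] else if g = 1 then [] else if g = 2 then [] else if g = 3 then []
  else if g = 4 then [(8, [(8, (0, 0))])] else if g = 5 then [(9, [(8, (1, 1))]), (18, [(8, (1, 5))]),
  (32, [(-8, (1, 14))]), (41, [(8, (1, 26))])] else if g = 6 then [(10, [(-32, (0, 0)), (-24, (1, 1)),
  (-8, (2, 2))]), (33, [(16, (1, 14))]), (42, [(-16, (1, 26))])] else [(11, [(8, (0, 0)), (8, (1, 1)),
  (8, (2, 2))]), (23, [(8, (2, 10))])]) else if n = 1 then (if g = 0 then [] else if g = 1 then [(26,
  [(-1, (0, 12)), (-3, (1, 14)), (1, (2, 15)), (-1, (2, 17)), (1, (4, 19)), (-1, (6, 21))]), (45,
  [(-4, (1, 37))])] else if g = 2 then [(20, [(-8, (0, 4))]), (32, [(-8, (4, 19))])] else if g = 3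
  then [(35, [(-2, (0, 12)), (-2, (1, 14)), (2, (2, 15)), (-2, (2, 17)), (10, (4, 19)), (8, (5, 20)),
  (2, (6, 21))])] else if g = 4 then [(24, [(8, (0, 12)), (8, (4, 19))]), (36, [(16, (1, 26)), (-8,
  (2, 27)), (8, (2, 28))])] else if g = 5 then [(6, [(8, (1, 1))]), (15, [(8, (1, 5))]), (17, [(-8,
  (1, 5)), (-8, (3, 7))]), (27, [(-2, (0, 12)), (2, (1, 14)), (2, (2, 15)), (-2, (2, 17)), (-6, (4,
  19)), (-2, (6, 21))]), (28, [(-4, (0, 12)), (4, (2, 15)), (4, (2, 17)), (-4, (4, 19))]), (38, [(8,
  (1, 26))])] else if g = 6 then [(10, [(-4, (1, 1)), (4, (6, 2))]), (21, [(-8, (2, 6)), (-8, (3,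
  7))]), (33, [(-1, (0, 12)), (1, (1, 14)), (1, (2, 15)), (-1, (2, 17)), (1, (4, 19)), (3, (6, 21))]),
  (42, [(8, (2, 27))]), (46, [(-4, (1, 37)), (-8, (2, 38))])] else [(30, [(-6, (0, 12)), (2, (1, 14)),
  (6, (2, 15)), (2, (2, 17)), (8, (3, 16)), (-10, (4, 19)), (-2, (6, 21))]), (40, [(-8, (2, 27)), (8,
  (5, 31))])]) else if n = 2 then (if g = 0 then [] else if g = 1 then [(37, [(-4, (0, 29))]), (45,
  [(-4, (0, 39))])] else if g = 2 then [(21, [(8, (2, 9))]), (33, [(-8, (2, 18))]), (42, [(4, (0,
  29)), (-8, (2, 31))]), (46, [(4, (0, 39)), (8, (2, 41))])] else [(47, [(-8, (0, 39)), (-8, (3,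
  43))])]) else (if g = 0 then [] else if g = 1 then [] else if g = 2 then [(46, [(1, (0, 0)), (-1,
  (1, 1))])] else [(47, [(6, (0, 0)), (-2, (1, 1))])]))"

definition proj :: "nat => nat => (nat \<times> nat comb) list" where
 "proj n g =
  (if n = 0 then (if g = 0 then [(44, [(8, 5)])] else if g = 1 then [(37, [(8, 3)]), (45, [(8, 6)])]
  else if g = 2 then [(21, [(-8, 1)]), (33, [(8, 2)]), (42, [(8, 4)]), (46, [(8, 7)])] else [(3, [(8,
  0)]), (47, [(8, 8)])]) else if n = 1 then (if g = 0 then [] else if g = 1 then [(45, [(8, 3)])] else
  if g = 2 then [] else if g = 3 then [] else if g = 4 then [] else if g = 5 then [] else if g = 6
  then [(10, [(8, 0)]), (33, [(-8, 1)]), (42, [(8, 2)]), (46, [(8, 4)])] else []) else if n = 2 then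
  (if g = 0 then [] else if g = 1 then [(1, [(8, 0)]), (5, [(8, 2)]), (14, [(8, 3)]), (37, [(8, 4)])]
  else if g = 2 then [] else if g = 3 then [] else if g = 4 then [(36, [(48, 4)])] else if g = 5 then
  [(6, [(16, 2)]), (15, [(16, 3)]), (17, [(-16, 3)]), (38, [(16, 4)])] else if g = 6 then [(2, [(8,
  1)]), (10, [(-8, 2)]), (21, [(8, 3)]), (42, [(-8, 4)])] else [(40, [(16, 4)])]) else if n = 3 then
  (if g = 0 then [(44, [(8, 6)])] else if g = 1 then [(5, [(8, 2)]), (14, [(8, 4)]), (26, [(8, 5)]),
  (45, [(4, 6)])] else if g = 2 then [(2, [(-8, 1)]), (10, [(8, 3)]), (21, [(-8, 4)]), (33, [(8, 5)]),
  (46, [(-4, 6)])] else [(3, [(-8, 0)]), (47, [(8, 6)])]) else (if g = 0 then [(44, [(8, 5)])] else if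
  g = 1 then [(37, [(8, 3)]), (45, [(8, 6)])] else if g = 2 then [(21, [(-8, 1)]), (33, [(8, 2)]),
  (42, [(8, 4)]), (46, [(8, 6)])] else [(3, [(8, 0)]), (47, [(-8, 5)])]))"

definition cycles :: "nat => (nat \<times> nat) comb list" where
 "cycles n =
  (if n = 0 then [[(1, (3, 3)), (1, (2, 2)), (1, (1, 1)), (1, (0, 0))], [(-1, (2, 21)), (1, (1, 14))],
  [(1, (2, 33)), (1, (1, 26))], [(1, (1, 37))], [(1, (2, 42))], [(1, (0, 44))], [(1, (1, 45))], [(1,
  (2, 46))], [(1, (3, 47))]] else if n = 1 then [[(1, (6, 10)), (1, (1, 5)), (3, (4, 8)), (2, (5, 9)),
  (1, (7, 11))], [(-1, (6, 33)), (1, (1, 26)), (-2, (5, 32))], [(1, (6, 42)), (1, (1, 37)), (2, (5,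
  41))], [(1, (1, 45))], [(1, (6, 46))]] else if n = 2 then [[(1, (1, 1))], [(1, (6, 2))], [(1, (1,
  5))], [(1, (1, 14))], [(1, (1, 37))]] else if n = 3 then [[(-1, (3, 3)), (1, (0, 0))], [(-1, (2,
  2)), (1, (1, 1))], [(1, (1, 5))], [(1, (2, 10))], [(1, (1, 14))], [(1, (1, 26))], [(1, (0, 44))]]
  else [[(1, (3, 3)), (1, (2, 2)), (1, (1, 1)), (1, (0, 0))], [(-1, (2, 21)), (1, (1, 14))], [(1, (2,
  33)), (1, (1, 26))], [(1, (1, 37))], [(1, (2, 42))], [(1, (0, 44))], [(1, (1, 45))]])"

text \<open>For index 4 the degrees are those before the shift by 8, which
  \<open>cohomology_basis\<close> takes into account.\<close>

definition cycle_degs :: "nat => int list" where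
 "cycle_degs n =
  (if n = 0 then [0, 2, 3, 4, 4, 5, 5, 5, 5] else if n = 1 then [0, 2, 3, 4, 4] else if n = 2 then
  [-2, -2, -1, 0, 2] else if n = 3 then [-3, -3, -2, -2, -1, 0, 2] else [0, 2, 3, 4, 4, 5, 5])"

section \<open>Products, differentials and index sets computed from the tables\<close>

definition b_src :: "nat => nat" where
 "b_src i = (if i < 4 then i else arc_src (hd (words i)))"

definition b_tgt :: "nat => nat" where
 "b_tgt i = (if i < 4 then i else arc_tgt (last (words i)))"

definition rmul :: "nat => nat => nat comb" where
 "rmul g i = lookup (rmul_row i) g"

text \<open>Only right multiplication by arcs is tabulated; a general product is obtained by
  applying the arcs of \<open>words j\<close> one after another. For a vertex \<open>j\<close> the
  word is empty and only the test on end points remains.\<close>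

definition mulb :: "nat => nat => nat comb" where
 "mulb i j = (if b_tgt i = b_src j then fold (\<lambda>g. lin (rmul g)) (words j) [(1, i)] else [])"

text \<open>The term of the resolution in degree \<open>n\<close> modulo 4 is the sum over \<open>g\<close> in \<open>gens n\<close> of \<open>A e \<otimes> e' A\<close>, where
 \<open>e\<close> and \<open>e'\<close> are the vertices \<open>gen_left n g\<close> and \<open>gen_right n g\<close>. Entries \<open>(c, l, h, r)\<close> of \<open>dmat n g\<close> say that
 the differential of the generator \<open>g\<close> contains \<open>c\<close> times \<open>l\<close> times the generator \<open>h\<close> times \<open>r\<close>.\<close>

definition gens :: "nat => nat list" where
 "gens n = (if n = 1 \<or> n = 2 then [0..<8] else [0..<4])"

definition gen_left :: "nat => nat => nat" where
 "gen_left n g = (if n = 1 then arc_src g else if n = 2 then arc_tgt g else g)"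

definition gen_right :: "nat => nat => nat" where
 "gen_right n g = (if n = 1 then arc_tgt g else if n = 2 then arc_src g else g)"

definition prv :: "nat => nat" where "prv n = (if n = 0 then 3 else n - 1)"
definition nxt :: "nat => nat" where "nxt n = (if n = 3 then 0 else n + 1)"

text \<open>In degree 1 the universal derivation of an arc, in degree 2 the two ways of singling out
  an arc in each term of a relation, in degree 3 the commutator of arcs with relations, and in
  degree 0 the Casimir element. The arc \<open>g\<close> is the basis path
  \<open>4 + g\<close>.\<close>

definition dmat :: "nat => nat => (nat \<times> nat \<times> nat) comb" where
 "dmat n g =
   (if n = 1 then [(1, 4 + g, arc_tgt g, arc_tgt g), (-1, arc_src g, arc_src g, 4 + g)]
   else if n = 2 then concat (map (\<lambda>(c, h, k). [(c, arc_tgt g, h, 4 + k), (c, 4 + h, k, arc_src g)]) (rels g))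
   else if n = 3 then map (\<lambda>h. (1, 4 + h, h, g)) (filter (\<lambda>h. arc_src h = g) [0..<8]) @
    map (\<lambda>h. (-1, g, h, 4 + h)) (filter (\<lambda>h. arc_tgt h = g) [0..<8])
   else map (\<lambda>(c, i, j). (c, i, b_tgt i, j)) (casimir g))"

definition full_diff :: "nat => nat \<times> nat \<times> nat => (nat \<times> nat \<times> nat) comb" where
 "full_diff n = (\<lambda>(g, r, l). lin (\<lambda>(l', h, r').
   lin (\<lambda>j. lin (\<lambda>k. [(1, h, k, j)]) (mulb r' r)) (mulb l l')) (dmat n g))"

text \<open>The differential with right factors reduced modulo paths of positive length: an entry
  survives only if its right factor is one of the vertices 0 to 3.\<close>

definition left_diff :: "nat => nat \<times> nat => (nat \<times> nat) comb" where
 "left_diff n = (\<lambda>(g, m). lin (\<lambda>(l, h, r).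
   if r < 4 then lin (\<lambda>j. [(1, h, j)]) (mulb m l) else []) (dmat n g))"

text \<open>Composition with the differential on maps into the algebra: the index
  \<open>(h, m)\<close> is the map that sends the generator \<open>h\<close> to the basis path
  \<open>m\<close> and the other generators to zero.\<close>

definition codiff :: "nat => nat \<times> nat => (nat \<times> nat) comb" where
 "codiff n = (\<lambda>(h, m). concat (map (\<lambda>g. lin (\<lambda>(l, h', r).
   if h' = h then lin (\<lambda>j. lin (\<lambda>k. [(1, g, k)]) (mulb j r)) (mulb l m) else []) (dmat (nxt n) g)) (gens (nxt n))))"

definition homot :: "nat => nat \<times> nat => (nat \<times> nat) comb" where
 "homot n = (\<lambda>(g, m). lookup (homotopy n g) m)"
definition spl :: "nat => nat \<times> nat => (nat \<times> nat) comb" where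
 "spl n = (\<lambda>(g, m). lookup (splitting n g) m)"
definition prj :: "nat => nat \<times> nat => nat comb" where
 "prj n = (\<lambda>(g, m). lookup (proj n g) m)"

definition pairs :: "nat => (nat \<times> nat) list" where
 "pairs n = filter (\<lambda>(g, m). b_tgt m = gen_left n g) (List.product (gens n) [0..<48])"

text \<open>A map into the algebra sends the generator of A e \<otimes> e' A into e A e', so these
  are the coordinates of the Hom space at position \<open>n\<close>.\<close>

definition cpairs :: "nat => (nat \<times> nat) list" where
 "cpairs n = filter (\<lambda>(g, m). b_src m = gen_left n g \<and> b_tgt m = gen_right n g) (List.product (gens n) [0..<48])"

text \<open>The degree of the map, as generators at position \<open>n\<close> have degree
  \<open>n\<close>; the multiple of 8 for later periods is accounted for elsewhere.\<close>

definition cdeg :: "nat => nat \<times> nat => int" where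
 "cdeg n = (\<lambda>(g, m). int (wlen m) - int n)"

section \<open>Identities decided by evaluation\<close>

lemma words_check: "list_all (\<lambda>i. (words i = []) = (i < 4) \<and> wlen i \<le> 5 \<and>
  list_all (\<lambda>g. g < 8) (words i) \<and> successively (\<lambda>g h. arc_tgt g = arc_src h) (words i)) [0..<48]"
 by code_simp

lemma words_arc_check: "list_all (\<lambda>g. words (4 + g) = [g] \<and> arc_src g < 4 \<and> arc_tgt g < 4) [0..<8]"
 by code_simp

lemma rmul_check: "list_all (\<lambda>i. list_all (\<lambda>(g, xs). g < 8 \<and> arc_src g = b_tgt i \<and>
  list_all (\<lambda>(c, k). k < 48 \<and> wlen k = wlen i + 1 \<and>
   b_src k = b_src i \<and> b_tgt k = arc_tgt g) xs) (rmul_row i)) [0..<48]"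
 by code_simp

lemma unit_check: "list_all (\<lambda>j. mulb (b_src j) j = [(1, j)]) [0..<48]"
 by code_simp

text \<open>Apart from the end points, the content is that each relation applied on the right
  annihilates every basis path of the table. This is what turns the table into a module over the
  quotient algebra.\<close>

lemma rels_check: "list_all (\<lambda>i. list_all (\<lambda>e. list_all (\<lambda>(c, g, h). g < 8 \<and> h < 8 \<and> arc_src g = arc_tgt e \<and>
  arc_tgt g = arc_src h \<and> arc_tgt h = arc_src e) (rels e) \<and>
  vanishes (lin (\<lambda>(g, h). lin (rmul h) (rmul g i)) (map (\<lambda>(c, g, h). (c, g, h)) (rels e)))) [0..<8]) [0..<48]"
 by code_simp

lemma dmat_check: "list_all (\<lambda>n. list_all (\<lambda>g. list_all (\<lambda>(c, l, h, r). l < 48 \<and> r < 48 \<and> h \<in> set (gens (prv n)) \<and>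
  b_src l = gen_left n g \<and> b_tgt l = gen_left (prv n) h \<and>
  b_src r = gen_right (prv n) h \<and> b_tgt r = gen_right n g \<and>
  wlen l + wlen r + prv n = n + (if n = 0 then 8 else 0)) (dmat n g)) (gens n)) [0..<4]"
 by code_simp

lemma hom_check: "list_all (\<lambda>n. list_all (\<lambda>t. list_all (\<lambda>(c, g, j). g \<in> set (gens (nxt n)) \<and> j < 48 \<and>
  b_tgt j = gen_left (nxt n) g \<and> gen_right n (fst t) = gen_right (nxt n) g) (homot n t)) (pairs n)) [0..<4]"
 by code_simp

text \<open>At the start of the resolution the Casimir differential out of degree 0 is replaced by
  the augmentation. The check says that its contribution to the homotopy identity comes only from
  left factors that are vertices.\<close>

lemma aug_check: "list_all (\<lambda>t. 4 \<le> snd t --> vanishes (lin (homot 3) (left_diff 0 t))) (pairs 0)"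
 by code_simp

definition homotopy_identity :: "nat => bool" where
 "homotopy_identity n = list_all (\<lambda>t. vanishes (lin (left_diff (nxt n)) (homot n t) @
  lin (homot (prv n)) (left_diff n t) @ [(-2, t)])) (pairs n)"

lemma homotopy_check_0: "homotopy_identity 0" by code_simp
lemma homotopy_check_1: "homotopy_identity 1" by code_simp
lemma homotopy_check_2: "homotopy_identity 2" by code_simp
lemma homotopy_check_3: "homotopy_identity 3" by code_simp

text \<open>The four cases express, in order: arcs commute with the Casimir element, the relations
  hold, the potential is cyclic, the Casimir element is a cycle. Checking generators with vertices
  on both sides suffices by linearity over the enveloping algebra.\<close>

definition complex_identity :: "nat => bool" where
 "complex_identity n = list_all (\<lambda>g. vanishes (lin (full_diff n)
  (full_diff (nxt n) (g, gen_right (nxt n) g, gen_left (nxt n) g)))) (gens (nxt n))"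

lemma complex_check_0: "complex_identity 0" by code_simp
lemma complex_check_1: "complex_identity 1" by code_simp
lemma complex_check_2: "complex_identity 2" by code_simp
lemma complex_check_3: "complex_identity 3" by code_simp

lemma codiff_check: "list_all (\<lambda>n. list_all (\<lambda>t. list_all (\<lambda>(c, u). u \<in> set (cpairs (nxt n)) \<and>
  cdeg (nxt n) u = cdeg n t + (if n = 3 then 8 else 0)) (codiff n t)) (cpairs n)) [0..<4]"
 by code_simp

lemma spl_check: "list_all (\<lambda>n. list_all (\<lambda>t. list_all (\<lambda>(c, u). u \<in> set (cpairs n) \<and>
  cdeg (nxt n) t = cdeg n u + (if n = 3 then 8 else 0)) (spl n t)) (cpairs (nxt n))) [0..<4]"
 by code_simp

lemma prj_check: "list_all (\<lambda>n. length (cycle_degs n) = length (cycles n) \<and>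
  list_all (\<lambda>t. list_all (\<lambda>(c, i). i < length (cycles n) \<and> cycle_degs n ! i = cdeg (n mod 4) t) (prj n t)) (cpairs (n mod 4)) \<and>
  list_all (\<lambda>i. list_all (\<lambda>(c, u). u \<in> set (cpairs (n mod 4)) \<and> cdeg (n mod 4) u = cycle_degs n ! i) (cycles n ! i)) [0..<length (cycles n)]) [0..<5]"
 by code_simp

text \<open>Indices 0 and 4 both concern position 0 of the period. They differ by the term with
  \<open>codiff 3\<close>, which is present only when a previous period supplies coboundaries; hence
  five cases for a complex of period 4.\<close>

definition splitting_identity :: "nat => bool" where
 "splitting_identity n = list_all (\<lambda>t. vanishes (lin (spl (n mod 4)) (codiff (n mod 4) t) @
  (if n = 0 then [] else lin (codiff (n - 1)) (spl (n - 1) t)) @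
  lin (\<lambda>i. cycles n ! i) (prj n t) @ [(-8, t)])) (cpairs (n mod 4))"

lemma splitting_check_0: "splitting_identity 0" by code_simp
lemma splitting_check_1: "splitting_identity 1" by code_simp
lemma splitting_check_2: "splitting_identity 2" by code_simp
lemma splitting_check_3: "splitting_identity 3" by code_simp
lemma splitting_check_4: "splitting_identity 4" by code_simp

lemma cycles_check: "list_all (\<lambda>n. list_all (\<lambda>i. vanishes (lin (codiff (n mod 4)) (cycles n ! i)) \<and>
  vanishes (lin (prj n) (cycles n ! i) @ [(-8, i)])) [0..<length (cycles n)]) [0..<5]"
 by code_simp

lemma prj_codiff_check:
 "list_all (\<lambda>n. list_all (\<lambda>t. vanishes (lin (prj (n + 1)) (codiff n t))) (cpairs n)) [0..<4]"
 by code_simp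

section \<open>The periodic bimodule resolution\<close>

lemma rmul_props:
 assumes "i < 48" "(c, k) \<in> set (rmul g i)"
 shows "g < 8" "arc_src g = b_tgt i" "k < 48" "wlen k = wlen i + 1"
  "b_src k = b_src i" "b_tgt k = arc_tgt g"
proof -
 obtain xs where xs: "map_of (rmul_row i) g = Some xs" "(c, k) \<in> set xs"
  using assms(2) by (cases "map_of (rmul_row i) g") (auto simp: rmul_def lookup_def)
 have "(g, xs) \<in> set (rmul_row i)" using map_of_SomeD[OF xs(1)] .
 moreover have "i \<in> set [0..<48]" using assms(1) by simp
 ultimately show "g < 8" "arc_src g = b_tgt i" "k < 48" "wlen k = wlen i + 1"
  "b_src k = b_src i" "b_tgt k = arc_tgt g"
  using rmul_check xs(2) unfolding list_all_iff by fastforce+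
qed

lemma fold_rmul_props:
 assumes "\<And>c k. (c, k) \<in> set xs ==> k < 48 \<and> wlen k = L \<and> b_src k = s \<and> b_tgt k = v"
  and "(c, k) \<in> set (fold (\<lambda>g. lin (rmul g)) w xs)"
 shows "k < 48 \<and> wlen k = L + length w \<and> b_src k = s \<and>
  b_tgt k = (if w = [] then v else arc_tgt (last w))"
 using assms
proof (induction w arbitrary: xs L v)
 case (Cons g w)
 have "k < 48 \<and> wlen k = (L + 1) + length w \<and> b_src k = s \<and>
   b_tgt k = (if w = [] then arc_tgt g else arc_tgt (last w))"
 proof (rule Cons.IH)
  show "(c, k) \<in> set (fold (\<lambda>g. lin (rmul g)) w (lin (rmul g) xs))" using Cons.prems(2) by simp
  fix c k assume "(c, k) \<in> set (lin (rmul g) xs)"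
  then obtain e i e' where i: "(e, i) \<in> set xs" "(e', k) \<in> set (rmul g i)" by (blast dest: lin_set)
  from Cons.prems(1)[OF i(1)] rmul_props[OF _ i(2)]
  show "k < 48 \<and> wlen k = L + 1 \<and> b_src k = s \<and> b_tgt k = arc_tgt g" by simp
 qed
 then show ?case by auto
qed auto

lemma words_Nil: "i < 48 ==> words i = [] \<longleftrightarrow> i < 4"
 using words_check by (simp add: list_all_iff)

lemma b_vertex [simp]: "v < 4 ==> b_src v = v" "v < 4 ==> b_tgt v = v"
 by (simp_all add: b_src_def b_tgt_def)

lemma words_vertex [simp]: "v < 4 ==> words v = []"
 using words_Nil[of v] by simp

lemma mulb_props:
 assumes ij: "i < 48" "j < 48" and k: "(c, k) \<in> set (mulb i j)"
 shows "k < 48" "wlen k = wlen i + wlen j" "b_src k = b_src i"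
  "b_tgt k = b_tgt j" "b_tgt i = b_src j"
proof -
 show eq: "b_tgt i = b_src j" using k by (auto simp: mulb_def split: if_splits)
 have "k < 48 \<and> wlen k = wlen i + wlen j \<and> b_src k = b_src i \<and>
  b_tgt k = (if words j = [] then b_tgt i else arc_tgt (last (words j)))"
  using k ij eq by (intro fold_rmul_props[of "[(1, i)]"]) (auto simp: mulb_def)
 moreover have "(if words j = [] then b_tgt i else arc_tgt (last (words j))) = b_tgt j"
  using words_Nil[OF ij(2)] eq by (auto simp: b_tgt_def b_src_def)
 ultimately show "k < 48" "wlen k = wlen i + wlen j" "b_src k = b_src i"
  "b_tgt k = b_tgt j" by auto
qed

lemma mulb_vertex_left: "j < 48 ==> v < 4 ==> mulb v j = (if v = b_src j then [(1, j)] else [])"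
proof (cases "v = b_src j")
 case True
 moreover assume "j < 48" "v < 4"
 ultimately show ?thesis using unit_check by (simp add: list_all_iff)
qed (simp add: mulb_def)

lemma mulb_vertex_right: "v < 4 ==> mulb i v = (if b_tgt i = v then [(1, i)] else [])"
 by (simp add: mulb_def)

lemma coeff_nonzero: "coeff xs k \<noteq> 0 ==> \<exists>c. (c, k) \<in> set xs"
 using coeff_outside[of k xs] by force

lemma coeff_mulb:
 assumes "i < 48" "j < 48" "coeff (mulb i j) k \<noteq> 0"
 shows "k < 48" "wlen k = wlen i + wlen j" "b_src k = b_src i"
  "b_tgt k = b_tgt j" "b_tgt i = b_src j"
proof -
 obtain c where "(c, k) \<in> set (mulb i j)" using coeff_nonzero[OF assms(3)] by blast
 from mulb_props[OF assms(1,2) this] show "k < 48" "wlen k = wlen i + wlen j"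
  "b_src k = b_src i" "b_tgt k = b_tgt j" "b_tgt i = b_src j" by auto
qed

lemma arc_vertex: "g < 8 ==> arc_src g < 4" "g < 8 ==> arc_tgt g < 4"
 using words_arc_check by (simp_all add: list_all_iff)

lemma gen_vertex: "g \<in> set (gens m) ==> gen_left m g < 4" "g \<in> set (gens m) ==> gen_right m g < 4"
 by (auto simp: gens_def gen_left_def gen_right_def arc_vertex)

lemma dmat_props:
 assumes "n < 4" "g \<in> set (gens n)" "(c, l, h, r) \<in> set (dmat n g)"
 shows "l < 48" "r < 48" "h \<in> set (gens (prv n))" "b_src l = gen_left n g" "b_tgt l = gen_left (prv n) h"
  "b_src r = gen_right (prv n) h" "b_tgt r = gen_right n g"
  "wlen l + wlen r + prv n = n + (if n = 0 then 8 else 0)"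
 using dmat_check assms unfolding list_all_iff by fastforce+

text \<open>Coordinates of a term of the resolution: \<open>(g, r, l)\<close> is the tensor with
  left factor \<open>l\<close> and right factor \<open>r\<close> at the generator \<open>g\<close>,
  so \<open>l\<close> must end at its left vertex and \<open>r\<close> must start at its right
  vertex.\<close>

definition blk :: "nat => (nat \<times> nat \<times> nat) set" where
 "blk m = {(g, r, l). g \<in> set (gens m) \<and> r < 48 \<and> l < 48 \<and> b_src r = gen_right m g \<and> b_tgt l = gen_left m g}"

lemma finite_blk: "finite (blk m)"
 by (rule finite_subset[of _ "set (gens m) \<times> {..<48} \<times> {..<48}"]) (auto simp: blk_def)

lemma coeff_lin_tensor:
 "coeff (lin (\<lambda>j. lin (\<lambda>k. [(1, h, k, j)]) ys) xs) (h', k, j) = (if h' = h then coeff xs j * coeff ys k else 0)"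
proof (induction xs)
 case (Cons x xs)
 obtain c i where x: "x = (c, i)" by (cases x)
 have "coeff (lin (\<lambda>k. [(1, h, k, i)]) ys) (h', k, j) = (if h' = h \<and> i = j then coeff ys k else 0)"
  by (induction ys) (auto simp: lin_Cons coeff_Cons)
 with Cons show ?case by (auto simp: x lin_Cons coeff_Cons coeff_scale distrib_right)
qed simp

lemma coeff_full_diff:
 assumes "n < 4" "g \<in> set (gens n)" "h \<in> set (gens (prv n))"
 shows "coeff (full_diff n (g, r, l)) (h, k, j) =
  (\<Sum>l'<48. \<Sum>r'<48. coeff (dmat n g) (l', h, r') * coeff (mulb l l') j * coeff (mulb r' r) k)"
proof -
 let ?I = "{..<48} \<times> set (gens (prv n)) \<times> {..<48 :: nat}"
 have sub: "snd ` set (dmat n g) \<subseteq> ?I" using dmat_props[OF assms(1,2)] by fastforce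
 have "coeff (full_diff n (g, r, l)) (h, k, j) =
   (\<Sum>i\<in>?I. coeff (dmat n g) i * (if h = fst (snd i) then coeff (mulb l (fst i)) j * coeff (mulb (snd (snd i)) r) k else 0))"
  unfolding full_diff_def prod.case
  by (subst coeff_lin[OF _ sub]) (auto simp: coeff_lin_tensor intro!: sum.cong)
 also have "... = (\<Sum>l'<48. \<Sum>h'\<in>set (gens (prv n)). \<Sum>r'<48. if h' = h then
   coeff (dmat n g) (l', h, r') * coeff (mulb l l') j * coeff (mulb r' r) k else 0)"
  unfolding sum.cartesian_product' by (intro sum.cong refl) auto
 also have "... = (\<Sum>l'<48. \<Sum>h'\<in>set (gens (prv n)). if h' = h then
   (\<Sum>r'<48. coeff (dmat n g) (l', h, r') * coeff (mulb l l') j * coeff (mulb r' r) k) else 0)"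
  by (intro sum.cong refl) auto
 also have "... = (\<Sum>l'<48. \<Sum>r'<48. coeff (dmat n g) (l', h, r') * coeff (mulb l l') j * coeff (mulb r' r) k)"
  using assms(3) by simp
 finally show ?thesis .
qed

lemma full_diff_in_blk:
 assumes n: "n < 4" and t: "t \<in> blk n" and u: "(c, u) \<in> set (full_diff n t)"
 shows "u \<in> blk (prv n)"
  "wlen (fst (snd u)) + wlen (snd (snd u)) + prv n =
   wlen (fst (snd t)) + wlen (snd (snd t)) + n + (if n = 0 then 8 else 0)"
  "wlen (fst (snd t)) \<le> wlen (fst (snd u))"
proof -
 obtain g r l where t': "t = (g, r, l)" by (cases t)
 obtain c1 l' h r' where 1: "(c1, l', h, r') \<in> set (dmat n g)"
  and 2: "\<exists>e. (e, u) \<in> set (lin (\<lambda>j. lin (\<lambda>k. [(1, h, k, j)]) (mulb r' r)) (mulb l l'))"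
  using u unfolding t' full_diff_def prod.case by (fastforce dest: lin_set)
 obtain c2 j c3 k where 3: "(c2, j) \<in> set (mulb l l')" "(c3, k) \<in> set (mulb r' r)" "u = (h, k, j)"
  using 2 by (fastforce dest!: lin_set)
 have t2: "g \<in> set (gens n)" "r < 48" "l < 48" "b_src r = gen_right n g" "b_tgt l = gen_left n g"
  using t by (auto simp: blk_def t')
 note d = dmat_props[OF n t2(1) 1]
 note m = mulb_props[OF t2(3) d(1) 3(1)] mulb_props[OF d(2) t2(2) 3(2)]
 show "u \<in> blk (prv n)" using d m 3(3) by (simp add: blk_def)
 show "wlen (fst (snd u)) + wlen (snd (snd u)) + prv n =
   wlen (fst (snd t)) + wlen (snd (snd t)) + n + (if n = 0 then 8 else 0)"
  using d(8) m 3(3) by (simp add: t')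
 show "wlen (fst (snd t)) \<le> wlen (fst (snd u))" using m 3(3) by (simp add: t')
qed

text \<open>From here on the cell system has disappeared: the algebra enters only through its
  coordinates, the product \<open>mulb\<close> and the lengths of the basis paths.\<close>

locale e8_algebra = env_coord_algebra A "{..<48 :: nat}" chi "\<lambda>i j k. of_int (coeff (mulb i j) k)"
  "\<lambda>i. int (wlen i)" GA
 for A :: "(complex, 'a) module" and chi GA +
 assumes chi_one: "chi \<one>\<^bsub>A\<^esub> = (\<lambda>i. if i < 4 then 1 else 0)"
begin

abbreviation "vert r l \<equiv> RC.basis (r, l)"

lemma vert: "r < 4 ==> l < 4 ==> vert r l \<in> carrier R"
 "r < 4 ==> l < 4 ==> env_chi (vert r l) p = (if p = (r, l) then 1 else 0)"
 by (auto simp: RC.basis)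

lemma env_\<mu>_vertex_right: "fst p < 48 ==> snd p < 48 ==> r < 4 ==> l < 4 ==>
  env_\<mu> p (r, l) q = (if q = p \<and> b_src (fst p) = r \<and> b_tgt (snd p) = l then 1 else 0)"
 by (cases p; cases q) (auto simp: env_\<mu>_def mulb_vertex_left mulb_vertex_right coeff_Cons)

lemma env_\<mu>_vertex_left: "fst p < 48 ==> snd p < 48 ==> r < 4 ==> l < 4 ==>
  env_\<mu> (r, l) p q = (if q = p \<and> b_tgt (fst p) = r \<and> b_src (snd p) = l then 1 else 0)"
 by (cases p; cases q) (auto simp: env_\<mu>_def mulb_vertex_left mulb_vertex_right coeff_Cons)

lemma chi_times_vert:
 assumes X: "X \<in> carrier R" and rl: "r < 4" "l < 4"
 shows "env_chi (X \<otimes>\<^bsub>R\<^esub> vert r l) q = (if b_src (fst q) = r \<and> b_tgt (snd q) = l then env_chi X q else 0)"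
proof -
 let ?B = "{..<48} \<times> {..<48 :: nat}"
 have "env_chi (X \<otimes>\<^bsub>R\<^esub> vert r l) q = (\<Sum>p\<in>?B. \<Sum>p'\<in>?B. if p' = (r, l) then env_chi X p * env_\<mu> p (r, l) q else 0)"
  unfolding env_chi_mult[OF X vert(1)[OF rl]] by (intro sum.cong refl) (simp add: vert(2)[OF rl])
 also have "... = (\<Sum>p\<in>?B. env_chi X p * env_\<mu> p (r, l) q)"
  using rl by (simp add: sum.delta)
 also have "... = (\<Sum>p\<in>?B. if p = q then (if b_src (fst q) = r \<and> b_tgt (snd q) = l then env_chi X q else 0) else 0)"
  by (intro sum.cong refl) (use rl in \<open>auto simp: env_\<mu>_vertex_right\<close>)
 also have "... = (if b_src (fst q) = r \<and> b_tgt (snd q) = l then env_chi X q else 0)"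
  using R.chi_outside[OF X, of q] by (simp add: sum.delta)
 finally show ?thesis .
qed

lemma chi_vert_times:
 assumes X: "X \<in> carrier R" and rl: "r < 4" "l < 4"
 shows "env_chi (vert r l \<otimes>\<^bsub>R\<^esub> X) q = (if b_tgt (fst q) = r \<and> b_src (snd q) = l then env_chi X q else 0)"
proof -
 let ?B = "{..<48} \<times> {..<48 :: nat}"
 have "env_chi (vert r l \<otimes>\<^bsub>R\<^esub> X) q = (\<Sum>p'\<in>?B. \<Sum>p\<in>?B. if p' = (r, l) then env_chi X p * env_\<mu> (r, l) p q else 0)"
  unfolding env_chi_mult[OF vert(1)[OF rl] X] by (intro sum.cong refl) (simp add: vert(2)[OF rl])
 also have "... = (\<Sum>p\<in>?B. \<Sum>p'\<in>?B. if p' = (r, l) then env_chi X p * env_\<mu> (r, l) p q else 0)"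
  by (rule sum.swap)
 also have "... = (\<Sum>p\<in>?B. env_chi X p * env_\<mu> (r, l) p q)"
  using rl by (simp add: sum.delta)
 also have "... = (\<Sum>p\<in>?B. if p = q then (if b_tgt (fst q) = r \<and> b_src (snd q) = l then env_chi X q else 0) else 0)"
  by (intro sum.cong refl) (use rl in \<open>auto simp: env_\<mu>_vertex_left\<close>)
 also have "... = (if b_tgt (fst q) = r \<and> b_src (snd q) = l then env_chi X q else 0)"
  using R.chi_outside[OF X, of q] by (simp add: sum.delta)
 finally show ?thesis .
qed

lemma R_nontriv: "\<one>\<^bsub>R\<^esub> \<noteq> \<zero>\<^bsub>R\<^esub>"
proof
 assume "\<one>\<^bsub>R\<^esub> = \<zero>\<^bsub>R\<^esub>"
 then have "env_chi (tens \<one>\<^bsub>A\<^esub> \<one>\<^bsub>A\<^esub>) (0, 0) = env_chi \<zero>\<^bsub>R\<^esub> (0, 0)" by (simp add: env_simps(3))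
 then show False by (simp add: env_chi_tens chi_one)
qed

text \<open>The pure tensor of the two end vertices of the generator, right one first; the left
  ideal it generates is the bimodule A e \<otimes> e' A.\<close>

definition E :: "nat => nat => 'a env" where
 "E m g = vert (gen_right m g) (gen_left m g)"

sublocale Q: ideal_sum R "set (gens m)" "E m" for m
proof
 fix g assume g: "g \<in> set (gens m)"
 note v = gen_vertex[OF g]
 show c: "E m g \<in> carrier R" using v by (simp add: E_def vert)
 show "E m g \<otimes>\<^bsub>R\<^esub> E m g = E m g"
  by (rule R.chi_eqI) (use v in \<open>auto simp: E_def vert chi_times_vert\<close>)
qed (use R_nontriv in auto)

abbreviation "QM m \<equiv> psum R (set (gens m)) (E m)"

definition qchi :: "nat => (nat => 'a env) => nat \<times> nat \<times> nat => complex" where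
 "qchi m f = (\<lambda>(g, p). if g \<in> set (gens m) then env_chi (f g) p else 0)"

lemma qchi_in: "g \<in> set (gens m) ==> qchi m f (g, p) = env_chi (f g) p"
 by (simp add: qchi_def)

lemma qchi_outside: "f \<in> carrier (QM m) ==> t \<notin> blk m ==> qchi m f t = 0"
proof -
 assume f: "f \<in> carrier (QM m)" and t: "t \<notin> blk m"
 obtain g r l where t': "t = (g, r, l)" by (cases t)
 show ?thesis
 proof (cases "g \<in> set (gens m)")
  case True
  note Fg = Q.psum_carrier(1)[OF f, of g] Q.psum_carrier(2)[OF f True]
  have "env_chi (f g) (r, l) = env_chi (f g \<otimes>\<^bsub>R\<^esub> E m g) (r, l)" using Fg by simp
  also have "... = 0"
   using t True R.chi_outside[OF Fg(1), of "(r, l)"] gen_vertex[OF True]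
   by (auto simp: E_def chi_times_vert[OF Fg(1)] blk_def t')
  finally show ?thesis by (simp add: t' qchi_def)
 qed (simp add: t' qchi_def)
qed

lemma QM_I:
 assumes "\<And>g. g \<in> set (gens m) ==> f g \<in> carrier R" "\<And>g. g \<notin> set (gens m) ==> f g = \<zero>\<^bsub>R\<^esub>"
  and "\<And>g r l. g \<in> set (gens m) ==> (g, r, l) \<notin> blk m ==> env_chi (f g) (r, l) = 0"
 shows "f \<in> carrier (QM m)"
proof (rule Q.psum_carrierI)
 fix g assume g: "g \<in> set (gens m)"
 show "f g \<otimes>\<^bsub>R\<^esub> E m g = f g"
 proof (rule R.chi_eqI)
  fix q
  show "env_chi (f g \<otimes>\<^bsub>R\<^esub> E m g) q = env_chi (f g) q"
   using assms(3)[OF g, of "fst q" "snd q"] gen_vertex[OF g]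
   by (cases q) (auto simp: E_def chi_times_vert assms(1) g blk_def)
 qed (use assms g gen_vertex in \<open>auto simp: E_def vert\<close>)
qed (use assms in auto)

sublocale QC: coord_group "QM m" "blk m" "qchi m" for m
proof -
 interpret Q: left_module R "QM m" by (rule Q.psum_left_module)
 show "coord_group (QM m) (blk m) (qchi m)"
 proof
  show "finite (blk m)" by (rule finite_blk)
  show "qchi m (f \<oplus>\<^bsub>QM m\<^esub> f') = (\<lambda>i. qchi m f i + qchi m f' i)"
   if "f \<in> carrier (QM m)" "f' \<in> carrier (QM m)" for f f'
   using Q.psum_carrier(1)[OF that(1)] Q.psum_carrier(1)[OF that(2)]
   by (auto simp: qchi_def fun_eq_iff R.chi_add)
  show "bij_betw (qchi m) (carrier (QM m)) {y. \<forall>i. i \<notin> blk m --> y i = 0}"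
   unfolding bij_betw_def
  proof (rule conjI)
   show "inj_on (qchi m) (carrier (QM m))"
   proof (rule inj_onI)
    fix f f' assume f: "f \<in> carrier (QM m)" "f' \<in> carrier (QM m)" "qchi m f = qchi m f'"
    show "f = f'"
    proof
     fix g
     show "f g = f' g"
     proof (cases "g \<in> set (gens m)")
      case True
      have "env_chi (f g) p = env_chi (f' g) p" for p
       using fun_cong[OF f(3), of "(g, p)"] True by (simp add: qchi_in)
      then show ?thesis
       by (rule R.chi_eqI[OF Q.psum_carrier(1)[OF f(1)] Q.psum_carrier(1)[OF f(2)]])
     qed (use Q.psum_carrier(3)[OF f(1)] Q.psum_carrier(3)[OF f(2)] in simp)
    qed
   qed
   show "qchi m ` carrier (QM m) = {y. \<forall>i. i \<notin> blk m --> y i = 0}"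
   proof (rule equalityI; rule subsetI)
    fix y assume "y \<in> qchi m ` carrier (QM m)"
    then show "y \<in> {y. \<forall>i. i \<notin> blk m --> y i = 0}" using qchi_outside by auto
   next
    fix y :: "nat \<times> nat \<times> nat => complex" assume "y \<in> {y. \<forall>i. i \<notin> blk m --> y i = 0}"
    then have y: "y i = 0" if "i \<notin> blk m" for i using that by blast
    let ?f = "\<lambda>g. if g \<in> set (gens m) then R.elem (\<lambda>p. y (g, p)) else \<zero>\<^bsub>R\<^esub>"
    have e: "R.elem (\<lambda>p. y (g, p)) \<in> carrier R" "env_chi (R.elem (\<lambda>p. y (g, p))) = (\<lambda>p. y (g, p))" for g
     by (rule R.elem; use y in \<open>auto simp: blk_def\<close>)+
    have "?f \<in> carrier (QM m)" by (rule QM_I) (use e y in auto)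
    moreover have "y = qchi m ?f"
     using y by (auto simp: fun_eq_iff qchi_def e blk_def)
    ultimately show "y \<in> qchi m ` carrier (QM m)" by blast
   qed
  qed
 qed
qed

end

section \<open>The complex of left factors\<close>

lemma coeff_left_diff:
 assumes "n < 4" "g \<in> set (gens n)"
 shows "coeff (left_diff n (g, m)) (h, j) =
  (\<Sum>l<48. \<Sum>r<48. if r < 4 then coeff (dmat n g) (l, h, r) * coeff (mulb m l) j else 0)"
proof -
 let ?H = "insert h (set (gens (prv n)))"
 let ?I = "{..<48} \<times> ?H \<times> {..<48 :: nat}"
 have sub: "snd ` set (dmat n g) \<subseteq> ?I" using dmat_props[OF assms] by fastforce
 have one: "coeff (lin (\<lambda>j. [(1, h', j)]) xs) (h, j) = (if h' = h then coeff xs j else 0)" for h' and xs :: "nat comb"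
  by (induction xs) (auto simp: lin_Cons coeff_Cons)
 have "coeff (left_diff n (g, m)) (h, j) =
   (\<Sum>i\<in>?I. coeff (dmat n g) i * (if snd (snd i) < 4 \<and> fst (snd i) = h then coeff (mulb m (fst i)) j else 0))"
  unfolding left_diff_def prod.case
  by (subst coeff_lin[OF _ sub]) (auto simp: one intro!: sum.cong)
 also have "... = (\<Sum>l<48. \<Sum>h'\<in>?H. \<Sum>r<48. if h' = h then
   (if r < 4 then coeff (dmat n g) (l, h, r) * coeff (mulb m l) j else 0) else 0)"
  unfolding sum.cartesian_product' by (intro sum.cong refl) auto
 also have "... = (\<Sum>l<48. \<Sum>h'\<in>?H. if h' = h then
   (\<Sum>r<48. if r < 4 then coeff (dmat n g) (l, h, r) * coeff (mulb m l) j else 0) else 0)"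
  by (intro sum.cong refl) auto
 finally show ?thesis by (simp add: sum.delta)
qed

lemma coeff_dmat:
 assumes "n < 4" "g \<in> set (gens n)" "coeff (dmat n g) (l, h, r) \<noteq> 0"
 shows "l < 48" "r < 48" "h \<in> set (gens (prv n))" "b_src l = gen_left n g" "b_tgt l = gen_left (prv n) h"
  "b_src r = gen_right (prv n) h" "b_tgt r = gen_right n g"
  "wlen l + wlen r + prv n = n + (if n = 0 then 8 else 0)"
proof -
 obtain c where "(c, l, h, r) \<in> set (dmat n g)" using coeff_nonzero[OF assms(3)] by blast
 from dmat_props[OF assms(1,2) this] show "l < 48" "r < 48" "h \<in> set (gens (prv n))" "b_src l = gen_left n g" "b_tgt l = gen_left (prv n) h"
  "b_src r = gen_right (prv n) h" "b_tgt r = gen_right n g"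
  "wlen l + wlen r + prv n = n + (if n = 0 then 8 else 0)" by auto
qed

text \<open>Modulo right factors of larger degree, the differential acts on the left factors only.\<close>

lemma coeff_full_diff_leading:
 assumes n: "n < 4" and t: "(g, r, l) \<in> blk n" and h: "h \<in> set (gens (prv n))"
  and len: "wlen k \<le> wlen r"
 shows "coeff (full_diff n (g, r, l)) (h, k, j) = (if r = k then coeff (left_diff n (g, l)) (h, j) else 0)"
proof -
 have t': "g \<in> set (gens n)" "r < 48" "l < 48" "b_src r = gen_right n g" "b_tgt l = gen_left n g"
  using t by (auto simp: blk_def)
 have "coeff (dmat n g) (l', h, r') * coeff (mulb l l') j * coeff (mulb r' r) k =
   (if r = k then (if r' < 4 then coeff (dmat n g) (l', h, r') * coeff (mulb l l') j else 0) else 0)"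
  if "r' < 48" for l' r'
 proof (cases "coeff (dmat n g) (l', h, r') = 0")
  case False
  note d = coeff_dmat[OF n t'(1) False]
  show ?thesis
  proof (cases "r' < 4")
   case True
   then have "mulb r' r = [(1, r)]" using d(7) t' by (simp add: mulb_vertex_left)
   then show ?thesis using True by (simp add: coeff_Cons)
  next
   case False
   then have "coeff (mulb r' r) k = 0"
    using coeff_mulb(2)[OF that t'(2), of k] len words_Nil[OF that] by fastforce
   then show ?thesis using False by simp
  qed
 qed simp
 then have "coeff (full_diff n (g, r, l)) (h, k, j) =
   (\<Sum>l'<48. \<Sum>r'<48. if r = k then (if r' < 4 then coeff (dmat n g) (l', h, r') * coeff (mulb l l') j else 0) else 0)"
  unfolding coeff_full_diff[OF n t'(1) h] by (intro sum.cong refl) auto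
 then show ?thesis by (simp add: coeff_left_diff[OF n t'(1)])
qed

lemma set_pairs: "(g, m) \<in> set (pairs n) \<longleftrightarrow> g \<in> set (gens n) \<and> m < 48 \<and> b_tgt m = gen_left n g"
 by (auto simp: pairs_def)

text \<open>Right factors can only become longer. If all right factors of \<open>y\<close> have
  length at least \<open>p\<close> and \<open>k\<close> has length at most \<open>p\<close>, then
  only terms with \<open>r = k\<close>, and with a vertex as right factor in the differential, can
  reach \<open>k\<close>.\<close>

lemma apply_full_diff_leading:
 assumes n: "n < 4" and y: "\<And>t. t \<notin> blk n ==> y t = 0"
  and low: "\<And>g r l. wlen r < p ==> y (g, r, l) = 0"
  and h: "h \<in> set (gens (prv n))" and k: "wlen k \<le> p"
 shows "apply_cols (blk n) (full_diff n) y (h, k, j) =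
  apply_cols (set (pairs n)) (left_diff n) (\<lambda>(g, l). y (g, k, l)) (h, j)"
proof -
 have "apply_cols (blk n) (full_diff n) y (h, k, j) =
   (\<Sum>(g, r, l)\<in>blk n. if r = k then y (g, k, l) * of_int (coeff (left_diff n (g, l)) (h, j)) else 0)"
  unfolding apply_cols_def
 proof (rule sum.cong[OF refl])
  fix t assume t: "t \<in> blk n"
  obtain g r l where t': "t = (g, r, l)" by (cases t)
  show "y t * of_int (coeff (full_diff n t) (h, k, j)) =
    (case t of (g, r, l) => if r = k then y (g, k, l) * of_int (coeff (left_diff n (g, l)) (h, j)) else 0)"
  proof (cases "wlen r < p")
   case True
   then show ?thesis using low[of r g l] by (auto simp: t')
  next
   case False
   then have "wlen k \<le> wlen r" using k by simp
   from coeff_full_diff_leading[OF n _ h this] t show ?thesis by (auto simp: t')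
  qed
 qed
 also have "... = (\<Sum>(g, r, l)\<in>blk n \<inter> {(g, r, l). r = k}. y (g, k, l) * of_int (coeff (left_diff n (g, l)) (h, j)))"
  by (rule sum.mono_neutral_cong_right) (auto simp: finite_blk split: if_splits)
 also have "... = (\<Sum>(g, l)\<in>{(g, l). (g, k, l) \<in> blk n}. y (g, k, l) * of_int (coeff (left_diff n (g, l)) (h, j)))"
  by (rule sum.reindex_bij_witness[of _ "\<lambda>(g, l). (g, k, l)" "\<lambda>(g, r, l). (g, l)"]) auto
 also have "... = apply_cols (set (pairs n)) (left_diff n) (\<lambda>(g, l). y (g, k, l)) (h, j)"
  unfolding apply_cols_def
  by (rule sum.mono_neutral_cong_left) (use y in \<open>auto simp: blk_def set_pairs\<close>)
 finally show ?thesis .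
qed

lemma left_diff_in_pairs:
 assumes "n < 4" "t \<in> set (pairs n)" "(c, u) \<in> set (left_diff n t)"
 shows "u \<in> set (pairs (prv n))"
proof -
 obtain g m where t: "t = (g, m)" by (cases t)
 obtain c1 l h r e where 1: "(c1, l, h, r) \<in> set (dmat n g)"
  and 2: "(e, u) \<in> set (if r < 4 then lin (\<lambda>j. [(1, h, j)]) (mulb m l) else [])"
  using assms(3) unfolding t left_diff_def prod.case by (fastforce dest: lin_set)
 then obtain e' j where 3: "(e', j) \<in> set (mulb m l)" "u = (h, j)"
  by (fastforce dest: lin_set split: if_splits)
 have m: "g \<in> set (gens n)" "m < 48" using assms(2) by (auto simp: t set_pairs)
 note d = dmat_props[OF assms(1) m(1) 1]
 show ?thesis using mulb_props[OF m(2) d(1) 3(1)] d by (simp add: 3(2) set_pairs)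
qed

lemma prv_nxt: "m < 4 ==> prv (nxt m) = m" "m < 4 ==> nxt (prv m) = m" "m < 4 ==> nxt m < 4" "m < 4 ==> prv m < 4"
 by (auto simp: prv_def nxt_def)

lemma hom_props:
 assumes "n < 4" "(g, m) \<in> set (pairs n)" "(c, h, j) \<in> set (homot n (g, m))"
 shows "(h, j) \<in> set (pairs (nxt n))" "gen_right (nxt n) h = gen_right n g"
 using hom_check[unfolded list_all_iff, THEN bspec, of n, THEN bspec, of "(g, m)", THEN bspec, of "(c, h, j)"] assms
 by (simp_all add: set_pairs)

lemma homotopy:
 assumes n: "n < 4" and Y: "\<And>t. t \<notin> set (pairs n) ==> Y t = 0"
 shows "apply_cols (set (pairs (nxt n))) (left_diff (nxt n)) (apply_cols (set (pairs n)) (homot n) Y) u +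
  apply_cols (set (pairs (prv n))) (homot (prv n)) (apply_cols (set (pairs n)) (left_diff n) Y) u = 2 * Y u"
proof -
 have id: "homotopy_identity n"
  using n homotopy_check_0 homotopy_check_1 homotopy_check_2 homotopy_check_3 by (auto simp: less_Suc_eq numeral_eq_Suc)
 have "apply_cols (set (pairs n)) (\<lambda>t. lin (left_diff (nxt n)) (homot n t) @
   lin (homot (prv n)) (left_diff n t) @ [(-2, t)]) Y u = 0"
  by (rule apply_cols_vanishes) (use id in \<open>auto simp: homotopy_identity_def list_all_iff\<close>)
 moreover have "apply_cols (set (pairs (nxt n))) (left_diff (nxt n)) (apply_cols (set (pairs n)) (homot n) Y) u =
   apply_cols (set (pairs n)) (\<lambda>t. lin (left_diff (nxt n)) (homot n t)) Y u"
  by (rule apply_cols_comp) (use hom_props[OF n] in auto)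
 moreover have "apply_cols (set (pairs (prv n))) (homot (prv n)) (apply_cols (set (pairs n)) (left_diff n) Y) u =
   apply_cols (set (pairs n)) (\<lambda>t. lin (homot (prv n)) (left_diff n t)) Y u"
  by (rule apply_cols_comp) (use left_diff_in_pairs[OF n] in auto)
 moreover have "apply_cols (set (pairs n)) (\<lambda>t. [(-2, t)]) Y u = - 2 * Y u"
  using Y[of u] by (simp add: apply_cols_diag)
 ultimately show ?thesis by (simp add: apply_cols_append) (simp add: algebra_simps)
qed

section \<open>Differentials on bimodules and exactness\<close>

context e8_algebra
begin

text \<open>The image of a generator, given by its coordinates; \<open>dmat\<close> lists the left
  factor first, hence the exchange of \<open>r\<close> and \<open>l\<close>.\<close>

definition dgen :: "nat => nat => nat => 'a env" where
 "dgen m g = (\<lambda>h. if h \<in> set (gens (prv m))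
   then R.elem (\<lambda>(r, l). of_int (coeff (dmat m g) (l, h, r))) else \<zero>\<^bsub>R\<^esub>)"

lemma dgen:
 assumes m: "m < 4" and g: "g \<in> set (gens m)"
 shows "dgen m g h \<in> carrier R"
  and "h \<in> set (gens (prv m)) ==> env_chi (dgen m g h) (r, l) = of_int (coeff (dmat m g) (l, h, r))"
  and "dgen m g \<in> carrier (QM (prv m))" "E m g \<odot>\<^bsub>QM (prv m)\<^esub> dgen m g = dgen m g"
proof -
 have e: "R.elem (\<lambda>(r, l). of_int (coeff (dmat m g) (l, h, r))) \<in> carrier R"
  "env_chi (R.elem (\<lambda>(r, l). of_int (coeff (dmat m g) (l, h, r)))) = (\<lambda>(r, l). of_int (coeff (dmat m g) (l, h, r)))" for h
  by (rule R.elem; use coeff_dmat[OF m g] in force)+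
 show c: "dgen m g h \<in> carrier R" for h using e by (simp add: dgen_def)
 show x: "env_chi (dgen m g h) (r, l) = of_int (coeff (dmat m g) (l, h, r))" if "h \<in> set (gens (prv m))" for h r l
  using that by (simp add: dgen_def e)
 show "dgen m g \<in> carrier (QM (prv m))"
 proof (rule QM_I)
  show "env_chi (dgen m g h) (r, l) = 0" if "h \<in> set (gens (prv m))" "(h, r, l) \<notin> blk (prv m)" for h r l
   using that coeff_dmat[OF m g, of l h r] by (auto simp: x blk_def)
 qed (use c in simp, simp add: dgen_def)
 show "E m g \<odot>\<^bsub>QM (prv m)\<^esub> dgen m g = dgen m g"
 proof
  fix h
  show "(E m g \<odot>\<^bsub>QM (prv m)\<^esub> dgen m g) h = dgen m g h"
  proof (cases "h \<in> set (gens (prv m))")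
   case True
   have "env_chi (vert (gen_right m g) (gen_left m g) \<otimes>\<^bsub>R\<^esub> dgen m g h) q = env_chi (dgen m g h) q" for q
    using coeff_dmat[OF m g, of "snd q" h "fst q"] gen_vertex[OF g] x[OF True, of "fst q" "snd q"]
    by (auto simp: chi_vert_times c)
   then have "E m g \<otimes>\<^bsub>R\<^esub> dgen m g h = dgen m g h"
    by (intro R.chi_eqI R.m_closed Q.e_closed[OF g] c) (simp add: E_def)
   then show ?thesis by simp
  qed (use Q.e_closed[OF g] in \<open>simp add: dgen_def\<close>)
 qed
qed

definition dq :: "nat => (nat => 'a env) => nat => 'a env" where
 "dq m = (\<lambda>f\<in>carrier (QM m). \<Oplus>\<^bsub>QM (prv m)\<^esub>g\<in>set (gens m). f g \<odot>\<^bsub>QM (prv m)\<^esub> dgen m g)"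

lemma dq_lin: "m < 4 ==> dq m \<in> lin_maps R (QM m) (QM (prv m))"
 and dq_gen: "m < 4 ==> g \<in> set (gens m) ==> dq m (ideal_sum.gen R (E m) g) = dgen m g"
 unfolding dq_def
 by (rule Q.lin_map_of_generators[OF Q.psum_left_module]; use dgen in blast)+

text \<open>In coordinates the module map becomes the evaluated matrix \<open>full_diff\<close>.
  Exactness and degrees of the maps \<open>dq\<close> are deduced through this formula.\<close>

lemma qchi_dq:
 assumes m: "m < 4" and f: "f \<in> carrier (QM m)"
 shows "qchi (prv m) (dq m f) = apply_cols (blk m) (full_diff m) (qchi m f)"
proof
 fix u :: "nat \<times> nat \<times> nat"
 obtain h k j where u: "u = (h, k, j)" by (cases u)
 interpret P: left_module R "QM (prv m)" by (rule Q.psum_left_module)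
 note fc = Q.psum_carrier(1)[OF f]
 show "qchi (prv m) (dq m f) u = apply_cols (blk m) (full_diff m) (qchi m f) u"
 proof (cases "h \<in> set (gens (prv m))")
  case False
  have "apply_cols (blk m) (full_diff m) (qchi m f) u = 0"
  proof (rule apply_cols_outside, rule notI)
   fix t assume t: "t \<in> blk m" "u \<in> snd ` set (full_diff m t)"
   then obtain c where "(c, u) \<in> set (full_diff m t)" by force
   from full_diff_in_blk(1)[OF m t(1) this] False show False by (simp add: u blk_def)
  qed
  then show ?thesis using False by (simp add: u qchi_def)
 next
  case h: True
  let ?B = "{..<48} \<times> {..<48 :: nat}"
  let ?c = "\<lambda>g r l l' r'. env_chi (f g) (r, l) * (of_int (coeff (dmat m g) (l', h, r')) * of_int (coeff (mulb l l') j) * of_int (coeff (mulb r' r) k))"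
  have cl: "f g \<odot>\<^bsub>QM (prv m)\<^esub> dgen m g \<in> carrier (QM (prv m))" if "g \<in> set (gens m)" for g
   using P.smult_closed[OF fc dgen(3)[OF m that]] .
  have eq: "dq m f h = (\<Oplus>\<^bsub>R\<^esub>g\<in>set (gens m). f g \<otimes>\<^bsub>R\<^esub> dgen m g h)"
   unfolding dq_def using f by (simp add: Q.psum_finsum[OF _ cl] del: Q.psum_simps) simp
  have "qchi (prv m) (dq m f) u = (\<Sum>g\<in>set (gens m). env_chi (f g \<otimes>\<^bsub>R\<^esub> dgen m g h) (k, j))"
   unfolding u qchi_in[OF h] eq by (rule R.chi_finsum) (use fc dgen(1)[OF m] in auto)
  also have "... = (\<Sum>g\<in>set (gens m). \<Sum>r<48. \<Sum>l<48. \<Sum>r'<48. \<Sum>l'<48. ?c g r l l' r')"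
  proof (rule sum.cong[OF refl])
   fix g assume g: "g \<in> set (gens m)"
   have "env_chi (f g \<otimes>\<^bsub>R\<^esub> dgen m g h) (k, j) =
     (\<Sum>p\<in>?B. \<Sum>q\<in>?B. env_chi (f g) p * env_chi (dgen m g h) q * env_\<mu> p q (k, j))"
    by (simp add: env_chi_mult[OF fc dgen(1)[OF m g]])
   also have "... = (\<Sum>r<48. \<Sum>l<48. \<Sum>r'<48. \<Sum>l'<48. ?c g r l l' r')"
    unfolding sum.cartesian_product' by (simp add: dgen(2)[OF m g h] env_\<mu>_def algebra_simps)
   finally show "env_chi (f g \<otimes>\<^bsub>R\<^esub> dgen m g h) (k, j) = (\<Sum>r<48. \<Sum>l<48. \<Sum>r'<48. \<Sum>l'<48. ?c g r l l' r')" .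
  qed
  also have "... = (\<Sum>g\<in>set (gens m). \<Sum>r<48. \<Sum>l<48. env_chi (f g) (r, l) * of_int (coeff (full_diff m (g, r, l)) (h, k, j)))"
  proof (intro sum.cong refl)
   fix g and r l :: nat assume g: "g \<in> set (gens m)"
   show "(\<Sum>r'<48. \<Sum>l'<48. ?c g r l l' r') = env_chi (f g) (r, l) * of_int (coeff (full_diff m (g, r, l)) (h, k, j))"
    unfolding coeff_full_diff[OF m g h] by (subst sum.swap) (simp add: sum_distrib_left)
  qed
  also have "... = (\<Sum>t\<in>set (gens m) \<times> {..<48} \<times> {..<48}. qchi m f t * of_int (coeff (full_diff m t) u))"
   unfolding sum.cartesian_product' by (intro sum.cong refl) (simp add: qchi_in u)
  also have "... = apply_cols (blk m) (full_diff m) (qchi m f) u"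
   unfolding apply_cols_def
   by (rule sum.mono_neutral_right) (use qchi_outside[OF f] in \<open>auto simp: blk_def\<close>)
  finally show ?thesis .
 qed
qed

lemma qchi_gen:
 assumes "g \<in> set (gens m)"
 shows "qchi m (ideal_sum.gen R (E m) g) t = (if t = (g, gen_right m g, gen_left m g) then 1 else 0)"
 using gen_vertex[OF assms] by (cases t) (auto simp: qchi_def Q.gen_def E_def vert assms)

text \<open>A linear map is determined on generators, and there the vanishing of the composite is
  the evaluated \<open>complex_identity\<close>.\<close>

lemma dq_dq:
 assumes m: "m < 4" and f: "f \<in> carrier (QM (nxt m))"
 shows "dq m (dq (nxt m) f) = \<zero>\<^bsub>QM (prv m)\<^esub>"
proof -
 interpret P: left_module R "QM (prv m)" by (rule Q.psum_left_module)
 interpret N: left_module R "QM (nxt m)" by (rule Q.psum_left_module)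
 note m' = prv_nxt[OF m]
 have l: "dq (nxt m) \<in> lin_maps R (QM (nxt m)) (QM m)" using dq_lin[OF m'(3)] m' by simp
 let ?\<phi> = "\<lambda>f\<in>carrier (QM (nxt m)). dq m (dq (nxt m) f)"
 have \<phi>: "?\<phi> \<in> lin_maps R (QM (nxt m)) (QM (prv m))"
  by (rule lin_mapsI) (auto simp del: Q.psum_simps simp: lin_mapsD(2-)[OF l] lin_mapsD(2-)[OF dq_lin[OF m]] N.smult_closed)
 have 0: "?\<phi> (ideal_sum.gen R (E (nxt m)) g) = \<zero>\<^bsub>QM (prv m)\<^esub>" if g: "g \<in> set (gens (nxt m))" for g
 proof (rule QC.chi_eqI)
  let ?g = "ideal_sum.gen R (E (nxt m)) g"
  have gc: "?g \<in> carrier (QM (nxt m))" by (rule Q.gen_closed[OF g])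
  show "?\<phi> ?g \<in> carrier (QM (prv m))" by (rule lin_mapsD(2)[OF \<phi> gc])
  fix u
  have id: "complex_identity m"
   using m complex_check_0 complex_check_1 complex_check_2 complex_check_3 by (auto simp: less_Suc_eq numeral_eq_Suc)
  have "qchi (prv m) (dq m (dq (nxt m) ?g)) u =
    apply_cols (blk m) (full_diff m) (apply_cols (blk (nxt m)) (full_diff (nxt m)) (qchi (nxt m) ?g)) u"
   using qchi_dq[OF m lin_mapsD(2)[OF l gc]] qchi_dq[OF m'(3) gc] m' by simp
  also have "... = apply_cols (blk (nxt m)) (\<lambda>t. lin (full_diff m) (full_diff (nxt m) t)) (qchi (nxt m) ?g) u"
   by (rule apply_cols_comp) (use full_diff_in_blk(1)[OF m'(3)] m' finite_blk in auto)
  also have "... = 0"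
   unfolding apply_cols_def
   by (rule sum.neutral) (use id g in \<open>auto simp: qchi_gen complex_identity_def list_all_iff vanishes_coeff\<close>)
  finally show "qchi (prv m) (?\<phi> ?g) u = qchi (prv m) \<zero>\<^bsub>QM (prv m)\<^esub> u"
   using gc by (simp add: QC.chi_zero[of "prv m", unfolded Q.psum_simps])
 qed (rule QC.zero_closed)
 have "?\<phi> f = (\<Oplus>\<^bsub>QM (prv m)\<^esub>g\<in>set (gens (nxt m)). f g \<odot>\<^bsub>QM (prv m)\<^esub> ?\<phi> (ideal_sum.gen R (E (nxt m)) g))"
  by (rule Q.lin_map_expand[OF P.left_module_axioms \<phi> f])
 also have "... = (\<Oplus>\<^bsub>QM (prv m)\<^esub>g\<in>set (gens (nxt m)). \<zero>\<^bsub>QM (prv m)\<^esub>)"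
  by (rule QC.finsum_cong') (use 0 P.smult_zero[OF Q.psum_carrier(1)[OF f]] in \<open>auto simp del: Q.psum_simps\<close>)
 finally show ?thesis using f by (simp del: Q.psum_simps)
qed

text \<open>The contraction is only available multiplied by 2, so the descent produces a preimage of
  \<open>f\<close> added to itself. The division by 2 is done with a scalar of the enveloping
  algebra, so that linearity of the differential carries it over to the preimage.\<close>

lemma half:
 obtains c where "c \<in> carrier R" "c \<oplus>\<^bsub>R\<^esub> c = \<one>\<^bsub>R\<^esub>"
proof
 let ?c = "(1 / 2) \<odot>\<^bsub>R\<^esub> \<one>\<^bsub>R\<^esub>"
 show c: "?c \<in> carrier R" by (rule env_chi_smult) simp
 show "?c \<oplus>\<^bsub>R\<^esub> ?c = \<one>\<^bsub>R\<^esub>"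
  by (rule R.chi_eqI) (use c in \<open>auto simp: R.chi_add env_chi_smult\<close>)
qed

text \<open>Exactness by descent on the degree of the right factors: the homotopy corrects the leading
 part, and what remains has right factors of larger degree.\<close>

lemma exactness:
 assumes m: "m < 4" and Ker: "Ker \<subseteq> carrier (QM m)"
  and step: "\<And>f f'. f \<in> Ker ==> f' \<in> carrier (QM (nxt m)) ==> (f \<oplus>\<^bsub>QM m\<^esub> f) \<ominus>\<^bsub>QM m\<^esub> dq (nxt m) f' \<in> Ker"
  and lead: "\<And>f p k u. f \<in> Ker ==> (\<And>g r l. wlen r < p ==> qchi m f (g, r, l) = 0) ==>
   wlen k \<le> p ==> apply_cols (set (pairs (prv m))) (homot (prv m))
    (apply_cols (set (pairs m)) (left_diff m) (\<lambda>(g, l). qchi m f (g, k, l))) u = 0"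
 shows "Ker \<subseteq> dq (nxt m) ` carrier (QM (nxt m))"
proof -
 interpret P: left_module R "QM m" by (rule Q.psum_left_module)
 interpret N: left_module R "QM (nxt m)" by (rule Q.psum_left_module)
 note m' = prv_nxt[OF m]
 have l: "dq (nxt m) \<in> lin_maps R (QM (nxt m)) (QM m)" using dq_lin[OF m'(3)] m' by simp
 interpret l: abelian_group_hom "QM (nxt m)" "QM m" "dq (nxt m)"
  by (rule lin_maps_group_hom[OF l QC.abelian_group_axioms QC.abelian_group_axioms])
 \<comment> \<open>Counting up to \<open>p = 6\<close>: basis paths have length at most 5, so an
   element without right factors shorter than 6 is zero.\<close>
 have main: "f \<in> dq (nxt m) ` carrier (QM (nxt m))"
  if "p + i = 6" "f \<in> Ker" "\<And>g r l. wlen r < p ==> qchi m f (g, r, l) = 0" for p i f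
  using that
 proof (induction i arbitrary: p f)
  case 0
  have f: "f \<in> carrier (QM m)" using 0 Ker by auto
  have "qchi m f t = 0" for t
  proof (cases "t \<in> blk m")
   case True
   obtain g r l where t: "t = (g, r, l)" by (cases t)
   have "wlen r \<le> 5" using True words_check by (auto simp: t blk_def list_all_iff)
   then show ?thesis using 0 by (simp add: t)
  qed (rule qchi_outside[OF f])
  then have "f = \<zero>\<^bsub>QM m\<^esub>"
   by (intro QC.chi_eqI[where m = m] f QC.zero_closed) (simp add: QC.chi_zero del: Q.psum_simps)
  also have "... = dq (nxt m) \<zero>\<^bsub>QM (nxt m)\<^esub>" by (simp del: Q.psum_simps)
  finally show ?case using QC.zero_closed by blast
 next
  case (Suc i)
  have f: "f \<in> carrier (QM m)" using Suc.prems Ker by auto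
  define y where "y = qchi m f"
  have y: "y t = 0" if "t \<notin> blk m" for t using qchi_outside[OF f that] by (simp add: y_def)
  define Y where "Y k = (\<lambda>(g, l). y (g, k, l))" for k
  have Y: "Y k t = 0" if "t \<notin> set (pairs m)" for k t
   using that y by (cases t) (auto simp: Y_def blk_def set_pairs)
  \<comment> \<open>The contraction is applied separately to the left factors belonging to each
    fixed right factor \<open>k\<close>. By \<open>hom_props\<close> it does not change the right
    end vertex of the generator, so the result still fits with \<open>k\<close>.\<close>
  define x where "x = (\<lambda>(h, k, j). if k < 48 then apply_cols (set (pairs m)) (homot m) (Y k) (h, j) else 0)"
  have x: "x t = 0" if "t \<notin> blk (nxt m)" for t
  proof -
   obtain h k j where t: "t = (h, k, j)" by (cases t)
   have "Y k s * of_int (coeff (homot m s) (h, j)) = 0" if k: "k < 48" and s: "s \<in> set (pairs m)" for s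
   proof (rule ccontr)
    assume nz: "Y k s * of_int (coeff (homot m s) (h, j)) \<noteq> 0"
    obtain g l' where s': "s = (g, l')" by (cases s)
    from nz obtain c where c: "(c, h, j) \<in> set (homot m (g, l'))" using coeff_nonzero s' by fastforce
    have "(g, k, l') \<in> blk m" using nz y by (auto simp: Y_def s')
    then have "b_src k = gen_right m g" by (simp add: blk_def)
    then show False using hom_props[OF m _ c] s s' \<open>t \<notin> blk (nxt m)\<close> k by (auto simp: t blk_def set_pairs)
   qed
   then show ?thesis by (auto simp: x_def t apply_cols_def intro!: sum.neutral)
  qed
  define f' where "f' = QC.elem (nxt m) x"
  have f': "f' \<in> carrier (QM (nxt m))" "qchi (nxt m) f' = x"
   unfolding f'_def by (rule QC.elem; use x in blast)+
  \<comment> \<open>Twice \<open>f\<close> minus the boundary just constructed. It vanishes on right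
    factors of length at most \<open>p\<close>, one more than was known for
    \<open>f\<close>.\<close>
  let ?z = "(f \<oplus>\<^bsub>QM m\<^esub> f) \<ominus>\<^bsub>QM m\<^esub> dq (nxt m) f'"
  have df': "dq (nxt m) f' \<in> carrier (QM m)" by (rule lin_mapsD(2)[OF l f'(1)])
  have z: "?z \<in> Ker" by (rule step[OF Suc.prems(2) f'(1)])
  have zchi: "qchi m ?z t = 2 * y t - apply_cols (blk (nxt m)) (full_diff (nxt m)) x t" for t
   using f df' qchi_dq[OF m'(3) f'(1)] f'(2) m'
   by (simp add: a_minus_def QC.chi_add QC.chi_minus y_def QC.a_closed del: Q.psum_simps)
  have "qchi m ?z (h, k, j) = 0" if k: "wlen k < Suc p" for h k j
  proof (cases "h \<in> set (gens m) \<and> k < 48")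
   case True
   have "apply_cols (blk (nxt m)) (full_diff (nxt m)) x (h, k, j) =
     apply_cols (set (pairs (nxt m))) (left_diff (nxt m)) (\<lambda>(g, l). x (g, k, l)) (h, j)"
   proof (rule apply_full_diff_leading[OF m'(3), where p = p])
    show "x (g, r, l) = 0" if "wlen r < p" for g r l
     using Suc.prems(3)[OF that] by (auto simp: x_def Y_def y_def intro!: apply_cols_zero)
   qed (use x k True m' in auto)
   also have "(\<lambda>(g, l). x (g, k, l)) = apply_cols (set (pairs m)) (homot m) (Y k)"
    using True by (auto simp: x_def fun_eq_iff)
   also have "apply_cols (set (pairs (nxt m))) (left_diff (nxt m)) (apply_cols (set (pairs m)) (homot m) (Y k)) (h, j) = 2 * Y k (h, j)"
   proof -
    have "apply_cols (set (pairs (prv m))) (homot (prv m))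
      (apply_cols (set (pairs m)) (left_diff m) (\<lambda>(g, l). qchi m f (g, k, l))) (h, j) = 0"
     by (rule lead[OF Suc.prems(2), of p]) (use Suc.prems(3) k in auto)
    then show ?thesis using homotopy[of m "Y k" "(h, j)", OF m Y] by (simp add: Y_def y_def)
   qed
   finally show ?thesis using zchi[of "(h, k, j)"] by (simp add: Y_def del: Q.psum_simps)
  next
   case False
   then show ?thesis using qchi_outside[of ?z m "(h, k, j)"] z Ker by (auto simp: blk_def)
  qed
  then have "?z \<in> dq (nxt m) ` carrier (QM (nxt m))"
   by (intro Suc.IH[of "Suc p"] z) (use Suc.prems in auto)
  then obtain f'' where f'': "f'' \<in> carrier (QM (nxt m))" "?z = dq (nxt m) f''" by blast
  have "f \<oplus>\<^bsub>QM m\<^esub> f = ?z \<oplus>\<^bsub>QM m\<^esub> dq (nxt m) f'"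
   using f df' by (simp add: a_minus_def QC.a_assoc QC.l_neg del: Q.psum_simps)
  also have "... = dq (nxt m) (f'' \<oplus>\<^bsub>QM (nxt m)\<^esub> f')"
   unfolding f''(2) by (rule l.hom_add[symmetric, OF f''(1) f'(1)])
  finally have ff: "f \<oplus>\<^bsub>QM m\<^esub> f = dq (nxt m) (f'' \<oplus>\<^bsub>QM (nxt m)\<^esub> f')" .
  obtain c where c: "c \<in> carrier R" "c \<oplus>\<^bsub>R\<^esub> c = \<one>\<^bsub>R\<^esub>" by (rule half)
  have "f = (c \<oplus>\<^bsub>R\<^esub> c) \<odot>\<^bsub>QM m\<^esub> f" unfolding c(2) by (rule P.smult_one[OF f, symmetric])
  also have "... = c \<odot>\<^bsub>QM m\<^esub> (f \<oplus>\<^bsub>QM m\<^esub> f)"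
   unfolding P.smult_l_distr[OF c(1) c(1) f] P.smult_r_distr[OF c(1) f f] ..
  also have "... = dq (nxt m) (c \<odot>\<^bsub>QM (nxt m)\<^esub> (f'' \<oplus>\<^bsub>QM (nxt m)\<^esub> f'))"
   unfolding ff by (rule lin_mapsD(4)[OF l c(1) QC.a_closed[OF f''(1) f'(1)], symmetric])
  finally show ?case using N.smult_closed[OF c(1) QC.a_closed[OF f''(1) f'(1)]] by blast
 qed
 show ?thesis using main[of 0 6] by auto
qed

text \<open>The condition on leading parts in \<open>exactness\<close> holds since the leading part
  of \<open>dq m f\<close> is the left differential of the leading part of \<open>f\<close>, and
  \<open>dq m f\<close> is zero.\<close>

lemma exact:
 assumes m: "m < 4"
 shows "dq (nxt m) ` carrier (QM (nxt m)) = {f \<in> carrier (QM m). dq m f = \<zero>\<^bsub>QM (prv m)\<^esub>}"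
proof
 interpret P: left_module R "QM m" by (rule Q.psum_left_module)
 interpret V: left_module R "QM (prv m)" by (rule Q.psum_left_module)
 note m' = prv_nxt[OF m]
 have l: "dq (nxt m) \<in> lin_maps R (QM (nxt m)) (QM m)" using dq_lin[OF m'(3)] m' by simp
 interpret d: abelian_group_hom "QM m" "QM (prv m)" "dq m"
  by (rule lin_maps_group_hom[OF dq_lin[OF m] QC.abelian_group_axioms QC.abelian_group_axioms])
 show "dq (nxt m) ` carrier (QM (nxt m)) \<subseteq> {f \<in> carrier (QM m). dq m f = \<zero>\<^bsub>QM (prv m)\<^esub>}"
  using lin_mapsD(2)[OF l] dq_dq[OF m] by blast
 show "{f \<in> carrier (QM m). dq m f = \<zero>\<^bsub>QM (prv m)\<^esub>} \<subseteq> dq (nxt m) ` carrier (QM (nxt m))" (is "?K \<subseteq> _")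
 proof (rule exactness[OF m])
  show "(f \<oplus>\<^bsub>QM m\<^esub> f) \<ominus>\<^bsub>QM m\<^esub> dq (nxt m) f' \<in> ?K"
   if f: "f \<in> ?K" and f': "f' \<in> carrier (QM (nxt m))" for f f'
  proof -
   have c: "f \<in> carrier (QM m)" "dq (nxt m) f' \<in> carrier (QM m)" using f lin_mapsD(2)[OF l f'] by auto
   have z: "dq m f = \<zero>\<^bsub>QM (prv m)\<^esub>" "dq m (dq (nxt m) f') = \<zero>\<^bsub>QM (prv m)\<^esub>" using f dq_dq[OF m f'] by auto
   show ?thesis using c z by (simp add: a_minus_def del: Q.psum_simps)
  qed
  fix f p k u assume f: "f \<in> ?K" and low: "\<And>g r l. wlen r < p ==> qchi m f (g, r, l) = 0"
   and k: "wlen k \<le> p"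
  have fc: "f \<in> carrier (QM m)" "dq m f = \<zero>\<^bsub>QM (prv m)\<^esub>" using f by auto
  show "apply_cols (set (pairs (prv m))) (homot (prv m))
    (apply_cols (set (pairs m)) (left_diff m) (\<lambda>(g, l). qchi m f (g, k, l))) u = 0"
  proof (rule apply_cols_zero)
   fix i assume i: "i \<in> set (pairs (prv m))"
   obtain h j where i': "i = (h, j)" by (cases i)
   have "apply_cols (set (pairs m)) (left_diff m) (\<lambda>(g, l). qchi m f (g, k, l)) (h, j) =
     qchi (prv m) (dq m f) (h, k, j)"
    unfolding qchi_dq[OF m fc(1)]
    by (rule apply_full_diff_leading[of m "qchi m f" p h k j, symmetric])
     (use m qchi_outside[OF fc(1)] low k i in \<open>auto simp: i' set_pairs\<close>)
   then show "apply_cols (set (pairs m)) (left_diff m) (\<lambda>(g, l). qchi m f (g, k, l)) i = 0"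
    by (simp add: fc(2) i' QC.chi_zero del: Q.psum_simps)
  qed
 qed auto
qed

end

section \<open>Grading and augmentation\<close>

lemma prv_mod: "prv (Suc n mod 4) = n mod 4" and nxt_mod: "nxt (n mod 4) = Suc n mod 4"
proof -
 have "n mod 4 < 4" by simp
 then consider "n mod 4 = 0" | "n mod 4 = 1" | "n mod 4 = 2" | "n mod 4 = 3" by linarith
 then show "prv (Suc n mod 4) = n mod 4" "nxt (n mod 4) = Suc n mod 4"
  by cases (simp_all add: mod_Suc prv_def nxt_def)
qed

lemma aug_rel_check: "list_all (\<lambda>g. vanishes (lin (\<lambda>(l, h, r). mulb l r) (dmat 1 g))) (gens 1)"
 by code_simp

text \<open>A generator at position \<open>m\<close> of the period has degree \<open>m\<close>, and
  each full period adds 8: the step from position 3 to the next position 0 adds the length 5 of the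
  Casimir element to the degree 3.\<close>

definition qdeg :: "nat => nat \<times> nat \<times> nat => int" where
 "qdeg n = (\<lambda>(g, r, l). int (wlen r) + int (wlen l) + int (n mod 4) + 8 * int (n div 4))"

context e8_algebra
begin

abbreviation "GR \<equiv> enveloping_grading A GA"

definition GQ :: "nat => int => (nat => 'a env) set" where
 "GQ n = QC.homogeneous (n mod 4) (qdeg n)"

lemma GQ_iff: "f \<in> GQ n j \<longleftrightarrow> f \<in> carrier (QM (n mod 4)) \<and> (\<forall>t. qchi (n mod 4) f t \<noteq> 0 --> qdeg n t = j)"
 by (simp add: GQ_def QC.homogeneous_def)

lemma Q_graded: "graded_module R GR (QM (n mod 4)) (GQ n)"
 unfolding graded_module_def
proof (intro conjI allI ballI Q.psum_left_module)
 show "subgroup (GQ n j) (add_monoid (QM (n mod 4)))" for j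
  unfolding GQ_def by (rule QC.homogeneous_subgroup)
 show "\<exists>!c. (\<forall>j. c j \<in> GQ n j) \<and> finite {j. c j \<noteq> \<zero>\<^bsub>QM (n mod 4)\<^esub>} \<and>
   x = (\<Oplus>\<^bsub>QM (n mod 4)\<^esub>j\<in>{j. c j \<noteq> \<zero>\<^bsub>QM (n mod 4)\<^esub>}. c j)" if "x \<in> carrier (QM (n mod 4))" for x
  unfolding GQ_def by (rule QC.homogeneous_decomposition[OF that])
 fix i j X f assume X0: "X \<in> GR i" and f: "f \<in> GQ n j"
 interpret P: left_module R "QM (n mod 4)" by (rule Q.psum_left_module)
 have X: "X \<in> R.homogeneous env_dg i" using X0 by (simp only: env_grading)
 then have Xc: "X \<in> carrier R" by (simp add: R.homogeneous_def)
 have fc: "f \<in> carrier (QM (n mod 4))" using f by (simp add: GQ_iff)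
 have "qdeg n (g, q) = i + j" if g: "g \<in> set (gens (n mod 4))" and nz: "env_chi (X \<otimes>\<^bsub>R\<^esub> f g) q \<noteq> 0" for g q
 proof -
  let ?B = "{..<48} \<times> {..<48 :: nat}"
  obtain p where "(\<Sum>p'\<in>?B. env_chi X p * env_chi (f g) p' * env_\<mu> p p' q) \<noteq> 0"
   using nz unfolding env_chi_mult[OF Xc Q.psum_carrier(1)[OF fc]] by (meson sum.neutral)
  then obtain p' where n: "env_chi X p * env_chi (f g) p' * env_\<mu> p p' q \<noteq> 0" by (meson sum.neutral)
  have "env_dg p = i" using X n by (cases p) (auto simp: R.homogeneous_def)
  moreover have "qdeg n (g, p') = j" using f n g by (cases p') (auto simp: GQ_iff qchi_def)
  moreover have "p \<in> ?B" "p' \<in> ?B"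
   using n R.chi_outside[OF Xc, of p] R.chi_outside[OF Q.psum_carrier(1)[OF fc], of p' g] by auto
  then have "env_dg q = env_dg p + env_dg p'" using n RC.\<mu>_graded by auto
  ultimately show ?thesis by (cases p; cases p'; cases q) (simp add: qdeg_def env_dg_def)
 qed
 then show "X \<odot>\<^bsub>QM (n mod 4)\<^esub> f \<in> GQ n (i + j)"
  using P.smult_closed[OF Xc fc] by (auto simp: GQ_iff qchi_def)
qed

lemma dq_deg: "dq (Suc n mod 4) \<in> deg_maps R (QM (Suc n mod 4)) (GQ (Suc n)) (QM (n mod 4)) (GQ n) 0"
proof -
 have m: "Suc n mod 4 < 4" by simp
 have "dq (Suc n mod 4) f \<in> GQ n j" if f: "f \<in> GQ (Suc n) j" for f j
 proof -
  have fc: "f \<in> carrier (QM (Suc n mod 4))" using f by (simp add: GQ_iff)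
  have dc: "dq (Suc n mod 4) f \<in> carrier (QM (n mod 4))"
   using lin_mapsD(2)[OF dq_lin[OF m] fc] by (simp add: prv_mod)
  have "qdeg n u = j" if nz: "qchi (n mod 4) (dq (Suc n mod 4) f) u \<noteq> 0" for u
  proof -
   have "apply_cols (blk (Suc n mod 4)) (full_diff (Suc n mod 4)) (qchi (Suc n mod 4) f) u \<noteq> 0"
    using nz qchi_dq[OF m fc] by (simp add: prv_mod)
   then obtain t where t: "t \<in> blk (Suc n mod 4)"
    "qchi (Suc n mod 4) f t * of_int (coeff (full_diff (Suc n mod 4) t) u) \<noteq> 0"
    unfolding apply_cols_def by (meson sum.neutral)
   then obtain c where "(c, u) \<in> set (full_diff (Suc n mod 4) t)" using coeff_nonzero by fastforce
   note d = full_diff_in_blk(2)[OF m t(1) this, unfolded prv_mod]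
   have "qchi (Suc n mod 4) f t \<noteq> 0" using t(2) by auto
   then have j: "qdeg (Suc n) t = j" using f unfolding GQ_iff by blast
   \<comment> \<open>Crossing a period resets the position to 0 but increases
     \<open>n div 4\<close>; the summand 8 in \<open>full_diff_in_blk\<close> compensates
     this.\<close>
   have e: "Suc n mod 4 + (if Suc n mod 4 = 0 then 8 else 0) + 8 * (n div 4) = Suc n mod 4 + 8 * (Suc n div 4)"
    by (simp add: mod_Suc div_Suc)
   obtain g r l g' r' l' where tu: "t = (g, r, l)" "u = (g', r', l')" by (cases t; cases u)
   have "wlen r' + wlen l' + n mod 4 + 8 * (n div 4) =
     wlen r + wlen l + Suc n mod 4 + 8 * (Suc n div 4)"
    using d e by (simp add: tu)
   then have "qdeg n u = qdeg (Suc n) t" unfolding tu qdeg_def prod.case by linarith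
   then show ?thesis using j by simp
  qed
  then show ?thesis using dc by (simp add: GQ_iff)
 qed
 then show ?thesis using dq_lin[OF m] by (auto simp: deg_maps_def prv_mod)
qed

text \<open>Each generator goes to its vertex, so on tensors this is multiplication, as
  \<open>aug_chi\<close> makes explicit.\<close>

definition aug :: "(nat => 'a env) => 'a" where
 "aug = (\<lambda>f\<in>carrier (QM 0). \<Oplus>\<^bsub>M\<^esub>g\<in>set (gens 0). f g \<odot>\<^bsub>M\<^esub> basis g)"

lemma gens_0: "set (gens 0) = {..<4}"
 by (auto simp: gens_def)

lemma basis_48: "g < 48 ==> basis g \<in> carrier A" "g < 48 ==> chi (basis g) k = (if k = g then 1 else 0)"
 by (simp_all add: basis)

lemma basis_mult: "i < 48 ==> j < 48 ==> chi (basis i \<otimes>\<^bsub>A\<^esub> basis j) k = of_int (coeff (mulb i j) k)"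
proof -
 assume ij: "i < 48" "j < 48"
 have "chi (basis i \<otimes>\<^bsub>A\<^esub> basis j) k = (\<Sum>i'<48. \<Sum>j'<48. if j' = j then (if i' = i then of_int (coeff (mulb i j) k) else 0) else 0)"
  unfolding chi_mult[OF basis_48(1)[OF ij(1)] basis_48(1)[OF ij(2)]]
  by (intro sum.cong refl) (auto simp: basis_48(2) ij)
 then show ?thesis using ij by (simp add: sum.delta)
qed

lemma basis_vertex_idem: "g < 4 ==> basis g \<otimes>\<^bsub>A\<^esub> basis g = basis g"
 by (rule chi_eqI) (auto simp: basis_48 basis_mult mulb_vertex_left coeff_Cons)

lemma E_0: "g < 4 ==> E 0 g = tens (basis g) (basis g)"
 by (simp add: E_def gen_left_def gen_right_def env_basis)

lemma E_act_basis: "g \<in> set (gens 0) ==> E 0 g \<odot>\<^bsub>M\<^esub> basis g = basis g"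
 by (simp add: gens_0 E_0 act_tens basis_48 basis_vertex_idem)

lemma aug_lin: "aug \<in> lin_maps R (QM 0) M"
 and aug_gen: "g \<in> set (gens 0) ==> aug (ideal_sum.gen R (E 0) g) = basis g"
 unfolding aug_def
 by (rule Q.lin_map_of_generators[OF bimodule_left_module]; use E_act_basis basis_48 gens_0 in force)+

lemma aug_chi:
 assumes f: "f \<in> carrier (QM 0)"
 shows "chi (aug f) k = (\<Sum>(g, r, l)\<in>blk 0. qchi 0 f (g, r, l) * of_int (coeff (mulb l r) k))"
proof -
 let ?B = "{..<48} \<times> {..<48 :: nat}"
 note fc = Q.psum_carrier(1)[OF f]
 have b: "basis g \<in> carrier A" if "g \<in> set (gens 0)" for g using that by (simp add: gens_0 basis_48)
 have "chi (aug f) k = (\<Sum>g\<in>set (gens 0). chi (f g \<odot>\<^bsub>M\<^esub> basis g) k)"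
  unfolding aug_def using f act(1)[OF fc b] by (subst M.chi_finsum[symmetric]) auto
 also have "... = (\<Sum>g\<in>set (gens 0). \<Sum>p\<in>?B. env_chi (f g) p * act_\<mu> p g k)"
 proof (rule sum.cong[OF refl])
  fix g assume g: "g \<in> set (gens 0)"
  then have g4: "g < 48" by (simp add: gens_0)
  have "chi (f g \<odot>\<^bsub>M\<^esub> basis g) k = (\<Sum>p\<in>?B. \<Sum>n<48. if n = g then env_chi (f g) p * act_\<mu> p g k else 0)"
   unfolding act(2)[OF fc b[OF g]] by (intro sum.cong refl) (auto simp: basis_48(2)[OF g4])
  then show "chi (f g \<odot>\<^bsub>M\<^esub> basis g) k = (\<Sum>p\<in>?B. env_chi (f g) p * act_\<mu> p g k)"
   using g4 by (simp add: sum.delta)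
 qed
 also have "... = (\<Sum>(g, p)\<in>set (gens 0) \<times> ?B. qchi 0 f (g, p) * act_\<mu> p g k)"
  unfolding sum.cartesian_product by (intro sum.cong refl) (auto simp: qchi_in)
 also have "... = (\<Sum>(g, r, l)\<in>blk 0. qchi 0 f (g, r, l) * of_int (coeff (mulb l r) k))"
 proof (rule sum.mono_neutral_cong_right)
  show "finite (set (gens 0) \<times> {..<48 :: nat} \<times> {..<48 :: nat})" by simp
  show "blk 0 \<subseteq> set (gens 0) \<times> ?B" by (auto simp: blk_def)
  show "\<forall>t\<in>set (gens 0) \<times> ?B - blk 0. (case t of (g, p) => qchi 0 f (g, p) * act_\<mu> p g k) = 0"
   using qchi_outside[OF f] by (auto simp del: Q.psum_simps)
  fix t assume t: "t \<in> blk 0"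
  obtain g r l where t': "t = (g, r, l)" by (cases t)
  have g: "g < 4" "b_tgt l = g" using t by (auto simp: t' blk_def gens_0 gen_left_def)
  have "act_\<mu> (r, l) g k = (\<Sum>j<48. if j = l then of_int (coeff (mulb l r) k) else 0)"
   unfolding act_\<mu>_def by (intro sum.cong refl) (auto simp: mulb_vertex_right[OF g(1)] g(2) coeff_Cons)
  also have "... = of_int (coeff (mulb l r) k)" using t by (simp add: t' blk_def sum.delta)
  finally show "(case t of (g, p) => qchi 0 f (g, p) * act_\<mu> p g k) =
    (case t of (g, r, l) => qchi 0 f (g, r, l) * of_int (coeff (mulb l r) k))" by (simp add: t')
 qed
 finally show ?thesis .
qed

lemma aug_dq:
 assumes f: "f \<in> carrier (QM 1)"
 shows "aug (dq 1 f) = \<zero>\<^bsub>A\<^esub>"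
proof -
 interpret N: left_module R "QM 1" by (rule Q.psum_left_module)
 have l: "dq 1 \<in> lin_maps R (QM 1) (QM 0)" using dq_lin[of 1] by (simp add: prv_def)
 let ?\<phi> = "\<lambda>f\<in>carrier (QM 1). aug (dq 1 f)"
 have \<phi>: "?\<phi> \<in> lin_maps R (QM 1) M"
  by (rule lin_mapsI) (auto simp del: Q.psum_simps One_nat_def bimodule_simps simp: lin_mapsD(2-)[OF l] lin_mapsD(2-)[OF aug_lin] N.smult_closed)
 have 0: "?\<phi> (ideal_sum.gen R (E 1) g) = \<zero>\<^bsub>A\<^esub>" if g: "g \<in> set (gens 1)" for g
 proof -
  let ?g = "ideal_sum.gen R (E 1) g"
  have gc: "?g \<in> carrier (QM 1)" by (rule Q.gen_closed[OF g])
  have D: "dq 1 ?g = dgen 1 g" "dgen 1 g \<in> carrier (QM 0)"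
   using dq_gen[of 1 g] dgen(3)[of 1 g] g by (simp_all add: prv_def)
  have "chi (aug (dgen 1 g)) k = 0" for k
  proof -
   have "chi (aug (dgen 1 g)) k =
     (\<Sum>(h, r, l)\<in>blk 0. of_int (coeff (dmat 1 g) (l, h, r)) * of_int (coeff (mulb l r) k))"
    unfolding aug_chi[OF D(2)]
    by (rule sum.cong) (use dgen(2)[of 1 g] g in \<open>auto simp: blk_def qchi_def prv_def\<close>)
   also have "... = (\<Sum>(l, h, r)\<in>(\<lambda>(h, r, l). (l, h, r)) ` blk 0. of_int (coeff (dmat 1 g) (l, h, r)) * of_int (coeff (mulb l r) k))"
    by (subst sum.reindex) (auto simp: inj_on_def case_prod_unfold)
   also have "... = of_int (coeff (lin (\<lambda>(l, h, r). mulb l r) (dmat 1 g)) k)"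
   proof -
    have "(l, h, r) \<in> (\<lambda>(h, r, l). (l, h, r)) ` blk 0" if "(c, l, h, r) \<in> set (dmat 1 g)" for c l h r
     using dmat_props[OF _ g that] by (force simp: blk_def prv_def)
    then have "snd ` set (dmat 1 g) \<subseteq> (\<lambda>(h, r, l). (l, h, r)) ` blk 0" by auto
    from coeff_lin[OF _ this, of "\<lambda>(l, h, r). mulb l r" k] show ?thesis
     by (simp add: finite_blk case_prod_unfold)
   qed
   also have "... = 0" using aug_rel_check g by (simp add: list_all_iff vanishes_coeff)
   finally show ?thesis .
  qed
  then have "aug (dgen 1 g) = \<zero>\<^bsub>A\<^esub>" using lin_mapsD(2)[OF aug_lin D(2)] by (intro chi_eqI) auto
  then show ?thesis using gc D by simp
 qed
 have "?\<phi> f = (\<Oplus>\<^bsub>M\<^esub>g\<in>set (gens 1). f g \<odot>\<^bsub>M\<^esub> ?\<phi> (ideal_sum.gen R (E 1) g))"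
  by (rule Q.lin_map_expand[OF bimodule_left_module \<phi> f])
 also have "... = (\<Oplus>\<^bsub>M\<^esub>g\<in>set (gens 1). \<zero>\<^bsub>M\<^esub>)"
  by (rule M.finsum_cong') (use 0 M.smult_zero[OF Q.psum_carrier(1)[OF f]] in \<open>auto simp del: restrict_apply\<close>)
 also have "... = \<zero>\<^bsub>M\<^esub>" by (rule M.finsum_zero)
 finally show ?thesis using f by simp
qed

lemma aug_kernel:
 "dq 1 ` carrier (QM 1) = {f \<in> carrier (QM 0). aug f = \<zero>\<^bsub>A\<^esub>}"
proof
 interpret P: left_module R "QM 0" by (rule Q.psum_left_module)
 have l: "dq 1 \<in> lin_maps R (QM 1) (QM 0)" using dq_lin[of 1] by (simp add: prv_def)
 interpret aug: abelian_group_hom "QM 0" M aug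
  by (rule lin_maps_group_hom[OF aug_lin QC.abelian_group_axioms M.abelian_group_axioms])
 show "dq 1 ` carrier (QM 1) \<subseteq> {f \<in> carrier (QM 0). aug f = \<zero>\<^bsub>A\<^esub>}"
  using lin_mapsD(2)[OF l] aug_dq by blast
 have "{f \<in> carrier (QM 0). aug f = \<zero>\<^bsub>A\<^esub>} \<subseteq> dq (nxt 0) ` carrier (QM (nxt 0))" (is "?K \<subseteq> _")
 proof (rule exactness)
  have nxt0: "nxt 0 = 1" by (simp add: nxt_def)
  show "(f \<oplus>\<^bsub>QM 0\<^esub> f) \<ominus>\<^bsub>QM 0\<^esub> dq (nxt 0) f' \<in> ?K"
   if f: "f \<in> ?K" and f': "f' \<in> carrier (QM (nxt 0))" for f f'
  proof -
   have c: "f \<in> carrier (QM 0)" "dq 1 f' \<in> carrier (QM 0)" using f f' lin_mapsD(2)[OF l] by (auto simp: nxt0)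
   have z: "aug f = \<zero>\<^bsub>M\<^esub>" "aug (dq 1 f') = \<zero>\<^bsub>M\<^esub>" using f f' aug_dq by (auto simp: nxt0)
   have "aug ((f \<oplus>\<^bsub>QM 0\<^esub> f) \<ominus>\<^bsub>QM 0\<^esub> dq 1 f') = \<zero>\<^bsub>M\<^esub>"
    unfolding a_minus_def using c z M.a_inv_closed
    by (simp add: aug.hom_add aug.hom_a_inv del: Q.psum_simps bimodule_simps)
   then show ?thesis using c by (simp add: nxt0 del: Q.psum_simps)
  qed
  fix f p k u assume f: "f \<in> ?K" and low: "\<And>g r l. wlen r < p ==> qchi 0 f (g, r, l) = 0"
   and k: "wlen k \<le> p"
  have fc: "f \<in> carrier (QM 0)" "aug f = \<zero>\<^bsub>A\<^esub>" using f by auto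
  \<comment> \<open>A product of \<open>l'\<close> and \<open>r'\<close> that reaches
    \<open>k\<close> has a right factor of length at least \<open>p\<close>, hence at least the
    length of \<open>k\<close>. So \<open>l'\<close> is a vertex, and a single term of
    \<open>aug f\<close> survives.\<close>
  have zero: "qchi 0 f (g, k, l) = 0" if l: "l < 4" for g l
  proof (cases "(g, k, l) \<in> blk 0")
   case True
   have gkl: "k < 48" "g < 4" "g = l" "b_src k = g"
    using True l by (auto simp: blk_def gens_0 gen_left_def gen_right_def)
   have "0 = chi (aug f) k" using fc(2) by simp
   also have "... = (\<Sum>t\<in>blk 0. if t = (g, k, l) then qchi 0 f (g, k, l) else 0)"
    unfolding aug_chi[OF fc(1)]
   proof (rule sum.cong[OF refl])
    fix t assume t: "t \<in> blk 0"
    obtain g' r' l' where t': "t = (g', r', l')" by (cases t)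
    have b: "r' < 48" "l' < 48" "b_src r' = g'" "b_tgt l' = g'"
     using t by (auto simp: t' blk_def gen_left_def gen_right_def)
    have "qchi 0 f t * of_int (coeff (mulb l' r') k) = (if t = (g, k, l) then qchi 0 f (g, k, l) else 0)"
    proof (cases "qchi 0 f t = 0 \<or> coeff (mulb l' r') k = 0")
     case True
     have "mulb l k = [(1, k)]" using gkl by (simp add: mulb_vertex_left)
     then show ?thesis using True by (auto simp: t' coeff_Cons)
    next
     case False
     then have "p \<le> wlen r'" using low[of r' g' l'] by (auto simp: t' not_less[symmetric])
     moreover have "wlen k = wlen l' + wlen r'"
      using coeff_mulb(2)[OF b(2,1)] False by auto
     ultimately have "wlen l' = 0" using k by linarith
     then have "words l' = []" by simp
     then have l'4: "l' < 4" using words_Nil[OF b(2)] by simp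
     then have "mulb l' r' = [(1, r')]" using b by (simp add: mulb_vertex_left)
     moreover from this have "r' = k" using False by (auto simp: coeff_Cons split: if_splits)
     ultimately show ?thesis using l'4 b gkl by (simp add: t' coeff_Cons)
    qed
    then show "(case t of (g, r, l) => qchi 0 f (g, r, l) * of_int (coeff (mulb l r) k)) =
      (if t = (g, k, l) then qchi 0 f (g, k, l) else 0)" by (simp add: t')
   qed
   also have "... = qchi 0 f (g, k, l)" using True finite_blk by (simp add: sum.delta)
   finally show ?thesis by simp
  qed (rule qchi_outside[OF fc(1)])
  have "apply_cols (set (pairs (prv 0))) (homot (prv 0)) (apply_cols (set (pairs 0)) (left_diff 0) (\<lambda>(g, l). qchi 0 f (g, k, l))) u =
    apply_cols (set (pairs 0)) (\<lambda>t. lin (homot (prv 0)) (left_diff 0 t)) (\<lambda>(g, l). qchi 0 f (g, k, l)) u"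
   by (rule apply_cols_comp) (use left_diff_in_pairs[of 0] in auto)
  also have "... = 0"
   unfolding apply_cols_def
  proof (rule sum.neutral, rule ballI)
   fix t assume t: "t \<in> set (pairs 0)"
   show "(case t of (g, l) => qchi 0 f (g, k, l)) * of_int (coeff (lin (homot (prv 0)) (left_diff 0 t)) u) = 0"
   proof (cases "snd t < 4")
    case True
    then show ?thesis using zero by (cases t) auto
   next
    case False
    then have "vanishes (lin (homot (prv 0)) (left_diff 0 t))"
     using aug_check t by (auto simp: list_all_iff prv_def)
    then show ?thesis by (simp add: vanishes_coeff)
   qed
  qed
  finally show "apply_cols (set (pairs (prv 0))) (homot (prv 0))
    (apply_cols (set (pairs 0)) (left_diff 0) (\<lambda>(g, l). qchi 0 f (g, k, l))) u = 0" .
 qed auto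
 then show "?K \<subseteq> dq 1 ` carrier (QM 1)" by (simp add: nxt_def)
qed

lemma one_expand: "\<one>\<^bsub>A\<^esub> = (\<Oplus>\<^bsub>A\<^esub>g\<in>{..<4}. basis g)"
proof (rule chi_eqI)
 show "(\<Oplus>\<^bsub>A\<^esub>g\<in>{..<4}. basis g) \<in> carrier A" by (rule finsum_closed) (auto simp: basis_48)
 fix k
 have "chi (\<Oplus>\<^bsub>A\<^esub>g\<in>{..<4}. basis g) k = (\<Sum>g<4. if k = g then 1 else 0)"
  by (subst chi_finsum) (auto simp: basis_48)
 then show "chi \<one>\<^bsub>A\<^esub> k = chi (\<Oplus>\<^bsub>A\<^esub>g\<in>{..<4}. basis g) k" by (simp add: chi_one)
qed simp

lemma aug_surj: "aug ` carrier (QM 0) = carrier M"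
proof
 show "aug ` carrier (QM 0) \<subseteq> carrier M" using lin_mapsD(2)[OF aug_lin] by blast
 show "carrier M \<subseteq> aug ` carrier (QM 0)"
 proof
  fix a assume "a \<in> carrier M"
  then have a: "a \<in> carrier A" by simp
  \<comment> \<open>The tensors of \<open>a e\<close> and \<open>e\<close>, over all vertices
    \<open>e\<close>, multiply to \<open>a\<close> because the vertices add up to the unit.\<close>
  define f where "f = (\<lambda>g. if g \<in> set (gens 0) then tens (basis g) (a \<otimes>\<^bsub>A\<^esub> basis g) else \<zero>\<^bsub>R\<^esub>)"
  have b: "basis g \<in> carrier A" if "g < 4" for g using that by (simp add: basis_48)
  have f: "f \<in> carrier (QM 0)"
  proof (rule Q.psum_carrierI)
   show "f g \<in> carrier R" if "g \<in> set (gens 0)" for g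
    using that a b by (auto simp: f_def gens_0 intro!: tens_closed)
   show "f g \<otimes>\<^bsub>R\<^esub> E 0 g = f g" if "g \<in> set (gens 0)" for g
    using that a b by (simp add: f_def gens_0 E_0 tens_mult m_assoc basis_vertex_idem)
  qed (simp add: f_def)
  have "aug f = (\<Oplus>\<^bsub>M\<^esub>g\<in>set (gens 0). f g \<odot>\<^bsub>M\<^esub> basis g)" using f by (simp add: aug_def)
  also have "... = (\<Oplus>\<^bsub>M\<^esub>g\<in>{..<4}. a \<otimes>\<^bsub>A\<^esub> basis g)"
   by (rule M.finsum_cong') (use a b in \<open>auto simp: gens_0 f_def act_tens m_assoc basis_vertex_idem\<close>)
  also have "... = (\<Oplus>\<^bsub>A\<^esub>g\<in>{..<4}. a \<otimes>\<^bsub>A\<^esub> basis g)" by (simp add: finsum_def finprod_def)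
  also have "... = a \<otimes>\<^bsub>A\<^esub> (\<Oplus>\<^bsub>A\<^esub>g\<in>{..<4}. basis g)"
   by (rule finsum_rdistr[symmetric]) (use a b in auto)
  also have "... = a" using a by (simp add: one_expand[symmetric])
  finally show "a \<in> aug ` carrier (QM 0)" using f by blast
 qed
qed

lemma aug_deg: "aug \<in> deg_maps R (QM 0) (GQ 0) M GA 0"
proof -
 have "aug f \<in> GA j" if f: "f \<in> GQ 0 j" for f j
 proof -
  have fc: "f \<in> carrier (QM 0)" using f by (simp add: GQ_iff)
  have "int (wlen k) = j" if nz: "chi (aug f) k \<noteq> 0" for k
  proof -
   obtain t where "t \<in> blk 0" "(case t of (g, r, l) => qchi 0 f (g, r, l) * of_int (coeff (mulb l r) k)) \<noteq> (0 :: complex)"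
    using nz unfolding aug_chi[OF fc] by (meson sum.neutral)
   then obtain g r l where t: "(g, r, l) \<in> blk 0" "qchi 0 f (g, r, l) \<noteq> 0" "coeff (mulb l r) k \<noteq> 0"
    by (cases t) auto
   have "qdeg 0 (g, r, l) = j" using f t(2) by (simp add: GQ_iff)
   moreover have "wlen k = wlen l + wlen r"
    using t by (intro coeff_mulb(2)) (auto simp: blk_def)
   ultimately show ?thesis by (simp add: qdeg_def)
  qed
  then show ?thesis using lin_mapsD(2)[OF aug_lin fc] by (simp add: GA homogeneous_def)
 qed
 then show ?thesis using aug_lin by (auto simp: deg_maps_def)
qed

lemma Q_resolution:
 "graded_projective_resolution R GR M GA (\<lambda>n. QM (n mod 4)) GQ (\<lambda>n. dq (Suc n mod 4)) aug"
 unfolding graded_projective_resolution_def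
proof (intro conjI allI)
 show "graded_module R GR (QM (n mod 4)) (GQ n)" for n by (rule Q_graded)
 show "projective_module R (QM (n mod 4))" for n by (rule Q.psum_projective)
 show "dq (Suc n mod 4) \<in> deg_maps R (QM (Suc n mod 4)) (GQ (Suc n)) (QM (n mod 4)) (GQ n) 0" for n
  by (rule dq_deg)
 show "dq (Suc 0 mod 4) ` carrier (QM (1 mod 4)) = {x \<in> carrier (QM (0 mod 4)). aug x = \<zero>\<^bsub>M\<^esub>}"
  using aug_kernel by simp
 show "dq (Suc (Suc n) mod 4) ` carrier (QM (Suc (Suc n) mod 4)) =
   {x \<in> carrier (QM (Suc n mod 4)). dq (Suc n mod 4) x = \<zero>\<^bsub>QM (n mod 4)\<^esub>}" for n
  using exact[of "Suc n mod 4"] by (simp only: prv_mod nxt_mod)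
qed (use aug_deg aug_surj in simp_all)

lemma resolution_Q: "resolution R GR M GA (\<lambda>n. QM (n mod 4)) GQ (\<lambda>n. dq (Suc n mod 4)) aug"
 by (rule resolution.intro[OF Q_resolution env_spanned bimodule_graded])

end

section \<open>Cocycles in coordinates\<close>

text \<open>The residue of a positive \<open>n\<close> modulo 4 is taken from 1 to 4, which keeps
  degree 0 apart, where there are no coboundaries.\<close>

definition cidx :: "nat => nat" where
 "cidx n = (case n of 0 => 0 | Suc m => Suc (m mod 4))"

lemma cidx: "cidx n < 5" "cidx n mod 4 = n mod 4" "cidx (Suc n) = n mod 4 + 1" "cidx n = 0 \<longleftrightarrow> n = 0"
 by (auto simp: cidx_def mod_Suc split: nat.splits)

text \<open>The degrees in \<open>cycle_degs\<close> ignore the shift by 8 per period, which is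
  therefore added to \<open>k\<close>.\<close>

definition cohomology_basis :: "nat => int => nat set" where
 "cohomology_basis n k =
   {i. i < length (cycles (cidx n)) \<and> cycle_degs (cidx n) ! i = k + 8 * int (n div 4)}"

lemma distinct_gens: "distinct (gens n)"
 by (simp add: gens_def)

lemma set_cpairs: "(g, k) \<in> set (cpairs n) \<longleftrightarrow>
  g \<in> set (gens n) \<and> k < 48 \<and> b_src k = gen_left n g \<and> b_tgt k = gen_right n g"
 by (auto simp: cpairs_def)

lemma coeff_concat_distinct:
 assumes "distinct gs" "g \<in> set gs" "\<And>g' c u. g' \<in> set gs ==> (c, u) \<in> set (f g') ==> fst u = g'"
 shows "coeff (concat (map f gs)) (g, k) = coeff (f g) (g, k)"
 using assms
proof (induction gs)
 case (Cons g' gs)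
 have other: "coeff (concat (map f hs)) (g, k) = 0" if "g \<notin> set hs" "set hs \<subseteq> set (g' # gs)" for hs
  using that Cons.prems(3) by (intro coeff_outside) fastforce
 show ?case
 proof (cases "g = g'")
  case True
  then show ?thesis using Cons.prems(1) other[of gs] by auto
 next
  case False
  then have "coeff (f g') (g, k) = 0" using other[of "[g']"] by auto
  then show ?thesis using Cons False by auto
 qed
qed simp

lemma coeff_codiff:
 assumes m: "m < 4" and g: "g \<in> set (gens (nxt m))" and h: "h \<in> set (gens m)" and n: "n < 48"
 shows "coeff (codiff m (h, n)) (g, k) = (\<Sum>l<48. \<Sum>r<48. coeff (dmat (nxt m) g) (l, h, r) *
  (\<Sum>j<48. coeff (mulb l n) j * coeff (mulb j r) k))"
proof -
 let ?f = "\<lambda>g. lin (\<lambda>(l, h', r). if h' = h then lin (\<lambda>j. lin (\<lambda>k. [(1, g, k)]) (mulb j r)) (mulb l n) else [])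
  (dmat (nxt m) g)"
 note m' = prv_nxt[OF m]
 have fst: "fst u = g'" if "(c, u) \<in> set (?f g')" for c u g'
  using that by (fastforce dest!: lin_set split: if_splits)
 have "coeff (codiff m (h, n)) (g, k) = coeff (?f g) (g, k)"
  unfolding codiff_def prod.case
  by (rule coeff_concat_distinct[OF distinct_gens g]) (rule fst)
 also have "... = (\<Sum>i\<in>{..<48} \<times> set (gens m) \<times> {..<48}. coeff (dmat (nxt m) g) i *
   (if fst (snd i) = h then coeff (lin (\<lambda>j. lin (\<lambda>k. [(1, g, k)]) (mulb j (snd (snd i)))) (mulb (fst i) n)) (g, k) else 0))"
  using dmat_props[OF m'(3) g] m'
  by (subst coeff_lin[of "{..<48} \<times> set (gens m) \<times> {..<48}"]) (fastforce intro!: sum.cong)+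
 also have "... = (\<Sum>l<48. \<Sum>h'\<in>set (gens m). \<Sum>r<48. if h' = h then coeff (dmat (nxt m) g) (l, h, r) *
   coeff (lin (\<lambda>j. lin (\<lambda>k. [(1, g, k)]) (mulb j r)) (mulb l n)) (g, k) else 0)"
  unfolding sum.cartesian_product' by (intro sum.cong refl) auto
 also have "... = (\<Sum>l<48. \<Sum>h'\<in>set (gens m). if h' = h then \<Sum>r<48. coeff (dmat (nxt m) g) (l, h, r) *
   coeff (lin (\<lambda>j. lin (\<lambda>k. [(1, g, k)]) (mulb j r)) (mulb l n)) (g, k) else 0)"
  by (intro sum.cong refl) auto
 also have "... = (\<Sum>l<48. \<Sum>r<48. coeff (dmat (nxt m) g) (l, h, r) *
   coeff (lin (\<lambda>j. lin (\<lambda>k. [(1, g, k)]) (mulb j r)) (mulb l n)) (g, k))"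
  using h by simp
 also have "... = (\<Sum>l<48. \<Sum>r<48. coeff (dmat (nxt m) g) (l, h, r) *
   (\<Sum>j<48. coeff (mulb l n) j * coeff (mulb j r) k))"
 proof (intro sum.cong refl)
  fix l r :: nat assume l: "l \<in> {..<48}"
  have single: "coeff (lin (\<lambda>k. [(1, g, k)]) xs) (g, k) = coeff xs k" for xs :: "nat comb"
   by (induction xs) (auto simp: lin_Cons coeff_Cons)
  have "coeff (lin (\<lambda>j. lin (\<lambda>k. [(1, g, k)]) (mulb j r)) (mulb l n)) (g, k) = (\<Sum>j<48. coeff (mulb l n) j * coeff (mulb j r) k)"
   using mulb_props(1)[of l n] l n by (subst coeff_lin[of "{..<48}"]) (auto simp: single)
  then show "coeff (dmat (nxt m) g) (l, h, r) * coeff (lin (\<lambda>j. lin (\<lambda>k. [(1, g, k)]) (mulb j r)) (mulb l n)) (g, k) =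
    coeff (dmat (nxt m) g) (l, h, r) * (\<Sum>j<48. coeff (mulb l n) j * coeff (mulb j r) k)" by simp
 qed
 finally show ?thesis .
qed

lemma codiff_props:
 assumes "m < 4" "t \<in> set (cpairs m)" "(c, u) \<in> set (codiff m t)"
 shows "u \<in> set (cpairs (nxt m))" "cdeg (nxt m) u = cdeg m t + (if m = 3 then 8 else 0)"
 using codiff_check[unfolded list_all_iff, THEN bspec, of m, THEN bspec, of t, THEN bspec, of "(c, u)"] assms
 by (auto split: if_splits)

lemma spl_props:
 assumes "m < 4" "t \<in> set (cpairs (nxt m))" "(c, u) \<in> set (spl m t)"
 shows "u \<in> set (cpairs m)" "cdeg (nxt m) t = cdeg m u + (if m = 3 then 8 else 0)"
 using spl_check[unfolded list_all_iff, THEN bspec, of m, THEN bspec, of t, THEN bspec, of "(c, u)"] assms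
 by (auto split: if_splits)

lemma prj_props:
 assumes "N < 5" "t \<in> set (cpairs (N mod 4))" "(c, i) \<in> set (prj N t)"
 shows "i < length (cycles N)" "cycle_degs N ! i = cdeg (N mod 4) t"
 using prj_check[unfolded list_all_iff, THEN bspec, of N, THEN conjunct2, THEN conjunct1, THEN bspec, of t,
   THEN bspec, of "(c, i)"] assms
 by auto

lemma cycles_props:
 assumes "N < 5" "i < length (cycles N)" "(c, u) \<in> set (cycles N ! i)"
 shows "u \<in> set (cpairs (N mod 4))" "cdeg (N mod 4) u = cycle_degs N ! i"
 using prj_check[unfolded list_all_iff, THEN bspec, of N, THEN conjunct2, THEN conjunct2, THEN bspec, of i,
   THEN bspec, of "(c, u)"] assms
 by auto

text \<open>On a cocycle the summand of \<open>splitting_identity\<close> that starts by applying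
  \<open>codiff\<close> drops out, so eight times the cocycle is a coboundary plus a combination of
  the listed cycles.\<close>

lemma splitting:
 assumes N: "N < 5" and y: "\<And>t. t \<notin> set (cpairs (N mod 4)) ==> y t = 0"
  and cocycle: "\<And>t. apply_cols (set (cpairs (N mod 4))) (codiff (N mod 4)) y t = 0"
 shows "(if N = 0 then 0 else apply_cols (set (cpairs (N - 1))) (codiff (N - 1))
   (apply_cols (set (cpairs (N mod 4))) (spl (N - 1)) y) u) +
  apply_cols {..<length (cycles N)} (\<lambda>i. cycles N ! i) (apply_cols (set (cpairs (N mod 4))) (prj N) y) u = 8 * y u"
proof -
 let ?C = "set (cpairs (N mod 4))"
 have id: "splitting_identity N"
  using N splitting_check_0 splitting_check_1 splitting_check_2 splitting_check_3 splitting_check_4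
  by (auto simp: less_Suc_eq numeral_eq_Suc)
 have "apply_cols ?C (\<lambda>t. lin (spl (N mod 4)) (codiff (N mod 4) t) @
   ((if N = 0 then [] else lin (codiff (N - 1)) (spl (N - 1) t)) @
   (lin (\<lambda>i. cycles N ! i) (prj N t) @ [(-8, t)]))) y u = 0"
  by (rule apply_cols_vanishes) (use id in \<open>auto simp: splitting_identity_def list_all_iff\<close>)
 then have sum: "apply_cols ?C (\<lambda>t. lin (spl (N mod 4)) (codiff (N mod 4) t)) y u +
   (apply_cols ?C (\<lambda>t. if N = 0 then [] else lin (codiff (N - 1)) (spl (N - 1) t)) y u +
   (apply_cols ?C (\<lambda>t. lin (\<lambda>i. cycles N ! i) (prj N t)) y u + apply_cols ?C (\<lambda>t. [(-8, t)]) y u)) = 0"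
  unfolding apply_cols_append .
 have m4: "N mod 4 < 4" by simp
 have 1: "apply_cols ?C (\<lambda>t. lin (spl (N mod 4)) (codiff (N mod 4) t)) y u = 0"
 proof -
  have "apply_cols (set (cpairs (nxt (N mod 4)))) (spl (N mod 4)) (apply_cols ?C (codiff (N mod 4)) y) u =
    apply_cols ?C (\<lambda>t. lin (spl (N mod 4)) (codiff (N mod 4) t)) y u"
   by (rule apply_cols_comp) (use codiff_props[OF m4] in auto)
  then show ?thesis using cocycle by (simp add: apply_cols_zero)
 qed
 have 2: "apply_cols ?C (\<lambda>t. if N = 0 then [] else lin (codiff (N - 1)) (spl (N - 1) t)) y u =
   (if N = 0 then 0 else apply_cols (set (cpairs (N - 1))) (codiff (N - 1)) (apply_cols ?C (spl (N - 1)) y) u)"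
 proof (cases N)
  case (Suc M)
  have M: "M < 4" "nxt M = N mod 4" using N Suc by (auto simp: nxt_def mod_Suc)
  have "apply_cols (set (cpairs M)) (codiff M) (apply_cols ?C (spl M) y) u =
    apply_cols ?C (\<lambda>t. lin (codiff M) (spl M t)) y u"
   by (rule apply_cols_comp) (use spl_props[OF M(1)] M(2) in auto)
  then show ?thesis using Suc by simp
 qed (simp add: apply_cols_def)
 have 3: "apply_cols ?C (\<lambda>t. lin (\<lambda>i. cycles N ! i) (prj N t)) y u =
   apply_cols {..<length (cycles N)} (\<lambda>i. cycles N ! i) (apply_cols ?C (prj N) y) u"
  by (rule apply_cols_comp[symmetric]) (use prj_props[OF N] in auto)
 have 4: "apply_cols ?C (\<lambda>t. [(-8, t)]) y u = - 8 * y u"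
  using y[of u] by (simp add: apply_cols_diag)
 show ?thesis using sum unfolding 1 2 3 4 by (simp add: algebra_simps add_eq_0_iff)
qed

lemma prj_cycles:
 assumes N: "N < 5" and z: "\<And>i. \<not> i < length (cycles N) ==> z i = 0"
 shows "apply_cols (set (cpairs (N mod 4))) (codiff (N mod 4)) (apply_cols {..<length (cycles N)} (\<lambda>i. cycles N ! i) z) u = 0"
  and "apply_cols (set (cpairs (N mod 4))) (prj N) (apply_cols {..<length (cycles N)} (\<lambda>i. cycles N ! i) z) j = 8 * z j"
proof -
 let ?I = "{..<length (cycles N)}"
 have c: "vanishes (lin (codiff (N mod 4)) (cycles N ! i))" "vanishes (lin (prj N) (cycles N ! i) @ [(-8, i)])" if "i \<in> ?I" for i
  using cycles_check N that by (auto simp: list_all_iff)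
 have sub: "snd ` set (cycles N ! i) \<subseteq> set (cpairs (N mod 4))" if "i \<in> ?I" for i
  using cycles_props[OF N] that by auto
 have "apply_cols (set (cpairs (N mod 4))) (codiff (N mod 4)) (apply_cols ?I (\<lambda>i. cycles N ! i) z) u =
   apply_cols ?I (\<lambda>i. lin (codiff (N mod 4)) (cycles N ! i)) z u"
  by (rule apply_cols_comp) (use sub in auto)
 also have "... = 0" by (rule apply_cols_vanishes) (rule c(1))
 finally show "apply_cols (set (cpairs (N mod 4))) (codiff (N mod 4)) (apply_cols ?I (\<lambda>i. cycles N ! i) z) u = 0" .
 have "apply_cols ?I (\<lambda>i. lin (prj N) (cycles N ! i)) z j + apply_cols ?I (\<lambda>i. [(-8, i)]) z j = 0"
  unfolding apply_cols_append[symmetric] by (rule apply_cols_vanishes) (rule c(2))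
 moreover have "apply_cols ?I (\<lambda>i. [(-8, i)]) z j = - 8 * z j" using z[of j] by (simp add: apply_cols_diag)
 moreover have "apply_cols (set (cpairs (N mod 4))) (prj N) (apply_cols ?I (\<lambda>i. cycles N ! i) z) j =
   apply_cols ?I (\<lambda>i. lin (prj N) (cycles N ! i)) z j"
  by (rule apply_cols_comp) (use sub in auto)
 ultimately show "apply_cols (set (cpairs (N mod 4))) (prj N) (apply_cols ?I (\<lambda>i. cycles N ! i) z) j = 8 * z j"
  by (simp add: add_eq_0_iff)
qed

lemma prj_codiff:
 assumes "m < 4"
 shows "apply_cols (set (cpairs (nxt m))) (prj (m + 1)) (apply_cols (set (cpairs m)) (codiff m) y) j = 0"
proof -
 have "apply_cols (set (cpairs (nxt m))) (prj (m + 1)) (apply_cols (set (cpairs m)) (codiff m) y) j =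
   apply_cols (set (cpairs m)) (\<lambda>t. lin (prj (m + 1)) (codiff m t)) y j"
  by (rule apply_cols_comp) (use codiff_props(1)[OF assms] in auto)
 also have "... = 0"
  by (rule apply_cols_vanishes) (use prj_codiff_check assms in \<open>simp add: list_all_iff\<close>)
 finally show ?thesis .
qed

section \<open>Maps into the algebra\<close>

context e8_algebra
begin

abbreviation "qgen m \<equiv> ideal_sum.gen R (E m)"

text \<open>A linear map is recorded by the coordinates of the images of the generators;
  \<open>co_outside\<close>, \<open>co_surj\<close> and \<open>co_inj\<close> show that the pairs in
  \<open>cpairs\<close> are exactly the free parameters.\<close>

definition co :: "nat => ((nat => 'a env) => 'a) => nat \<times> nat => complex" where
 "co m \<phi> = (\<lambda>(g, k). if g \<in> set (gens m) then chi (\<phi> (qgen m g)) k else 0)"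

lemma chi_vertex_mult:
 assumes x: "x \<in> carrier A" and v: "v < 4"
 shows "chi (basis v \<otimes>\<^bsub>A\<^esub> x) k = (if b_src k = v then chi x k else 0)"
  and "chi (x \<otimes>\<^bsub>A\<^esub> basis v) k = (if b_tgt k = v then chi x k else 0)"
proof -
 have b: "basis v \<in> carrier A" using v by (simp add: basis_48)
 have "chi (basis v \<otimes>\<^bsub>A\<^esub> x) k = (\<Sum>i<48. \<Sum>j<48. if i = v then (if j = k then (if b_src k = v then chi x k else 0) else 0) else 0)"
  unfolding chi_mult[OF b x] by (intro sum.cong refl) (use v in \<open>auto simp: basis_48 mulb_vertex_left coeff_Cons\<close>)
 also have "... = (\<Sum>i<48. if i = v then (\<Sum>j<48. if j = k then (if b_src k = v then chi x k else 0) else 0) else 0)"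
  by (intro sum.cong refl) auto
 also have "... = (if b_src k = v then chi x k else 0)"
  using v chi_outside[OF x, of k] by (auto simp: sum.delta)
 finally show "chi (basis v \<otimes>\<^bsub>A\<^esub> x) k = (if b_src k = v then chi x k else 0)" .
 have "chi (x \<otimes>\<^bsub>A\<^esub> basis v) k = (\<Sum>i<48. \<Sum>j<48. if j = v then (if i = k then (if b_tgt k = v then chi x k else 0) else 0) else 0)"
  unfolding chi_mult[OF x b] by (intro sum.cong refl) (use v in \<open>auto simp: basis_48 mulb_vertex_right coeff_Cons\<close>)
 also have "... = (if b_tgt k = v then chi x k else 0)"
  using v chi_outside[OF x, of k] by (auto simp: sum.delta)
 finally show "chi (x \<otimes>\<^bsub>A\<^esub> basis v) k = (if b_tgt k = v then chi x k else 0)" .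
qed

lemma chi_E_act:
 assumes g: "g \<in> set (gens m)" and x: "x \<in> carrier A"
 shows "chi (E m g \<odot>\<^bsub>M\<^esub> x) k = (if b_src k = gen_left m g \<and> b_tgt k = gen_right m g then chi x k else 0)"
proof -
 note v = gen_vertex[OF g]
 have b: "basis (gen_left m g) \<in> carrier A" "basis (gen_right m g) \<in> carrier A" using v by (simp_all add: basis_48)
 have "E m g = tens (basis (gen_right m g)) (basis (gen_left m g))"
  using v by (simp add: E_def env_basis)
 then have "E m g \<odot>\<^bsub>M\<^esub> x = basis (gen_left m g) \<otimes>\<^bsub>A\<^esub> x \<otimes>\<^bsub>A\<^esub> basis (gen_right m g)"
  using act_tens[OF b(2,1) x] by simp
 then show ?thesis using x b v by (simp add: chi_vertex_mult)
qed

lemma co_outside: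
 assumes \<phi>: "\<phi> \<in> lin_maps R (QM m) M" and t: "t \<notin> set (cpairs m)"
 shows "co m \<phi> t = 0"
proof -
 obtain g k where t': "t = (g, k)" by (cases t)
 show ?thesis
 proof (cases "g \<in> set (gens m)")
  case True
  have c: "\<phi> (qgen m g) \<in> carrier A" using lin_mapsD(2)[OF \<phi> Q.gen_closed[OF True]] by simp
  have "E m g \<odot>\<^bsub>QM m\<^esub> qgen m g = qgen m g"
   using Q.e_closed[OF True] Q.e_idem[OF True] by (auto simp: Q.gen_def fun_eq_iff)
  then have "\<phi> (qgen m g) = E m g \<odot>\<^bsub>M\<^esub> \<phi> (qgen m g)"
   using lin_mapsD(4)[OF \<phi> Q.e_closed[OF True] Q.gen_closed[OF True]] by simp
  then have "chi (\<phi> (qgen m g)) k = chi (E m g \<odot>\<^bsub>M\<^esub> \<phi> (qgen m g)) k" by simp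
  also have "... = 0"
   unfolding chi_E_act[OF True c] using t True chi_outside[OF c, of k] by (auto simp: t' set_cpairs)
  finally show ?thesis by (simp add: co_def t')
 qed (simp add: co_def t')
qed

lemma co_surj:
 assumes y: "\<And>t. t \<notin> set (cpairs m) ==> y t = 0"
 obtains \<phi> where "\<phi> \<in> lin_maps R (QM m) M" "co m \<phi> = y"
proof -
 define x where "x g = elem (\<lambda>k. y (g, k))" for g
 have x: "x g \<in> carrier A" "chi (x g) = (\<lambda>k. y (g, k))" for g
  unfolding x_def by (rule elem; use y in \<open>auto simp: set_cpairs\<close>)+
 have Ex: "E m g \<odot>\<^bsub>M\<^esub> x g = x g" if g: "g \<in> set (gens m)" for g
 proof (rule chi_eqI)
  show "E m g \<odot>\<^bsub>M\<^esub> x g \<in> carrier A" by (rule act(1)[OF Q.e_closed[OF g] x(1)])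
  show "chi (E m g \<odot>\<^bsub>M\<^esub> x g) k = chi (x g) k" for k
   unfolding chi_E_act[OF g x(1)] using y[of "(g, k)"] by (auto simp: x(2) set_cpairs)
 qed (rule x(1))
 have xM: "x g \<in> carrier M" for g using x(1) by simp
 note \<phi> = Q.lin_map_of_generators[OF bimodule_left_module xM Ex]
 show ?thesis
 proof (rule that[OF \<phi>(1)])
  show "co m (\<lambda>F\<in>carrier (QM m). \<Oplus>\<^bsub>M\<^esub>g\<in>set (gens m). F g \<odot>\<^bsub>M\<^esub> x g) = y"
  proof
   fix t show "co m (\<lambda>F\<in>carrier (QM m). \<Oplus>\<^bsub>M\<^esub>g\<in>set (gens m). F g \<odot>\<^bsub>M\<^esub> x g) t = y t"
    using y[of t] by (cases t) (auto simp: co_def \<phi>(2) x(2) set_cpairs simp del: restrict_apply)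
  qed
 qed
qed

lemma co_inj:
 assumes \<phi>: "\<phi> \<in> lin_maps R (QM m) M" and \<psi>: "\<psi> \<in> lin_maps R (QM m) M" and eq: "\<And>t. co m \<phi> t = co m \<psi> t"
 shows "\<phi> = \<psi>"
proof -
 have g: "\<phi> (qgen m g) = \<psi> (qgen m g)" if g: "g \<in> set (gens m)" for g
 proof (rule chi_eqI)
  show "\<phi> (qgen m g) \<in> carrier A" "\<psi> (qgen m g) \<in> carrier A"
   using lin_mapsD(2)[OF \<phi> Q.gen_closed[OF g]] lin_mapsD(2)[OF \<psi> Q.gen_closed[OF g]] by simp_all
  show "chi (\<phi> (qgen m g)) k = chi (\<psi> (qgen m g)) k" for k using eq[of "(g, k)"] g by (simp add: co_def)
 qed
 have "\<phi> f = \<psi> f" if f: "f \<in> carrier (QM m)" for f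
  unfolding Q.lin_map_expand[OF bimodule_left_module \<phi> f] Q.lin_map_expand[OF bimodule_left_module \<psi> f]
  by (rule M.finsum_cong') (use g in \<open>auto intro!: act(1) Q.psum_carrier(1)[OF f] simp: lin_mapsD(2)[OF \<psi> Q.gen_closed, simplified]\<close>)
 then show ?thesis by (rule PiE_ext[OF lin_mapsD(1)[OF \<phi>] lin_mapsD(1)[OF \<psi>]])
qed

text \<open>Expanding \<phi> over the generators turns its value on \<open>dgen\<close> into
  sandwiches of a left factor, a value of \<phi> and a right factor, whose coordinates are the
  entries of \<open>codiff\<close>.\<close>

lemma co_comp_dq:
 assumes m: "m < 4" and \<phi>: "\<phi> \<in> lin_maps R (QM m) M"
 shows "co (nxt m) (\<lambda>f\<in>carrier (QM (nxt m)). \<phi> (dq (nxt m) f)) = apply_cols (set (cpairs m)) (codiff m) (co m \<phi>)"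
proof
 fix t :: "nat \<times> nat"
 obtain g k where t: "t = (g, k)" by (cases t)
 note m' = prv_nxt[OF m]
 show "co (nxt m) (\<lambda>f\<in>carrier (QM (nxt m)). \<phi> (dq (nxt m) f)) t = apply_cols (set (cpairs m)) (codiff m) (co m \<phi>) t"
 proof (cases "g \<in> set (gens (nxt m))")
  case False
  have "apply_cols (set (cpairs m)) (codiff m) (co m \<phi>) t = 0"
  proof (rule apply_cols_outside, rule notI)
   fix s assume s: "s \<in> set (cpairs m)" "t \<in> snd ` set (codiff m s)"
   then obtain c where "(c, t) \<in> set (codiff m s)" by auto
   from codiff_props(1)[OF m s(1) this] False show False by (simp add: t set_cpairs)
  qed
  then show ?thesis using False by (simp add: t co_def)
 next
  case g: True
  let ?B = "{..<48} \<times> {..<48 :: nat}"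
  have D3: "dgen (nxt m) g \<in> carrier (QM m)" using dgen(3)[OF m'(3) g] m' by simp
  have D2: "env_chi (dgen (nxt m) g h) (r, l) = of_int (coeff (dmat (nxt m) g) (l, h, r))" if "h \<in> set (gens m)" for h r l
   using dgen(2)[OF m'(3) g] that m' by simp
  note D1 = dgen(1)[OF m'(3) g]
  have c: "\<phi> (qgen m h) \<in> carrier A" if "h \<in> set (gens m)" for h
   using lin_mapsD(2)[OF \<phi> Q.gen_closed[OF that]] by simp
  have "co (nxt m) (\<lambda>f\<in>carrier (QM (nxt m)). \<phi> (dq (nxt m) f)) t = chi (\<phi> (dgen (nxt m) g)) k"
   using g Q.gen_closed[OF g] by (simp add: t co_def dq_gen[OF m'(3) g])
  also have "... = (\<Sum>h\<in>set (gens m). chi (dgen (nxt m) g h \<odot>\<^bsub>M\<^esub> \<phi> (qgen m h)) k)"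
   unfolding Q.lin_map_expand[OF bimodule_left_module \<phi> D3]
   by (rule M.chi_finsum) (use act(1)[OF D1 c] in auto)
  also have "... = (\<Sum>h\<in>set (gens m). \<Sum>n<48. co m \<phi> (h, n) * of_int (coeff (codiff m (h, n)) (g, k)))"
  proof (rule sum.cong[OF refl])
   fix h assume h: "h \<in> set (gens m)"
   have "chi (dgen (nxt m) g h \<odot>\<^bsub>M\<^esub> \<phi> (qgen m h)) k =
     (\<Sum>p\<in>?B. \<Sum>n<48. env_chi (dgen (nxt m) g h) p * chi (\<phi> (qgen m h)) n * act_\<mu> p n k)"
    by (rule act(2)[OF D1 c[OF h]])
   also have "... = (\<Sum>n<48. \<Sum>p\<in>?B. env_chi (dgen (nxt m) g h) p * chi (\<phi> (qgen m h)) n * act_\<mu> p n k)"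
    by (rule sum.swap)
   also have "... = (\<Sum>n<48. co m \<phi> (h, n) * of_int (coeff (codiff m (h, n)) (g, k)))"
   proof (rule sum.cong[OF refl])
    fix n :: nat assume n: "n \<in> {..<48}"
    have "(\<Sum>p\<in>?B. env_chi (dgen (nxt m) g h) p * chi (\<phi> (qgen m h)) n * act_\<mu> p n k) =
      (\<Sum>r<48. \<Sum>l<48. chi (\<phi> (qgen m h)) n * (of_int (coeff (dmat (nxt m) g) (l, h, r)) *
       (\<Sum>j<48. of_int (coeff (mulb l n) j) * of_int (coeff (mulb j r) k))))"
     unfolding sum.cartesian_product' by (intro sum.cong refl) (simp add: D2[OF h] act_\<mu>_def)
    also have "... = (\<Sum>l<48. \<Sum>r<48. chi (\<phi> (qgen m h)) n * (of_int (coeff (dmat (nxt m) g) (l, h, r)) *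
       (\<Sum>j<48. of_int (coeff (mulb l n) j) * of_int (coeff (mulb j r) k))))"
     by (rule sum.swap)
    also have "... = co m \<phi> (h, n) * of_int (coeff (codiff m (h, n)) (g, k))"
     using n h by (simp add: coeff_codiff[OF m g h] co_def sum_distrib_left)
    finally show "(\<Sum>p\<in>?B. env_chi (dgen (nxt m) g h) p * chi (\<phi> (qgen m h)) n * act_\<mu> p n k) =
      co m \<phi> (h, n) * of_int (coeff (codiff m (h, n)) (g, k))" .
   qed
   finally show "chi (dgen (nxt m) g h \<odot>\<^bsub>M\<^esub> \<phi> (qgen m h)) k =
     (\<Sum>n<48. co m \<phi> (h, n) * of_int (coeff (codiff m (h, n)) (g, k)))" .
  qed
  also have "... = (\<Sum>s\<in>set (gens m) \<times> {..<48}. co m \<phi> s * of_int (coeff (codiff m s) t))"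
   by (simp add: sum.cartesian_product' t)
  also have "... = apply_cols (set (cpairs m)) (codiff m) (co m \<phi>) t"
   unfolding apply_cols_def
  proof (rule sum.mono_neutral_right)
   show "set (cpairs m) \<subseteq> set (gens m) \<times> {..<48}" by (auto simp: cpairs_def)
  qed (use co_outside[OF \<phi>] in auto)
  finally show ?thesis .
 qed
qed

text \<open>The generators of term \<open>n\<close> have degree
  \<open>n mod 4 + 8 (n div 4)\<close>, while \<open>cdeg\<close> subtracts only
  \<open>n mod 4\<close>. Conversely the values on generators determine the degree of the map
  because the components of a homogeneous element are homogeneous scalars.\<close>

lemma deg_maps_iff:
 "\<phi> \<in> deg_maps R (QM (n mod 4)) (GQ n) M GA k \<longleftrightarrow>
  \<phi> \<in> lin_maps R (QM (n mod 4)) M \<and> (\<forall>t. co (n mod 4) \<phi> t \<noteq> 0 --> cdeg (n mod 4) t = k + 8 * int (n div 4))"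
proof safe
 assume \<phi>: "\<phi> \<in> deg_maps R (QM (n mod 4)) (GQ n) M GA k"
 then show "\<phi> \<in> lin_maps R (QM (n mod 4)) M" by (rule deg_mapsD(1))
 fix g j assume nz: "co (n mod 4) \<phi> (g, j) \<noteq> 0"
 then have g: "g \<in> set (gens (n mod 4))" by (auto simp: co_def split: if_splits)
 note v = gen_vertex[OF g]
 have "qgen (n mod 4) g \<in> GQ n (int (n mod 4) + 8 * int (n div 4))"
  using Q.gen_closed[OF g] v by (auto simp: GQ_iff qchi_gen[OF g] qdeg_def split: if_splits simp del: Q.psum_simps)
 from deg_mapsD(2)[OF \<phi> this] show "cdeg (n mod 4) (g, j) = k + 8 * int (n div 4)"
  using nz g by (auto simp: GA homogeneous_def co_def cdeg_def)
next
 assume \<phi>: "\<phi> \<in> lin_maps R (QM (n mod 4)) M"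
  and deg: "\<forall>t. co (n mod 4) \<phi> t \<noteq> 0 --> cdeg (n mod 4) t = k + 8 * int (n div 4)"
 have "\<phi> f \<in> GA (j + k)" if f: "f \<in> GQ n j" for f j
 proof -
  have fc: "f \<in> carrier (QM (n mod 4))" using f by (simp add: GQ_iff)
  have gc: "\<phi> (qgen (n mod 4) g) \<in> carrier A" if "g \<in> set (gens (n mod 4))" for g
   using lin_mapsD(2)[OF \<phi> Q.gen_closed[OF that]] by simp
  have "int (wlen i) = j + k" if nz: "chi (\<phi> f) i \<noteq> 0" for i
  proof -
   have "chi (\<phi> f) i = (\<Sum>g\<in>set (gens (n mod 4)). chi (f g \<odot>\<^bsub>M\<^esub> \<phi> (qgen (n mod 4) g)) i)"
    unfolding Q.lin_map_expand[OF bimodule_left_module \<phi> fc]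
    by (rule M.chi_finsum) (use act(1)[OF Q.psum_carrier(1)[OF fc] gc] in auto)
   then obtain g where g: "g \<in> set (gens (n mod 4))" and nz': "chi (f g \<odot>\<^bsub>M\<^esub> \<phi> (qgen (n mod 4) g)) i \<noteq> 0"
    using nz by (metis (no_types, lifting) sum.neutral)
   let ?e = "int (n mod 4) + 8 * int (n div 4)"
   have "f g \<in> R.homogeneous env_dg (j - ?e)"
   proof -
    have "env_dg p = j - ?e" if "env_chi (f g) p \<noteq> 0" for p
    proof -
     have "qdeg n (g, p) = j" using f that g by (cases p) (auto simp: GQ_iff qchi_def)
     then show ?thesis by (cases p) (simp add: qdeg_def env_dg_def)
    qed
    then show ?thesis using Q.psum_carrier(1)[OF fc] by (simp add: R.homogeneous_def)
   qed
   then have r: "f g \<in> GR (j - ?e)" by (simp only: env_grading)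
   have "int (wlen i) = ?e + k" if "chi (\<phi> (qgen (n mod 4) g)) i \<noteq> 0" for i
    using deg[rule_format, of "(g, i)"] g that by (simp add: co_def cdeg_def)
   then have "\<phi> (qgen (n mod 4) g) \<in> GA (?e + k)" using gc[OF g] by (simp add: GA homogeneous_def)
   with r have "f g \<odot>\<^bsub>M\<^esub> \<phi> (qgen (n mod 4) g) \<in> GA ((j - ?e) + (?e + k))"
    using bimodule_graded unfolding graded_module_def by blast
   then show ?thesis using nz' by (simp add: GA homogeneous_def)
  qed
  then show ?thesis using lin_mapsD(2)[OF \<phi> fc] by (simp add: GA homogeneous_def)
 qed
 then show "\<phi> \<in> deg_maps R (QM (n mod 4)) (GQ n) M GA k" using \<phi> by (auto simp: deg_maps_def)
qed

text \<open>The cohomology class in coordinates, in the normalization in which a listed cycle has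
  coordinate 8.\<close>

definition cls :: "nat => ((nat => 'a env) => 'a) => nat => complex" where
 "cls n \<phi> = apply_cols (set (cpairs (n mod 4))) (prj (cidx n)) (co (n mod 4) \<phi>)"

abbreviation "QZ \<equiv> ext_cocycles R (\<lambda>n. QM (n mod 4)) GQ (\<lambda>n. dq (Suc n mod 4)) M GA"
abbreviation "QB \<equiv> ext_coboundaries R (\<lambda>n. QM (n mod 4)) GQ (\<lambda>n. dq (Suc n mod 4)) M GA"

lemma zero_lin: "(\<lambda>f\<in>carrier (QM m). \<zero>\<^bsub>M\<^esub>) \<in> lin_maps R (QM m) M"
proof -
 interpret N: left_module R "QM m" by (rule Q.psum_left_module)
 show ?thesis by (rule lin_mapsI) (auto simp del: Q.psum_simps simp: N.smult_closed M.smult_zero[simplified])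
qed

lemma co_zero: "co m (\<lambda>f\<in>carrier (QM m). \<zero>\<^bsub>M\<^esub>) t = 0"
 by (cases t) (auto simp: co_def Q.gen_closed simp del: Q.psum_simps)

lemma comp_dq_lin:
 assumes "\<phi> \<in> lin_maps R (QM (n mod 4)) M"
 shows "(\<lambda>f\<in>carrier (QM (Suc n mod 4)). \<phi> (dq (Suc n mod 4) f)) \<in> lin_maps R (QM (Suc n mod 4)) M"
proof -
 interpret N: left_module R "QM (Suc n mod 4)" by (rule Q.psum_left_module)
 have l: "dq (Suc n mod 4) \<in> lin_maps R (QM (Suc n mod 4)) (QM (n mod 4))"
  using dq_lin[of "Suc n mod 4"] by (simp add: prv_mod)
 show ?thesis
  by (rule lin_mapsI)
   (auto simp del: Q.psum_simps bimodule_simps simp: lin_mapsD(2-)[OF l] lin_mapsD(2-)[OF assms] N.smult_closed)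
qed

lemma co_comp_dq_mod:
 "\<phi> \<in> lin_maps R (QM (n mod 4)) M ==>
  co (Suc n mod 4) (\<lambda>f\<in>carrier (QM (Suc n mod 4)). \<phi> (dq (Suc n mod 4) f)) =
  apply_cols (set (cpairs (n mod 4))) (codiff (n mod 4)) (co (n mod 4) \<phi>)"
 using co_comp_dq[of "n mod 4" \<phi>] by (simp only: nxt_mod)

text \<open>Composition with the differential is the zero map exactly if its coordinates vanish, by
  \<open>co_inj\<close>; this makes the cocycle condition a linear system.\<close>

lemma QZ_iff:
 "\<phi> \<in> QZ n k \<longleftrightarrow> \<phi> \<in> deg_maps R (QM (n mod 4)) (GQ n) M GA k \<and>
  (\<forall>t. apply_cols (set (cpairs (n mod 4))) (codiff (n mod 4)) (co (n mod 4) \<phi>) t = 0)"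
proof -
 have "(\<forall>f\<in>carrier (QM (Suc n mod 4)). \<phi> (dq (Suc n mod 4) f) = \<zero>\<^bsub>M\<^esub>) \<longleftrightarrow>
   (\<forall>t. apply_cols (set (cpairs (n mod 4))) (codiff (n mod 4)) (co (n mod 4) \<phi>) t = 0)" (is "?L \<longleftrightarrow> ?R")
  if "\<phi> \<in> deg_maps R (QM (n mod 4)) (GQ n) M GA k"
 proof -
  note l = deg_mapsD(1)[OF that]
  note eq = co_comp_dq_mod[OF l]
  show ?thesis
  proof
   assume ?L
   then have "(\<lambda>f\<in>carrier (QM (Suc n mod 4)). \<phi> (dq (Suc n mod 4) f)) = (\<lambda>f\<in>carrier (QM (Suc n mod 4)). \<zero>\<^bsub>M\<^esub>)"
    by (intro restrict_ext) auto
   then show ?R unfolding eq[symmetric] by (simp only: co_zero) simp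
  next
   assume ?R
   have eq0: "(\<lambda>f\<in>carrier (QM (Suc n mod 4)). \<phi> (dq (Suc n mod 4) f)) = (\<lambda>f\<in>carrier (QM (Suc n mod 4)). \<zero>\<^bsub>M\<^esub>)"
    by (rule co_inj[OF comp_dq_lin[OF l] zero_lin]) (use \<open>?R\<close> in \<open>simp only: eq co_zero\<close>)
   show ?L
   proof
    fix f assume f: "f \<in> carrier (QM (Suc n mod 4))"
    from fun_cong[OF eq0, of f] f show "\<phi> (dq (Suc n mod 4) f) = \<zero>\<^bsub>M\<^esub>"
     by (simp only: restrict_apply if_True)
   qed
  qed
 qed
 then show ?thesis by (auto simp: ext_cocycles_def)
qed

lemma cls_in_basis:
 assumes \<phi>: "\<phi> \<in> QZ n k" and i: "cls n \<phi> i \<noteq> 0"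
 shows "i \<in> cohomology_basis n k"
proof -
 obtain t where t: "t \<in> set (cpairs (n mod 4))" "co (n mod 4) \<phi> t * of_int (coeff (prj (cidx n) t) i) \<noteq> 0"
  using i unfolding cls_def apply_cols_def by (meson sum.neutral)
 then obtain c where c: "(c, i) \<in> set (prj (cidx n) t)" using coeff_nonzero by fastforce
 note p = prj_props[OF cidx(1)[of n] _ c, unfolded cidx(2)]
 have "co (n mod 4) \<phi> t \<noteq> 0" using t(2) by auto
 then have "cdeg (n mod 4) t = k + 8 * int (n div 4)"
  using \<phi>[unfolded QZ_iff deg_maps_iff, THEN conjunct1, THEN conjunct2] by blast
 then show ?thesis using p t(1) by (simp add: cohomology_basis_def)
qed

text \<open>If the class vanishes, \<open>splitting\<close> expresses eight times the cocycle as a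
  coboundary; in degree 0 there is no such term and the cocycle is zero. Conversely
  \<open>proj\<close> kills the image of \<open>codiff\<close>.\<close>

lemma cls_coboundary:
 assumes \<phi>: "\<phi> \<in> QZ n k"
 shows "\<phi> \<in> QB n k \<longleftrightarrow> (\<forall>i. cls n \<phi> i = 0)"
proof -
 note \<phi>' = \<phi>[unfolded QZ_iff deg_maps_iff]
 note l = \<phi>'[THEN conjunct1, THEN conjunct1]
 let ?C = "set (cpairs (n mod 4))"
 have spl: "(if cidx n = 0 then 0 else apply_cols (set (cpairs (cidx n - 1))) (codiff (cidx n - 1))
   (apply_cols ?C (spl (cidx n - 1)) (co (n mod 4) \<phi>)) u) +
  apply_cols {..<length (cycles (cidx n))} (\<lambda>i. cycles (cidx n) ! i) (cls n \<phi>) u = 8 * co (n mod 4) \<phi> u" for u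
  using splitting[OF cidx(1)[of n], unfolded cidx(2), of "co (n mod 4) \<phi>" u] co_outside[OF l] \<phi>'
  unfolding cls_def by blast
 show ?thesis
 proof (cases n)
  case 0
  show ?thesis
  proof
   assume "\<phi> \<in> QB n k"
   then have "\<phi> = (\<lambda>f\<in>carrier (QM 0). \<zero>\<^bsub>M\<^esub>)" by (simp add: ext_coboundaries_def 0)
   then show "\<forall>i. cls n \<phi> i = 0" using co_zero[of 0] by (simp add: cls_def 0 apply_cols_zero)
  next
   assume c: "\<forall>i. cls n \<phi> i = 0"
   have "\<phi> = (\<lambda>f\<in>carrier (QM 0). \<zero>\<^bsub>M\<^esub>)"
   proof (rule co_inj[OF _ zero_lin])
    show "\<phi> \<in> lin_maps R (QM 0) M" using l by (simp add: 0)
    fix t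
    have "co 0 \<phi> t = 0" using spl[of t] c cidx(4)[of 0] by (simp add: 0 apply_cols_zero)
    then show "co 0 \<phi> t = co 0 (\<lambda>f\<in>carrier (QM 0). \<zero>\<^bsub>M\<^esub>) t" by (simp only: co_zero)
   qed
   then show "\<phi> \<in> QB n k" by (simp add: ext_coboundaries_def 0)
  qed
 next
  case (Suc m)
  have cm: "cidx n = m mod 4 + 1" by (simp add: Suc cidx(3))
  have m4: "m mod 4 < 4" by simp
  show ?thesis
  proof
   assume "\<phi> \<in> QB n k"
   then obtain \<psi> where \<psi>: "\<psi> \<in> deg_maps R (QM (m mod 4)) (GQ m) M GA k"
    "\<phi> = (\<lambda>x\<in>carrier (QM (Suc m mod 4)). \<psi> (dq (Suc m mod 4) x))"
    unfolding ext_coboundaries_def Suc nat.case by blast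
   have "cls n \<phi> i = 0" for i
    unfolding cls_def cm unfolding \<psi>(2) Suc co_comp_dq_mod[OF deg_mapsD(1)[OF \<psi>(1)]]
    using prj_codiff[OF m4] by (simp add: nxt_mod)
   then show "\<forall>i. cls n \<phi> i = 0" by blast
  next
   assume c: "\<forall>i. cls n \<phi> i = 0"
   \<comment> \<open>The primitive given by the splitting table, divided by 8. Its degree must be
     checked, since coboundaries come from maps of the same degree \<open>k\<close>.\<close>
   define y where "y t = (1 / 8) * apply_cols ?C (spl (m mod 4)) (co (n mod 4) \<phi>) t" for t
   have nm: "n mod 4 = nxt (m mod 4)" by (simp add: nxt_mod Suc)
   have y: "y t = 0 \<or> t \<in> set (cpairs (m mod 4)) \<and> cdeg (m mod 4) t = k + 8 * int (m div 4)" for t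
   proof (rule disjCI, rule ccontr)
    assume nz: "\<not> (t \<in> set (cpairs (m mod 4)) \<and> cdeg (m mod 4) t = k + 8 * int (m div 4))" "y t \<noteq> 0"
    then obtain s where s: "s \<in> ?C" "co (n mod 4) \<phi> s * of_int (coeff (spl (m mod 4) s) t) \<noteq> 0"
     unfolding y_def apply_cols_def by (metis (no_types, lifting) mult_zero_right sum.neutral)
    then obtain c where c: "(c, t) \<in> set (spl (m mod 4) s)" using coeff_nonzero by fastforce
    note p = spl_props[OF m4 _ c, folded nm]
    have "co (n mod 4) \<phi> s \<noteq> 0" using s(2) by auto
    then have "cdeg (n mod 4) s = k + 8 * int (n div 4)"
     using \<phi>'[THEN conjunct1, THEN conjunct2] by blast
    \<comment> \<open>The shift by 8 in \<open>spl_props\<close> occurs exactly when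
      \<open>n\<close> begins a new period.\<close>
    moreover have "int (n div 4) = int (m div 4) + (if m mod 4 = 3 then 1 else 0)"
     by (simp add: Suc div_Suc mod_Suc)
    ultimately show False using p s(1) nz(1) by (auto split: if_splits)
   qed
   obtain \<psi> where \<psi>: "\<psi> \<in> lin_maps R (QM (m mod 4)) M" "co (m mod 4) \<psi> = y"
    by (rule co_surj[of "m mod 4" y]) (use y in auto)
   have "\<phi> = (\<lambda>x\<in>carrier (QM (Suc m mod 4)). \<psi> (dq (Suc m mod 4) x))"
   proof (rule co_inj)
    show "\<phi> \<in> lin_maps R (QM (Suc m mod 4)) M" using l by (simp add: Suc)
    show "(\<lambda>x\<in>carrier (QM (Suc m mod 4)). \<psi> (dq (Suc m mod 4) x)) \<in> lin_maps R (QM (Suc m mod 4)) M"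
     by (rule comp_dq_lin[OF \<psi>(1)])
    fix t
    have "apply_cols (set (cpairs (m mod 4))) (codiff (m mod 4)) y t =
      (1 / 8) * apply_cols (set (cpairs (m mod 4))) (codiff (m mod 4)) (apply_cols ?C (spl (m mod 4)) (co (n mod 4) \<phi>)) t"
     unfolding y_def by (rule apply_cols_scale)
    also have "... = co (n mod 4) \<phi> t"
     using spl[of t] c by (simp add: cm apply_cols_zero)
    finally show "co (Suc m mod 4) \<phi> t = co (Suc m mod 4) (\<lambda>x\<in>carrier (QM (Suc m mod 4)). \<psi> (dq (Suc m mod 4) x)) t"
     unfolding co_comp_dq_mod[OF \<psi>(1)] \<psi>(2) by (simp add: Suc)
   qed
   moreover have "\<psi> \<in> deg_maps R (QM (m mod 4)) (GQ m) M GA k"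
    unfolding deg_maps_iff using \<psi> y by auto
   ultimately show "\<phi> \<in> QB n k" unfolding Suc by (rule coboundariesI[rotated])
  qed
 qed
qed

text \<open>The combination of listed cycles with coefficients \<open>z i / 8\<close> works, as
  \<open>proj\<close> returns eight times the coefficients of a combination of cycles.\<close>

lemma cls_surj:
 assumes z: "\<And>i. i \<notin> cohomology_basis n k ==> z i = 0"
 shows "\<exists>\<phi>\<in>QZ n k. cls n \<phi> = z"
proof -
 let ?I = "{..<length (cycles (cidx n))}"
 define w where "w i = (1 / 8) * z i" for i
 define y where "y = apply_cols ?I (\<lambda>i. cycles (cidx n) ! i) w"
 have w: "\<not> i < length (cycles (cidx n)) ==> w i = 0" for i using z[of i] by (simp add: w_def cohomology_basis_def)
 have y: "y t = 0 \<or> t \<in> set (cpairs (n mod 4)) \<and> cdeg (n mod 4) t = k + 8 * int (n div 4)" for t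
 proof (rule disjCI, rule ccontr)
  assume nz: "\<not> (t \<in> set (cpairs (n mod 4)) \<and> cdeg (n mod 4) t = k + 8 * int (n div 4))" "y t \<noteq> 0"
  then obtain i where i: "i \<in> ?I" "w i * of_int (coeff (cycles (cidx n) ! i) t) \<noteq> 0"
   unfolding y_def apply_cols_def by (metis (no_types, lifting) sum.neutral)
  then obtain c where c: "(c, t) \<in> set (cycles (cidx n) ! i)" using coeff_nonzero by fastforce
  have "i \<in> cohomology_basis n k" using i z[of i] by (auto simp: w_def)
  then show False using cycles_props[OF cidx(1)[of n] _ c] nz i by (auto simp: cidx(2) cohomology_basis_def)
 qed
 obtain \<phi> where \<phi>: "\<phi> \<in> lin_maps R (QM (n mod 4)) M" "co (n mod 4) \<phi> = y"
  by (rule co_surj[of "n mod 4" y]) (use y in auto)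
 note p = prj_cycles[OF cidx(1)[of n], of w, unfolded cidx(2), folded y_def, OF w]
 have "\<phi> \<in> QZ n k" unfolding QZ_iff deg_maps_iff using \<phi> y p(1) by auto
 moreover have "cls n \<phi> = z" by (rule ext) (simp add: cls_def \<phi>(2) p(2) w_def)
 ultimately show ?thesis by blast
qed

end

section \<open>Graded vector spaces by dimension\<close>

abbreviation "cfun I \<equiv> free_module complex_alg I"

lemma cfun_simps [simp]:
 "\<zero>\<^bsub>cfun I\<^esub> = (\<lambda>i. 0)" "f \<oplus>\<^bsub>cfun I\<^esub> g = (\<lambda>i. f i + g i)" "c \<odot>\<^bsub>cfun I\<^esub> f = (\<lambda>i. c * f i)"
 by (simp_all add: free_module_def)

lemma cfun_carrier: "finite I ==> f \<in> carrier (cfun I) \<longleftrightarrow> (\<forall>i. i \<notin> I --> f i = 0)"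
 by (auto simp: free_module_def intro: finite_subset[of _ I])

text \<open>Closure under the operations is all that isomorphisms need in order to be inverted and
  composed. It passes along isomorphisms, so the Ext spaces, duals and sums at hand never have to be
  shown to be vector spaces.\<close>

definition cvs_closed :: "(complex, 'v) module => bool" where
 "cvs_closed V \<longleftrightarrow> (\<forall>x\<in>carrier V. \<forall>y\<in>carrier V. x \<oplus>\<^bsub>V\<^esub> y \<in> carrier V) \<and>
   (\<forall>c. \<forall>x\<in>carrier V. c \<odot>\<^bsub>V\<^esub> x \<in> carrier V)"

lemma cvs_closedD:
 assumes "cvs_closed V"
 shows "x \<in> carrier V ==> y \<in> carrier V ==> x \<oplus>\<^bsub>V\<^esub> y \<in> carrier V"
  "x \<in> carrier V ==> c \<odot>\<^bsub>V\<^esub> x \<in> carrier V"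
 using assms by (auto simp: cvs_closed_def)

lemma cfun_closed: "finite I ==> cvs_closed (cfun I)"
 by (auto simp: cvs_closed_def cfun_carrier)

lemma cvs_isoI:
 assumes V: "cvs_closed V" and bij: "bij_betw f (carrier V) (carrier W)"
  and add: "\<And>x y. x \<in> carrier V ==> y \<in> carrier V ==> f (x \<oplus>\<^bsub>V\<^esub> y) = f x \<oplus>\<^bsub>W\<^esub> f y"
  and smult: "\<And>c x. x \<in> carrier V ==> f (c \<odot>\<^bsub>V\<^esub> x) = c \<odot>\<^bsub>W\<^esub> f x"
 shows "cvs_iso V W"
 unfolding cvs_iso_def
proof
 show "restrict f (carrier V) \<in> lin_maps complex_alg V W"
  by (rule lin_mapsI) (use cvs_closedD[OF V] bij_betwE[OF bij] add smult in auto)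
 show "bij_betw (restrict f (carrier V)) (carrier V) (carrier W)"
  using bij by (subst bij_betw_cong[of _ _ f]) auto
qed

locale linear_bijection =
 fixes V :: "(complex, 'v) module" and W :: "(complex, 'w) module" and f g
 assumes bij: "bij_betw f (carrier V) (carrier W)" and inverse_bij: "bij_betw g (carrier W) (carrier V)"
  and closed: "\<And>x. x \<in> carrier V ==> f x \<in> carrier W"
  and inverse_closed: "\<And>y. y \<in> carrier W ==> g y \<in> carrier V"
  and inverse_left: "\<And>x. x \<in> carrier V ==> g (f x) = x"
  and inverse_right: "\<And>y. y \<in> carrier W ==> f (g y) = y"
  and add: "\<And>x y. x \<in> carrier V ==> y \<in> carrier V ==> f (x \<oplus>\<^bsub>V\<^esub> y) = f x \<oplus>\<^bsub>W\<^esub> f y"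
  and smult: "\<And>c x. x \<in> carrier V ==> f (c \<odot>\<^bsub>V\<^esub> x) = c \<odot>\<^bsub>W\<^esub> f x"
  and inverse_add: "\<And>x y. x \<in> carrier W ==> y \<in> carrier W ==> g (x \<oplus>\<^bsub>W\<^esub> y) = g x \<oplus>\<^bsub>V\<^esub> g y"
  and inverse_smult: "\<And>c x. x \<in> carrier W ==> g (c \<odot>\<^bsub>W\<^esub> x) = c \<odot>\<^bsub>V\<^esub> g x"
  and target_closed: "cvs_closed W"

lemma cvs_isoE:
 assumes "cvs_iso V W" "cvs_closed V"
 obtains f g where "linear_bijection V W f g"
proof -
 from assms(1) obtain f where f: "f \<in> lin_maps complex_alg V W" "bij_betw f (carrier V) (carrier W)"
  by (auto simp: cvs_iso_def)
 define g where "g = inv_into (carrier V) f"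
 note V = cvs_closedD[OF assms(2)]
 note fl = lin_mapsD(2-)[OF f(1)]
 have fs: "f (c \<odot>\<^bsub>V\<^esub> x) = c \<odot>\<^bsub>W\<^esub> f x" if "x \<in> carrier V" for c x using fl(3) that by simp
 have g: "bij_betw g (carrier W) (carrier V)" unfolding g_def by (rule bij_betw_inv_into[OF f(2)])
 have gc: "g y \<in> carrier V" if "y \<in> carrier W" for y using bij_betwE[OF g] that by blast
 have gf: "g (f x) = x" if "x \<in> carrier V" for x
  unfolding g_def by (rule bij_betw_inv_into_left[OF f(2) that])
 have fg: "f (g y) = y" if "y \<in> carrier W" for y
  unfolding g_def by (rule bij_betw_inv_into_right[OF f(2) that])
 have ga: "g (x \<oplus>\<^bsub>W\<^esub> y) = g x \<oplus>\<^bsub>V\<^esub> g y" if "x \<in> carrier W" "y \<in> carrier W" for x y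
  using gf[OF V(1)[OF gc[OF that(1)] gc[OF that(2)]]] fl(2)[OF gc[OF that(1)] gc[OF that(2)]] fg that by simp
 have gs: "g (c \<odot>\<^bsub>W\<^esub> x) = c \<odot>\<^bsub>V\<^esub> g x" if "x \<in> carrier W" for c x
  using gf[OF V(2)[OF gc[OF that]], of c] fs[OF gc[OF that], of c] fg that by simp
 have W: "cvs_closed W"
  unfolding cvs_closed_def
 proof (intro conjI ballI allI)
  fix x y assume "x \<in> carrier W" "y \<in> carrier W"
  then show "x \<oplus>\<^bsub>W\<^esub> y \<in> carrier W"
   using fl(2)[of "g x" "g y"] fl(1)[OF V(1)[of "g x" "g y"]] fg gc by simp
 next
  fix c x assume "x \<in> carrier W"
  then show "c \<odot>\<^bsub>W\<^esub> x \<in> carrier W"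
   using fs[of "g x" c] fl(1)[OF V(2)[of "g x" c]] fg gc by simp
 qed
 show ?thesis
  by (rule that, rule linear_bijection.intro[OF f(2) g]) (simp_all add: fl(1,2) gc gf fg fs ga gs W)
qed

lemma cvs_iso_sym:
 assumes "cvs_iso V W" "cvs_closed V"
 shows "cvs_iso W V"
proof -
 obtain f g where "linear_bijection V W f g" by (rule cvs_isoE[OF assms])
 then interpret linear_bijection V W f g .
 show ?thesis by (rule cvs_isoI[OF target_closed inverse_bij inverse_add inverse_smult])
qed

lemma cvs_iso_closed:
 assumes "cvs_iso V W" "cvs_closed V"
 shows "cvs_closed W"
proof -
 obtain f g where "linear_bijection V W f g" by (rule cvs_isoE[OF assms])
 then show ?thesis by (rule linear_bijection.target_closed)
qed

lemma cvs_iso_trans: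
 assumes vw: "cvs_iso V W" and wx: "cvs_iso W X" and V: "cvs_closed V"
 shows "cvs_iso V X"
proof -
 obtain f g where "linear_bijection V W f g" by (rule cvs_isoE[OF vw V])
 then interpret f: linear_bijection V W f g .
 obtain h k where "linear_bijection W X h k" by (rule cvs_isoE[OF wx f.target_closed])
 then interpret h: linear_bijection W X h k .
 show ?thesis
  by (rule cvs_isoI[OF V bij_betw_trans[OF f.bij h.bij]])
   (simp_all add: f.add f.smult h.add h.smult f.closed)
qed

lemma cfun_reindex:
 assumes I: "finite I" and J: "finite J" and card: "card I = card J"
 shows "cvs_iso (cfun I) (cfun J)"
proof -
 obtain h where h: "bij_betw h J I" using I J card by (metis finite_same_card_bij)
 define k where "k = inv_into J h"
 have kh: "k (h j) = j" "h j \<in> I" if "j \<in> J" for j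
  using that bij_betw_inv_into_left[OF h that] bij_betwE[OF h] by (auto simp: k_def)
 have hk: "h (k i) = i" "k i \<in> J" if "i \<in> I" for i
  using that bij_betw_inv_into_right[OF h that] bij_betwE[OF bij_betw_inv_into[OF h]] by (auto simp: k_def)
 have "bij_betw (\<lambda>c j. if j \<in> J then c (h j) else 0) (carrier (cfun I)) (carrier (cfun J))"
  by (rule bij_betw_byWitness[where f' = "\<lambda>c i. if i \<in> I then c (k i) else 0"])
   (auto simp: cfun_carrier I J kh hk fun_eq_iff)
 then show ?thesis by (rule cvs_isoI[OF cfun_closed[OF I]]) (auto simp: fun_eq_iff)
qed

text \<open>Uniqueness of coefficients in \<open>has_dim\<close> concerns functions that are
  undefined outside the index range, while \<open>cfun\<close> prescribes zero there; the proof
  translates between the two conventions by restriction.\<close>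

lemma has_dim_cfun:
 assumes V: "Module.module complex_alg V" and dim: "has_dim V n"
 shows "cvs_iso (cfun {..<n}) V"
proof -
 interpret V: Module.module complex_alg V by fact
 obtain b where b0: "b ` {..<n} \<subseteq> carrier V \<and>
   (\<forall>x\<in>carrier V. \<exists>!c. c \<in> {..<n} \<rightarrow>\<^sub>E UNIV \<and> x = (\<Oplus>\<^bsub>V\<^esub>i\<in>{..<n}. c i \<odot>\<^bsub>V\<^esub> b i))"
  using dim unfolding has_dim_def by (rule exE)
 note b = b0[THEN conjunct1] and ex1 = b0[THEN conjunct2, THEN bspec]
 have bc: "c \<odot>\<^bsub>V\<^esub> b i \<in> carrier V" if "i < n" for c i using b that by (intro V.smult_closed) auto
 define f where "f c = (\<Oplus>\<^bsub>V\<^esub>i\<in>{..<n}. c i \<odot>\<^bsub>V\<^esub> b i)" for c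
 have fc: "f c \<in> carrier V" for c unfolding f_def by (rule V.finsum_closed) (use bc in auto)
 have fr: "f (restrict c {..<n}) = f c" for c
  unfolding f_def by (rule V.finsum_cong') (use bc in auto)
 have "bij_betw f (carrier (cfun {..<n})) (carrier V)"
  unfolding bij_betw_def
 proof
  show "inj_on f (carrier (cfun {..<n}))"
  proof (rule inj_onI)
   fix c c' assume c: "c \<in> carrier (cfun {..<n})" "c' \<in> carrier (cfun {..<n})" "f c = f c'"
   have "restrict c {..<n} = restrict c' {..<n}"
    using ex1[OF fc[of c]] c(3) fr[of c] fr[of c'] unfolding f_def[symmetric] by (metis restrict_PiE_iff UNIV_I)
   then have "c i = c' i" if "i < n" for i using that by (metis lessThan_iff restrict_apply')
   then show "c = c'" using c(1,2) by (metis cfun_carrier finite_lessThan lessThan_iff ext)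
  qed
  show "f ` carrier (cfun {..<n}) = carrier V"
  proof
   show "carrier V \<subseteq> f ` carrier (cfun {..<n})"
   proof
    fix x assume "x \<in> carrier V"
    then obtain c where c: "x = f c" using ex1 unfolding f_def by blast
    have "f c = f (\<lambda>i. if i < n then c i else 0)"
     unfolding f_def by (rule V.finsum_cong') (use bc in auto)
    moreover have "(\<lambda>i. if i < n then c i else 0) \<in> carrier (cfun {..<n})" by (simp add: cfun_carrier)
    ultimately show "x \<in> f ` carrier (cfun {..<n})" using c by blast
   qed
  qed (use fc in blast)
 qed
 then show ?thesis
 proof (rule cvs_isoI[OF cfun_closed[OF finite_lessThan]])
  fix c d
  have "f (\<lambda>i. c i + d i) = (\<Oplus>\<^bsub>V\<^esub>i\<in>{..<n}. c i \<odot>\<^bsub>V\<^esub> b i \<oplus>\<^bsub>V\<^esub> d i \<odot>\<^bsub>V\<^esub> b i)"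
   unfolding f_def by (rule V.finsum_cong') (use b bc V.smult_l_distr in \<open>auto simp: subset_iff\<close>)
  also have "... = f c \<oplus>\<^bsub>V\<^esub> f d" unfolding f_def by (rule V.finsum_addf) (use bc in auto)
  finally show "f (c \<oplus>\<^bsub>cfun {..<n}\<^esub> d) = f c \<oplus>\<^bsub>V\<^esub> f d" by simp
 next
  fix e c
  have "f (\<lambda>i. e * c i) = (\<Oplus>\<^bsub>V\<^esub>i\<in>{..<n}. e \<odot>\<^bsub>V\<^esub> (c i \<odot>\<^bsub>V\<^esub> b i))"
   unfolding f_def by (rule V.finsum_cong') (use b bc V.smult_assoc1 in \<open>auto simp: subset_iff\<close>)
  also have "... = e \<odot>\<^bsub>V\<^esub> f c"
   unfolding f_def by (rule V.finsum_smult_ldistr[symmetric]) (use bc in auto)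
  finally show "f (e \<odot>\<^bsub>cfun {..<n}\<^esub> c) = e \<odot>\<^bsub>V\<^esub> f c" by simp
 qed
qed

lemma cfun_functional:
 assumes I: "finite I" and c: "c \<in> carrier (cfun I)"
  and add: "\<And>x y. x \<in> carrier (cfun I) ==> y \<in> carrier (cfun I) ==> h (\<lambda>i. x i + y i) = h x + h y"
  and smult: "\<And>e x. x \<in> carrier (cfun I) ==> h (\<lambda>i. e * x i) = e * h x"
 shows "h c = (\<Sum>i\<in>I. c i * h (ind i))"
proof -
 have "h (\<lambda>i. if i \<in> S then c i else 0) = (\<Sum>i\<in>S. c i * h (ind i))" if "S \<subseteq> I" "finite S" for S
  using that(2,1)
 proof (induction S)
  case empty
  then show ?case using smult[of "\<lambda>_. 0" 0] by (simp add: cfun_carrier I)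
 next
  case (insert s S)
  have "(\<lambda>i. if i \<in> insert s S then c i else 0) = (\<lambda>i. c s * ind s i + (if i \<in> S then c i else 0))"
   using insert by (auto simp: fun_eq_iff ind_def)
  moreover have "h (\<lambda>i. c s * ind s i + (if i \<in> S then c i else 0)) =
    h (\<lambda>i. c s * ind s i) + h (\<lambda>i. if i \<in> S then c i else 0)"
   by (rule add) (use insert.prems in \<open>auto simp: cfun_carrier I ind_def\<close>)
  moreover have "h (\<lambda>i. c s * ind s i) = c s * h (ind s)"
   by (rule smult) (use insert.prems in \<open>auto simp: cfun_carrier I ind_def\<close>)
  ultimately show ?case using insert by simp
 qed
 moreover have "(\<lambda>i. if i \<in> I then c i else 0) = c" using c by (auto simp: cfun_carrier I fun_eq_iff)
 ultimately show ?thesis using I by fastforce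
qed

lemma cvs_dual_simps:
 "carrier (cvs_dual V) = lin_maps complex_alg V complex_alg"
 "f \<oplus>\<^bsub>cvs_dual V\<^esub> g = (\<lambda>x\<in>carrier V. f x + g x)" "c \<odot>\<^bsub>cvs_dual V\<^esub> f = (\<lambda>x\<in>carrier V. c * f x)"
 by (simp_all add: cvs_dual_def hom_space_def)

text \<open>A coefficient vector goes to the functional with these values on the basis transported
  from the indicator functions. It is onto because a functional is determined by its values on that
  basis.\<close>

lemma dual_cfun:
 assumes I: "finite I" and iso: "cvs_iso (cfun I) V"
 shows "cvs_iso (cfun I) (cvs_dual V)"
proof -
 obtain f g where "linear_bijection (cfun I) V f g" by (rule cvs_isoE[OF iso cfun_closed[OF I]])
 then interpret L: linear_bijection "cfun I" V f g .
 note fg = L.closed L.inverse_closed L.inverse_left L.inverse_right L.add L.smult L.inverse_add L.inverse_smult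
 note V = L.target_closed
 have u: "ind i \<in> carrier (cfun I)" if "i \<in> I" for i using that by (auto simp: cfun_carrier I ind_def)
 let ?F = "\<lambda>c. \<lambda>x\<in>carrier V. \<Sum>i\<in>I. c i * g x i"
 have Fl: "?F c \<in> lin_maps complex_alg V complex_alg" for c
  by (rule lin_mapsI) (auto simp: fg cvs_closedD[OF V] sum.distrib sum_distrib_left algebra_simps)
 have Fu: "?F c (f (ind i)) = c i" if i: "i \<in> I" for c i
 proof -
  have "?F c (f (ind i)) = (\<Sum>j\<in>I. if j = i then c j else 0)"
   using fg(1,3) u[OF i] by (auto simp: ind_def intro!: sum.cong)
  then show ?thesis using I i by simp
 qed
 have "bij_betw ?F (carrier (cfun I)) (carrier (cvs_dual V))"
  unfolding bij_betw_def cvs_dual_simps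
 proof
  show "inj_on ?F (carrier (cfun I))"
  proof (rule inj_onI)
   fix c c' assume c: "c \<in> carrier (cfun I)" "c' \<in> carrier (cfun I)" "?F c = ?F c'"
   show "c = c'"
   proof
    fix i show "c i = c' i"
     using Fu[of i c] Fu[of i c'] c by (cases "i \<in> I") (auto simp: cfun_carrier[OF I] simp del: restrict_apply)
   qed
  qed
  show "?F ` carrier (cfun I) = lin_maps complex_alg V complex_alg"
  proof (rule equalityI; rule subsetI)
   fix \<psi> assume \<psi>: "\<psi> \<in> lin_maps complex_alg V complex_alg"
   note l = lin_mapsD(2-)[OF \<psi>, simplified]
   let ?c = "\<lambda>i. if i \<in> I then \<psi> (f (ind i)) else 0"
   have "\<psi> = ?F ?c"
   proof (rule PiE_ext[OF lin_mapsD(1)[OF \<psi>] lin_mapsD(1)[OF Fl]])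
    fix x assume x: "x \<in> carrier V"
    have "\<psi> (f (g x)) = (\<Sum>i\<in>I. g x i * \<psi> (f (ind i)))"
     by (rule cfun_functional[OF I fg(2)[OF x], of "\<lambda>y. \<psi> (f y)"])
      (use fg(5,6) fg(1) l in \<open>auto simp: cfun_carrier[OF I]\<close>)
    then show "\<psi> x = ?F ?c x" using x by (simp add: fg(4) mult.commute)
   qed
   moreover have "?c \<in> carrier (cfun I)" by (simp add: cfun_carrier I)
   ultimately show "\<psi> \<in> ?F ` carrier (cfun I)" by (rule image_eqI)
  qed (use Fl in blast)
 qed
 then show ?thesis
  by (rule cvs_isoI[OF cfun_closed[OF I]])
   (auto simp: cvs_dual_simps fun_eq_iff sum.distrib sum_distrib_left algebra_simps)
qed

lemma cvs_sum_simps: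
 "carrier (cvs_sum V W) = carrier V \<times> carrier W"
 "(x, y) \<oplus>\<^bsub>cvs_sum V W\<^esub> (x', y') = (x \<oplus>\<^bsub>V\<^esub> x', y \<oplus>\<^bsub>W\<^esub> y')"
 "c \<odot>\<^bsub>cvs_sum V W\<^esub> (x, y) = (c \<odot>\<^bsub>V\<^esub> x, c \<odot>\<^bsub>W\<^esub> y)"
 by (simp_all add: cvs_sum_def)

lemma sum_cfun:
 assumes I: "finite I" "cvs_iso (cfun I) V" and J: "finite J" "cvs_iso (cfun J) W"
 shows "cvs_iso (cfun (I <+> J)) (cvs_sum V W)"
proof -
 obtain f f' where "linear_bijection (cfun I) V f f'" by (rule cvs_isoE[OF I(2) cfun_closed[OF I(1)]])
 then interpret f: linear_bijection "cfun I" V f f' .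
 obtain h h' where "linear_bijection (cfun J) W h h'" by (rule cvs_isoE[OF J(2) cfun_closed[OF J(1)]])
 then interpret h: linear_bijection "cfun J" W h h' .
 have IJ: "finite (I <+> J)" using I J by simp
 have io: "Inl i \<in> I <+> J \<longleftrightarrow> i \<in> I" "Inr j \<in> I <+> J \<longleftrightarrow> j \<in> J" for i j by auto
 let ?s = "\<lambda>c :: 'a + 'c => complex. (\<lambda>i. c (Inl i), \<lambda>j. c (Inr j))"
 have s: "bij_betw ?s (carrier (cfun (I <+> J))) (carrier (cfun I) \<times> carrier (cfun J))"
  by (rule bij_betw_byWitness[where f' = "\<lambda>(a, b). case_sum a b"])
   (auto simp: cfun_carrier[OF IJ] cfun_carrier[OF I(1)] cfun_carrier[OF J(1)] split_sum_all fun_eq_iff io)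
 have "bij_betw (map_prod f h \<circ> ?s) (carrier (cfun (I <+> J))) (carrier V \<times> carrier W)"
  by (rule bij_betw_trans[OF s bij_betw_map_prod[OF f.bij h.bij]])
 then have "bij_betw (\<lambda>c. (f (\<lambda>i. c (Inl i)), h (\<lambda>j. c (Inr j)))) (carrier (cfun (I <+> J))) (carrier (cvs_sum V W))"
  by (simp add: comp_def cvs_sum_simps)
 then show ?thesis
 proof (rule cvs_isoI[OF cfun_closed[OF IJ]])
  fix x y assume "x \<in> carrier (cfun (I <+> J))" "y \<in> carrier (cfun (I <+> J))"
  then have "(\<lambda>i. x (Inl i)) \<in> carrier (cfun I)" "(\<lambda>i. y (Inl i)) \<in> carrier (cfun I)"
   "(\<lambda>i. x (Inr i)) \<in> carrier (cfun J)" "(\<lambda>i. y (Inr i)) \<in> carrier (cfun J)"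
   by (auto simp: cfun_carrier[OF IJ] cfun_carrier[OF I(1)] cfun_carrier[OF J(1)] split_sum_all io)
  from f.add[OF this(1,2)] h.add[OF this(3,4)]
  show "(f (\<lambda>i. (x \<oplus>\<^bsub>cfun (I <+> J)\<^esub> y) (Inl i)), h (\<lambda>j. (x \<oplus>\<^bsub>cfun (I <+> J)\<^esub> y) (Inr j))) =
    (f (\<lambda>i. x (Inl i)), h (\<lambda>j. x (Inr j))) \<oplus>\<^bsub>cvs_sum V W\<^esub> (f (\<lambda>i. y (Inl i)), h (\<lambda>j. y (Inr j)))"
   by (simp add: cvs_sum_simps)
 next
  fix c x assume "x \<in> carrier (cfun (I <+> J))"
  then have "(\<lambda>i. x (Inl i)) \<in> carrier (cfun I)" "(\<lambda>i. x (Inr i)) \<in> carrier (cfun J)"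
   by (auto simp: cfun_carrier[OF IJ] cfun_carrier[OF I(1)] cfun_carrier[OF J(1)] split_sum_all io)
  from f.smult[OF this(1), of c] h.smult[OF this(2), of c]
  show "(f (\<lambda>i. (c \<odot>\<^bsub>cfun (I <+> J)\<^esub> x) (Inl i)), h (\<lambda>j. (c \<odot>\<^bsub>cfun (I <+> J)\<^esub> x) (Inr j))) =
    c \<odot>\<^bsub>cvs_sum V W\<^esub> (f (\<lambda>i. x (Inl i)), h (\<lambda>j. x (Inr j)))"
   by (simp add: cvs_sum_simps)
 qed
qed

text \<open>A first isomorphism theorem that does not presuppose the vector space axioms for \<open>V\<close>.\<close>

lemma quot_module_iso:
 fixes V :: "(complex, 'v) module" and F :: "'v => 'i => complex"
 assumes add: "\<And>x y. x \<in> carrier V ==> y \<in> carrier V ==> x \<oplus>\<^bsub>V\<^esub> y \<in> carrier V \<and> F (x \<oplus>\<^bsub>V\<^esub> y) = (\<lambda>i. F x i + F y i)"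
  and smult: "\<And>c x. x \<in> carrier V ==> c \<odot>\<^bsub>V\<^esub> x \<in> carrier V \<and> F (c \<odot>\<^bsub>V\<^esub> x) = (\<lambda>i. c * F x i)"
  and diff: "\<And>x y. x \<in> carrier V ==> y \<in> carrier V ==> \<exists>z\<in>carrier V. z \<oplus>\<^bsub>V\<^esub> x = y"
  and N: "N = {x \<in> carrier V. F x = (\<lambda>_. 0)}" and surj: "F ` carrier V = carrier (cfun I)" and I: "finite I"
 shows "cvs_iso (cfun I) (quot_module V N)"
proof -
 \<comment> \<open>The cosets of \<open>N\<close> are the fibres of \<open>F\<close>, so the
   quotient is parametrized by the values of \<open>F\<close>. The hypothesis \<open>diff\<close>
   supplies the element by which two members of a fibre differ.\<close>
 define fib where "fib y = {x \<in> carrier V. F x = y}" for y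
 have coset: "N +>\<^bsub>V\<^esub> x = fib (F x)" if x: "x \<in> carrier V" for x
 proof (rule equalityI; rule subsetI)
  fix y assume "y \<in> N +>\<^bsub>V\<^esub> x"
  then show "y \<in> fib (F x)" using add x by (auto simp: a_r_coset_def' N fib_def)
 next
  fix y assume y: "y \<in> fib (F x)"
  then obtain z where z: "z \<in> carrier V" "z \<oplus>\<^bsub>V\<^esub> x = y" using diff[OF x] by (auto simp: fib_def)
  have "F z i + F x i = F x i" for i using add[OF z(1) x] y z(2) by (auto simp: fib_def fun_eq_iff)
  then have "z \<in> N" using z(1) by (auto simp: N fun_eq_iff)
  then show "y \<in> N +>\<^bsub>V\<^esub> x" using z(2) by (auto simp: a_r_coset_def')
 qed
 have car: "carrier (quot_module V N) = fib ` carrier (cfun I)"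
  using coset by (simp add: quot_module_def A_RCOSETS_def' surj[symmetric]) blast
 have ex: "\<exists>x\<in>carrier V. F x = y" if "y \<in> carrier (cfun I)" for y using that unfolding surj[symmetric] by blast
 have qadd: "fib y \<oplus>\<^bsub>quot_module V N\<^esub> fib z = fib (\<lambda>i. y i + z i)" if yz: "y \<in> carrier (cfun I)" "z \<in> carrier (cfun I)" for y z
 proof (rule equalityI; rule subsetI)
  fix v assume "v \<in> fib y \<oplus>\<^bsub>quot_module V N\<^esub> fib z"
  then show "v \<in> fib (\<lambda>i. y i + z i)" using add by (auto simp: quot_module_def set_add_def' fib_def)
 next
  fix v assume v: "v \<in> fib (\<lambda>i. y i + z i)"
  obtain x where x: "x \<in> carrier V" "F x = z" using ex[OF yz(2)] by blast
  obtain u where u: "u \<in> carrier V" "u \<oplus>\<^bsub>V\<^esub> x = v" using diff[OF x(1)] v by (auto simp: fib_def)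
  have "F u i = y i" for i using add[OF u(1) x(1)] u(2) v x(2) by (auto simp: fib_def fun_eq_iff)
  then have "u \<in> fib y" using u(1) by (auto simp: fib_def fun_eq_iff)
  then show "v \<in> fib y \<oplus>\<^bsub>quot_module V N\<^esub> fib z" using u(2) x by (auto simp: quot_module_def set_add_def' fib_def)
 qed
 have qsmult: "c \<odot>\<^bsub>quot_module V N\<^esub> fib y = fib (\<lambda>i. c * y i)" if y: "y \<in> carrier (cfun I)" for c y
 proof -
  have "N +>\<^bsub>V\<^esub> (c \<odot>\<^bsub>V\<^esub> x) = fib (\<lambda>i. c * y i)" if "x \<in> fib y" for x
   using that coset[of "c \<odot>\<^bsub>V\<^esub> x"] smult[of x c] by (simp add: fib_def)
  moreover have "fib y \<noteq> {}" using ex[OF y] by (auto simp: fib_def)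
  ultimately show ?thesis by (simp add: quot_module_def)
 qed
 have "inj_on fib (carrier (cfun I))"
 proof (rule inj_onI)
  fix y z assume "y \<in> carrier (cfun I)" "fib y = fib z"
  then show "y = z" using ex[of y] by (auto simp: fib_def)
 qed
 then have "bij_betw fib (carrier (cfun I)) (carrier (quot_module V N))"
  unfolding car by (rule inj_on_imp_bij_betw)
 then show ?thesis
  by (rule cvs_isoI[OF cfun_closed[OF I]]) (simp_all add: qadd qsmult)
qed

section \<open>Sums of graded maps; coboundaries are cocycles\<close>

lemma deg_maps_add:
 assumes f: "f \<in> deg_maps R M GM N GN k" and g: "g \<in> deg_maps R M GM N GN k"
  and M: "graded_module R GR M GM" and N: "graded_module R GR N GN"
 shows "(\<lambda>x\<in>carrier M. f x \<oplus>\<^bsub>N\<^esub> g x) \<in> deg_maps R M GM N GN k"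
proof -
 interpret M: graded R M GR GM by (rule gradedI) fact
 interpret N: graded R N GR GN by (rule gradedI) fact
 note f = deg_mapsD[OF f] and g = deg_mapsD[OF g]
 note cl = lin_mapsD(2)[OF f(1)] lin_mapsD(2)[OF g(1)]
 have "(\<lambda>x\<in>carrier M. f x \<oplus>\<^bsub>N\<^esub> g x) \<in> lin_maps R M N"
  by (rule lin_mapsI)
   (simp_all add: lin_mapsD(3,4)[OF f(1)] lin_mapsD(3,4)[OF g(1)] cl M.smult_closed N.smult_r_distr N.M.a_ac)
 moreover have "f x \<oplus>\<^bsub>N\<^esub> g x \<in> GN (j + k)" if "x \<in> GM j" for x j
  using f(2)[OF that] g(2)[OF that] by (rule N.component_add)
 ultimately show ?thesis using M.component_carrier by (auto simp: deg_maps_def)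
qed

lemma ext_cocyclesD:
 assumes "f \<in> ext_cocycles R P GP d N GN n k"
 shows "f \<in> deg_maps R (P n) (GP n) N GN k" "x \<in> carrier (P (Suc n)) ==> f (d n x) = \<zero>\<^bsub>N\<^esub>"
 using assms by (auto simp: ext_cocycles_def)

lemma (in resolution) coboundary_cocycle:
 assumes N: "graded_module R GR N GN" and f: "f \<in> ext_coboundaries R P GP d N GN n k"
 shows "f \<in> ext_cocycles R P GP d N GN n k"
proof -
 interpret N: graded R N GR GN by (rule gradedI) fact
 have dc: "d n x \<in> carrier (P n)" if "x \<in> carrier (P (Suc n))" for n x
  by (rule lin_mapsD(2)[OF deg_mapsD(1)[OF d] that])
 show ?thesis
 proof (cases n)
  case 0
  have "(\<lambda>x\<in>carrier (P 0). \<zero>\<^bsub>N\<^esub>) \<in> lin_maps R (P 0) N"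
   by (rule lin_mapsI) (auto simp: P.smult_closed N.smult_zero)
  then show ?thesis using f 0 dc[of _ 0] P.component_carrier[of _ 0] N.component_zero
   by (auto simp: ext_coboundaries_def ext_cocycles_def deg_maps_def)
 next
  case (Suc m)
  then obtain u where u: "u \<in> deg_maps R (P m) (GP m) N GN k" "f = (\<lambda>x\<in>carrier (P (Suc m)). u (d m x))"
   using f by (auto simp: ext_coboundaries_def)
  have "f \<in> deg_maps R (P (Suc m)) (GP (Suc m)) N GN k"
   unfolding u(2) using deg_maps_comp[OF d u(1) graded_P] by simp
  moreover have "u \<zero>\<^bsub>P m\<^esub> = \<zero>\<^bsub>N\<^esub>"
  proof -
   interpret u: abelian_group_hom "P m" N u
    by (rule lin_maps_group_hom[OF deg_mapsD(1)[OF u(1)] P.M.abelian_group_axioms N.M.abelian_group_axioms])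
   show ?thesis by (rule u.hom_zero)
  qed
  ultimately show ?thesis using Suc dc d_d by (auto simp: ext_cocycles_def u(2))
 qed
qed

lemma (in abelian_group) minus_plus_cancel: "x \<in> carrier G ==> y \<in> carrier G ==> (x \<ominus> y) \<oplus> y = x"
 by (simp add: a_minus_def a_assoc l_neg)

lemma finite_cohomology_basis: "finite (cohomology_basis n k)"
 by (simp add: cohomology_basis_def)

section \<open>Ext for an arbitrary resolution\<close>

context e8_algebra
begin

lemma scalar_act:
 assumes "m \<in> carrier A"
 shows "chi ((c \<odot>\<^bsub>R\<^esub> \<one>\<^bsub>R\<^esub>) \<odot>\<^bsub>M\<^esub> m) k = c * chi m k"
proof -
 have 1: "\<one>\<^bsub>R\<^esub> \<in> carrier R" by simp
 have "chi ((c \<odot>\<^bsub>R\<^esub> \<one>\<^bsub>R\<^esub>) \<odot>\<^bsub>M\<^esub> m) k = c * chi (\<one>\<^bsub>R\<^esub> \<odot>\<^bsub>M\<^esub> m) k"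
  unfolding act(2)[OF env_chi_smult(1)[OF 1] assms] act(2)[OF 1 assms] env_chi_smult(2)[OF 1]
  by (simp add: sum_distrib_left mult.assoc)
 then show ?thesis using M.smult_one assms by simp
qed

text \<open>In \<open>hom_space\<close> a complex number acts through a multiple of the unit of the
  enveloping algebra. A scaled cocycle is again linear because the action of this multiple on
  \<open>M\<close> commutes with that of every scalar.\<close>

lemma scalar_act_commute:
 assumes X: "X \<in> carrier R" and m: "m \<in> carrier A"
 shows "(c \<odot>\<^bsub>R\<^esub> \<one>\<^bsub>R\<^esub>) \<odot>\<^bsub>M\<^esub> (X \<odot>\<^bsub>M\<^esub> m) = X \<odot>\<^bsub>M\<^esub> ((c \<odot>\<^bsub>R\<^esub> \<one>\<^bsub>R\<^esub>) \<odot>\<^bsub>M\<^esub> m)"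
proof (rule chi_eqI)
 have c: "c \<odot>\<^bsub>R\<^esub> \<one>\<^bsub>R\<^esub> \<in> carrier R" by (rule env_chi_smult(1)) simp
 note cl = act(1)[OF c] act(1)[OF X]
 show "(c \<odot>\<^bsub>R\<^esub> \<one>\<^bsub>R\<^esub>) \<odot>\<^bsub>M\<^esub> (X \<odot>\<^bsub>M\<^esub> m) \<in> carrier A" "X \<odot>\<^bsub>M\<^esub> ((c \<odot>\<^bsub>R\<^esub> \<one>\<^bsub>R\<^esub>) \<odot>\<^bsub>M\<^esub> m) \<in> carrier A"
  using cl m by blast+
 fix k
 show "chi ((c \<odot>\<^bsub>R\<^esub> \<one>\<^bsub>R\<^esub>) \<odot>\<^bsub>M\<^esub> (X \<odot>\<^bsub>M\<^esub> m)) k = chi (X \<odot>\<^bsub>M\<^esub> ((c \<odot>\<^bsub>R\<^esub> \<one>\<^bsub>R\<^esub>) \<odot>\<^bsub>M\<^esub> m)) k"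
  unfolding scalar_act[OF cl(2)[OF m]] act(2)[OF X cl(1)[OF m]] act(2)[OF X m] scalar_act[OF m]
  by (simp add: sum_distrib_left algebra_simps)
qed

text \<open>Classes see only values on generators. Assuming additivity just there spares a
  comparison of restricted functions for cocycles that are pulled back from another
  resolution.\<close>

lemma cls_add:
 assumes "\<And>g. g \<in> set (gens (n mod 4)) ==> \<phi> (qgen (n mod 4) g) = \<psi> (qgen (n mod 4) g) \<oplus>\<^bsub>A\<^esub> \<psi>' (qgen (n mod 4) g)"
  and "\<And>g. g \<in> set (gens (n mod 4)) ==> \<psi> (qgen (n mod 4) g) \<in> carrier A"
  and "\<And>g. g \<in> set (gens (n mod 4)) ==> \<psi>' (qgen (n mod 4) g) \<in> carrier A"
 shows "cls n \<phi> i = cls n \<psi> i + cls n \<psi>' i"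
proof -
 have "co (n mod 4) \<phi> = (\<lambda>t. co (n mod 4) \<psi> t + co (n mod 4) \<psi>' t)"
  using assms by (auto simp: co_def chi_add fun_eq_iff)
 then show ?thesis unfolding cls_def by (simp only: apply_cols_add)
qed

lemma cls_scalar:
 assumes "\<And>g. g \<in> set (gens (n mod 4)) ==> \<phi> (qgen (n mod 4) g) = (c \<odot>\<^bsub>R\<^esub> \<one>\<^bsub>R\<^esub>) \<odot>\<^bsub>M\<^esub> \<psi> (qgen (n mod 4) g)"
  and "\<And>g. g \<in> set (gens (n mod 4)) ==> \<psi> (qgen (n mod 4) g) \<in> carrier A"
 shows "cls n \<phi> i = c * cls n \<psi> i"
proof -
 have "co (n mod 4) \<phi> = (\<lambda>t. c * co (n mod 4) \<psi> t)"
  using assms by (auto simp: co_def scalar_act fun_eq_iff)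
 then show ?thesis unfolding cls_def by (simp only: apply_cols_scale)
qed

text \<open>The map sends a cocycle on the given resolution to the class of its pullback to the
  periodic one. Its kernel is the space of coboundaries, by \<open>ext_comparison\<close> on one
  side and \<open>cls_coboundary\<close> on the other, and it is onto by \<open>cls_surj\<close>
  together with the lifting clause of the comparison.\<close>

theorem cohomology_iso:
 assumes res: "graded_projective_resolution R GR M GA P GP d \<epsilon>"
 shows "cvs_iso (cfun (cohomology_basis n k)) (graded_Ext R P GP d M GA n k)"
proof -
 let ?Q = "\<lambda>n. QM (n mod 4)"
 interpret P: resolution R GR M GA P GP d \<epsilon> by (rule resolution.intro[OF res env_spanned bimodule_graded])
 interpret QR: resolution R GR M GA ?Q GQ "\<lambda>n. dq (Suc n mod 4)" aug by (rule resolution_Q)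
 interpret T: two_resolutions R GR M GA P GP d \<epsilon> ?Q GQ "\<lambda>n. dq (Suc n mod 4)" aug ..
 interpret N: graded R M GR GA by (rule gradedI[OF bimodule_graded])
 let ?Z = "ext_cocycles R P GP d M GA n k" and ?B = "ext_coboundaries R P GP d M GA n k"
 obtain f where F: "(\<forall>n. f n \<in> deg_maps R (?Q n) (GQ n) (P n) (GP n) 0) \<and> (\<forall>n k.
  (\<forall>\<phi>\<in>ext_cocycles R P GP d M GA n k.
   (\<lambda>x\<in>carrier (?Q n). \<phi> (f n x)) \<in> QZ n k \<and>
   ((\<lambda>x\<in>carrier (?Q n). \<phi> (f n x)) \<in> QB n k \<longleftrightarrow> \<phi> \<in> ext_coboundaries R P GP d M GA n k)) \<and>
  (\<forall>\<psi>\<in>QZ n k. \<exists>\<phi>\<in>ext_cocycles R P GP d M GA n k.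
   (\<lambda>x\<in>carrier (?Q n). \<phi> (f n x) \<ominus>\<^bsub>M\<^esub> \<psi> x) \<in> QB n k))"
  using T.ext_comparison[OF bimodule_graded] by (rule exE)
 note f = F[THEN conjunct1, THEN spec] and F' = F[THEN conjunct2, THEN spec, THEN spec]
 have pull: "(\<lambda>x\<in>carrier (?Q n). \<phi> (f n x)) \<in> QZ n k" if "\<phi> \<in> ?Z" for \<phi>
  by (rule F'[THEN conjunct1, THEN bspec, THEN conjunct1, OF that])
 have cob: "(\<lambda>x\<in>carrier (?Q n). \<phi> (f n x)) \<in> QB n k \<longleftrightarrow> \<phi> \<in> ?B" if "\<phi> \<in> ?Z" for \<phi>
  by (rule F'[THEN conjunct1, THEN bspec, THEN conjunct2, OF that])
 have lift: "\<exists>\<phi>\<in>?Z. (\<lambda>x\<in>carrier (?Q n). \<phi> (f n x) \<ominus>\<^bsub>M\<^esub> \<psi> x) \<in> QB n k" if "\<psi> \<in> QZ n k" for \<psi>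
  by (rule F'[THEN conjunct2, THEN bspec, OF that])
 define pb where "pb \<phi> = (\<lambda>x\<in>carrier (?Q n). \<phi> (f n x))" for \<phi> :: "'b => 'a"
 let ?F = "\<lambda>\<phi>. cls n (pb \<phi>)"
 let ?V = "(hom_space R (P n) M)\<lparr>carrier := ?Z\<rparr>"
 note fl = lin_mapsD(2)[OF deg_mapsD(1)[OF f]]
 have qg: "qgen (n mod 4) g \<in> carrier (?Q n)" if "g \<in> set (gens (n mod 4))" for g by (rule Q.gen_closed[OF that])
 have dl: "d n x \<in> carrier (P n)" if "x \<in> carrier (P (Suc n))" for x
  by (rule lin_mapsD(2)[OF deg_mapsD(1)[OF P.d] that])
 have pbg: "pb \<phi> (qgen (n mod 4) g) = \<phi> (f n (qgen (n mod 4) g))" if "g \<in> set (gens (n mod 4))" for \<phi> g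
  using qg[OF that] by (simp add: pb_def)
 have \<phi>c: "\<phi> x \<in> carrier A" if "\<phi> \<in> ?Z" "x \<in> carrier (P n)" for \<phi> x
  using lin_mapsD(2)[OF deg_mapsD(1)[OF ext_cocyclesD(1)[OF that(1)]] that(2)] by simp
 have pbc: "pb \<phi> (qgen (n mod 4) g) \<in> carrier A" if "\<phi> \<in> ?Z" "g \<in> set (gens (n mod 4))" for \<phi> g
  unfolding pbg[OF that(2)] by (rule \<phi>c[OF that(1) fl[OF qg[OF that(2)]]])
 have add: "(\<lambda>x\<in>carrier (P n). \<phi> x \<oplus>\<^bsub>M\<^esub> \<psi> x) \<in> ?Z" if "\<phi> \<in> ?Z" "\<psi> \<in> ?Z" for \<phi> \<psi>
  unfolding ext_cocycles_def
  using deg_maps_add[OF ext_cocyclesD(1)[OF that(1)] ext_cocyclesD(1)[OF that(2)] P.graded_P bimodule_graded]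
   ext_cocyclesD(2)[OF that(1)] ext_cocyclesD(2)[OF that(2)] dl
  by auto
 have minus: "(\<lambda>x\<in>carrier (P n). \<phi> x \<ominus>\<^bsub>M\<^esub> \<psi> x) \<in> ?Z" if "\<phi> \<in> ?Z" "\<psi> \<in> ?Z" for \<phi> \<psi>
  unfolding ext_cocycles_def
  using deg_maps_minus[OF ext_cocyclesD(1)[OF that(1)] ext_cocyclesD(1)[OF that(2)] P.graded_P bimodule_graded]
   ext_cocyclesD(2)[OF that(1)] ext_cocyclesD(2)[OF that(2)] dl
  by (auto simp: a_minus_def simp del: bimodule_simps)
 have smult: "(\<lambda>x\<in>carrier (P n). (c \<odot>\<^bsub>R\<^esub> \<one>\<^bsub>R\<^esub>) \<odot>\<^bsub>M\<^esub> \<phi> x) \<in> ?Z" if \<phi>: "\<phi> \<in> ?Z" for c \<phi>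
 proof -
  have 1: "\<one>\<^bsub>R\<^esub> \<in> carrier R" by simp
  have c: "c \<odot>\<^bsub>R\<^esub> \<one>\<^bsub>R\<^esub> \<in> carrier R" by (rule env_chi_smult(1)) simp
  note l = lin_mapsD[OF deg_mapsD(1)[OF ext_cocyclesD(1)[OF \<phi>]]]
  have "(\<lambda>x\<in>carrier (P n). (c \<odot>\<^bsub>R\<^esub> \<one>\<^bsub>R\<^esub>) \<odot>\<^bsub>M\<^esub> \<phi> x) \<in> lin_maps R (P n) M"
  proof (rule lin_mapsI)
   show "(c \<odot>\<^bsub>R\<^esub> \<one>\<^bsub>R\<^esub>) \<odot>\<^bsub>M\<^esub> \<phi> x \<in> carrier M" if "x \<in> carrier (P n)" for x
    using M.smult_closed[OF c l(2)[OF that]] .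
   show "(c \<odot>\<^bsub>R\<^esub> \<one>\<^bsub>R\<^esub>) \<odot>\<^bsub>M\<^esub> \<phi> (x \<oplus>\<^bsub>P n\<^esub> y) = (c \<odot>\<^bsub>R\<^esub> \<one>\<^bsub>R\<^esub>) \<odot>\<^bsub>M\<^esub> \<phi> x \<oplus>\<^bsub>M\<^esub> (c \<odot>\<^bsub>R\<^esub> \<one>\<^bsub>R\<^esub>) \<odot>\<^bsub>M\<^esub> \<phi> y"
    if "x \<in> carrier (P n)" "y \<in> carrier (P n)" for x y
    unfolding l(3)[OF that] by (rule M.smult_r_distr[OF c l(2)[OF that(1)] l(2)[OF that(2)]])
   show "(c \<odot>\<^bsub>R\<^esub> \<one>\<^bsub>R\<^esub>) \<odot>\<^bsub>M\<^esub> \<phi> (r \<odot>\<^bsub>P n\<^esub> x) = r \<odot>\<^bsub>M\<^esub> ((c \<odot>\<^bsub>R\<^esub> \<one>\<^bsub>R\<^esub>) \<odot>\<^bsub>M\<^esub> \<phi> x)"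
    if "r \<in> carrier R" "x \<in> carrier (P n)" for r x
    unfolding l(4)[OF that] by (rule scalar_act_commute[OF that(1) \<phi>c[OF \<phi> that(2)]])
  qed (use P.P.smult_closed in auto)
  moreover have "(c \<odot>\<^bsub>R\<^esub> \<one>\<^bsub>R\<^esub>) \<odot>\<^bsub>M\<^esub> \<phi> x \<in> GA (j + k)" if x: "x \<in> GP n j" for x j
  proof -
   have "\<phi> x \<in> GA (j + k)" using deg_mapsD(2)[OF ext_cocyclesD(1)[OF \<phi>] x] .
   then show ?thesis using M.smult_closed[OF c, of "\<phi> x"] scalar_act[of "\<phi> x" c] by (auto simp: GA homogeneous_def)
  qed
  moreover have "(c \<odot>\<^bsub>R\<^esub> \<one>\<^bsub>R\<^esub>) \<odot>\<^bsub>M\<^esub> \<phi> (d n x) = \<zero>\<^bsub>M\<^esub>" if "x \<in> carrier (P (Suc n))" for x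
   using ext_cocyclesD(2)[OF \<phi> that] M.smult_zero[OF c] by simp
  ultimately show ?thesis using P.P.component_carrier dl by (auto simp: ext_cocycles_def deg_maps_def)
 qed
 have Vs: "carrier ?V = ?Z" "\<phi> \<oplus>\<^bsub>?V\<^esub> \<psi> = (\<lambda>x\<in>carrier (P n). \<phi> x \<oplus>\<^bsub>M\<^esub> \<psi> x)"
  "c \<odot>\<^bsub>?V\<^esub> \<phi> = (\<lambda>x\<in>carrier (P n). (c \<odot>\<^bsub>R\<^esub> \<one>\<^bsub>R\<^esub>) \<odot>\<^bsub>M\<^esub> \<phi> x)" for \<phi> \<psi> c
  by (simp_all add: hom_space_def)
 have Fadd: "?F (\<lambda>x\<in>carrier (P n). \<phi> x \<oplus>\<^bsub>M\<^esub> \<psi> x) = (\<lambda>i. ?F \<phi> i + ?F \<psi> i)" if "\<phi> \<in> ?Z" "\<psi> \<in> ?Z" for \<phi> \<psi>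
  by (rule ext, rule cls_add) (use pbc that fl[OF qg] in \<open>simp_all add: pbg\<close>)
 have Fsmult: "?F (\<lambda>x\<in>carrier (P n). (c \<odot>\<^bsub>R\<^esub> \<one>\<^bsub>R\<^esub>) \<odot>\<^bsub>M\<^esub> \<phi> x) = (\<lambda>i. c * ?F \<phi> i)" if "\<phi> \<in> ?Z" for c \<phi>
  by (rule ext, rule cls_scalar) (use pbc that fl[OF qg] in \<open>simp_all add: pbg\<close>)
 have "cvs_iso (cfun (cohomology_basis n k)) (quot_module ?V ?B)"
 proof (rule quot_module_iso[where F = ?F])
  show "\<phi> \<oplus>\<^bsub>?V\<^esub> \<psi> \<in> carrier ?V \<and> ?F (\<phi> \<oplus>\<^bsub>?V\<^esub> \<psi>) = (\<lambda>i. ?F \<phi> i + ?F \<psi> i)"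
   if "\<phi> \<in> carrier ?V" "\<psi> \<in> carrier ?V" for \<phi> \<psi>
   using that unfolding Vs by (intro conjI add Fadd)
  show "c \<odot>\<^bsub>?V\<^esub> \<phi> \<in> carrier ?V \<and> ?F (c \<odot>\<^bsub>?V\<^esub> \<phi>) = (\<lambda>i. c * ?F \<phi> i)" if "\<phi> \<in> carrier ?V" for c \<phi>
   using that unfolding Vs by (intro conjI smult Fsmult)
  show "\<exists>\<chi>\<in>carrier ?V. \<chi> \<oplus>\<^bsub>?V\<^esub> \<phi> = \<psi>" if "\<phi> \<in> carrier ?V" "\<psi> \<in> carrier ?V" for \<phi> \<psi>
   unfolding Vs
  proof (rule bexI)
   have z: "\<phi> \<in> ?Z" "\<psi> \<in> ?Z" using that by simp_all
   show "(\<lambda>x\<in>carrier (P n). \<psi> x \<ominus>\<^bsub>M\<^esub> \<phi> x) \<in> ?Z" by (rule minus[OF z(2,1)])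
   have e: "(\<psi> x \<ominus>\<^bsub>M\<^esub> \<phi> x) \<oplus>\<^bsub>M\<^esub> \<phi> x = \<psi> x" if "x \<in> carrier (P n)" for x
    by (rule M.M.minus_plus_cancel) (use \<phi>c[OF z(1) that] \<phi>c[OF z(2) that] in simp_all)
   show "(\<lambda>x\<in>carrier (P n). (\<lambda>x\<in>carrier (P n). \<psi> x \<ominus>\<^bsub>M\<^esub> \<phi> x) x \<oplus>\<^bsub>M\<^esub> \<phi> x) = \<psi>"
   proof (rule PiE_ext[of _ "carrier (P n)" "\<lambda>_. carrier M"])
    show "(\<lambda>x\<in>carrier (P n). (\<lambda>x\<in>carrier (P n). \<psi> x \<ominus>\<^bsub>M\<^esub> \<phi> x) x \<oplus>\<^bsub>M\<^esub> \<phi> x) \<in> carrier (P n) \<rightarrow>\<^sub>E carrier M"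
     using \<phi>c[OF z(2)] by (auto simp: e simp del: bimodule_simps(2,3))
    show "\<psi> \<in> carrier (P n) \<rightarrow>\<^sub>E carrier M" by (rule lin_mapsD(1)[OF deg_mapsD(1)[OF ext_cocyclesD(1)[OF z(2)]]])
   qed (simp add: e del: bimodule_simps)
  qed
  show "?B = {\<phi> \<in> carrier ?V. ?F \<phi> = (\<lambda>_. 0)}"
  proof -
   have "?B \<subseteq> ?Z" using P.coboundary_cocycle[OF bimodule_graded] by blast
   moreover have "\<phi> \<in> ?B \<longleftrightarrow> ?F \<phi> = (\<lambda>_. 0)" if "\<phi> \<in> ?Z" for \<phi>
    using cob[OF that] cls_coboundary[OF pull[OF that]] by (simp add: pb_def fun_eq_iff)
   ultimately show ?thesis unfolding Vs by blast
  qed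
  show "?F ` carrier ?V = carrier (cfun (cohomology_basis n k))"
  proof (rule equalityI; rule subsetI)
   fix y assume "y \<in> ?F ` carrier ?V"
   then obtain \<phi> where "\<phi> \<in> ?Z" "y = ?F \<phi>" unfolding Vs by blast
   then show "y \<in> carrier (cfun (cohomology_basis n k))"
    using cls_in_basis[OF pull] by (auto simp: cfun_carrier[OF finite_cohomology_basis] pb_def)
  next
   fix y :: "nat => complex" assume "y \<in> carrier (cfun (cohomology_basis n k))"
   then have "y i = 0" if "i \<notin> cohomology_basis n k" for i
    using that by (simp add: cfun_carrier[OF finite_cohomology_basis])
   from cls_surj[of n k y, OF this] obtain \<psi> where \<psi>: "\<psi> \<in> QZ n k" "cls n \<psi> = y" by blast
   obtain \<phi> where \<phi>: "\<phi> \<in> ?Z" "(\<lambda>x\<in>carrier (?Q n). \<phi> (f n x) \<ominus>\<^bsub>M\<^esub> \<psi> x) \<in> QB n k" (is "?\<delta> \<in> _") using lift[OF \<psi>(1)] by blast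
   have \<psi>c: "\<psi> (qgen (n mod 4) g) \<in> carrier A" if "g \<in> set (gens (n mod 4))" for g
    using lin_mapsD(2)[OF deg_mapsD(1)[OF ext_cocyclesD(1)[OF \<psi>(1)]] qg[OF that]] by simp
   have \<delta>: "?\<delta> \<in> QZ n k" by (rule QR.coboundary_cocycle[OF bimodule_graded \<phi>(2)])
   \<comment> \<open>The pullback of the lifted cocycle equals \<psi> up to a coboundary, and the
     class of a coboundary is zero.\<close>
   have "cls n (pb \<phi>) i = cls n ?\<delta> i + cls n \<psi> i" for i
   proof (rule cls_add)
    fix g assume g: "g \<in> set (gens (n mod 4))"
    note c = pbc[OF \<phi>(1) g] \<psi>c[OF g]
    show "\<psi> (qgen (n mod 4) g) \<in> carrier A" by (rule c(2))
    have eq: "?\<delta> (qgen (n mod 4) g) = pb \<phi> (qgen (n mod 4) g) \<ominus>\<^bsub>M\<^esub> \<psi> (qgen (n mod 4) g)"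
     using qg[OF g] by (simp only: pbg[OF g] restrict_apply if_True)
    show "?\<delta> (qgen (n mod 4) g) \<in> carrier A" unfolding eq using M.M.minus_closed[of "pb \<phi> (qgen (n mod 4) g)"] c by simp
    have "(pb \<phi> (qgen (n mod 4) g) \<ominus>\<^bsub>M\<^esub> \<psi> (qgen (n mod 4) g)) \<oplus>\<^bsub>M\<^esub> \<psi> (qgen (n mod 4) g) = pb \<phi> (qgen (n mod 4) g)"
     by (rule M.M.minus_plus_cancel) (use c in simp_all)
    then show "pb \<phi> (qgen (n mod 4) g) = ?\<delta> (qgen (n mod 4) g) \<oplus>\<^bsub>A\<^esub> \<psi> (qgen (n mod 4) g)"
     unfolding eq by simp
   qed
   then have "?F \<phi> = y" using cls_coboundary[OF \<delta>] \<phi>(2) \<psi>(2) by (auto simp: fun_eq_iff)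
   then show "y \<in> ?F ` carrier ?V" using \<phi>(1) unfolding Vs by blast
  qed
 qed (rule finite_cohomology_basis)
 then show ?thesis by (simp add: graded_Ext_def)
qed

end

section \<open>Cell systems\<close>

lemma cis_ne_inverse: "cis x \<noteq> cis (- x)" if "0 < x" "x < pi"
 using sin_gt_zero[OF that] by (auto simp: complex_eq_iff)

text \<open>The differences of second and third powers are divisible by \<open>q - q^-1\<close>,
  which is nonzero because \<open>q\<close> has positive imaginary part; the quotients are sums of
  powers of \<open>q\<close> and its conjugate.\<close>

lemma qint_cos:
 assumes "h \<ge> 2"
 shows "qint h 2 = complex_of_real (2 * cos (pi / h))" "qint h 3 = complex_of_real (1 + 2 * cos (2 * pi / h))"
proof -
 define x where "x = pi / h"
 have x: "0 < x" "x < pi" using assms by (auto simp: x_def field_simps)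
 have q: "exp (\<i> * complex_of_real pi / of_nat h) = cis x"
  by (simp add: cis_conv_exp x_def)
 let ?q = "cis x"
 have i: "inverse ?q = cis (- x)" by (simp add: cis_inverse)
 have ne: "?q - inverse ?q \<noteq> 0" using cis_ne_inverse[OF x] by (simp add: i)
 have one: "?q * inverse ?q = 1" by (rule right_inverse) simp
 have "?q ^ 2 - inverse ?q ^ 2 = (?q + inverse ?q) * (?q - inverse ?q)"
  by (simp add: power2_eq_square algebra_simps)
 then have "qint h 2 = ?q + inverse ?q" unfolding qint_def Let_def q using ne by (simp add: field_simps del: cis_inverse)
 also have "... = complex_of_real (2 * cos x)" unfolding i by (simp add: complex_eq_iff)
 finally show "qint h 2 = complex_of_real (2 * cos (pi / h))" by (simp add: x_def)
 have "?q ^ 3 - inverse ?q ^ 3 = (?q ^ 2 + ?q * inverse ?q + inverse ?q ^ 2) * (?q - inverse ?q)"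
  by (simp add: power2_eq_square power3_eq_cube algebra_simps)
 then have "qint h 3 = ?q ^ 2 + 1 + inverse ?q ^ 2" unfolding qint_def Let_def q using ne one by (simp add: del: cis_inverse)
 also have "... = complex_of_real (1 + 2 * cos (2 * x))" unfolding i by (simp add: DeMoivre complex_eq_iff)
 finally show "qint h 3 = complex_of_real (1 + 2 * cos (2 * pi / h))" by (simp add: x_def)
qed

abbreviation "E8_arcs \<equiv> {(1, 2), (2, 2), (2, 3), (2, 4), (3, 1), (3, 2), (3, 3), (4, 3)} :: (nat \<times> nat) set"

lemma E8star_simps [simp]:
 "verts E8star = {1, 2, 3, 4}" "arcs E8star = E8_arcs" "tail E8star = fst" "head E8star = snd"
 by (simp_all add: E8star_def)

text \<open>Arcs are pairs of vertices, so there are no parallel ones, and a path of length 2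
  between given end points is the same as its middle vertex.\<close>

lemma sum_paths:
 fixes f :: "('v \<times> 'v) \<times> ('v \<times> 'v) => complex"
 assumes E: "\<And>i k. (i, k) \<in> E ==> k \<in> V" and V: "finite V"
 shows "sum f {(b1, b2). b1 \<in> E \<and> b2 \<in> E \<and> fst b1 = j \<and> snd b1 = fst b2 \<and> snd b2 = i} =
  (\<Sum>k\<in>V. if (j, k) \<in> E \<and> (k, i) \<in> E then f ((j, k), (k, i)) else 0)"
 unfolding sum.inter_filter[OF V, symmetric]
 by (rule sum.reindex_bij_witness[of _ "\<lambda>k. ((j, k), (k, i))" "\<lambda>(b1, b2). snd b1"]) (use E in auto)

lemma sum_squares:
 fixes f :: "'v \<times> ('v \<times> 'v) \<times> ('v \<times> 'v) \<times> ('v \<times> 'v) \<times> ('v \<times> 'v) => complex"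
 assumes V: "finite V"
 shows "sum f {(k, b1, b2, b3, b4). k \<in> V \<and> b1 \<in> E \<and> b2 \<in> E \<and> b3 \<in> E \<and> b4 \<in> E \<and>
   fst b1 = i1 \<and> snd b1 = k \<and> fst b2 = k \<and> snd b2 = i2 \<and> fst b3 = i3 \<and> snd b3 = k \<and> fst b4 = k \<and> snd b4 = i4} =
  (\<Sum>k\<in>V. if (i1, k) \<in> E \<and> (k, i2) \<in> E \<and> (i3, k) \<in> E \<and> (k, i4) \<in> E
   then f (k, (i1, k), (k, i2), (i3, k), (k, i4)) else 0)"
 unfolding sum.inter_filter[OF V, symmetric]
 by (rule sum.reindex_bij_witness[of _ "\<lambda>k. (k, (i1, k), (k, i2), (i3, k), (k, i4))" "\<lambda>(k, _). k"]) auto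

lemma E8_arcs_verts: "(i, k) \<in> E8_arcs ==> k \<in> {1, 2, 3, 4}"
 by auto

lemma finite_verts: "finite {1, 2, 3, 4 :: nat}"
 by simp

section \<open>Cells of the graph\<close>

locale E8_cells =
 fixes \<phi> :: "nat => real" and W
 assumes pf: "perron_frobenius E8star 8 \<phi>" and cs: "cell_system E8star 8 \<phi> W"
begin

lemma W_cyclic:
 assumes "(i, j) \<in> E8_arcs" "(j, k) \<in> E8_arcs" "(k, i) \<in> E8_arcs"
 shows "W (i, j) (j, k) (k, i) = W (j, k) (k, i) (i, j)"
proof -
 have "\<forall>a\<in>E8_arcs. \<forall>b\<in>E8_arcs. \<forall>c\<in>E8_arcs. snd a = fst b \<and> snd b = fst c \<and> snd c = fst a -->
   W a b c = W b c a \<and> W a b c = W c a b"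
  using cs unfolding cell_system_def E8star_simps by (rule conjunct1)
 from this[THEN bspec, OF assms(1), THEN bspec, OF assms(2), THEN bspec, OF assms(3)] show ?thesis
  by (simp only: fst_conv snd_conv simp_thms)
qed

lemma type_I:
 assumes "(i, j) \<in> E8_arcs"
 shows "(\<Sum>k\<in>{1, 2, 3, 4}. if (j, k) \<in> E8_arcs \<and> (k, i) \<in> E8_arcs
   then W (i, j) (j, k) (k, i) * cnj (W (i, j) (j, k) (k, i)) else 0) = qint 8 2 * \<phi> i * \<phi> j"
proof -
 have ij: "i \<in> verts E8star" "j \<in> verts E8star" using assms by auto
 have "(\<Sum>(b1, b2)\<in>{(b1, b2). b1 \<in> E8_arcs \<and> b2 \<in> E8_arcs \<and> fst b1 = j \<and> snd b1 = fst b2 \<and> snd b2 = i}.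
   W (i, j) b1 b2 * cnj (W (i, j) b1 b2)) = qint 8 2 * \<phi> i * \<phi> j"
  using cs[unfolded cell_system_def, THEN conjunct2, THEN conjunct1, THEN bspec[OF _ ij(1)], THEN bspec[OF _ ij(2)],
    unfolded E8star_simps, THEN bspec[OF _ assms], THEN bspec[OF _ assms], THEN mp]
  by (simp only: fst_conv snd_conv simp_thms if_True)
 then show ?thesis
  using sum_paths[of E8_arcs "{1, 2, 3, 4}" "\<lambda>(b1, b2). W (i, j) b1 b2 * cnj (W (i, j) b1 b2)" j i,
    OF E8_arcs_verts finite_verts]
  by (simp only: prod.case)
qed

lemma type_II:
 assumes "(i4, i1) \<in> E8_arcs" "(i2, i1) \<in> E8_arcs" "(i2, i3) \<in> E8_arcs" "(i4, i3) \<in> E8_arcs"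
 shows "(\<Sum>k\<in>{1, 2, 3, 4}. if (i1, k) \<in> E8_arcs \<and> (k, i2) \<in> E8_arcs \<and> (i3, k) \<in> E8_arcs \<and> (k, i4) \<in> E8_arcs
   then inverse (complex_of_real (\<phi> k)) * W (i2, i1) (i1, k) (k, i2) * cnj (W (i2, i3) (i3, k) (k, i2)) *
    W (i4, i3) (i3, k) (k, i4) * cnj (W (i4, i1) (i1, k) (k, i4)) else 0) =
  (if (i4, i1) = (i4, i3) \<and> (i2, i1) = (i2, i3) then complex_of_real (\<phi> i4 * \<phi> i1 * \<phi> i2) else 0) +
  (if (i4, i1) = (i2, i1) \<and> (i2, i3) = (i4, i3) then complex_of_real (\<phi> i1 * \<phi> i2 * \<phi> i3) else 0)"
proof -
 let ?S = "{(k, b1, b2, b3, b4). k \<in> {1, 2, 3, 4} \<and> b1 \<in> E8_arcs \<and> b2 \<in> E8_arcs \<and> b3 \<in> E8_arcs \<and> b4 \<in> E8_arcs \<and>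
  fst b1 = i1 \<and> snd b1 = k \<and> fst b2 = k \<and> snd b2 = i2 \<and> fst b3 = i3 \<and> snd b3 = k \<and> fst b4 = k \<and> snd b4 = i4}"
 let ?f = "\<lambda>(k, b1, b2, b3, b4). inverse (complex_of_real (\<phi> k)) * W (i2, i1) b1 b2 * cnj (W (i2, i3) b3 b2) *
  W (i4, i3) b3 b4 * cnj (W (i4, i1) b1 b4)"
 have i: "i1 \<in> verts E8star" "i2 \<in> verts E8star" "i3 \<in> verts E8star" "i4 \<in> verts E8star" using assms by auto
 have "sum ?f ?S = (if (i4, i1) = (i4, i3) \<and> (i2, i1) = (i2, i3) then complex_of_real (\<phi> i4 * \<phi> i1 * \<phi> i2) else 0) +
   (if (i4, i1) = (i2, i1) \<and> (i2, i3) = (i4, i3) then complex_of_real (\<phi> i1 * \<phi> i2 * \<phi> i3) else 0)"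
  using cs[unfolded cell_system_def, THEN conjunct2, THEN conjunct2, THEN bspec[OF _ i(1)], THEN bspec[OF _ i(2)],
    THEN bspec[OF _ i(3)], THEN bspec[OF _ i(4)], unfolded E8star_simps, THEN bspec[OF _ assms(1)],
    THEN bspec[OF _ assms(2)], THEN bspec[OF _ assms(3)], THEN bspec[OF _ assms(4)], THEN mp]
  by (simp only: fst_conv snd_conv simp_thms)
 then show ?thesis unfolding sum_squares[OF finite_verts] prod.case .
qed

text \<open>Up to rotation, these six are the cells of all closed paths of length 3 in the
  graph.\<close>

abbreviation "w_1 \<equiv> W (1, 2) (2, 3) (3, 1)"
abbreviation "w_4 \<equiv> W (2, 4) (4, 3) (3, 2)"
abbreviation "w_p \<equiv> W (2, 2) (2, 3) (3, 2)"
abbreviation "w_q \<equiv> W (3, 3) (3, 2) (2, 3)"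
abbreviation "w_a \<equiv> W (2, 2) (2, 2) (2, 2)"
abbreviation "w_b \<equiv> W (3, 3) (3, 3) (3, 3)"

lemma W_rotations:
 "W (2, 3) (3, 1) (1, 2) = w_1" "W (3, 1) (1, 2) (2, 3) = w_1"
 "W (4, 3) (3, 2) (2, 4) = w_4" "W (3, 2) (2, 4) (4, 3) = w_4"
 "W (2, 3) (3, 2) (2, 2) = w_p" "W (3, 2) (2, 2) (2, 3) = w_p"
 "W (3, 2) (2, 3) (3, 3) = w_q" "W (2, 3) (3, 3) (3, 2) = w_q"
 using W_cyclic[of 1 2 3] W_cyclic[of 2 3 1] W_cyclic[of 2 4 3] W_cyclic[of 4 3 2]
  W_cyclic[of 2 2 3] W_cyclic[of 2 3 2] W_cyclic[of 3 3 2] W_cyclic[of 3 2 3]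
 by simp_all

text \<open>The eigenvalue is \<open>c = 1 + sqrt 2\<close>, a root of \<open>c^2 = 1 + 2 c\<close>.
  Substituting the equations at the vertices 1 and 4 into the one at 2 leaves
  \<open>(1 + c) (\<phi> 4 - \<phi> 1) = 0\<close>.\<close>

lemma PF:
 shows "\<phi> 1 > 0" "\<phi> 2 = (1 + sqrt 2) * \<phi> 1" "\<phi> 3 = \<phi> 2" "\<phi> 4 = \<phi> 1"
proof -
 have q3: "qint 8 3 = complex_of_real (1 + sqrt 2)"
  using qint_cos(2)[of 8] by (simp add: cos_45)
 have out: "out_arcs E8star 1 = {(1, 2)}" "out_arcs E8star 2 = {(2, 2), (2, 3), (2, 4)}"
  "out_arcs E8star 3 = {(3, 1), (3, 2), (3, 3)}" "out_arcs E8star 4 = {(4, 3)}"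
  by (auto simp: out_arcs_def)
 have eq: "(\<Sum>a\<in>out_arcs E8star v. \<phi> (snd a)) = (1 + sqrt 2) * \<phi> v" if "v \<in> {1, 2, 3, 4}" for v
 proof -
  have "v \<in> verts E8star" using that by simp
  from pf[unfolded perron_frobenius_def, THEN conjunct2, THEN bspec, OF this]
  have "complex_of_real (\<Sum>a\<in>out_arcs E8star v. \<phi> (snd a)) = complex_of_real ((1 + sqrt 2) * \<phi> v)"
   by (simp add: q3)
  then show ?thesis by (simp only: of_real_eq_iff)
 qed
 show "\<phi> 1 > 0" using pf by (simp add: perron_frobenius_def)
 let ?c = "1 + sqrt 2"
 have c: "?c * ?c = 1 + 2 * ?c" by (simp add: algebra_simps)
 have e: "\<phi> 2 = ?c * \<phi> 1" "\<phi> 2 + \<phi> 3 + \<phi> 4 = ?c * \<phi> 2" "\<phi> 3 = ?c * \<phi> 4"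
  using eq[of 1] eq[of 2] eq[of 4] by (simp_all add: out del: One_nat_def)
 show "\<phi> 2 = ?c * \<phi> 1" by (rule e)
 have "?c * \<phi> 1 + ?c * \<phi> 4 + \<phi> 4 = (?c * ?c) * \<phi> 1" using e by (simp add: algebra_simps)
 then have "(1 + ?c) * (\<phi> 4 - \<phi> 1) = 0" unfolding c by (simp add: algebra_simps)
 moreover have "1 + ?c \<noteq> 0" using real_sqrt_ge_zero[of 2] by linarith
 ultimately show "\<phi> 4 = \<phi> 1" by simp
 then show "\<phi> 3 = \<phi> 2" using e by simp
qed

lemma norm_identity: "z * cnj z = complex_of_real ((cmod z)\<^sup>2)"
 by (simp add: complex_norm_square[symmetric])

text \<open>The moduli come first. (I) fixes the sums \<open>X + Y\<close>, \<open>Z + U\<close> and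
  \<open>Y + U\<close>, and (II) at the two loops fixes the sums of squares, whence the products of
  \<open>X\<close>, \<open>Y\<close> and of \<open>Z\<close>, \<open>U\<close> are nonzero and
  equal. So \<open>Y = U\<close>, and one more instance of (II) gives the cubic identity.\<close>

theorem cells:
 "w_1 \<noteq> 0" "w_4 \<noteq> 0" "w_p \<noteq> 0" "w_q \<noteq> 0" "w_a \<noteq> 0" "w_b \<noteq> 0" "w_p ^ 3 * w_b = - (w_q ^ 3 * w_a)"
proof -
 define t where "t = 2 * cos (pi / 8)"
 define \<alpha> \<beta> where "\<alpha> = \<phi> 1" and "\<beta> = \<phi> 2"
 have q2: "qint 8 2 = complex_of_real t" using qint_cos(1)[of 8] by (simp add: t_def)
 have t0: "t > 0" unfolding t_def by (auto intro!: cos_gt_zero)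
 have tt: "t\<^sup>2 = 2 + sqrt 2"
  using cos_double_cos[of "pi / 8"] by (simp add: t_def power_mult_distrib cos_45)
 have ab: "\<alpha> > 0" "\<beta> > 0" using PF(1,2) by (auto simp: \<alpha>_def \<beta>_def add_pos_pos)
 have ph: "\<phi> 1 = \<alpha>" "\<phi> 2 = \<beta>" "\<phi> 3 = \<beta>" "\<phi> 4 = \<alpha>" using PF by (auto simp: \<alpha>_def \<beta>_def)
 have ph': "\<phi> (Suc 0) = \<alpha>" using ph(1) by simp
 define X Y Z U where "X = (cmod w_a)\<^sup>2" and "Y = (cmod w_p)\<^sup>2" and "Z = (cmod w_b)\<^sup>2" and "U = (cmod w_q)\<^sup>2"
 have re: "complex_of_real r = complex_of_real s ==> r = s" for r s by simp
 have "(cmod w_1)\<^sup>2 = t * \<alpha> * \<beta>"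
  by (rule re) (use type_I[of 1 2] in \<open>simp add: norm_identity q2 ph ph'\<close>)
 moreover have "(cmod w_4)\<^sup>2 = t * \<beta> * \<alpha>"
  by (rule re) (use type_I[of 2 4] in \<open>simp add: norm_identity q2 ph ph'\<close>)
 moreover have pos: "t * \<alpha> * \<beta> > 0" using t0 ab by simp
 ultimately show "w_1 \<noteq> 0" "w_4 \<noteq> 0" by (auto simp: mult_ac)
 have w1: "(cmod w_1)\<^sup>2 = t * \<alpha> * \<beta>" by fact
 have XY: "X + Y = t * \<beta>\<^sup>2"
  by (rule re) (use type_I[of 2 2] in \<open>simp add: norm_identity q2 ph ph' X_def Y_def power2_eq_square\<close>)
 have ZU: "Z + U = t * \<beta>\<^sup>2"
  by (rule re) (use type_I[of 3 3] in \<open>simp add: norm_identity q2 ph ph' Z_def U_def power2_eq_square algebra_simps\<close>)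
 have "(cmod w_1)\<^sup>2 + Y + U = t * \<beta>\<^sup>2"
  by (rule re) (use type_I[of 2 3] in \<open>simp add: norm_identity q2 ph ph' U_def Y_def power2_eq_square W_rotations algebra_simps del: One_nat_def\<close>)
 then have YU: "t * \<alpha> * \<beta> + Y + U = t * \<beta>\<^sup>2" by (simp only: w1)
 have quart: "inverse (complex_of_real \<beta>) * z * cnj z * z * cnj z = complex_of_real (((cmod z)\<^sup>2)\<^sup>2 / \<beta>)" for z
 proof -
  have "inverse (complex_of_real \<beta>) * z * cnj z * z * cnj z = inverse (complex_of_real \<beta>) * ((z * cnj z) * (z * cnj z))"
   by (simp only: mult_ac)
  then show ?thesis unfolding norm_identity by (simp add: power2_eq_square divide_inverse mult_ac)
 qed
 have "X\<^sup>2 / \<beta> + Y\<^sup>2 / \<beta> = 2 * \<beta> ^ 3"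
  by (rule re) (use type_II[of 2 2 2 2] in \<open>simp add: quart ph ph' X_def Y_def power3_eq_cube\<close>)
 then have XY2: "X\<^sup>2 + Y\<^sup>2 = 2 * \<beta> ^ 4" using ab by (simp add: field_simps power_numeral_reduce)
 have "U\<^sup>2 / \<beta> + Z\<^sup>2 / \<beta> = 2 * \<beta> ^ 3"
  by (rule re) (use type_II[of 3 3 3 3] in \<open>simp add: quart ph ph' Z_def U_def power3_eq_cube\<close>)
 then have ZU2: "Z\<^sup>2 + U\<^sup>2 = 2 * \<beta> ^ 4" using ab by (simp add: field_simps power_numeral_reduce)
 \<comment> \<open>With \<open>t^2 = 2 + sqrt 2\<close> the square of the sum exceeds the sum of
   squares by \<open>sqrt 2 * \<beta> ^ 4\<close>, so the same product results at both
   loops.\<close>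
 have prod: "2 * (A * B) = sqrt 2 * \<beta> ^ 4" if "A + B = t * \<beta>\<^sup>2" "A\<^sup>2 + B\<^sup>2 = 2 * \<beta> ^ 4" for A B
 proof -
  have "2 * (A * B) = (A + B)\<^sup>2 - (A\<^sup>2 + B\<^sup>2)" by (simp add: power2_eq_square algebra_simps)
  also have "... = t\<^sup>2 * \<beta> ^ 4 - 2 * \<beta> ^ 4" unfolding that by (simp add: power_mult_distrib flip: power_mult)
  finally show ?thesis unfolding tt by (simp add: algebra_simps)
 qed
 have b4: "sqrt 2 * \<beta> ^ 4 \<noteq> 0" using ab by simp
 have "X * Y \<noteq> 0" "Z * U \<noteq> 0" using prod[OF XY XY2] prod[OF ZU ZU2] b4 by auto
 then show nz: "w_p \<noteq> 0" "w_q \<noteq> 0" "w_a \<noteq> 0" "w_b \<noteq> 0" by (auto simp: X_def Y_def Z_def U_def)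
 have "2 * ((t * \<beta>\<^sup>2 - Y) * Y) = 2 * ((t * \<beta>\<^sup>2 - U) * U)"
 proof -
  have "X = t * \<beta>\<^sup>2 - Y" "Z = t * \<beta>\<^sup>2 - U" using XY ZU by linarith+
  then show ?thesis using prod[OF XY XY2] prod[OF ZU ZU2] by metis
 qed
 \<comment> \<open>Equal products leave two possibilities for \<open>Y\<close> and \<open>U\<close>.
   The second factor equals \<open>t * \<alpha> * \<beta>\<close> by the equation for the arc from 2
   to 3, so it is positive.\<close>
 then have "(Y - U) * (t * \<beta>\<^sup>2 - Y - U) = 0" by (simp add: algebra_simps)
 moreover have "t * \<beta>\<^sup>2 - Y - U \<noteq> 0" using YU pos by linarith
 ultimately have eq: "Y = U" by simp
 \<comment> \<open>Here the four arcs are distinct, so both deltas vanish, and the sum has the two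
   terms \<open>k = 2\<close> and \<open>k = 3\<close>, which must cancel.\<close>
 have "inverse (complex_of_real \<beta>) * (w_p ^ 2 * cnj w_q * cnj w_a + w_q ^ 2 * cnj w_b * cnj w_p) = 0"
  using type_II[of 2 2 3 3] by (simp add: ph W_rotations power2_eq_square algebra_simps)
 then have "w_p ^ 2 * cnj w_q * cnj w_a + w_q ^ 2 * cnj w_b * cnj w_p = 0" using ab by simp
 then have "cnj (w_p ^ 2 * cnj w_q * cnj w_a + w_q ^ 2 * cnj w_b * cnj w_p) = 0" by simp
 then have c: "cnj w_p ^ 2 * w_q * w_a + cnj w_q ^ 2 * w_b * w_p = 0" by simp
 have n: "w_p * cnj w_p = complex_of_real Y" "w_q * cnj w_q = complex_of_real Y"
  using eq by (simp_all add: norm_identity Y_def U_def)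
 \<comment> \<open>Multiplying the conjugate equation by \<open>w_p ^ 2 * w_q ^ 2\<close> collects
   moduli, and these are the same for \<open>w_p\<close> and \<open>w_q\<close>.\<close>
 have "(w_p * cnj w_p) ^ 2 * (w_q ^ 3 * w_a) + (w_q * cnj w_q) ^ 2 * (w_p ^ 3 * w_b) =
   w_p ^ 2 * w_q ^ 2 * (cnj w_p ^ 2 * w_q * w_a + cnj w_q ^ 2 * w_b * w_p)"
  by (simp add: power2_eq_square power3_eq_cube algebra_simps)
 then have "complex_of_real Y ^ 2 * (w_q ^ 3 * w_a + w_p ^ 3 * w_b) = 0"
  unfolding n c by (simp add: algebra_simps)
 moreover have "Y \<noteq> 0" using nz by (simp add: Y_def)
 ultimately have "w_q ^ 3 * w_a + w_p ^ 3 * w_b = 0" by simp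
 then show "w_p ^ 3 * w_b = - (w_q ^ 3 * w_a)" by (simp add: eq_neg_iff_add_eq_0 add.commute)
qed

end

section \<open>Path algebras\<close>

lemma ring_extend: "ring R ==> ring (ring.extend R m)"
proof -
 assume "ring R"
 then interpret R: ring R .
 have a: "abelian_group (ring.extend R m)"
  by (rule abelian_groupI) (auto simp: ring.defs R.a_ac intro: bexI[of _ "\<ominus>\<^bsub>R\<^esub> _"] R.l_neg)
 show ?thesis
  by (rule ringI[OF a monoidI]) (auto simp: ring.defs R.m_assoc R.l_distr R.r_distr)
qed

context wf_digraph
begin

abbreviation "PA \<equiv> path_algebra G"

lemma paths_iff: "(u, p) \<in> paths G \<longleftrightarrow> awalk u p (awlast u p)"
 by (auto simp: paths_def)

lemma paths_Nil [simp]: "(u, []) \<in> paths G \<longleftrightarrow> u \<in> verts G"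
 by (simp add: paths_iff awalk_Nil_iff)

lemma paths_append [simp]: "(u, p @ q) \<in> paths G \<longleftrightarrow> (u, p) \<in> paths G \<and> (awlast u p, q) \<in> paths G"
 by (simp add: paths_iff awlast_append)

lemma paths_single [simp]: "(v, [e]) \<in> paths G \<longleftrightarrow> e \<in> arcs G \<and> tail G e = v"
 by (auto simp: paths_iff awalk_simps)

lemma paths_awlast: "(u, p) \<in> paths G ==> awlast u p \<in> verts G"
 by (auto simp: paths_iff)

lemma path_algebra_simps:
 "f \<in> carrier PA \<longleftrightarrow> finite {z. f z \<noteq> 0} \<and> (\<forall>z. f z \<noteq> 0 --> z \<in> paths G)"
 "f \<oplus>\<^bsub>PA\<^esub> g = (\<lambda>z. f z + g z)" "\<zero>\<^bsub>PA\<^esub> = (\<lambda>z. 0)" "c \<odot>\<^bsub>PA\<^esub> f = (\<lambda>z. c * f z)"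
 "(f \<otimes>\<^bsub>PA\<^esub> g) (u, p) = (\<Sum>k\<le>length p. f (u, take k p) * g (awlast u (take k p), drop k p))"
 "\<one>\<^bsub>PA\<^esub> = (\<lambda>(u, p). if u \<in> verts G \<and> p = [] then 1 else 0)"
 by (auto simp: path_algebra_def free_module_def)

text \<open>The definition sums over the cutting points of one path. Here the product becomes the
  bilinear extension of concatenation: a pair of composable paths contributes through the single
  cutting point at the end of the first.\<close>

lemma path_mult_pairs:
 assumes S: "finite S" "\<And>z. f z \<noteq> 0 ==> z \<in> S" and T: "finite T" "\<And>z. g z \<noteq> 0 ==> z \<in> T"
 shows "(f \<otimes>\<^bsub>PA\<^esub> g) z = (\<Sum>s\<in>S. \<Sum>t\<in>T. if awlast (fst s) (snd s) = fst t
  then f s * g t * ind (fst s, snd s @ snd t) z else 0)"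
proof -
 obtain u p where z: "z = (u, p)" by (cases z)
 have "(f \<otimes>\<^bsub>PA\<^esub> g) z = (\<Sum>k\<le>length p. \<Sum>s\<in>S. \<Sum>t\<in>T. f s * g t *
   (if s = (u, take k p) \<and> t = (awlast u (take k p), drop k p) then 1 else 0))"
  unfolding z path_algebra_simps
 proof (rule sum.cong[OF refl])
  fix k
  have "(\<Sum>s\<in>S. \<Sum>t\<in>T. f s * g t * (if s = (u, take k p) \<and> t = (awlast u (take k p), drop k p) then 1 else 0)) =
    (\<Sum>s\<in>S. if s = (u, take k p) then (\<Sum>t\<in>T. if t = (awlast u (take k p), drop k p) then f s * g t else 0) else 0)"
   by (intro sum.cong refl) (auto intro!: sum.cong)
  also have "... = f (u, take k p) * g (awlast u (take k p), drop k p)"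
   using S T by (auto simp: sum.delta)
  finally show "f (u, take k p) * g (awlast u (take k p), drop k p) =
   (\<Sum>s\<in>S. \<Sum>t\<in>T. f s * g t * (if s = (u, take k p) \<and> t = (awlast u (take k p), drop k p) then 1 else 0))" ..
 qed
 also have "... = (\<Sum>s\<in>S. \<Sum>k\<le>length p. \<Sum>t\<in>T. f s * g t *
   (if s = (u, take k p) \<and> t = (awlast u (take k p), drop k p) then 1 else 0))"
  by (rule sum.swap)
 also have "... = (\<Sum>s\<in>S. \<Sum>t\<in>T. \<Sum>k\<le>length p. f s * g t *
   (if s = (u, take k p) \<and> t = (awlast u (take k p), drop k p) then 1 else 0))"
  by (intro sum.cong refl sum.swap)
 also have "... = (\<Sum>s\<in>S. \<Sum>t\<in>T. if awlast (fst s) (snd s) = fst t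
   then f s * g t * ind (fst s, snd s @ snd t) z else 0)"
 proof (intro sum.cong refl)
  fix s t assume "s \<in> S" "t \<in> T"
  obtain u' p' v q where st: "s = (u', p')" "t = (v, q)" by (cases s; cases t)
  have "(s = (u, take k p) \<and> t = (awlast u (take k p), drop k p)) \<longleftrightarrow>
    k = length p' \<and> awlast u' p' = v \<and> z = (u', p' @ q)" if "k \<le> length p" for k
   using that unfolding st z by (auto simp: append_eq_conv_conj)
  then have "(\<Sum>k\<le>length p. f s * g t * (if s = (u, take k p) \<and> t = (awlast u (take k p), drop k p) then 1 else 0)) =
    (\<Sum>k\<le>length p. if k = length p' then (if awlast u' p' = v then f s * g t * ind (u', p' @ q) z else 0) else 0)"
   by (intro sum.cong refl) (auto simp: ind_def)
  also have "... = (if awlast u' p' = v then f s * g t * ind (u', p' @ q) z else 0)"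
   by (auto simp: ind_def z)
  finally show "(\<Sum>k\<le>length p. f s * g t * (if s = (u, take k p) \<and> t = (awlast u (take k p), drop k p) then 1 else 0)) =
    (if awlast (fst s) (snd s) = fst t then f s * g t * ind (fst s, snd s @ snd t) z else 0)"
   by (simp add: st)
 qed
 finally show ?thesis .
qed

lemma path_mult_closed:
 assumes "f \<in> carrier PA" "g \<in> carrier PA"
 shows "f \<otimes>\<^bsub>PA\<^esub> g \<in> carrier PA"
proof -
 let ?S = "{z. f z \<noteq> 0}" and ?T = "{z. g z \<noteq> 0}"
 have fin: "finite ?S" "finite ?T" and paths: "?S \<subseteq> paths G" "?T \<subseteq> paths G"
  using assms by (auto simp: path_algebra_simps)
 have sub: "{z. (f \<otimes>\<^bsub>PA\<^esub> g) z \<noteq> 0} \<subseteq>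
   (\<lambda>(s, t). (fst s, snd s @ snd t)) ` {(s, t). s \<in> ?S \<and> t \<in> ?T \<and> awlast (fst s) (snd s) = fst t}"
 proof (rule subsetI, drule CollectD)
  fix z assume z: "(f \<otimes>\<^bsub>PA\<^esub> g) z \<noteq> 0"
  have "(\<Sum>s\<in>?S. \<Sum>t\<in>?T. if awlast (fst s) (snd s) = fst t then f s * g t * ind (fst s, snd s @ snd t) z else 0) \<noteq> 0"
   using z path_mult_pairs[OF fin(1) _ fin(2), of f g z] by simp
  then obtain s where s: "s \<in> ?S" "(\<Sum>t\<in>?T. if awlast (fst s) (snd s) = fst t then f s * g t * ind (fst s, snd s @ snd t) z else 0) \<noteq> 0"
   by (rule sum.not_neutral_contains_not_neutral)
  obtain t where t: "t \<in> ?T" "(if awlast (fst s) (snd s) = fst t then f s * g t * ind (fst s, snd s @ snd t) z else 0) \<noteq> 0"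
   using s(2) by (rule sum.not_neutral_contains_not_neutral)
  have "awlast (fst s) (snd s) = fst t" "z = (fst s, snd s @ snd t)"
   using t(2) by (auto simp: ind_def split: if_splits)
  then show "z \<in> (\<lambda>(s, t). (fst s, snd s @ snd t)) ` {(s, t). s \<in> ?S \<and> t \<in> ?T \<and> awlast (fst s) (snd s) = fst t}"
   using s(1) t(1) by (intro image_eqI[of _ _ "(s, t)"]) simp_all
 qed
 have "finite {(s, t). s \<in> ?S \<and> t \<in> ?T \<and> awlast (fst s) (snd s) = fst t}"
  by (rule finite_subset[of _ "?S \<times> ?T"]) (use fin in auto)
 from finite_subset[OF sub finite_imageI[OF this]] have "finite {z. (f \<otimes>\<^bsub>PA\<^esub> g) z \<noteq> 0}" .
 moreover have "z \<in> paths G" if "(f \<otimes>\<^bsub>PA\<^esub> g) z \<noteq> 0" for z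
 proof -
  have "z \<in> {z. (f \<otimes>\<^bsub>PA\<^esub> g) z \<noteq> 0}" using that by simp
  then obtain s t where st: "s \<in> ?S" "t \<in> ?T" "awlast (fst s) (snd s) = fst t" "z = (fst s, snd s @ snd t)"
   using sub by fast
  have "(fst s, snd s) \<in> paths G" "(fst t, snd t) \<in> paths G" using paths st(1,2) by auto
  then show ?thesis using st(3,4) by simp
 qed
 ultimately show ?thesis by (simp add: path_algebra_simps)
qed

lemma path_mult_assoc: "(f \<otimes>\<^bsub>PA\<^esub> g) \<otimes>\<^bsub>PA\<^esub> h = f \<otimes>\<^bsub>PA\<^esub> (g \<otimes>\<^bsub>PA\<^esub> h)"
proof
 fix z :: "'a \<times> 'b list"
 obtain u p where z: "z = (u, p)" by (cases z)
 let ?F = "\<lambda>j i. f (u, take j p) * g (awlast u (take j p), take i (drop j p)) * h (awlast u (take (j + i) p), drop (j + i) p)"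
 have "((f \<otimes>\<^bsub>PA\<^esub> g) \<otimes>\<^bsub>PA\<^esub> h) z = (\<Sum>k\<le>length p. \<Sum>j\<le>k. ?F j (k - j))"
  unfolding z path_algebra_simps(5)
  by (intro sum.cong refl) (auto simp: sum_distrib_right drop_take min_def intro!: sum.cong)
 \<comment> \<open>Both bracketings are sums over two cutting points. Recording the lengths of the
   first two pieces turns either one into a sum over the same triangle.\<close>
 also have "... = (\<Sum>(j, i)\<in>{(j, i). j + i \<le> length p}. ?F j i)"
  by (rule sum.triangle_reindex_eq[symmetric])
 also have "{(j, i). j + i \<le> length p} = (SIGMA j:{..length p}. {..length p - j})" by auto
 also have "(\<Sum>(j, i)\<in>.... ?F j i) = (\<Sum>j\<le>length p. \<Sum>i\<le>length p - j. ?F j i)"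
  by (rule sum.Sigma[symmetric]) auto
 also have "... = (f \<otimes>\<^bsub>PA\<^esub> (g \<otimes>\<^bsub>PA\<^esub> h)) z"
  unfolding z path_algebra_simps(5)
 proof (intro sum.cong refl)
  fix j assume "j \<in> {..length p}"
  have "awlast (awlast u (take j p)) (take i (drop j p)) = awlast u (take (j + i) p)" for i
   by (simp add: awlast_append[symmetric] take_add)
  then show "(\<Sum>i\<le>length p - j. ?F j i) = f (u, take j p) *
    (\<Sum>k\<le>length (drop j p). g (awlast u (take j p), take k (drop j p)) *
     h (awlast (awlast u (take j p)) (take k (drop j p)), drop k (drop j p)))"
   by (simp add: sum_distrib_left mult.assoc add.commute)
 qed
 finally show "((f \<otimes>\<^bsub>PA\<^esub> g) \<otimes>\<^bsub>PA\<^esub> h) z = (f \<otimes>\<^bsub>PA\<^esub> (g \<otimes>\<^bsub>PA\<^esub> h)) z" .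
qed

text \<open>Finiteness of the vertex set makes the unit, the sum of all vertices, a function of
  finite support.\<close>

lemma path_algebra_ring:
 assumes "finite (verts G)"
 shows "ring PA"
proof (rule ringI)
 have fin: "finite {x. f x \<noteq> (0::complex)} ==> finite {x. g x \<noteq> 0} ==> finite {x. f x + g x \<noteq> 0}" for f g :: "'a \<times> 'b list => complex"
  by (rule finite_subset[of _ "{x. f x \<noteq> 0} \<union> {x. g x \<noteq> 0}"]) auto
 show "abelian_group PA"
 proof (rule abelian_groupI)
  fix f assume f: "f \<in> carrier PA"
  show "\<exists>g\<in>carrier PA. g \<oplus>\<^bsub>PA\<^esub> f = \<zero>\<^bsub>PA\<^esub>"
   by (rule bexI[of _ "\<lambda>z. - f z"]) (use f in \<open>auto simp: path_algebra_simps\<close>)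
 next
  fix f g assume "f \<in> carrier PA" "g \<in> carrier PA"
  then show "f \<oplus>\<^bsub>PA\<^esub> g \<in> carrier PA"
   using fin[of f g] by (auto simp: path_algebra_simps) (metis add_0)
 qed (auto simp: path_algebra_simps)
 show "monoid PA"
 proof (rule monoidI)
  have "{z. \<one>\<^bsub>PA\<^esub> z \<noteq> 0} \<subseteq> verts G \<times> {[]}" by (auto simp: path_algebra_simps split: if_splits)
  then have "finite {z. \<one>\<^bsub>PA\<^esub> z \<noteq> 0}" by (rule finite_subset) (use assms in simp)
  then show "\<one>\<^bsub>PA\<^esub> \<in> carrier PA" by (auto simp: path_algebra_simps split: if_splits)
 next
  fix f assume f: "f \<in> carrier PA"
  show "\<one>\<^bsub>PA\<^esub> \<otimes>\<^bsub>PA\<^esub> f = f"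
  proof
   fix z :: "'a \<times> 'b list"
   obtain u p where z: "z = (u, p)" by (cases z)
   have "(\<one>\<^bsub>PA\<^esub> \<otimes>\<^bsub>PA\<^esub> f) z = (\<Sum>k\<le>length p. if k = 0 then (if u \<in> verts G then f (u, p) else 0) else 0)"
    unfolding z path_algebra_simps(5) by (intro sum.cong refl) (auto simp: path_algebra_simps(6))
   moreover have "u \<in> verts G" if "f (u, p) \<noteq> 0"
    using f that by (auto simp: path_algebra_simps paths_iff)
   ultimately show "(\<one>\<^bsub>PA\<^esub> \<otimes>\<^bsub>PA\<^esub> f) z = f z" by (auto simp: z)
  qed
  show "f \<otimes>\<^bsub>PA\<^esub> \<one>\<^bsub>PA\<^esub> = f"
  proof
   fix z :: "'a \<times> 'b list"
   obtain u p where z: "z = (u, p)" by (cases z)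
   have "(f \<otimes>\<^bsub>PA\<^esub> \<one>\<^bsub>PA\<^esub>) z = (\<Sum>k\<le>length p. if k = length p then (if awlast u p \<in> verts G then f (u, p) else 0) else 0)"
    unfolding z path_algebra_simps(5) by (intro sum.cong refl) (auto simp: path_algebra_simps(6))
   moreover have "awlast u p \<in> verts G" if "f (u, p) \<noteq> 0"
    using f that paths_awlast by (auto simp: path_algebra_simps)
   ultimately show "(f \<otimes>\<^bsub>PA\<^esub> \<one>\<^bsub>PA\<^esub>) z = f z" by (auto simp: z)
  qed
 qed (auto intro: path_mult_closed path_mult_assoc)
 show "(f \<oplus>\<^bsub>PA\<^esub> g) \<otimes>\<^bsub>PA\<^esub> h = f \<otimes>\<^bsub>PA\<^esub> h \<oplus>\<^bsub>PA\<^esub> g \<otimes>\<^bsub>PA\<^esub> h" for f g h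
  by (auto simp: path_algebra_simps fun_eq_iff distrib_right sum.distrib)
 show "h \<otimes>\<^bsub>PA\<^esub> (f \<oplus>\<^bsub>PA\<^esub> g) = h \<otimes>\<^bsub>PA\<^esub> f \<oplus>\<^bsub>PA\<^esub> h \<otimes>\<^bsub>PA\<^esub> g" for f g h
  by (auto simp: path_algebra_simps fun_eq_iff distrib_left sum.distrib)
qed

lemma path_mult_sum:
 "((\<lambda>z. \<Sum>i\<in>S. c i * F i z) \<otimes>\<^bsub>PA\<^esub> g) z = (\<Sum>i\<in>S. c i * (F i \<otimes>\<^bsub>PA\<^esub> g) z)"
 "(g \<otimes>\<^bsub>PA\<^esub> (\<lambda>z. \<Sum>i\<in>S. c i * F i z)) z = (\<Sum>i\<in>S. c i * (g \<otimes>\<^bsub>PA\<^esub> F i) z)"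
proof -
 obtain u p where z: "z = (u, p)" by (cases z)
 show "((\<lambda>z. \<Sum>i\<in>S. c i * F i z) \<otimes>\<^bsub>PA\<^esub> g) z = (\<Sum>i\<in>S. c i * (F i \<otimes>\<^bsub>PA\<^esub> g) z)"
  unfolding z path_algebra_simps by (simp add: sum_distrib_left sum_distrib_right mult.assoc) (rule sum.swap)
 show "(g \<otimes>\<^bsub>PA\<^esub> (\<lambda>z. \<Sum>i\<in>S. c i * F i z)) z = (\<Sum>i\<in>S. c i * (g \<otimes>\<^bsub>PA\<^esub> F i) z)"
  unfolding z path_algebra_simps
  by (simp add: sum_distrib_left mult.left_commute) (rule sum.swap)
qed

lemma path_mult_scale:
 "(\<lambda>z. c * f z) \<otimes>\<^bsub>PA\<^esub> g = (\<lambda>z. c * (f \<otimes>\<^bsub>PA\<^esub> g) z)" "g \<otimes>\<^bsub>PA\<^esub> (\<lambda>z. c * f z) = (\<lambda>z. c * (g \<otimes>\<^bsub>PA\<^esub> f) z)"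
 by (auto simp: path_algebra_simps fun_eq_iff sum_distrib_left mult_ac)

lemma path_mult_ind:
 "ind (u, p) \<otimes>\<^bsub>PA\<^esub> ind (v, q) = (\<lambda>z. if awlast u p = v then ind (u, p @ q) z else 0)"
proof
 fix z
 show "(ind (u, p) \<otimes>\<^bsub>PA\<^esub> ind (v, q)) z = (if awlast u p = v then ind (u, p @ q) z else 0)"
  by (subst path_mult_pairs[of "{(u, p)}" _ "{(v, q)}"]) (auto simp: ind_def split: if_splits)
qed

end

section \<open>A basis of the almost Calabi-Yau algebra\<close>

text \<open>An entry \<open>(g, n, cs)\<close> of \<open>reductions i\<close> certifies that \<open>n\<close> times the product of the \<open>i\<close>-th basis path
 with the arc \<open>g\<close> has its tabulated value modulo the combination \<open>cs\<close> of products \<open>(j, e)\<close> of the \<open>j\<close>-th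
 basis path with the relation of the arc \<open>e\<close>.\<close>

definition reductions :: "nat => (nat \<times> int \<times> (nat \<times> nat) comb) list" where
 "reductions i =
  [[], [], [], [], [(2, 1, [(1, 0, 4)])], [], [(4, 1, [(1, 1, 0)]), (5, 1, [(1, 1, 1)])], [(7, 1, [(1,
  1, 5)])], [(0, 1, [(1, 2, 2)])], [(2, 1, [(1, 2, 6)]), (3, 1, [(1, 2, 7)])], [], [(5, 1, [(1, 3,
  3)])], [(1, 1, [(-1, 4, 1)])], [(7, 1, [(1, 4, 5)])], [(3, 1, [(1, 6, 7)])], [(4, 1, [(1, 5, 0)]),
  (5, 1, [(1, 5, 1)])], [(7, 1, [(1, 5, 5)])], [(5, 1, [(1, 6, 2)]), (6, 1, [(1, 6, 6)])], [(1, 1,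
  [(-1, 9, 1)]), (2, 1, [(1, 9, 5)])], [(0, 1, [(1, 10, 2)])], [(2, 1, [(-1, 8, 4), (-1, 9, 5)]), (3,
  1, [(1, 10, 7)])], [(4, 1, [(-1, 9, 0)])], [(0, 1, [(1, 11, 2)])], [(6, 1, [(1, 11, 6)])], [(4, 1,
  [(1, 12, 0)]), (5, 1, [(1, 12, 1)])], [(7, 1, [(1, 12, 5)])], [(3, 1, [(1, 15, 7)])], [(4, 1, [(1,
  14, 0)]), (5, 1, [(1, 14, 1)]), (6, 1, [(1, 14, 5)])], [(5, 1, [(1, 15, 2)]), (6, 1, [(1, 15, 6)])],
  [(0, 1, [(1, 14, 1), (1, 17, 2)])], [(7, 1, [(1, 18, 5), (-1, 19, 4), (-1, 20, 5)])], [(1, 1, [(-1,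
  20, 1)]), (2, 1, [(1, 20, 5)])], [(1, 1, [(1, 18, 1)]), (2, 1, [(-1, 19, 4), (-1, 20, 5)]), (3, 1,
  [(1, 21, 7)])], [(4, 1, [(1, 18, 0)])], [(0, 1, [(1, 23, 2)])], [(2, 1, [(-1, 22, 4)]), (3, 1, [(1,
  23, 7)])], [(5, 1, [(1, 24, 2)]), (6, 1, [(1, 24, 6)])], [(2, 2, [(1, 26, 5), (1, 27, 6)]), (3, 1,
  [(1, 27, 7)])], [(4, 1, [(1, 26, 0)]), (5, 1, [(1, 26, 1)]), (6, 2, [(1, 26, 5), (-1, 27, 6)])],
  [(0, 1, [(1, 26, 1), (1, 28, 2)])], [(7, 1, [(1, 31, 5), (-1, 32, 5)])], [(1, 2, [(1, 30, 3), (2,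
  31, 1)]), (2, 1, [(-1, 32, 5)]), (3, 1, [(1, 33, 7)])], [(4, 1, [(1, 31, 0)]), (5, 2, [(-1, 30,
  3)])], [(1, 1, [(-1, 35, 1)]), (2, 1, [(-1, 34, 4)])], [(0, 1, [(1, 36, 2)])], [(1, 1, [(-1, 37,
  1)]), (2, 1, [(1, 37, 5)]), (3, 1, [(1, 38, 7)])], [(4, 1, [(-1, 41, 0)]), (5, 2, [(-1, 40, 3)]),
  (6, 1, [(-1, 41, 5)])], [(7, 1, [(1, 43, 5)])]] ! i"

text \<open>Basis words are closed under deleting the last arc, so that every nontrivial one is a
  product of a shorter basis word with an arc. This puts both sides of a rewriting step into the
  same form. The list starts at index 4, after the vertices.\<close>

definition parent :: "nat => nat \<times> nat" where
 "parent k =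
  [(0, 0), (1, 1), (1, 2), (1, 3), (2, 4), (2, 5), (2, 6), (3, 7), (4, 1), (4, 3), (5, 1), (5, 2), (5,
  3), (6, 6), (9, 1), (10, 4), (10, 5), (10, 6), (11, 4), (11, 6), (12, 2), (12, 3), (14, 1), (14, 2),
  (15, 6), (17, 4), (18, 3), (20, 1), (21, 5), (21, 6), (23, 4), (23, 5), (24, 6), (26, 1), (26, 2),
  (28, 4), (31, 3), (33, 5), (33, 6), (35, 1), (36, 4), (37, 1), (42, 6), (43, 3)] ! (k - 4)"

text \<open>The default stands for products that are basis paths themselves: factor 1 and no
  relations.\<close>

definition reduction :: "nat => nat => int \<times> (nat \<times> nat) comb" where
 "reduction i g = (case map_of (reductions i) g of None => (1, []) | Some x => x)"

text \<open>In the product of the basis path \<open>j\<close> with a relation, the first arc of each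
  term is already multiplied out by the table and the second is kept as a formal factor. This is
  legitimate in \<open>straighten\<close> because \<open>j\<close> is shorter there than the path
  under consideration.\<close>

definition relation_row :: "nat \<times> nat => (nat \<times> nat) comb" where
 "relation_row = (\<lambda>(j, e). lin (\<lambda>(a, b). lin (\<lambda>i. [(1, (i, b))]) (rmul a j)) (rels e))"

lemma parent_check: "list_all (\<lambda>k. 4 \<le> k --> (case parent k of (i, g) => i < 48 \<and> g < 8 \<and>
  words k = words i @ [g] \<and> b_src k = b_src i \<and> arc_src g = b_tgt i)) [0..<48]"
 by code_simp

lemma reduction_check: "list_all (\<lambda>i. list_all (\<lambda>g. arc_src g = b_tgt i --> (case reduction i g of (n, cs) =>
  n \<noteq> 0 \<and> list_all (\<lambda>(c, j, e). j < 48 \<and> e < 8 \<and> wlen j < wlen i) cs \<and>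
  vanishes ((n, (i, g)) # lin (\<lambda>k. [(- n, parent k)]) (rmul g i) @ lin (\<lambda>t. lin (\<lambda>u. [(-1, u)]) (relation_row t)) cs)))
  [0..<8]) [0..<48]"
 by code_simp

lemma two_paths_check: "list_all (\<lambda>e. distinct (map snd (rels e)) \<and> list_all (\<lambda>a. list_all (\<lambda>b.
  (arc_src a = arc_tgt e \<and> arc_tgt a = arc_src b \<and> arc_tgt b = arc_src e) = ((a, b) \<in> set (map snd (rels e))))
  [0..<8]) [0..<8]) [0..<8]"
 by code_simp

section \<open>Integer combinations of functions\<close>

definition ev :: "('i => 'z => complex) => 'i comb => 'z => complex" where
 "ev F xs z = (\<Sum>(c, t)\<leftarrow>xs. of_int c * F t z)"

lemma ev_Nil [simp]: "ev F [] z = 0" and ev_Cons [simp]: "ev F ((c, t) # xs) z = of_int c * F t z + ev F xs z"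
 and ev_append [simp]: "ev F (xs @ ys) z = ev F xs z + ev F ys z"
 by (simp_all add: ev_def)

lemma ev_scale: "ev F (map (\<lambda>(e, j). (c * e, j)) xs) z = of_int c * ev F xs z"
 by (induction xs) (auto simp: algebra_simps)

lemma ev_lin: "ev F (lin h xs) z = ev (\<lambda>t. ev F (h t)) xs z"
 by (induction xs) (auto simp: lin_Cons ev_scale)

lemma ev_coeff:
 assumes "finite S" "snd ` set xs \<subseteq> S"
 shows "ev F xs z = (\<Sum>t\<in>S. of_int (coeff xs t) * F t z)"
 using assms(2)
proof (induction xs)
 case (Cons x xs)
 obtain c t where x: "x = (c, t)" by (cases x)
 have "(\<Sum>s\<in>S. of_int (coeff (x # xs) s) * F s z) =
   (\<Sum>s\<in>S. if s = t then of_int c * F t z else 0) + (\<Sum>s\<in>S. of_int (coeff xs s) * F s z)"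
  unfolding sum.distrib[symmetric] by (rule sum.cong) (auto simp: x coeff_Cons algebra_simps)
 then show ?case using Cons assms(1) by (simp add: x)
qed simp

lemma ev_vanishes: "vanishes xs ==> ev F xs z = 0"
 by (subst ev_coeff[of "snd ` set xs"]) (auto simp: vanishes_coeff)

text \<open>The tables number the vertices from 0, the graph from 1.\<close>

definition arc_pair :: "nat => nat \<times> nat" where
 "arc_pair g = (arc_src g + 1, arc_tgt g + 1)"

definition arc_index :: "nat \<times> nat => nat" where
 "arc_index e = (THE g. g < 8 \<and> arc_pair g = e)"

declare E8star_simps(2) [simp del]

lemma arc_pair_image: "arc_pair ` {..<8} = arcs E8star"
proof -
 have "set (map arc_pair [0..<8]) = E8_arcs" by code_simp
 moreover have "set [0..<8] = {..<8 :: nat}" by auto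
 ultimately show ?thesis unfolding E8star_simps set_map by simp
qed

lemma arc_pair_inj: "inj_on arc_pair {..<8}"
 by (rule eq_card_imp_inj_on) (simp_all add: arc_pair_image E8star_simps(2))

lemma arc_index_pair [simp]: "g < 8 ==> arc_index (arc_pair g) = g"
 unfolding arc_index_def by (rule the_equality) (auto dest: inj_onD[OF arc_pair_inj])

lemma arc_index: "e \<in> arcs E8star ==> arc_index e < 8" "e \<in> arcs E8star ==> arc_pair (arc_index e) = e"
 unfolding arc_pair_image[symmetric] by (elim imageE, simp)+

lemma arc_pair_simps [simp]: "fst (arc_pair g) = arc_src g + 1" "snd (arc_pair g) = arc_tgt g + 1"
 by (simp_all add: arc_pair_def)

interpretation E8: wf_digraph E8star
 by unfold_locales (auto simp: E8star_simps(2))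

abbreviation "PE \<equiv> path_algebra E8star"

abbreviation path_mult (infixl "\<star>" 70) where
 "f \<star> g \<equiv> f \<otimes>\<^bsub>PE\<^esub> g"

interpretation PE: ring PE
 by (rule E8.path_algebra_ring) simp

lemma E8_paths_snoc: "(u, p @ [e]) \<in> paths E8star \<longleftrightarrow>
  (u, p) \<in> paths E8star \<and> e \<in> arcs E8star \<and> fst e = E8.awlast u p"
 by simp

lemma E8_awlast_snoc [simp]: "E8.awlast u (p @ [e]) = snd e"
 by (simp add: E8.awlast_append)

text \<open>The right action of the graph on coordinate vectors: the arc \<open>g\<close> acts by the table \<open>rmul\<close>,
 corrected by the scaling factor \<open>s g\<close> between the arc and the generator of the normalized presentation.\<close>

definition rstep :: "nat => (nat => complex) => nat => complex" where
 "rstep g v = apply_cols {..<48} (rmul g) v"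

definition at_vertex :: "nat => (nat => complex) => nat => complex" where
 "at_vertex u v = (\<lambda>i. if i < 48 \<and> b_tgt i + 1 = u then v i else 0)"

lemma rstep_support:
 assumes "rstep g v k \<noteq> 0"
 obtains i where "i < 48" "v i \<noteq> 0" "coeff (rmul g i) k \<noteq> 0" "k < 48" "b_tgt k = arc_tgt g"
  "wlen k = wlen i + 1"
proof -
 obtain i where i: "i \<in> {..<48}" "v i * of_int (coeff (rmul g i) k) \<noteq> 0"
  using assms unfolding rstep_def apply_cols_def by (meson sum.neutral)
 then obtain c where "(c, k) \<in> set (rmul g i)" using coeff_nonzero by fastforce
 from rmul_props[OF _ this] show ?thesis using i by (intro that[of i]) auto
qed

text \<open>The generator \<open>g\<close> of the normalized presentation is \<open>s g\<close>
  times the arc. The second assumption says that the relation \<open>rels e\<close>, written in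
  these generators, is a nonzero multiple \<kappa> of the cell relation of the arc
  \<open>e\<close>.\<close>

locale scaled_E8 =
 fixes W :: "nat \<times> nat => nat \<times> nat => nat \<times> nat => complex" and s :: "nat => complex"
 assumes s_nonzero: "g < 8 ==> s g \<noteq> 0"
  and scaled: "e < 8 ==> \<exists>\<kappa>. \<kappa> \<noteq> 0 \<and> (\<forall>(c, a, b)\<in>set (rels e).
   of_int c * s a * s b = \<kappa> * W (arc_pair e) (arc_pair a) (arc_pair b))"
begin

definition pa :: "(nat => complex) => nat \<times> (nat \<times> nat) list => nat => complex" where
 "pa v = (\<lambda>(u, p). fold (\<lambda>e v i. rstep (arc_index e) v i / s (arc_index e)) p (at_vertex u v))"

text \<open>A right action of the path algebra on coordinate vectors. Applied to the indicator
  vector of the vertices, it will give the coordinates of an element modulo the cell ideal.\<close>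

definition act :: "(nat => complex) => (nat \<times> (nat \<times> nat) list => complex) => nat => complex" where
 "act v f i = (\<Sum>z\<in>{z. f z \<noteq> 0}. f z * pa v z i)"

lemma pa_Nil: "pa v (u, []) = at_vertex u v"
 and pa_snoc: "pa v (u, p @ [e]) i = rstep (arc_index e) (pa v (u, p)) i / s (arc_index e)"
 by (simp_all add: pa_def)

lemma pa_sum: "pa (\<lambda>i. \<Sum>x\<in>S. c x * V x i) z i = (\<Sum>x\<in>S. c x * pa (V x) z i)"
proof -
 obtain u p where z: "z = (u, p)" by (cases z)
 have "pa (\<lambda>i. \<Sum>x\<in>S. c x * V x i) (u, p) = (\<lambda>i. \<Sum>x\<in>S. c x * pa (V x) (u, p) i)"
 proof (induction p rule: rev_induct)
  case Nil
  then show ?case by (auto simp: pa_Nil at_vertex_def fun_eq_iff)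
 next
  case (snoc e p)
  have "rstep g (\<lambda>i. \<Sum>x\<in>S. c x * V x i) i = (\<Sum>x\<in>S. c x * rstep g (V x) i)" for g i V
   unfolding rstep_def apply_cols_def
   by (simp add: sum_distrib_left sum_distrib_right mult.assoc) (rule sum.swap)
  then show ?case by (rule_tac ext) (simp add: pa_snoc snoc sum_divide_distrib)
 qed
 then show ?thesis by (simp add: z)
qed

lemma pa_support:
 assumes "(u, p) \<in> paths E8star" "pa v (u, p) i \<noteq> 0"
 shows "i < 48 \<and> b_tgt i + 1 = E8.awlast u p"
proof (cases p rule: rev_cases)
 case Nil
 then show ?thesis using assms(2) by (auto simp: pa_Nil at_vertex_def split: if_splits)
next
 case (snoc p' e)
 then have e: "e \<in> arcs E8star" using assms(1) by (simp add: E8_paths_snoc)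
 have "rstep (arc_index e) (pa v (u, p')) i \<noteq> 0" using assms(2) by (simp add: snoc pa_snoc)
 then obtain "i < 48" "b_tgt i = arc_tgt (arc_index e)" by (rule rstep_support)
 then show ?thesis using arc_index(2)[OF e] by (metis E8_awlast_snoc arc_pair_simps(2) snoc)
qed

text \<open>Every arc raises the length of the basis paths it meets by one. This is what identifies
  the grading of the quotient by path length with lengths of basis words.\<close>

lemma pa_degree:
 assumes "(u, p) \<in> paths E8star" "pa (\<lambda>i. if i < 4 then 1 else 0) (u, p) i \<noteq> 0"
 shows "wlen i = length p"
 using assms
proof (induction p arbitrary: i rule: rev_induct)
 case Nil
 then show ?case by (auto simp: pa_Nil at_vertex_def split: if_splits)
next
 case (snoc e p)
 have "rstep (arc_index e) (pa (\<lambda>i. if i < 4 then 1 else 0) (u, p)) i \<noteq> 0" using snoc.prems(2) by (simp add: pa_snoc)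
 then obtain j where "pa (\<lambda>i. if i < 4 then 1 else 0) (u, p) j \<noteq> 0" "wlen i = wlen j + 1"
  by (rule rstep_support)
 then show ?case using snoc by (simp add: E8_paths_snoc)
qed

lemma pa_pa:
 assumes "(u, p) \<in> paths E8star"
 shows "pa (pa v (u, p)) (w, q) i = (if E8.awlast u p = w then pa v (u, p @ q) i else 0)"
proof -
 have 0: "at_vertex w (pa v (u, p)) = (if E8.awlast u p = w then pa v (u, p) else (\<lambda>_. 0))"
 proof -
  have sup: "pa v (u, p) i = 0" if "\<not> (i < 48 \<and> b_tgt i + 1 = E8.awlast u p)" for i
   using pa_support[OF assms, of v] that by blast
  show ?thesis by (cases "E8.awlast u p = w") (auto simp: at_vertex_def fun_eq_iff sup)
 qed
 have "pa (pa v (u, p)) (w, q) = (\<lambda>i. if E8.awlast u p = w then pa v (u, p @ q) i else 0)"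
 proof (induction q rule: rev_induct)
  case Nil
  then show ?case by (simp add: pa_Nil 0)
 next
  case (snoc e q)
  have z: "rstep g (\<lambda>_. 0) i = 0" for g i by (simp add: rstep_def apply_cols_def)
  show ?case
  proof (rule ext)
   fix i show "pa (pa v (u, p)) (w, q @ [e]) i = (if E8.awlast u p = w then pa v (u, p @ q @ [e]) i else 0)"
    unfolding pa_snoc snoc append_assoc[symmetric] by (cases "E8.awlast u p = w") (simp_all add: z)
  qed
 qed
 then show ?thesis by simp
qed

lemma act_superset: "finite S ==> (\<And>z. f z \<noteq> 0 ==> z \<in> S) ==> act v f i = (\<Sum>z\<in>S. f z * pa v z i)"
 unfolding act_def by (rule sum.mono_neutral_left) auto

lemma act_sum:
 assumes S: "finite S" and F: "\<And>x. x \<in> S ==> finite {z. F x z \<noteq> 0}"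
 shows "act v (\<lambda>z. \<Sum>x\<in>S. c x * F x z) i = (\<Sum>x\<in>S. c x * act v (F x) i)"
proof -
 let ?T = "\<Union>x\<in>S. {z. F x z \<noteq> 0}"
 have T: "finite ?T" using S F by simp
 have sub: "z \<in> ?T" if nz: "(\<Sum>x\<in>S. c x * F x z) \<noteq> 0" for z
 proof -
  obtain x where "x \<in> S" "c x * F x z \<noteq> 0" using nz by (meson sum.neutral)
  then show ?thesis by auto
 qed
 have "act v (\<lambda>z. \<Sum>x\<in>S. c x * F x z) i = (\<Sum>z\<in>?T. \<Sum>x\<in>S. c x * (F x z * pa v z i))"
  by (subst act_superset[OF T sub]) (simp_all add: sum_distrib_right mult.assoc)
 also have "... = (\<Sum>x\<in>S. c x * (\<Sum>z\<in>?T. F x z * pa v z i))"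
  by (subst sum.swap) (simp add: sum_distrib_left)
 also have "... = (\<Sum>x\<in>S. c x * act v (F x) i)"
  by (intro sum.cong refl arg_cong2[of _ _ _ _ "(*)"] act_superset[OF T, symmetric]) auto
 finally show ?thesis .
qed

lemma act_ind [simp]: "act v (ind z) i = pa v z i"
 by (subst act_superset[of "{z}"]) (auto simp: ind_def split: if_splits)

lemma act_scale: "act v (\<lambda>z. c * f z) i = c * act v f i"
 by (cases "c = 0") (simp_all add: act_def sum_distrib_left mult.assoc)

lemma act_add:
 assumes "f \<in> carrier PE" "g \<in> carrier PE"
 shows "act v (\<lambda>z. f z + g z) i = act v f i + act v g i"
proof -
 let ?T = "{z. f z \<noteq> 0} \<union> {z. g z \<noteq> 0}"
 have T: "finite ?T" using assms by (simp add: E8.path_algebra_simps)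
 have "act v (\<lambda>z. f z + g z) i = (\<Sum>z\<in>?T. (f z + g z) * pa v z i)" by (rule act_superset[OF T]) auto
 moreover have "act v f i = (\<Sum>z\<in>?T. f z * pa v z i)" by (rule act_superset[OF T]) auto
 moreover have "act v g i = (\<Sum>z\<in>?T. g z * pa v z i)" by (rule act_superset[OF T]) auto
 ultimately show ?thesis by (simp add: distrib_right sum.distrib)
qed

lemma act_zero: "act (\<lambda>_. 0) f i = 0"
 using pa_sum[of "\<lambda>_. 0" "\<lambda>_ _. 0" "{0 :: nat}"] by (simp add: act_def)

lemma path_expand: "f \<in> carrier PE ==> f = (\<lambda>z. \<Sum>x\<in>{x. f x \<noteq> 0}. f x * ind x z)"
proof
 fix z assume f: "f \<in> carrier PE"
 have "(\<Sum>x\<in>{x. f x \<noteq> 0}. f x * ind x z) = (\<Sum>x\<in>{x. f x \<noteq> 0}. if x = z then f x else 0)"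
  by (rule sum.cong) (auto simp: ind_def)
 then show "f z = (\<Sum>x\<in>{x. f x \<noteq> 0}. f x * ind x z)"
  using f by (simp add: E8.path_algebra_simps sum.delta)
qed

lemma act_mult:
 assumes f: "f \<in> carrier PE" and g: "g \<in> carrier PE"
 shows "act v (f \<star> g) i = act (act v f) g i"
proof -
 let ?S = "{z. f z \<noteq> 0}" and ?T = "{z. g z \<noteq> 0}"
 have fin: "finite ?S" "finite ?T" and paths: "?S \<subseteq> paths E8star"
  using f g by (auto simp: E8.path_algebra_simps)
 have ii: "ind x \<star> ind y = (\<lambda>z. if E8.awlast (fst x) (snd x) = fst y then ind (fst x, snd x @ snd y) z else 0)" for x y
  using E8.path_mult_ind[of "fst x" "snd x" "fst y" "snd y"] by simp
 have fin2: "finite {z. (ind x \<star> ind y) z \<noteq> 0}" for x y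
  unfolding ii by (rule finite_subset[of _ "{(fst x, snd x @ snd y)}"]) (auto simp: ind_def split: if_splits)
 have "(f \<star> g) = (\<lambda>z. \<Sum>x\<in>?S. f x * (ind x \<star> g) z)"
  using E8.path_mult_sum(1)[where S = ?S and c = f and F = ind and g = g] unfolding path_expand[OF f, symmetric] by (intro ext)
 also have "... = (\<lambda>z. \<Sum>x\<in>?S. f x * (\<Sum>y\<in>?T. g y * (ind x \<star> ind y) z))"
 proof -
  have "(h \<star> g) z = (\<Sum>y\<in>?T. g y * (h \<star> ind y) z)" for h z
   using E8.path_mult_sum(2)[where S = ?T and c = g and F = ind and g = h and z = z] unfolding path_expand[OF g, symmetric] .
  then show ?thesis by simp
 qed
 also have "... = (\<lambda>z. \<Sum>t\<in>?S \<times> ?T. (f (fst t) * g (snd t)) * (ind (fst t) \<star> ind (snd t)) z)"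
  by (simp add: sum_distrib_left sum.cartesian_product case_prod_unfold mult.assoc)
 finally have "act v (f \<star> g) i = (\<Sum>t\<in>?S \<times> ?T. (f (fst t) * g (snd t)) * act v (ind (fst t) \<star> ind (snd t)) i)"
  by (simp only:) (rule act_sum, use fin fin2 in auto)
 also have "... = (\<Sum>t\<in>?S \<times> ?T. (f (fst t) * g (snd t)) * pa (pa v (fst t)) (snd t) i)"
 proof (rule sum.cong[OF refl])
  fix t assume t: "t \<in> ?S \<times> ?T"
  obtain u p w q where t': "t = ((u, p), (w, q))" by (cases t) auto
  have "(u, p) \<in> paths E8star" using t paths by (auto simp: t')
  then have "act v (ind (u, p) \<star> ind (w, q)) i = pa (pa v (u, p)) (w, q) i"
   using act_scale[of v 0 "\<lambda>_. 0" i] by (simp add: E8.path_mult_ind pa_pa)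
  then show "(f (fst t) * g (snd t)) * act v (ind (fst t) \<star> ind (snd t)) i =
    (f (fst t) * g (snd t)) * pa (pa v (fst t)) (snd t) i" by (simp add: t')
 qed
 also have "... = (\<Sum>y\<in>?T. g y * (\<Sum>x\<in>?S. f x * pa (pa v x) y i))"
 proof -
  have "(\<Sum>t\<in>?S \<times> ?T. (f (fst t) * g (snd t)) * pa (pa v (fst t)) (snd t) i) =
    (\<Sum>x\<in>?S. \<Sum>y\<in>?T. (f x * g y) * pa (pa v x) y i)"
   by (simp add: sum.cartesian_product case_prod_unfold)
  also have "... = (\<Sum>y\<in>?T. \<Sum>x\<in>?S. (f x * g y) * pa (pa v x) y i)" by (rule sum.swap)
  finally show ?thesis by (simp add: sum_distrib_left mult_ac)
 qed
 also have "... = (\<Sum>y\<in>?T. g y * pa (\<lambda>i. \<Sum>x\<in>?S. f x * pa v x i) y i)"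
  by (simp only: pa_sum)
 also have "... = act (act v f) g i" unfolding act_def ..
 finally show ?thesis .
qed

end

lemma ev_cong: "(\<And>c t. (c, t) \<in> set xs ==> F t z = F' t z') ==> ev F xs z = ev F' xs z'"
proof (induction xs)
 case (Cons x xs)
 obtain c t where x: "x = (c, t)" by (cases x)
 have "F t z = F' t z'" by (rule Cons.prems[of c]) (simp add: x)
 moreover have "ev F xs z = ev F' xs z'" by (rule Cons.IH, rule Cons.prems) auto
 ultimately show ?case by (simp add: x)
qed simp

lemma ev_times: "ev (\<lambda>t z. a * F t z) xs z = a * ev F xs z"
 and ev_minus: "ev (\<lambda>t z. F t z - F' t z) xs z = ev F xs z - ev F' xs z"
 by (induction xs) (auto simp: algebra_simps)

lemma (in wf_digraph) path_mult_ev: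
 "(f \<otimes>\<^bsub>PA\<^esub> ev F xs) = ev (\<lambda>t. f \<otimes>\<^bsub>PA\<^esub> F t) xs" "(ev F xs \<otimes>\<^bsub>PA\<^esub> f) = ev (\<lambda>t. F t \<otimes>\<^bsub>PA\<^esub> f) xs"
proof -
 have "(f \<otimes>\<^bsub>PA\<^esub> ev F xs) (u, p) = ev (\<lambda>t. f \<otimes>\<^bsub>PA\<^esub> F t) xs (u, p)"
  and "(ev F xs \<otimes>\<^bsub>PA\<^esub> f) (u, p) = ev (\<lambda>t. F t \<otimes>\<^bsub>PA\<^esub> f) xs (u, p)" for u p
  unfolding path_algebra_simps
  by (induction xs) (auto simp: path_algebra_simps sum_distrib_left sum.distrib algebra_simps)
 then show "(f \<otimes>\<^bsub>PA\<^esub> ev F xs) = ev (\<lambda>t. f \<otimes>\<^bsub>PA\<^esub> F t) xs" "(ev F xs \<otimes>\<^bsub>PA\<^esub> f) = ev (\<lambda>t. F t \<otimes>\<^bsub>PA\<^esub> f) xs"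
  by (auto simp: fun_eq_iff)
qed

lemma rstep_coeff:
 assumes "snd ` set xs \<subseteq> {..<48}"
 shows "rstep g (\<lambda>i. of_int (coeff xs i)) = (\<lambda>k. of_int (coeff (lin (rmul g) xs) k))"
 by (rule ext) (simp add: rstep_def apply_cols_def coeff_lin[OF _ assms])

lemma fold_rstep_coeff:
 assumes "snd ` set xs \<subseteq> {..<48}"
 shows "fold rstep w (\<lambda>i. of_int (coeff xs i)) = (\<lambda>k. of_int (coeff (fold (\<lambda>g. lin (rmul g)) w xs) k))"
 using assms
proof (induction w arbitrary: xs)
 case (Cons g w)
 have "snd ` set (lin (rmul g) xs) \<subseteq> {..<48}"
 proof
  fix k assume "k \<in> snd ` set (lin (rmul g) xs)"
  then obtain c where "(c, k) \<in> set (lin (rmul g) xs)" by auto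
  from lin_set[OF this] obtain e i e' where "(e, i) \<in> set xs" "(e', k) \<in> set (rmul g i)" by blast
  then show "k \<in> {..<48}" using rmul_props(3)[of i e' k g] Cons.prems by force
 qed
 then show ?case using Cons by (simp add: rstep_coeff)
qed simp

lemma parent:
 assumes "4 \<le> k" "k < 48" "parent k = (i, g)"
 shows "i < 48" "g < 8" "words k = words i @ [g]" "b_src k = b_src i" "arc_src g = b_tgt i"
 using parent_check[unfolded list_all_iff, THEN bspec, of k] assms by auto

lemma word_path: "i < 48 ==> (b_src i + 1, map arc_pair (words i)) \<in> paths E8star \<and>
  E8.awlast (b_src i + 1) (map arc_pair (words i)) = b_tgt i + 1 \<and> set (words i) \<subseteq> {..<8}"
proof (induction "wlen i" arbitrary: i rule: less_induct)
 case less
 show ?case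
 proof (cases "i < 4")
  case True
  then show ?thesis using less.prems by auto
 next
  case False
  obtain j g where p: "parent i = (j, g)" by (cases "parent i")
  note p = parent[OF _ less.prems p]
  have "b_tgt i = arc_tgt g" using False p(3) by (simp add: b_tgt_def)
  moreover have "arc_pair g \<in> arcs E8star" using p(2) False by (simp add: arc_pair_image[symmetric])
  ultimately show ?thesis using less.hyps[of j] p False by auto
 qed
qed

section \<open>Normalized words and the cell ideal\<close>

context scaled_E8
begin

abbreviation "one0 \<equiv> \<lambda>i :: nat. if i < 4 then 1 else 0 :: complex"
abbreviation "unit i \<equiv> \<lambda>k :: nat. if k = i then 1 else 0 :: complex"

definition wd :: "nat => nat list => nat \<times> (nat \<times> nat) list => complex" where
 "wd u w = (\<lambda>z. prod_list (map s w) * ind (u + 1, map arc_pair w) z)"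

abbreviation "Wd i \<equiv> wd (b_src i) (words i)"
abbreviation "Xg g \<equiv> wd (arc_src g) [g]"

lemma wd_closed: "(u + 1, map arc_pair w) \<in> paths E8star ==> wd u w \<in> carrier PE"
 by (auto simp: wd_def E8.path_algebra_simps ind_def)

lemma Wd_closed: "i < 48 ==> Wd i \<in> carrier PE"
 using word_path[of i] by (intro wd_closed) simp

lemma Xg_closed: "g < 8 ==> Xg g \<in> carrier PE"
 by (intro wd_closed) (simp add: arc_pair_image[symmetric])

lemma wd_mult: "wd u w \<star> wd v q =
  (\<lambda>z. if E8.awlast (u + 1) (map arc_pair w) = v + 1 then wd u (w @ q) z else 0)"
 unfolding wd_def E8.path_mult_scale E8.path_mult_ind by (auto simp: fun_eq_iff)

lemma Wd_Xg: "i < 48 ==> Wd i \<star> Xg g = (\<lambda>z. if b_tgt i = arc_src g then wd (b_src i) (words i @ [g]) z else 0)"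
 using word_path[of i] by (simp add: wd_mult)

lemma Xg_Xg: "arc_tgt a = arc_src b ==> Xg a \<star> Xg b = wd (arc_src a) [a, b]"
 by (simp add: wd_mult)

lemma rstep_scale: "rstep g (\<lambda>i. c * v i) i = c * rstep g v i"
 unfolding rstep_def by (rule apply_cols_scale)

lemma act_wd:
 assumes "set w \<subseteq> {..<8}"
 shows "act v (wd u w) i = fold rstep w (at_vertex (u + 1) v) i"
proof -
 have "prod_list (map s w) * pa v (u + 1, map arc_pair w) i = fold rstep w (at_vertex (u + 1) v) i" for i
  using assms
 proof (induction w arbitrary: i rule: rev_induct)
  case (snoc g w)
  then have "fold rstep (w @ [g]) (at_vertex (u + 1) v) i =
    rstep g (\<lambda>i. prod_list (map s w) * pa v (u + 1, map arc_pair w) i) i" by simp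
  then show ?case using snoc.prems s_nonzero[of g] by (simp add: pa_snoc rstep_scale)
 qed (simp add: pa_Nil)
 then show ?thesis unfolding wd_def act_scale by simp
qed

lemma act_Wd:
 assumes i: "i < 48" and j: "j < 48"
 shows "act (unit i) (Wd j) k = of_int (coeff (mulb i j) k)"
proof -
 have "at_vertex (b_src j + 1) (unit i) = (\<lambda>k. of_int (coeff (if b_tgt i = b_src j then [(1, i)] else []) k))"
  using i by (auto simp: at_vertex_def fun_eq_iff coeff_Cons)
 then have "act (unit i) (Wd j) k = fold rstep (words j) (\<lambda>k. of_int (coeff (if b_tgt i = b_src j then [(1, i)] else []) k)) k"
  using word_path[OF j] by (simp add: act_wd)
 also have "... = of_int (coeff (fold (\<lambda>g. lin (rmul g)) (words j) (if b_tgt i = b_src j then [(1, i)] else [])) k)"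
  by (subst fold_rstep_coeff) (use i in auto)
 also have "fold (\<lambda>g. lin (rmul g)) (words j) (if b_tgt i = b_src j then [(1, i)] else []) = mulb i j"
 proof -
  have "fold (\<lambda>g. lin (rmul g)) w [] = []" for w by (induction w) auto
  then show ?thesis by (simp add: mulb_def)
 qed
 finally show ?thesis .
qed

lemma b_src_less: "i < 48 ==> b_src i < 4"
proof -
 assume "i < 48"
 then have "b_src i + 1 \<in> verts E8star"
  using word_path[of i] E8.awalk_hd_in_verts unfolding E8.paths_iff by blast
 then show ?thesis by auto
qed

text \<open>A word acts on its source vertex by the table, where that vertex is a left unit. It
  follows that the 48 words are linearly independent modulo everything that acts by zero.\<close>

lemma act_one_Wd: "i < 48 ==> act one0 (Wd i) k = (if k = i then 1 else 0)"
proof -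
 assume i: "i < 48"
 have "at_vertex (b_src i + 1) one0 = at_vertex (b_src i + 1) (unit (b_src i))"
  using b_src_less[OF i] by (auto simp: at_vertex_def fun_eq_iff)
 then have "act one0 (Wd i) k = act (unit (b_src i)) (Wd i) k"
  using word_path[OF i] by (simp add: act_wd)
 also have "... = of_int (coeff (mulb (b_src i) i) k)" using b_src_less[OF i] i by (intro act_Wd) auto
 also have "mulb (b_src i) i = [(1, i)]" using unit_check i by (simp add: list_all_iff)
 finally show ?thesis by (auto simp: coeff_Cons)
qed

abbreviation "nrel e \<equiv> ev (\<lambda>(a, b). wd (arc_src a) [a, b]) (rels e)"

lemma rels_props:
 assumes "e < 8" "(c, a, b) \<in> set (rels e)"
 shows "a < 8" "b < 8" "arc_src a = arc_tgt e" "arc_tgt a = arc_src b" "arc_tgt b = arc_src e"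
 using rels_check assms by (fastforce simp: list_all_iff)+

text \<open>By \<open>two_paths_check\<close> the list \<open>rels e\<close> contains every path of
  length 2 from the target of \<open>e\<close> to its source exactly once, so no term of the cell
  relation is missing.\<close>

lemma nrel_cell:
 assumes e: "e < 8"
 obtains \<kappa> where "\<kappa> \<noteq> 0" "nrel e = (\<lambda>z. \<kappa> * cell_relation E8star W (arc_pair e) z)"
proof -
 obtain \<kappa> where \<kappa>: "\<kappa> \<noteq> 0" "\<And>c a b. (c, a, b) \<in> set (rels e) ==>
   of_int c * s a * s b = \<kappa> * W (arc_pair e) (arc_pair a) (arc_pair b)"
  using scaled[OF e] by blast
 let ?T = "set (map snd (rels e))"
 have T: "(a, b) \<in> ?T \<longleftrightarrow> a < 8 \<and> b < 8 \<and> arc_src a = arc_tgt e \<and> arc_tgt a = arc_src b \<and> arc_tgt b = arc_src e" for a b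
 proof
  assume "(a, b) \<in> ?T"
  then obtain c where "(c, a, b) \<in> set (rels e)" by auto
  from rels_props[OF e this] show "a < 8 \<and> b < 8 \<and> arc_src a = arc_tgt e \<and> arc_tgt a = arc_src b \<and> arc_tgt b = arc_src e" by simp
 next
  assume "a < 8 \<and> b < 8 \<and> arc_src a = arc_tgt e \<and> arc_tgt a = arc_src b \<and> arc_tgt b = arc_src e"
  then show "(a, b) \<in> ?T"
   using two_paths_check[unfolded list_all_iff, THEN bspec, of e, THEN conjunct2, THEN bspec, of a, THEN bspec, of b] e
   by simp
 qed
 let ?h = "\<lambda>z (a, b). W (arc_pair e) (arc_pair a) (arc_pair b) * ind (arc_src a + 1, [arc_pair a, arc_pair b]) z"
 have "nrel e z = \<kappa> * cell_relation E8star W (arc_pair e) z" for z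
 proof -
  obtain u p where z: "z = (u, p)" by (cases z)
  have "nrel e z = (\<Sum>x\<leftarrow>rels e. \<kappa> * ?h z (snd x))"
   unfolding ev_def
  proof (intro arg_cong[where f = sum_list] map_cong refl)
   fix x assume x: "x \<in> set (rels e)"
   obtain c a b where x': "x = (c, a, b)" by (cases x)
   show "(case x of (c, t) => of_int c * (case t of (a, b) => wd (arc_src a) [a, b]) z) = \<kappa> * ?h z (snd x)"
    using \<kappa>(2)[of c a b] x by (simp add: x' wd_def mult.assoc[symmetric])
  qed
  also have "... = \<kappa> * (\<Sum>t\<leftarrow>map snd (rels e). ?h z t)"
   by (simp add: sum_list_const_mult comp_def)
  also have "(\<Sum>t\<leftarrow>map snd (rels e). ?h z t) = sum (?h z) ?T"
   using two_paths_check e by (intro sum_list_distinct_conv_sum_set) (simp add: list_all_iff)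
  also have "sum (?h z) ?T = cell_relation E8star W (arc_pair e) z"
  proof (cases "\<exists>a b. (a, b) \<in> ?T \<and> z = (arc_src a + 1, [arc_pair a, arc_pair b])")
   case True
   then obtain a b where ab: "(a, b) \<in> ?T" "z = (arc_src a + 1, [arc_pair a, arc_pair b])" by blast
   note ab' = ab(1)[unfolded T]
   have "sum (?h z) ?T = (\<Sum>t\<in>?T. if t = (a, b) then ?h z (a, b) else 0)"
   proof (rule sum.cong[OF refl])
    fix t assume t: "t \<in> ?T"
    obtain a' b' where t': "t = (a', b')" by (cases t)
    have "a' < 8" "b' < 8" using t unfolding t' T by auto
    then have "a' = a \<and> b' = b" if "arc_pair a' = arc_pair a" "arc_pair b' = arc_pair b"
     using that ab' by (metis arc_index_pair)
    then show "?h z t = (if t = (a, b) then ?h z (a, b) else 0)"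
     unfolding t' ab(2) by (auto simp: ind_def)
   qed
   also have "... = W (arc_pair e) (arc_pair a) (arc_pair b)"
    using ab by (simp add: sum.delta ind_def)
   also have "... = cell_relation E8star W (arc_pair e) z"
   proof -
    have "arc_pair a \<in> arcs E8star" "arc_pair b \<in> arcs E8star" using ab' by (simp_all add: arc_pair_image[symmetric])
    then show ?thesis using ab' E8.head_in_verts[of "arc_pair b"]
     by (simp add: cell_relation_def ab(2) E8.awalk_simps)
   qed
   finally show ?thesis .
  next
   case False
   have "cell_relation E8star W (arc_pair e) z = 0"
   proof (rule ccontr)
    assume nz: "cell_relation E8star W (arc_pair e) z \<noteq> 0"
    then have up: "u = arc_tgt e + 1" "E8.awalk u p (arc_src e + 1)" "length p = 2"
     by (auto simp: cell_relation_def z split: if_splits)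
    then obtain x y where p: "p = [x, y]" by (auto simp: length_Suc_conv numeral_2_eq_2)
    have xy: "x \<in> arcs E8star" "y \<in> arcs E8star" "u = fst x" "snd x = fst y" "snd y = arc_src e + 1"
     using up(2) by (auto simp: p E8.awalk_simps)
    let ?a = "arc_index x" and ?b = "arc_index y"
    have i: "?a < 8" "?b < 8" "arc_pair ?a = x" "arc_pair ?b = y" using arc_index xy(1,2) by auto
    have "fst x = arc_src ?a + 1" "snd x = arc_tgt ?a + 1" "fst y = arc_src ?b + 1" "snd y = arc_tgt ?b + 1"
     using arc_pair_simps[of ?a] arc_pair_simps[of ?b] i by simp_all
    then have "(?a, ?b) \<in> ?T" "z = (arc_src ?a + 1, [arc_pair ?a, arc_pair ?b])"
     unfolding T using up xy i by (simp_all add: z p)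
    then show False using False by blast
   qed
   moreover have "sum (?h z) ?T = 0"
   proof (rule sum.neutral, rule ballI)
    fix t assume t: "t \<in> ?T"
    obtain a b where t': "t = (a, b)" by (cases t)
    have "z \<noteq> (arc_src a + 1, [arc_pair a, arc_pair b])" using False t unfolding t' by blast
    then show "?h z t = 0" by (simp add: t' ind_def)
   qed
   ultimately show ?thesis by simp
  qed
  finally show ?thesis .
 qed
 then show ?thesis using \<kappa>(1) by (intro that) auto
qed

lemma ev_closed: "(\<And>c t. (c, t) \<in> set xs ==> F t \<in> carrier PE) ==> ev F xs \<in> carrier PE"
proof (induction xs)
 case (Cons x xs)
 obtain c t where x: "x = (c, t)" by (cases x)
 have "F t \<in> carrier PE" "ev F xs \<in> carrier PE" using Cons x by auto
 moreover have "(\<lambda>z. of_int c * F t z) \<in> carrier PE" if "F t \<in> carrier PE"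
  using that unfolding E8.path_algebra_simps by (auto intro: finite_subset[of _ "{z. F t z \<noteq> 0}"])
 ultimately have "(\<lambda>z. of_int c * F t z) \<oplus>\<^bsub>PE\<^esub> ev F xs \<in> carrier PE" by (intro PE.a_closed)
 then show ?case by (simp add: x E8.path_algebra_simps(2) ev_def)
qed (simp add: ev_def E8.path_algebra_simps)

lemma carrier_scale: "f \<in> carrier PE ==> (\<lambda>z. c * f z) \<in> carrier PE"
 unfolding E8.path_algebra_simps by (auto intro: finite_subset[of _ "{z. f z \<noteq> 0}"])

abbreviation "CI \<equiv> cell_ideal E8star W"

lemma cell_relation_closed: "e \<in> arcs E8star ==> cell_relation E8star W e \<in> carrier PE"
proof -
 assume e: "e \<in> arcs E8star"
 obtain \<kappa> where \<kappa>: "\<kappa> \<noteq> 0" "nrel (arc_index e) = (\<lambda>z. \<kappa> * cell_relation E8star W (arc_pair (arc_index e)) z)"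
  by (rule nrel_cell[OF arc_index(1)[OF e]])
 have "nrel (arc_index e) \<in> carrier PE"
 proof (rule ev_closed)
  fix c t assume t: "(c, t) \<in> set (rels (arc_index e))"
  obtain a b where ab: "t = (a, b)" by (cases t)
  note r = rels_props[OF arc_index(1)[OF e] t[unfolded ab]]
  show "(case t of (a, b) => wd (arc_src a) [a, b]) \<in> carrier PE"
   using PE.m_closed[OF Xg_closed[OF r(1)] Xg_closed[OF r(2)]] unfolding Xg_Xg[OF r(4)] by (simp only: ab prod.case)
 qed
 from carrier_scale[OF this, of "1 / \<kappa>"] show ?thesis using \<kappa> arc_index(2)[OF e] by simp
qed

lemma CI_ideal: "ideal CI PE"
 unfolding cell_ideal_def by (rule PE.genideal_ideal) (use cell_relation_closed in auto)

interpretation CI: ideal CI PE by (rule CI_ideal)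

lemma CI_mult: "f \<in> CI ==> g \<in> carrier PE ==> f \<star> g \<in> CI" "f \<in> CI ==> g \<in> carrier PE ==> g \<star> f \<in> CI"
 by (simp_all add: CI.I_l_closed CI.I_r_closed)

lemma CI_carrier: "f \<in> CI ==> f \<in> carrier PE"
 using CI.a_subset by blast

lemma CI_zero: "(\<lambda>z. 0) \<in> CI"
 using CI.zero_closed by (simp add: E8.path_algebra_simps)

lemma CI_add: "f \<in> CI ==> g \<in> CI ==> (\<lambda>z. f z + g z) \<in> CI"
 using CI.a_closed[of f g] by (simp add: E8.path_algebra_simps)

lemma CI_scale: "f \<in> CI ==> (\<lambda>z. c * f z) \<in> CI"
proof -
 assume f: "f \<in> CI"
 have "(\<lambda>z. c * \<one>\<^bsub>PE\<^esub> z) \<star> f \<in> CI" by (rule CI_mult(2)[OF f carrier_scale[OF PE.one_closed]])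
 then show ?thesis unfolding E8.path_mult_scale using PE.l_one[OF CI_carrier[OF f]] by simp
qed

lemma CI_sum: "finite S ==> (\<And>x. x \<in> S ==> F x \<in> CI) ==> (\<lambda>z. \<Sum>x\<in>S. c x * F x z) \<in> CI"
proof (induction S rule: finite_induct)
 case (insert x S)
 then show ?case using CI_add[OF CI_scale[of "F x" "c x"], of "\<lambda>z. \<Sum>x\<in>S. c x * F x z"] by simp
qed (simp add: CI_zero)

lemma CI_ev: "(\<And>c t. (c, t) \<in> set xs ==> F t \<in> CI) ==> ev F xs \<in> CI"
proof (induction xs)
 case (Cons x xs)
 obtain c t where x: "x = (c, t)" by (cases x)
 have "(\<lambda>z. of_int c * F t z + ev F xs z) \<in> CI"
  by (rule CI_add[OF CI_scale]) (use Cons x in auto)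
 moreover have "ev F (x # xs) = (\<lambda>z. of_int c * F t z + ev F xs z)" by (rule ext) (simp add: x)
 ultimately show ?case by simp
next
 case Nil
 have "ev F [] = (\<lambda>z. 0)" by (rule ext) simp
 then show ?case using CI_zero by simp
qed

lemma nrel_CI: "e < 8 ==> nrel e \<in> CI"
proof -
 assume e: "e < 8"
 obtain \<kappa> where \<kappa>: "nrel e = (\<lambda>z. \<kappa> * cell_relation E8star W (arc_pair e) z)" by (rule nrel_cell[OF e])
 have "arc_pair e \<in> arcs E8star" using e by (simp add: arc_pair_image[symmetric])
 then have "cell_relation E8star W (arc_pair e) \<in> CI"
  unfolding cell_ideal_def using PE.genideal_self[of "cell_relation E8star W ` arcs E8star"] cell_relation_closed by blast
 then show ?thesis unfolding \<kappa> by (rule CI_scale)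
qed

text \<open>Relations annihilate each basis vector by the evaluated \<open>rels_check\<close>;
  linearity extends this to all vectors.\<close>

lemma act_nrel:
 assumes e: "e < 8"
 shows "act v (nrel e) k = 0"
proof -
 let ?T = "set (map snd (rels e))"
 let ?F = "\<lambda>(a, b). wd (arc_src a) [a, b]"
 have T: "a < 8 \<and> b < 8 \<and> arc_tgt a = arc_src b" if "(a, b) \<in> ?T" for a b
  using that rels_props[OF e] by auto
 have eq: "nrel e = (\<lambda>z. \<Sum>t\<in>?T. of_int (coeff (rels e) t) * ?F t z)"
  by (rule ext, rule ev_coeff) auto
 have fin: "finite {z. ?F t z \<noteq> 0}" if "t \<in> ?T" for t
 proof -
  obtain a b where t: "t = (a, b)" by (cases t)
  note ab = T[OF that[unfolded t]]
  have "Xg a \<star> Xg b \<in> carrier PE" using ab by (intro PE.m_closed Xg_closed) auto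
  then have "wd (arc_src a) [a, b] \<in> carrier PE" using ab by (simp only: Xg_Xg)
  then show ?thesis by (simp add: t E8.path_algebra_simps(1))
 qed
 have F: "act v (?F t) k = (\<Sum>i<48. v i * of_int (coeff ((\<lambda>(a, b). lin (rmul b) (rmul a i)) t) k))" if "t \<in> ?T" for t
 proof -
  obtain a b where t: "t = (a, b)" by (cases t)
  note ab = T[OF that[unfolded t]]
  have av: "rstep a (at_vertex (arc_src a + 1) v) = rstep a v"
  proof
   fix i
   have "coeff (rmul a j) i = 0" if "j < 48" "b_tgt j \<noteq> arc_src a" for j
    using coeff_nonzero[of "rmul a j" i] rmul_props(2)[OF that(1)] that(2) by metis
   then show "rstep a (at_vertex (arc_src a + 1) v) i = rstep a v i"
    unfolding rstep_def apply_cols_def by (intro sum.cong refl) (auto simp: at_vertex_def)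
  qed
  have "act v (?F t) k = rstep b (rstep a v) k" using ab by (simp add: t act_wd av[simplified])
  also have "... = apply_cols {..<48} (\<lambda>i. lin (rmul b) (rmul a i)) v k"
   unfolding rstep_def by (rule apply_cols_comp) (use rmul_props(3) in auto)
  finally show ?thesis by (simp add: t apply_cols_def)
 qed
 have "act v (nrel e) k = (\<Sum>t\<in>?T. of_int (coeff (rels e) t) * act v (?F t) k)"
  unfolding eq by (rule act_sum[OF _ fin]) auto
 also have "... = (\<Sum>t\<in>?T. \<Sum>i<48. v i * (of_int (coeff (rels e) t) * of_int (coeff ((\<lambda>(a, b). lin (rmul b) (rmul a i)) t) k)))"
  by (intro sum.cong refl) (simp only: F sum_distrib_left mult.left_commute)
 also have "... = (\<Sum>i<48. v i * of_int (\<Sum>t\<in>?T. coeff (rels e) t * coeff ((\<lambda>(a, b). lin (rmul b) (rmul a i)) t) k))"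
  by (subst sum.swap) (simp add: sum_distrib_left)
 also have "... = (\<Sum>i<48. v i * of_int (coeff (lin (\<lambda>(a, b). lin (rmul b) (rmul a i)) (rels e)) k))"
  by (subst coeff_lin[of ?T]) auto
 also have "... = 0"
 proof (rule sum.neutral, rule ballI)
  fix i :: nat assume "i \<in> {..<48}"
  then have "vanishes (lin (\<lambda>(a, b). lin (rmul b) (rmul a i)) (rels e))"
   using rels_check e by (simp add: list_all_iff case_prod_unfold)
  then show "v i * of_int (coeff (lin (\<lambda>(a, b). lin (rmul b) (rmul a i)) (rels e)) k) = 0" by (simp add: vanishes_coeff)
 qed
 finally show ?thesis .
qed

text \<open>The elements that annihilate all coordinate vectors form a two-sided ideal containing
  the cell relations. All vectors \<open>v\<close> have to be considered at once, since multiplying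
  by an element on the left replaces \<open>v\<close> by its image under that element.\<close>

lemma act_CI:
 assumes "f \<in> CI"
 shows "act v f i = 0"
proof -
 let ?J = "{f \<in> carrier PE. \<forall>v i. act v f i = 0}"
 have "ideal ?J PE"
 proof (rule idealI[OF PE.ring_axioms])
  show "subgroup ?J (add_monoid PE)"
  proof (rule subgroup.intro)
   show "x \<otimes>\<^bsub>add_monoid PE\<^esub> y \<in> ?J" if "x \<in> ?J" "y \<in> ?J" for x y
    using that PE.a_closed[of x y] act_add[of x y] by (auto simp: E8.path_algebra_simps(2))
   show "inv\<^bsub>add_monoid PE\<^esub> x \<in> ?J" if x: "x \<in> ?J" for x
   proof -
    have c: "(\<lambda>z. (-1) * x z) \<in> carrier PE" by (rule carrier_scale) (use x in simp)
    have "\<ominus>\<^bsub>PE\<^esub> x = (\<lambda>z. (-1) * x z)"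
     by (rule PE.minus_equality) (use x c in \<open>simp_all add: E8.path_algebra_simps\<close>)
    then have "inv\<^bsub>add_monoid PE\<^esub> x = (\<lambda>z. (-1) * x z)" by (simp only: a_inv_def)
    moreover have "act v (\<lambda>z. (-1) * x z) i = 0" for v i unfolding act_scale using x by simp
    ultimately show ?thesis using c by auto
   qed
  qed (auto simp: E8.path_algebra_simps(3) act_def intro: PE.zero_closed[unfolded E8.path_algebra_simps(3)])
  show "x \<star> a \<in> ?J" "a \<star> x \<in> ?J" if a: "a \<in> ?J" and x: "x \<in> carrier PE" for a x
  proof -
   have "act v a = (\<lambda>_. 0)" for v using a by auto
   then show "x \<star> a \<in> ?J" "a \<star> x \<in> ?J" using a x by (auto simp: act_mult act_zero)
  qed
 qed
 moreover have "cell_relation E8star W ` arcs E8star \<subseteq> ?J"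
 proof
  fix f assume "f \<in> cell_relation E8star W ` arcs E8star"
  then obtain e where e: "e \<in> arcs E8star" "f = cell_relation E8star W e" by blast
  obtain \<kappa> where \<kappa>: "\<kappa> \<noteq> 0" "nrel (arc_index e) = (\<lambda>z. \<kappa> * cell_relation E8star W (arc_pair (arc_index e)) z)"
   by (rule nrel_cell[OF arc_index(1)[OF e(1)]])
  have "act v f i = 0" for v i
   using act_nrel[OF arc_index(1)[OF e(1)], of v i] \<kappa>(1) unfolding \<kappa>(2) act_scale
   by (simp add: arc_index(2)[OF e(1)] e(2))
  then show "f \<in> ?J" using cell_relation_closed[OF e(1)] e(2) by simp
 qed
 ultimately have "CI \<subseteq> ?J" unfolding cell_ideal_def by (rule PE.genideal_minimal)
 then show ?thesis using assms by blast
qed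

abbreviation "PX t \<equiv> Wd (fst t) \<star> Xg (snd t)"

text \<open>Induction on the length of the word. The certificate in \<open>reduction\<close>
  expresses the difference by products of shorter words \<open>j\<close> with relations. These
  products lie in the ideal, and rewriting their first arc by the table is covered by the induction
  hypothesis.\<close>

lemma straighten:
 "i < 48 ==> g < 8 ==> (\<lambda>z. (Wd i \<star> Xg g) z - ev Wd (rmul g i) z) \<in> CI"
proof (induction "wlen i" arbitrary: i g rule: less_induct)
 case less
 show ?case
 proof (cases "arc_src g = b_tgt i")
  case False
  then have "rmul g i = []" using rmul_props(2)[OF less.prems(1), of _ _ g] by (cases "rmul g i") force+
  then show ?thesis using False less.prems by (simp add: Wd_Xg CI_zero)
 next
  case True
  obtain n cs where r: "reduction i g = (n, cs)" by (cases "reduction i g")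
  have chk: "n \<noteq> 0 \<and> list_all (\<lambda>(c, j, e). j < 48 \<and> e < 8 \<and> wlen j < wlen i) cs \<and>
   vanishes ((n, (i, g)) # lin (\<lambda>k. [(- n, parent k)]) (rmul g i) @ lin (\<lambda>t. lin (\<lambda>u. [(-1, u)]) (relation_row t)) cs)"
   using reduction_check[unfolded list_all_iff, THEN bspec, of i, THEN bspec, of g] less.prems True r
   by (simp add: list_all_iff)
  have cs: "j < 48" "e < 8" "wlen j < wlen i" if "(c, j, e) \<in> set cs" for c j e
   using chk that by (auto simp: list_all_iff)
  have par: "PX (parent k) = Wd k" if "(c, k) \<in> set (rmul g i)" for c k
  proof -
   note k = rmul_props[OF less.prems(1) that]
   have "4 \<le> k" using words_Nil[OF k(3)] k(4) by fastforce
   obtain j h where p: "parent k = (j, h)" by (cases "parent k")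
   note p' = parent[OF \<open>4 \<le> k\<close> k(3) p]
   show ?thesis unfolding p fst_conv snd_conv Wd_Xg[OF p'(1)] using p' by simp
  qed
  have eq: "(Wd i \<star> Xg g) z - ev Wd (rmul g i) z = (1 / of_int n) * ev (\<lambda>t. ev (\<lambda>t. PX t) (relation_row t)) cs z" for z
  proof -
   have "of_int n * (Wd i \<star> Xg g) z + ev (\<lambda>t. PX t) (lin (\<lambda>k. [(- n, parent k)]) (rmul g i)) z +
     ev (\<lambda>t. PX t) (lin (\<lambda>t. lin (\<lambda>u. [(-1, u)]) (relation_row t)) cs) z = 0"
    using ev_vanishes[OF chk[THEN conjunct2, THEN conjunct2], of "\<lambda>t. PX t" z] by (simp add: add.assoc)
   moreover have "ev (\<lambda>t. PX t) (lin (\<lambda>k. [(- n, parent k)]) (rmul g i)) z = - of_int n * ev Wd (rmul g i) z"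
    unfolding ev_lin ev_times[symmetric] by (rule ev_cong) (simp add: par)
   moreover have "ev (\<lambda>t. PX t) (lin (\<lambda>t. lin (\<lambda>u. [(-1, u)]) (relation_row t)) cs) z =
     (- 1) * ev (\<lambda>t. ev (\<lambda>t. PX t) (relation_row t)) cs z"
   proof -
    have neg: "ev (\<lambda>t. PX t) (lin (\<lambda>u. [(-1, u)]) ys) z = (-1) * ev (\<lambda>t. PX t) ys z" for ys
     unfolding ev_lin ev_times[symmetric] by (rule ev_cong) simp
    show ?thesis
     unfolding ev_lin[where h = "\<lambda>t. lin (\<lambda>u. [(-1, u)]) (relation_row t)"] ev_times[symmetric]
     by (rule ev_cong) (simp only: neg ev_times)
   qed
   ultimately show ?thesis using chk by (simp add: field_simps)
  qed
  have "ev (\<lambda>t. PX t) (relation_row (j, e)) \<in> CI" if "(c, j, e) \<in> set cs" for c j e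
  proof -
   note je = cs[OF that]
   have 1: "Wd j \<star> nrel e \<in> CI" by (rule CI_mult(2)[OF nrel_CI[OF je(2)] Wd_closed[OF je(1)]])
   \<comment> \<open>The error made by using the table for the first arc, multiplied by the second
     arc; it lies in the ideal by the induction hypothesis for the shorter word
     \<open>j\<close>.\<close>
   have 2: "ev (\<lambda>(a, b) z. (Wd j \<star> wd (arc_src a) [a, b]) z - ev (\<lambda>i. PX (i, b)) (rmul a j) z) (rels e) \<in> CI"
   proof (rule CI_ev)
    fix c t assume t: "(c, t) \<in> set (rels e)"
    obtain a b where ab: "t = (a, b)" by (cases t)
    note r = rels_props[OF je(2) t[unfolded ab]]
    have "(\<lambda>z. (Wd j \<star> Xg a) z - ev Wd (rmul a j) z) \<star> Xg b \<in> CI"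
     by (rule CI_mult(1)[OF less.hyps[OF je(3,1) r(1)] Xg_closed[OF r(2)]])
    also have "(\<lambda>z. (Wd j \<star> Xg a) z - ev Wd (rmul a j) z) \<star> Xg b =
      (\<lambda>z. ((Wd j \<star> Xg a) \<star> Xg b) z - (ev Wd (rmul a j) \<star> Xg b) z)"
     by (auto simp: E8.path_algebra_simps fun_eq_iff left_diff_distrib sum_subtractf)
    also have "(Wd j \<star> Xg a) \<star> Xg b = Wd j \<star> wd (arc_src a) [a, b]"
     unfolding E8.path_mult_assoc using Xg_Xg[OF r(4)] by simp
    finally show "(case t of (a, b) => \<lambda>z. (Wd j \<star> wd (arc_src a) [a, b]) z - ev (\<lambda>i. PX (i, b)) (rmul a j) z) \<in> CI"
     by (simp add: ab E8.path_mult_ev)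
   qed
   have "ev (\<lambda>t. PX t) (relation_row (j, e)) = (\<lambda>z. (Wd j \<star> nrel e) z + (- 1) *
     ev (\<lambda>(a, b) z. (Wd j \<star> wd (arc_src a) [a, b]) z - ev (\<lambda>i. PX (i, b)) (rmul a j) z) (rels e) z)"
   proof
    fix z
    have a: "ev (\<lambda>t. PX t) (relation_row (j, e)) z = ev (\<lambda>(a, b). ev (\<lambda>i. PX (i, b)) (rmul a j)) (rels e) z"
     unfolding relation_row_def prod.case ev_lin
     by (rule ev_cong) (auto simp: ev_lin intro!: ev_cong)
    have b: "(Wd j \<star> nrel e) z = ev (\<lambda>(a, b). Wd j \<star> wd (arc_src a) [a, b]) (rels e) z"
     unfolding E8.path_mult_ev by (rule ev_cong) auto
    have c: "ev (\<lambda>(a, b) z. (Wd j \<star> wd (arc_src a) [a, b]) z - ev (\<lambda>i. PX (i, b)) (rmul a j) z) (rels e) z =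
      ev (\<lambda>(a, b). Wd j \<star> wd (arc_src a) [a, b]) (rels e) z - ev (\<lambda>(a, b). ev (\<lambda>i. PX (i, b)) (rmul a j)) (rels e) z"
     unfolding ev_minus[symmetric] by (rule ev_cong) auto
    show "ev (\<lambda>t. PX t) (relation_row (j, e)) z = (Wd j \<star> nrel e) z + (- 1) *
     ev (\<lambda>(a, b) z. (Wd j \<star> wd (arc_src a) [a, b]) z - ev (\<lambda>i. PX (i, b)) (rmul a j) z) (rels e) z"
     unfolding a b c by simp
   qed
   then show ?thesis using CI_add[OF 1 CI_scale[OF 2, of "- 1"]] by simp
  qed
  then have "ev (\<lambda>t. PX t) (relation_row t) \<in> CI" if "(c, t) \<in> set cs" for c t using that by (cases t) blast
  then have "ev (\<lambda>t. ev (\<lambda>t. PX t) (relation_row t)) cs \<in> CI" by (rule CI_ev)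
  from CI_scale[OF this, of "1 / of_int n"] show ?thesis unfolding eq .
 qed
qed

text \<open>Appending an arc changes the coordinates by \<open>rstep\<close>, and
  \<open>straighten\<close> provides the matching congruence. The division by \<open>s\<close> of
  the arc converts the normalized generator back to the arc.\<close>

lemma path_reduction:
 "(u, p) \<in> paths E8star ==> (\<lambda>z. ind (u, p) z - (\<Sum>i<48. pa one0 (u, p) i * Wd i z)) \<in> CI"
proof (induction p rule: rev_induct)
 case Nil
 then have u: "u \<in> {1, 2, 3, 4}" by simp
 have "(\<Sum>i<48. pa one0 (u, []) i * Wd i z) = (\<Sum>i<48. if i = u - 1 then ind (u, []) z else 0)" for z
  by (rule sum.cong) (use u in \<open>auto simp: pa_Nil at_vertex_def wd_def\<close>)
 also have "... z = ind (u, []) z" for z using u by (auto simp: sum.delta)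
 finally show ?case by (simp add: CI_zero)
next
 case (snoc e p)
 let ?g = "arc_index e" and ?c = "pa one0 (u, p)"
 have e: "e \<in> arcs E8star" "fst e = E8.awlast u p" and up: "(u, p) \<in> paths E8star" using snoc.prems by auto
 note g = arc_index[OF e(1)]
 note gs = s_nonzero[OF g(1)]
 have X: "Xg ?g = (\<lambda>z. s ?g * ind (fst e, [e]) z)"
  using arc_pair_simps(1)[of ?g] by (simp add: wd_def g(2))
 have ind: "(ind (u, p) \<star> Xg ?g) z = s ?g * ind (u, p @ [e]) z" for z
  unfolding X E8.path_mult_scale E8.path_mult_ind using e(2) by simp
 have 1: "(\<lambda>z. ind (u, p) z - (\<Sum>i<48. ?c i * Wd i z)) \<star> Xg ?g \<in> CI"
  by (rule CI_mult(1)[OF snoc.IH[OF up] Xg_closed[OF g(1)]])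
 have 2: "(\<lambda>z. \<Sum>i<48. ?c i * ((Wd i \<star> Xg ?g) z - ev Wd (rmul ?g i) z)) \<in> CI"
  by (rule CI_sum) (use straighten g(1) in auto)
 have sum: "(\<Sum>i<48. ?c i * ev Wd (rmul ?g i) z) = s ?g * (\<Sum>k<48. pa one0 (u, p @ [e]) k * Wd k z)" for z
 proof -
  have "ev Wd (rmul ?g i) z = (\<Sum>k<48. of_int (coeff (rmul ?g i) k) * Wd k z)" if "i < 48" for i
   by (rule ev_coeff) (use rmul_props(3)[OF that] in auto)
  then have "(\<Sum>i<48. ?c i * ev Wd (rmul ?g i) z) = (\<Sum>i<48. \<Sum>k<48. ?c i * of_int (coeff (rmul ?g i) k) * Wd k z)"
   by (simp add: sum_distrib_left mult.assoc)
  also have "... = (\<Sum>k<48. rstep ?g ?c k * Wd k z)"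
   by (subst sum.swap) (simp add: rstep_def apply_cols_def sum_distrib_right)
  finally show ?thesis using gs by (simp add: pa_snoc sum_distrib_left)
 qed
 have "(\<lambda>z. ind (u, p) z - (\<Sum>i<48. ?c i * Wd i z)) \<star> Xg ?g =
   (\<lambda>z. s ?g * ind (u, p @ [e]) z - (\<Sum>i<48. ?c i * (Wd i \<star> Xg ?g) z))"
 proof
  fix z
  have "((\<lambda>z. ind (u, p) z - (\<Sum>i<48. ?c i * Wd i z)) \<star> Xg ?g) z =
    (ind (u, p) \<star> Xg ?g) z - ((\<lambda>z. \<Sum>i<48. ?c i * Wd i z) \<star> Xg ?g) z"
   by (cases z) (simp add: E8.path_algebra_simps left_diff_distrib sum_subtractf)
  then show "((\<lambda>z. ind (u, p) z - (\<Sum>i<48. ?c i * Wd i z)) \<star> Xg ?g) z =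
    s ?g * ind (u, p @ [e]) z - (\<Sum>i<48. ?c i * (Wd i \<star> Xg ?g) z)"
   unfolding ind E8.path_mult_sum .
 qed
 with CI_add[OF 1 2] have "(\<lambda>z. s ?g * ind (u, p @ [e]) z - s ?g * (\<Sum>k<48. pa one0 (u, p @ [e]) k * Wd k z)) \<in> CI"
  by (simp add: right_diff_distrib sum_subtractf sum)
 from CI_scale[OF this, of "1 / s ?g"] show ?case using gs by (simp add: right_diff_distrib)
qed

lemma reduce:
 assumes f: "f \<in> carrier PE"
 shows "(\<lambda>z. f z - (\<Sum>i<48. act one0 f i * Wd i z)) \<in> CI"
proof -
 let ?S = "{x. f x \<noteq> 0}"
 have S: "finite ?S" "\<And>x. x \<in> ?S ==> x \<in> paths E8star" using f by (auto simp: E8.path_algebra_simps)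
 have "(\<lambda>z. \<Sum>x\<in>?S. f x * (ind x z - (\<Sum>i<48. pa one0 x i * Wd i z))) \<in> CI"
  by (rule CI_sum[OF S(1)]) (use path_reduction S(2) in auto)
 also have "(\<lambda>z. \<Sum>x\<in>?S. f x * (ind x z - (\<Sum>i<48. pa one0 x i * Wd i z))) =
   (\<lambda>z. f z - (\<Sum>i<48. act one0 f i * Wd i z))"
 proof
  fix z
  have "(\<Sum>x\<in>?S. f x * (\<Sum>i<48. pa one0 x i * Wd i z)) = (\<Sum>i<48. act one0 f i * Wd i z)"
   unfolding sum_distrib_left act_def sum_distrib_right by (subst sum.swap) (simp add: mult.assoc)
  moreover have "(\<Sum>x\<in>?S. f x * ind x z) = f z" using fun_cong[OF path_expand[OF f], of z] by simp
  ultimately show "(\<Sum>x\<in>?S. f x * (ind x z - (\<Sum>i<48. pa one0 x i * Wd i z))) =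
    f z - (\<Sum>i<48. act one0 f i * Wd i z)"
   by (simp add: right_diff_distrib sum_subtractf)
 qed
 finally show ?thesis .
qed

section \<open>Coordinates on the quotient\<close>

lemma act_outside:
 assumes "f \<in> carrier PE" "\<not> i < 48"
 shows "act v f i = 0"
 unfolding act_def
proof (rule sum.neutral, rule ballI)
 fix z assume "z \<in> {z. f z \<noteq> 0}"
 then have "z \<in> paths E8star" using assms(1) unfolding E8.path_algebra_simps(1) by blast
 then show "f z * pa v z i = 0" using pa_support[of "fst z" "snd z" v i] assms(2) by auto
qed

lemma combination_closed: "(\<lambda>z. \<Sum>i<48. c i * Wd i z) \<in> carrier PE"
proof -
 have "(\<lambda>z. \<Sum>i\<in>S. c i * Wd i z) \<in> carrier PE" if "S \<subseteq> {..<48}" for S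
  using finite_subset[OF that finite_lessThan] that
 proof (induction S rule: finite_induct)
  case empty
  then show ?case using PE.zero_closed by (simp add: E8.path_algebra_simps(3))
 next
  case (insert i S)
  then show ?case
   using PE.a_closed[OF carrier_scale[OF Wd_closed[of i], of "c i"], of "\<lambda>z. \<Sum>i\<in>S. c i * Wd i z"]
   by (simp add: E8.path_algebra_simps(2))
 qed
 then show ?thesis by blast
qed

lemma act_combination: "act v (\<lambda>z. \<Sum>i<48. c i * Wd i z) k = (\<Sum>i<48. c i * act v (Wd i) k)"
 by (rule act_sum) (use Wd_closed in \<open>auto simp: E8.path_algebra_simps(1)\<close>)

text \<open>The ideal acts by zero, and an element with zero coordinates is congruent to the empty
  combination by \<open>reduce\<close>. Both halves of the basis argument meet here: the ideal is
  the annihilator of a single vector.\<close>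

lemma CI_iff: "f \<in> CI \<longleftrightarrow> f \<in> carrier PE \<and> (\<forall>i. act one0 f i = 0)"
 using act_CI CI_carrier reduce[of f] by auto

text \<open>Modulo the ideal, \<open>g\<close> may be replaced by its combination of words, and
  words act on unit vectors by \<open>mulb\<close>.\<close>

lemma act_one_mult:
 assumes f: "f \<in> carrier PE" and g: "g \<in> carrier PE"
 shows "act one0 (f \<star> g) k = (\<Sum>i<48. \<Sum>j<48. act one0 f i * act one0 g j * of_int (coeff (mulb i j) k))"
proof -
 let ?c = "act one0 f" and ?d = "act one0 g"
 have c: "?c = (\<lambda>k. \<Sum>i<48. ?c i * unit i k)"
 proof
  fix k
  have "(\<Sum>i<48. ?c i * unit i k) = (\<Sum>i<48. if i = k then ?c k else 0)" by (rule sum.cong) auto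
  then show "?c k = (\<Sum>i<48. ?c i * unit i k)" using act_outside[OF f, of k] by (simp add: sum.delta)
 qed
 have vlin: "act (\<lambda>k. \<Sum>i<48. ?c i * unit i k) h k = (\<Sum>i<48. ?c i * act (unit i) h k)" for h
  unfolding act_def pa_sum sum_distrib_left by (subst sum.swap) (simp add: mult.left_commute)
 have g': "act v g k = (\<Sum>j<48. ?d j * act v (Wd j) k)" for v
 proof -
  have comb: "(\<lambda>z. \<Sum>j<48. ?d j * Wd j z) \<in> carrier PE" by (rule combination_closed)
  have "act v (\<lambda>z. (g z - (\<Sum>j<48. ?d j * Wd j z)) + (\<Sum>j<48. ?d j * Wd j z)) k = 0 + act v (\<lambda>z. \<Sum>j<48. ?d j * Wd j z) k"
   unfolding act_add[OF CI_carrier[OF reduce[OF g]] comb] act_CI[OF reduce[OF g]] ..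
  moreover have "(\<lambda>z. (g z - (\<Sum>j<48. ?d j * Wd j z)) + (\<Sum>j<48. ?d j * Wd j z)) = g" by (rule ext) simp
  ultimately show ?thesis by (simp only: act_combination add_0)
 qed
 have "act one0 (f \<star> g) k = act ?c g k" by (rule act_mult[OF f g])
 also have "... = (\<Sum>j<48. ?d j * (\<Sum>i<48. ?c i * act (unit i) (Wd j) k))"
  unfolding g' by (subst c) (simp only: vlin)
 also have "... = (\<Sum>j<48. \<Sum>i<48. ?c i * ?d j * of_int (coeff (mulb i j) k))"
  unfolding sum_distrib_left by (intro sum.cong refl) (simp add: act_Wd mult_ac)
 finally show ?thesis by (subst sum.swap)
qed

abbreviation "AA \<equiv> almost_CY_algebra E8star W"

definition chi :: "(nat \<times> (nat \<times> nat) list => complex) set => nat => complex" where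
 "chi X = act one0 (SOME f. f \<in> X)"

lemma coset_iff: "f \<in> carrier PE ==> g \<in> CI +>\<^bsub>PE\<^esub> f \<longleftrightarrow> g \<in> carrier PE \<and> act one0 g = act one0 f"
proof
 assume f: "f \<in> carrier PE" and "g \<in> CI +>\<^bsub>PE\<^esub> f"
 then obtain h where h: "h \<in> CI" "g = (\<lambda>z. h z + f z)" by (auto simp: a_r_coset_def' E8.path_algebra_simps(2))
 then show "g \<in> carrier PE \<and> act one0 g = act one0 f"
  using act_add[OF CI_carrier[OF h(1)] f] act_CI[OF h(1)] PE.a_closed[OF CI_carrier[OF h(1)] f]
  by (auto simp: E8.path_algebra_simps(2))
next
 assume f: "f \<in> carrier PE" and g: "g \<in> carrier PE \<and> act one0 g = act one0 f"
 have m: "(\<lambda>z. (-1) * f z) \<in> carrier PE" by (rule carrier_scale[OF f])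
 have "(\<lambda>z. g z + (-1) * f z) \<in> carrier PE" using PE.a_closed[OF conjunct1[OF g] m] by (simp add: E8.path_algebra_simps(2))
 moreover have "act one0 (\<lambda>z. g z + (-1) * f z) i = 0" for i
  using act_add[OF conjunct1[OF g] m] g by (simp only: act_scale) simp
 ultimately have "(\<lambda>z. g z + (-1) * f z) \<in> CI" unfolding CI_iff by blast
 then show "g \<in> CI +>\<^bsub>PE\<^esub> f"
  by (auto simp: a_r_coset_def' E8.path_algebra_simps(2) intro!: bexI[of _ "\<lambda>z. g z + (-1) * f z"])
qed

lemma chi_coset: "f \<in> carrier PE ==> chi (CI +>\<^bsub>PE\<^esub> f) = act one0 f"
proof -
 assume f: "f \<in> carrier PE"
 have "(SOME g. g \<in> CI +>\<^bsub>PE\<^esub> f) \<in> CI +>\<^bsub>PE\<^esub> f" by (rule someI[of _ f]) (simp add: coset_iff f)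
 then show ?thesis unfolding chi_def using coset_iff[OF f] by blast
qed

lemma coset_eqI: "f \<in> carrier PE ==> g \<in> carrier PE ==> act one0 f = act one0 g ==> CI +>\<^bsub>PE\<^esub> f = CI +>\<^bsub>PE\<^esub> g"
 by (auto simp: coset_iff)

lemma AA_simps:
 "carrier AA = (\<lambda>f. CI +>\<^bsub>PE\<^esub> f) ` carrier PE" "\<one>\<^bsub>AA\<^esub> = CI +>\<^bsub>PE\<^esub> \<one>\<^bsub>PE\<^esub>"
 "f \<in> carrier PE ==> g \<in> carrier PE ==> (CI +>\<^bsub>PE\<^esub> f) \<oplus>\<^bsub>AA\<^esub> (CI +>\<^bsub>PE\<^esub> g) = CI +>\<^bsub>PE\<^esub> (f \<oplus>\<^bsub>PE\<^esub> g)"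
 "f \<in> carrier PE ==> g \<in> carrier PE ==> (CI +>\<^bsub>PE\<^esub> f) \<otimes>\<^bsub>AA\<^esub> (CI +>\<^bsub>PE\<^esub> g) = CI +>\<^bsub>PE\<^esub> (f \<star> g)"
 "f \<in> carrier PE ==> c \<odot>\<^bsub>AA\<^esub> (CI +>\<^bsub>PE\<^esub> f) = CI +>\<^bsub>PE\<^esub> (\<lambda>z. c * f z)"
proof -
 show "carrier AA = (\<lambda>f. CI +>\<^bsub>PE\<^esub> f) ` carrier PE" "\<one>\<^bsub>AA\<^esub> = CI +>\<^bsub>PE\<^esub> \<one>\<^bsub>PE\<^esub>"
  by (auto simp: almost_CY_algebra_def quot_algebra_def ring.defs module.defs FactRing_def A_RCOSETS_def')
 assume f: "f \<in> carrier PE"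
 show "(CI +>\<^bsub>PE\<^esub> f) \<oplus>\<^bsub>AA\<^esub> (CI +>\<^bsub>PE\<^esub> g) = CI +>\<^bsub>PE\<^esub> (f \<oplus>\<^bsub>PE\<^esub> g)"
  "(CI +>\<^bsub>PE\<^esub> f) \<otimes>\<^bsub>AA\<^esub> (CI +>\<^bsub>PE\<^esub> g) = CI +>\<^bsub>PE\<^esub> (f \<star> g)" if "g \<in> carrier PE"
  using CI.a_rcos_sum[OF f that] CI.rcoset_mult_add[OF f that]
  by (simp_all add: almost_CY_algebra_def quot_algebra_def ring.defs module.defs FactRing_def)
 have "CI +>\<^bsub>PE\<^esub> (\<lambda>z. c * h z) = CI +>\<^bsub>PE\<^esub> (\<lambda>z. c * f z)" if "h \<in> CI +>\<^bsub>PE\<^esub> f" for h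
 proof (rule coset_eqI)
  have h: "h \<in> carrier PE" "act one0 h = act one0 f" using that coset_iff[OF f] by auto
  show "(\<lambda>z. c * h z) \<in> carrier PE" "(\<lambda>z. c * f z) \<in> carrier PE" using carrier_scale f h by blast+
  show "act one0 (\<lambda>z. c * h z) = act one0 (\<lambda>z. c * f z)" using h by (auto simp: act_scale fun_eq_iff)
 qed
 moreover have "f \<in> CI +>\<^bsub>PE\<^esub> f" by (simp add: coset_iff f)
 ultimately have "(\<Union>h\<in>CI +>\<^bsub>PE\<^esub> f. CI +>\<^bsub>PE\<^esub> (\<lambda>z. c * h z)) = CI +>\<^bsub>PE\<^esub> (\<lambda>z. c * f z)" by blast
 then show "c \<odot>\<^bsub>AA\<^esub> (CI +>\<^bsub>PE\<^esub> f) = CI +>\<^bsub>PE\<^esub> (\<lambda>z. c * f z)"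
  by (simp add: almost_CY_algebra_def quot_algebra_def ring.defs module.defs quot_module_def E8.path_algebra_simps(4))
qed

lemma AA_ring: "ring AA"
 unfolding almost_CY_algebra_def quot_algebra_def by (rule ring_extend[OF CI.quotient_is_ring])

theorem e8_algebra:
 assumes env: "ring (enveloping_algebra AA)"
 shows "e8_algebra AA chi (almost_CY_grading E8star W)"
proof -
 interpret AA: ring AA by (rule AA_ring)
 have car: "\<exists>f\<in>carrier PE. X = CI +>\<^bsub>PE\<^esub> f" if "X \<in> carrier AA" for X using that by (auto simp: AA_simps(1))
 have chi_out: "chi X i = 0" if "X \<in> carrier AA" "\<not> i < 48" for X i
  using car[OF that(1)] act_outside that(2) by (auto simp: chi_coset)
 interpret C: coord_group AA "{..<48 :: nat}" chi
 proof
  show "chi (X \<oplus>\<^bsub>AA\<^esub> Y) = (\<lambda>i. chi X i + chi Y i)" if "X \<in> carrier AA" "Y \<in> carrier AA" for X Y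
   using car[OF that(1)] car[OF that(2)] PE.a_closed
   by (auto simp: AA_simps(3) chi_coset fun_eq_iff E8.path_algebra_simps(2) act_add)
  show "bij_betw chi (carrier AA) {y. \<forall>i. i \<notin> {..<48} --> y i = 0}"
   unfolding bij_betw_def
  proof
   show "inj_on chi (carrier AA)"
   proof (rule inj_onI)
    fix X Y assume XY: "X \<in> carrier AA" "Y \<in> carrier AA" "chi X = chi Y"
    obtain f where f: "f \<in> carrier PE" "X = CI +>\<^bsub>PE\<^esub> f" using car[OF XY(1)] by blast
    obtain g where g: "g \<in> carrier PE" "Y = CI +>\<^bsub>PE\<^esub> g" using car[OF XY(2)] by blast
    show "X = Y" unfolding f(2) g(2)
     by (rule coset_eqI[OF f(1) g(1)]) (use XY(3) f g in \<open>simp only: chi_coset\<close>)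
   qed
   show "chi ` carrier AA = {y. \<forall>i. i \<notin> {..<48} --> y i = 0}"
   proof (rule equalityI; rule subsetI)
    fix y :: "nat => complex" assume y: "y \<in> {y. \<forall>i. i \<notin> {..<48} --> y i = 0}"
    let ?f = "\<lambda>z. \<Sum>i<48. y i * Wd i z"
    have "act one0 ?f k = y k" for k
    proof -
     have "act one0 ?f k = (\<Sum>i<48. if i = k then y k else 0)"
      unfolding act_combination by (rule sum.cong) (auto simp: act_one_Wd)
     then show ?thesis using y by (auto simp: sum.delta)
    qed
    then have c: "chi (CI +>\<^bsub>PE\<^esub> ?f) = y" by (simp add: chi_coset combination_closed fun_eq_iff)
    have fc: "CI +>\<^bsub>PE\<^esub> ?f \<in> carrier AA"
     unfolding AA_simps(1) by (rule imageI[OF combination_closed])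
    have "chi (CI +>\<^bsub>PE\<^esub> ?f) \<in> chi ` carrier AA" by (rule imageI[OF fc])
    then show "y \<in> chi ` carrier AA" by (simp only: c)
   qed (use chi_out in auto)
  qed
 qed simp
 have one: "act one0 \<one>\<^bsub>PE\<^esub> = one0"
 proof
  fix i
  have "act one0 \<one>\<^bsub>PE\<^esub> i = (\<Sum>z\<in>{1, 2, 3, 4} \<times> {[]}. \<one>\<^bsub>PE\<^esub> z * pa one0 z i)"
   by (rule act_superset) (auto simp: E8.path_algebra_simps(6) split: if_splits)
  also have "{1, 2, 3, 4} \<times> {[]} = (\<lambda>u. (u, [])) ` {1, 2, 3, 4 :: nat}" by auto
  also have "(\<Sum>z\<in>.... \<one>\<^bsub>PE\<^esub> z * pa one0 z i) = (\<Sum>u\<in>{1, 2, 3, 4}. \<one>\<^bsub>PE\<^esub> (u, []) * pa one0 (u, []) i)"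
   by (rule sum.reindex_cong[of "\<lambda>u. (u, [])"]) (auto simp: inj_on_def)
  also have "... = (\<Sum>u\<in>{1, 2, 3, 4}. at_vertex u one0 i)"
   by (intro sum.cong refl) (auto simp: E8.path_algebra_simps(6) pa_Nil)
  also have "... = one0 i" by (auto simp: at_vertex_def)
  finally show "act one0 \<one>\<^bsub>PE\<^esub> i = one0 i" .
 qed
 have grading: "almost_CY_grading E8star W = C.homogeneous (\<lambda>i. int (wlen i))"
 proof (rule ext, rule equalityI; rule subsetI)
  fix j X assume "X \<in> almost_CY_grading E8star W j"
  then obtain f where f: "f \<in> carrier PE" "\<And>u p. f (u, p) \<noteq> 0 ==> int (length p) = j" "X = CI +>\<^bsub>PE\<^esub> f"
   unfolding almost_CY_grading_def by blast
  have "int (wlen i) = j" if nz: "act one0 f i \<noteq> 0" for i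
  proof -
   obtain z where z: "f z \<noteq> 0" "pa one0 z i \<noteq> 0"
    using nz unfolding act_def by (metis (no_types, lifting) mult_eq_0_iff sum.neutral)
   obtain u p where z': "z = (u, p)" by (cases z)
   have "(u, p) \<in> paths E8star" using f(1) z(1) by (auto simp: E8.path_algebra_simps(1) z')
   from pa_degree[OF this z(2)[unfolded z']] show ?thesis using f(2)[of u p] z(1) by (simp add: z')
  qed
  then show "X \<in> C.homogeneous (\<lambda>i. int (wlen i)) j"
   using f(1) by (auto simp: C.homogeneous_def f(3) chi_coset AA_simps(1))
 next
  fix j X assume X: "X \<in> C.homogeneous (\<lambda>i. int (wlen i)) j"
  then obtain f where f: "f \<in> carrier PE" "X = CI +>\<^bsub>PE\<^esub> f" using car by (auto simp: C.homogeneous_def)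
  \<comment> \<open>An arbitrary representative need not be homogeneous; the combination of words
    with the same coordinates is.\<close>
  let ?g = "\<lambda>z. \<Sum>i<48. act one0 f i * Wd i z"
  have "act one0 ?g k = act one0 f k" for k
  proof -
   have "act one0 ?g k = (\<Sum>i<48. if i = k then act one0 f k else 0)"
    unfolding act_combination by (rule sum.cong) (auto simp: act_one_Wd)
   then show ?thesis using act_outside[OF f(1), of k] by (auto simp: sum.delta)
  qed
  then have "X = CI +>\<^bsub>PE\<^esub> ?g" unfolding f(2) by (intro coset_eqI f(1) combination_closed) auto
  moreover have "int (length p) = j" if nz: "?g (u, p) \<noteq> 0" for u p
  proof -
   obtain i where i: "act one0 f i \<noteq> 0" "Wd i (u, p) \<noteq> 0"
    using nz by (metis (no_types, lifting) mult_eq_0_iff sum.neutral)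
   then have "length p = wlen i" by (auto simp: wd_def ind_def split: if_splits)
   moreover have "int (wlen i) = j" using X i(1) f by (auto simp: C.homogeneous_def chi_coset)
   ultimately show ?thesis by simp
  qed
  ultimately show "X \<in> almost_CY_grading E8star W j"
   unfolding almost_CY_grading_def using combination_closed by blast
 qed
 show ?thesis
 proof (intro e8_algebra.intro env_coord_algebra.intro coord_algebra.intro AA_ring C.coord_group_axioms
   coord_algebra_axioms.intro env_coord_algebra_axioms.intro e8_algebra_axioms.intro)
  show "ring (enveloping_algebra AA)" by (rule env)
  show "chi \<one>\<^bsub>AA\<^esub> = one0" by (simp add: AA_simps(2) chi_coset one)
  show "c \<odot>\<^bsub>AA\<^esub> X \<in> carrier AA" "chi (c \<odot>\<^bsub>AA\<^esub> X) = (\<lambda>i. c * chi X i)" if "X \<in> carrier AA" for c X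
   using car[OF that] carrier_scale by (auto simp: AA_simps(5) AA_simps(1) chi_coset act_scale fun_eq_iff)
  show "chi (X \<otimes>\<^bsub>AA\<^esub> Y) = (\<lambda>k. \<Sum>i\<in>{..<48}. \<Sum>j\<in>{..<48}. chi X i * chi Y j * of_int (coeff (mulb i j) k))"
   if "X \<in> carrier AA" "Y \<in> carrier AA" for X Y
   using car[OF that(1)] car[OF that(2)] PE.m_closed
   by (auto simp: AA_simps(4) chi_coset fun_eq_iff act_one_mult)
  show "int (wlen k) = int (wlen i) + int (wlen j)"
   if "i \<in> {..<48}" "j \<in> {..<48}" "of_int (coeff (mulb i j) k) \<noteq> (0 :: complex)" for i j k
   using coeff_mulb(2)[of i j k] that by auto
  show "almost_CY_grading E8star W = C.homogeneous (\<lambda>i. int (wlen i))" by (rule grading)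
 qed
qed

end

section \<open>Hochschild cohomology\<close>

text \<open>The arcs \<open>y\<close>, \<open>q\<close> and \<open>v\<close> keep the factor 1, and
  \<open>\<kappa> = 1\<close> in the relation of \<open>p\<close> gives \<open>wp\<close>,
  \<open>wq\<close>, \<open>w1\<close> for \<open>a\<close>, \<open>b\<close>, \<open>x\<close>. For
  the factor \<open>r\<close> of \<open>p\<close>, the relations of the loops demand
  \<open>r = - wp^3 / wa\<close> and \<open>r = wq^3 / wb\<close>; the cubic identity of the cells
  says that these agree. The relation of \<open>q\<close> then gives \<open>w4 * r\<close> for
  \<open>u\<close>.\<close>

lemma scaled_E8:
 assumes "perron_frobenius E8star 8 \<phi>" "cell_system E8star 8 \<phi> W"
 obtains s where "scaled_E8 W s"
proof -
 interpret E8_cells \<phi> W by unfold_locales (rule assms)+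
 define wa wb wp wq w1 w4 where "wa = W (2, 2) (2, 2) (2, 2)" and "wb = W (3, 3) (3, 3) (3, 3)"
  and "wp = W (2, 2) (2, 3) (3, 2)" and "wq = W (3, 3) (3, 2) (2, 3)"
  and "w1 = W (1, 2) (2, 3) (3, 1)" and "w4 = W (2, 4) (4, 3) (3, 2)"
 note w = wa_def wb_def wp_def wq_def w1_def w4_def
 define r where "r = - (wp * wp * wp / wa)"
 define s where "s g = [1, wp, r, w4 * r, w1, 1, wq, 1] ! g" for g
 note nz = cells(1-6)[folded w] and cube = cells(7)[folded w]
 have r: "r \<noteq> 0" using nz by (simp add: r_def)
 have "scaled_E8 W s"
 proof
  fix g :: nat assume "g < 8"
  then have "g \<in> {0, 1, 2, 3, 4, 5, 6, 7}" by auto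
  then show "s g \<noteq> 0" using nz r by (auto simp: s_def)
 next
  fix e :: nat assume e: "e < 8"
  define \<kappa> where "\<kappa> = [r, - (wp * wp / wa), 1, 1 / w4, r / w1, r, wq * wq / wb, r] ! e"
  have b: "wq * wq / wb * wq = r" "r * wa = - (wp * wp * wp)"
   using cube nz by (simp_all add: r_def field_simps power3_eq_cube eq_neg_iff_add_eq_0)
  have cell: "W (1, 2) (2, 3) (3, 1) = w1" "W (2, 2) (2, 2) (2, 2) = wa" "W (2, 2) (2, 3) (3, 2) = wp"
   "W (2, 3) (3, 2) (2, 2) = wp" "W (2, 3) (3, 3) (3, 2) = wq" "W (2, 3) (3, 1) (1, 2) = w1"
   "W (2, 4) (4, 3) (3, 2) = w4" "W (3, 1) (1, 2) (2, 3) = w1" "W (3, 2) (2, 2) (2, 3) = wp"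
   "W (3, 2) (2, 3) (3, 3) = wq" "W (3, 2) (2, 4) (4, 3) = w4" "W (3, 3) (3, 3) (3, 3) = wb"
   "W (3, 3) (3, 2) (2, 3) = wq" "W (4, 3) (3, 2) (2, 4) = w4"
   unfolding w W_rotations by (rule refl)+
  have arc: "arc_pair 0 = (1, 2)" "arc_pair 1 = (2, 2)" "arc_pair 2 = (2, 3)" "arc_pair 3 = (2, 4)"
   "arc_pair 4 = (3, 1)" "arc_pair 5 = (3, 2)" "arc_pair 6 = (3, 3)" "arc_pair 7 = (4, 3)"
   by (simp_all add: arc_pair_def arc_src_def arc_tgt_def del: One_nat_def)
  have e8: "e \<in> {0, 1, 2, 3, 4, 5, 6, 7}" using e by auto
  have "\<kappa> \<noteq> 0" using e8 nz r by (auto simp: \<kappa>_def)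
  moreover have "\<forall>(c, a, b)\<in>set (rels e). of_int c * s a * s b = \<kappa> * W (arc_pair e) (arc_pair a) (arc_pair b)"
   using e8 nz b
   by (elim insertE emptyE) (simp_all add: \<kappa>_def s_def rels_def arc cell r_def[symmetric] del: One_nat_def)
  ultimately show "\<exists>\<kappa>. \<kappa> \<noteq> 0 \<and> (\<forall>(c, a, b)\<in>set (rels e).
   of_int c * s a * s b = \<kappa> * W (arc_pair e) (arc_pair a) (arc_pair b))" by blast
 qed
 then show ?thesis by (rule that)
qed

text \<open>\<open>cidx\<close> has period 4 on positive numbers only: 0 and 4 use different tables,
  because some central elements of degree 5 become coboundaries one period later. Hence the start at
  1.\<close>

lemma cohomology_basis_period: "1 \<le> i ==> cohomology_basis (4 + i) j = cohomology_basis i (j + 8)"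
proof -
 assume "1 \<le> i"
 then obtain m where m: "i = Suc m" by (cases i) auto
 have "cidx (4 + i) = cidx i" by (simp add: m cidx_def)
 then show ?thesis by (simp add: cohomology_basis_def algebra_simps)
qed

section \<open>Counting dimensions\<close>

lemma card_nth_eq: "card {i. i < length xs \<and> xs ! i = j} = length (filter (\<lambda>x. x = j) xs)"
 by (simp add: length_filter_conv_card)

lemma card_cohomology_basis:
 "card (cohomology_basis n j) = length (filter (\<lambda>x. x = j + 8 * int (n div 4)) (cycle_degs (cidx n)))"
proof -
 have "length (cycle_degs (cidx n)) = length (cycles (cidx n))"
  using prj_check cidx(1)[of n] by (simp add: list_all_iff)
 then show ?thesis by (simp add: cohomology_basis_def card_nth_eq[symmetric])
qed

lemma hilbert_iso:
 assumes "graded_vector_space V" "has_hilbert_series V H"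
 obtains n where "\<And>j. cvs_iso (cfun {..<n j}) (V j)" "\<And>j. int (n j) = fls_nth H j"
proof -
 have "\<forall>j. \<exists>n. has_dim (V j) n \<and> fls_nth H j = int n" using assms(2) by (simp add: has_hilbert_series_def)
 then obtain n where n: "\<And>j. has_dim (V j) (n j) \<and> fls_nth H j = int (n j)" by metis
 have "cvs_iso (cfun {..<n j}) (V j)" for j
  by (rule has_dim_cfun) (use assms(1) n in \<open>auto simp: graded_vector_space_def\<close>)
 then show ?thesis using n by (intro that) auto
qed

lemma cvs_iso_via:
 assumes "finite I" "finite J" "card I = card J" "cvs_iso (cfun I) V" "cvs_iso (cfun J) W"
 shows "cvs_iso V W"
proof -
 note I = cfun_closed[OF assms(1)]
 have "cvs_iso V (cfun I)" by (rule cvs_iso_sym[OF assms(4) I])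
 moreover have "cvs_iso (cfun I) W"
  by (rule cvs_iso_trans[OF cfun_reindex[OF assms(1-3)] assms(5) I])
 ultimately show ?thesis by (rule cvs_iso_trans) (rule cvs_iso_closed[OF assms(4) I])
qed

lemma fls_nth_series:
 "fls_nth (2 * fls_X + fls_X ^ 2 + fls_X ^ 3 + fls_X ^ 5 :: int fls) j =
   (if j = 1 then 2 else if j = 2 \<or> j = 3 \<or> j = 5 then 1 else 0)"
 "fls_nth (4 * fls_X ^ 5 :: int fls) j = (if j = 5 then 4 else 0)"
 "fls_nth (2 :: int fls) j = (if j = 0 then 2 else 0)"
proof -
 have "(2 * fls_X :: int fls) = fls_const 2 * fls_X" "(4 * fls_X ^ 5 :: int fls) = fls_const 4 * fls_X ^ 5"
  by (simp_all add: fls_const_numeral)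
 then show "fls_nth (2 * fls_X + fls_X ^ 2 + fls_X ^ 3 + fls_X ^ 5 :: int fls) j =
   (if j = 1 then 2 else if j = 2 \<or> j = 3 \<or> j = 5 then 1 else 0)"
  "fls_nth (4 * fls_X ^ 5 :: int fls) j = (if j = 5 then 4 else 0)"
  by (simp_all add: fls_X_power_nth)
 show "fls_nth (2 :: int fls) j = (if j = 0 then 2 else 0)" by simp
qed

theorem theorem4p12:
 fixes \<phi> :: "nat => real"
  and W :: "nat \<times> nat => nat \<times> nat => nat \<times> nat => complex"
  and C :: "'c gvs" and L :: "'l gvs" and K :: "'k gvs"
  and P :: "nat => ((((nat, nat \<times> nat) path => complex) set) env, 'p) module"
  and GP :: "nat => int => 'p set"
  and d :: "nat => 'p => 'p"
  and aug :: "'p => ((nat, nat \<times> nat) path => complex) set"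
 defines "A \<equiv> almost_CY_algebra E8star W"
  and "GA \<equiv> almost_CY_grading E8star W"
 defines "HH \<equiv> hochschild_cohomology A GA P GP d"
 assumes "perron_frobenius E8star 8 \<phi>"
  and "cell_system E8star 8 \<phi> W"
  and "graded_vector_space C"
  and "has_hilbert_series C (2 * fls_X + fls_X ^ 2 + fls_X ^ 3 + fls_X ^ 5)"
  and "graded_vector_space L"
  and "has_hilbert_series L (4 * fls_X ^ 5)"
  and "graded_vector_space K"
  and "has_hilbert_series K 2"
  and "hochschild_resolution A GA P GP d aug"
 shows "HH 0 \<simeq>\<^sub>g gvs_shift (gvs_dual C) 5 \<oplus>\<^sub>g L \<and>
     HH 1 \<simeq>\<^sub>g gvs_shift (gvs_dual C) 5 \<and>
     HH 2 \<simeq>\<^sub>g gvs_shift C (- 3) \<and>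
     HH 3 \<simeq>\<^sub>g gvs_shift C (- 3) \<oplus>\<^sub>g gvs_shift (gvs_dual K) (- 3) \<and>
     HH 4 \<simeq>\<^sub>g gvs_shift (gvs_dual C) (- 3) \<oplus>\<^sub>g gvs_shift K (- 3) \<and>
     (\<forall>i\<ge>1. HH (4 + i) \<simeq>\<^sub>g gvs_shift (HH i) (- 8))"
proof -
 obtain s where "scaled_E8 W s" by (rule scaled_E8[OF assms(4,5)])
 then interpret S: scaled_E8 W s .
 note res = assms(12)[unfolded hochschild_resolution_def]
 \<comment> \<open>The ring axioms of the enveloping algebra are extracted from the first term of
   the given resolution.\<close>
 have "left_module (enveloping_algebra A) (P 0)"
  using res unfolding graded_projective_resolution_def graded_module_def by blast
 then have "ring (enveloping_algebra A)" by (rule left_module.axioms(1))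
 then interpret A: e8_algebra A S.chi GA unfolding A_def GA_def by (rule S.e8_algebra)
 have HH: "cvs_iso (cfun (cohomology_basis n j)) (HH n j)" for n j
  unfolding HH_def hochschild_cohomology_def by (rule A.cohomology_iso[OF res])
 obtain c where c: "\<And>j. cvs_iso (cfun {..<c j}) (C j)"
  "\<And>j. int (c j) = fls_nth (2 * fls_X + fls_X ^ 2 + fls_X ^ 3 + fls_X ^ 5) j"
  by (rule hilbert_iso[OF assms(6,7)]) blast
 obtain l where l: "\<And>j. cvs_iso (cfun {..<l j}) (L j)" "\<And>j. int (l j) = fls_nth (4 * fls_X ^ 5) j"
  by (rule hilbert_iso[OF assms(8,9)]) blast
 obtain k where k: "\<And>j. cvs_iso (cfun {..<k j}) (K j)" "\<And>j. int (k j) = fls_nth 2 j"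
  by (rule hilbert_iso[OF assms(10,11)]) blast
 have dims: "c j = (if j = 1 then 2 else if j = 2 \<or> j = 3 \<or> j = 5 then 1 else 0)"
  "l j = (if j = 5 then 4 else 0)" "k j = (if j = 0 then 2 else 0)" for j
  using c(2)[of j] l(2)[of j] k(2)[of j] unfolding fls_nth_series by (auto split: if_splits)
 note iso = cvs_iso_via[OF finite_cohomology_basis _ _ HH]
 have dual: "cvs_iso (cfun {..<c j}) (cvs_dual (C j))" "cvs_iso (cfun {..<k j}) (cvs_dual (K j))" for j
  by (rule dual_cfun[OF finite_lessThan c(1)], rule dual_cfun[OF finite_lessThan k(1)])
 note sum = sum_cfun[OF finite_lessThan _ finite_lessThan]
 have cidx_simps: "cidx 0 = 0" "cidx 1 = 1" "cidx 2 = 2" "cidx 3 = 3" "cidx 4 = 4"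
  by code_simp+
 note card = card_cohomology_basis cycle_degs_def cidx_simps dims
 have fin: "finite {..<i}" "finite ({..<i} <+> {..<i'})" "card {..<i} = i" "card ({..<i} <+> {..<i'}) = i + i'" for i i' :: nat
  by (simp_all add: card_Plus)
 \<comment> \<open>The tabulated degrees of the cycles compared with the Hilbert series. The
   arguments of \<open>c\<close> and \<open>k\<close> are the degrees before dualizing and shifting:
   \<open>- (j - 5)\<close> for a dual shifted by 5, \<open>j - - 3\<close> for a shift by -3, and
   its negative for a dual shifted by -3.\<close>
 have cards: "card (cohomology_basis 0 j) = c (- (j - 5)) + l j" "card (cohomology_basis 1 j) = c (- (j - 5))"
  "card (cohomology_basis 2 j) = c (j - - 3)" "card (cohomology_basis 3 j) = c (j - - 3) + k (- (j - - 3))"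
  "card (cohomology_basis 4 j) = c (- (j - - 3)) + k (j - - 3)" for j
  unfolding card by (simp; linarith)+
 have "HH 0 \<simeq>\<^sub>g gvs_shift (gvs_dual C) 5 \<oplus>\<^sub>g L"
  unfolding gvs_iso_def gvs_shift_def gvs_sum_def gvs_dual_def
  by (intro allI, rule iso[OF _ _ sum[OF dual(1) l(1)]]) (simp_all only: fin cards)
 moreover have "HH 1 \<simeq>\<^sub>g gvs_shift (gvs_dual C) 5"
  unfolding gvs_iso_def gvs_shift_def gvs_dual_def
  by (intro allI, rule iso[OF _ _ dual(1)]) (simp_all only: fin cards)
 moreover have "HH 2 \<simeq>\<^sub>g gvs_shift C (- 3)"
  unfolding gvs_iso_def gvs_shift_def
  by (intro allI, rule iso[OF _ _ c(1)]) (simp_all only: fin cards)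
 moreover have "HH 3 \<simeq>\<^sub>g gvs_shift C (- 3) \<oplus>\<^sub>g gvs_shift (gvs_dual K) (- 3)"
  unfolding gvs_iso_def gvs_shift_def gvs_sum_def gvs_dual_def
  by (intro allI, rule iso[OF _ _ sum[OF c(1) dual(2)]]) (simp_all only: fin cards)
 moreover have "HH 4 \<simeq>\<^sub>g gvs_shift (gvs_dual C) (- 3) \<oplus>\<^sub>g gvs_shift K (- 3)"
  unfolding gvs_iso_def gvs_shift_def gvs_sum_def gvs_dual_def
  by (intro allI, rule iso[OF _ _ sum[OF dual(1) k(1)]]) (simp_all only: fin cards)
 moreover have "HH (4 + i) \<simeq>\<^sub>g gvs_shift (HH i) (- 8)" if "i \<ge> 1" for i
  unfolding gvs_iso_def gvs_shift_def
  by (intro allI, rule iso[OF _ _ HH]) (use cohomology_basis_period[OF that] in \<open>auto simp: finite_cohomology_basis\<close>)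
 ultimately show ?thesis by blast
qed

end
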